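(* Let $\mathcal{C}_5=\mathcal{C}(\lambda_1,\dots,\lambda_5)$ be a weighted projective line with $5$ distinct points of weight $2$ over an algebraically closed field. Let $V$ be an omnipresent exceptional bundle of rank $r$ and degree $d<0$ on $\mathcal{C}_5$, and suppose that $r>(-d+1)^2$. Then $(r,d)=(11,-2)$, and $\pi[V]$ is in the $W(D_5)$-orbit of $-\frac52\sum_{i=1}^5\varepsilon_i$.
   Context: For distinct points $\lambda_1,\dots,\lambda_n\in\mathbb{P}^1$, $\mathcal{C}=\mathcal{C}_n=\mathcal{C}(\lambda_1,\dots,\lambda_n)$ denotes the weighted projective line with all weights $2$: the stacky $\mathbb{P}^1$ obtained by taking the square-root stack of $\mathbb{P}^1$ at each $\lambda_i$ (stabilizer $\mu_2$ at each $\lambda_i$). $\mathrm{Pic}(\mathcal{C})$ is generated by $x_1,\dots,x_n$ with relations $2x_1=\dots=2x_n$, where $\mathcal{O}_{\mathcal{C}}(x_i)$ is the tautological square root of $\mathcal{O}_{\mathbb{P}^1}(\lambda_i)$, and $\mathcal{O}_{\mathcal{C}}(1):=\mathcal{O}_{\mathcal{C}}(2x_i)$. The degree is determined by $\deg(x_i)=1$ and $\deg(V)=\deg(\det V)$. For each $i$ there are simple sheaves $S_i,S'_i$ given by $$0\to\mathcal{O}_{\mathcal{C}}(-x_i)\to\mathcal{O}_{\mathcal{C}}\to S_i\to0,\qquad 0\to\mathcal{O}_{\mathcal{C}}\to\mathcal{O}_{\mathcal{C}}(x_i)\to S'_i\to 0.$$ A bundle $V$ is exceptional if $R\mathrm{Hom}(V,V)$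 is the ground field in degree $0$. An exceptional bundle $V$ on $\mathcal{C}_n$ is omnipresent if $\mathrm{Hom}(V,S_i)\ne0$ and $\mathrm{Hom}(V,S'_i)\neq 0$ for all $i=1,\dots,n$. Let $\chi$ be the Euler form on $K_0(\mathcal{C})$ and $\Lambda_n=\ker(\mathrm{rk},\deg)\subset K_0(\mathcal{C})$. The elements $\varepsilon_i=[S_i]+\frac12([\mathcal{O}_{\mathcal{C}}(-1)]-[\mathcal{O}_{\mathcal{C}}])$, $i=1,\dots,n$, form a basis of $(\Lambda_n)_{\mathbb{Q}}$, orthonormal with respect to $\chi$. One has $K_0(\mathcal{C})_{\mathbb{Q}}=M\oplus(\Lambda_n)_{\mathbb{Q}}$, where $M$ is the orthogonal to $\Lambda_n$ with respect to $\chi$ (left and right orthogonals coincide), and $\pi:K_0(\mathcal{C})_{\mathbb{Q}}\to(\Lambda_n)_{\mathbb{Q}}$ is the projection along $M$. The Weyl group $W(D_n)$ acts on $(\Lambda_n)_{\mathbb{Q}}=\bigoplus\mathbb{Q}\varepsilon_i$ by permutations of the $\varepsilon_i$ and sign changes of an even number of them. *)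

theory Defs
  imports "HOL-Library.Function_Algebras" "HOL-Library.Cardinality" "HOL-Computational_Algebra.Polynomial"
begin

text \<open>
  The weighted projective line \<open>\<C>\<close> with all weights 2 is the quotient stack
  \<open>[(Spec S - 0) / Spec k[L]]\<close>, where
  \<open>S = k[X0, X1, t_i] / (t_i^2 = l_i(X0, X1))\<close>, \<open>l_i\<close> is the linear form vanishing at the
  \<open>i\<close>-th marked point, \<open>L\<close> is the group generated by \<open>x_i\<close> with relations \<open>2 x_i = 2 x_j\<close>,
  \<open>t_i\<close> has degree \<open>x_i\<close> and \<open>X0, X1\<close> have degree \<open>c = 2 x_i\<close>. (A point of the root stack is a point
  of the projective line with square roots \<open>t_i\<close> of the sections \<open>l_i\<close> of \<open>O(1)\<close>.)
  Sheaves are \<open>L\<close>-graded modules glued along the cover by the loci where \<open>X0\<close>, resp. \<open>X1\<close>, is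
  invertible. The marked points are given by a function \<open>lam\<close> from a finite index type into pairs of
  homogeneous coordinates.
\<close>

section \<open>The Picard group\<close>

quotient_type 'n pic = "'n::finite \<Rightarrow> int" /
  "\<lambda>a b. (\<forall>i. even (a i - b i)) \<and> (\<Sum>i\<in>UNIV. a i) = (\<Sum>i\<in>UNIV. b i)"
  by (rule equivpI; auto simp: reflp_def symp_def transp_def)

text \<open>The subgroup spanned by the \<open>2 x_i - 2 x_j\<close> consists of the vectors with even entries and sum 0.\<close>

instantiation pic :: (finite) ab_group_add
begin
lift_definition zero_pic :: "'a pic" is "\<lambda>_. 0" .
lift_definition plus_pic :: "'a pic \<Rightarrow> 'a pic \<Rightarrow> 'a pic" is "\<lambda>a b i. a i + b i"
  by (auto simp: sum.distrib)
lift_definition uminus_pic :: "'a pic \<Rightarrow> 'a pic" is "\<lambda>a i. - a i"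
  by (auto simp: sum_negf)
lift_definition minus_pic :: "'a pic \<Rightarrow> 'a pic \<Rightarrow> 'a pic" is "\<lambda>a b i. a i - b i"
  by (auto simp: sum_subtractf)
instance
  by standard (transfer; simp add: algebra_simps)+
end

lift_definition px :: "'n::finite \<Rightarrow> 'n pic" is "\<lambda>i j. if j = i then 1 else 0" .

definition pc :: "'n::finite pic" where
  "pc = (THE u. \<forall>i. u = px i + px i)"

lift_definition pdeg :: "'n::finite pic \<Rightarrow> int" is "\<lambda>a. \<Sum>i\<in>UNIV. a i" by blast

lift_definition podd :: "'n::finite pic \<Rightarrow> 'n set" is "\<lambda>a. {i. odd (a i)}" by auto

text \<open>Normal form: \<open>u = (sum of x_i over podd u) + pmul u * c\<close>.\<close>
definition pmul :: "'n::finite pic \<Rightarrow> int" where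
  "pmul u = (pdeg u - int (card (podd u))) div 2"

section \<open>Graded modules on the charts\<close>

text \<open>All modules live on subspaces of one vector space of infinite dimension. Sections of
  coherent sheaves over the charts have countable dimension, so every coherent sheaf has an
  isomorphic copy of this form.\<close>
type_synonym 'k amb = "int \<Rightarrow> 'k"

definition asc :: "'k::field \<Rightarrow> 'k amb \<Rightarrow> 'k amb" where
  "asc c a = (\<lambda>n. c * a n)"

text \<open>\<open>U0\<close> and \<open>U1\<close> are the loci where \<open>X0\<close>, resp. \<open>X1\<close>, is invertible; \<open>U01\<close> is their intersection.\<close>
datatype chart = U0 | U1 | U01

record ('n, 'k) gmod =
  gsp :: "'n pic \<Rightarrow> 'k amb set"
  opt :: "'n \<Rightarrow> 'n pic \<Rightarrow> 'k amb \<Rightarrow> 'k amb"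
  opx0 :: "'n pic \<Rightarrow> 'k amb \<Rightarrow> 'k amb"
  opx1 :: "'n pic \<Rightarrow> 'k amb \<Rightarrow> 'k amb"

definition linear_between :: "'k::field amb set \<Rightarrow> 'k amb set \<Rightarrow> ('k amb \<Rightarrow> 'k amb) \<Rightarrow> bool" where
  "linear_between U W f \<longleftrightarrow>
     (\<forall>a\<in>U. f a \<in> W) \<and> (\<forall>a\<in>U. \<forall>b\<in>U. f (a + b) = f a + f b) \<and>
     (\<forall>c. \<forall>a\<in>U. f (asc c a) = asc c (f a))"

text \<open>Multiplication by the linear form \<open>\<alpha> X0 + \<beta> X1\<close>, and by a product of such forms (tracking
  degrees).\<close>
definition lmul :: "('n::finite, 'k::field) gmod \<Rightarrow> 'k \<times> 'k \<Rightarrow> 'n pic \<Rightarrow> 'k amb \<Rightarrow> 'k amb" where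
  "lmul M l u a = asc (fst l) (opx0 M u a) + asc (snd l) (opx1 M u a)"

fun lmuls :: "('n::finite, 'k::field) gmod \<Rightarrow> ('k \<times> 'k) list \<Rightarrow> 'n pic \<times> 'k amb \<Rightarrow> 'n pic \<times> 'k amb" where
  "lmuls M [] y = y"
| "lmuls M (l # ls) y = lmuls M ls (fst y + pc, lmul M l (fst y) (snd y))"

text \<open>The linear form vanishing at the point \<open>[q0 : q1]\<close>.\<close>
definition vform :: "'k::field \<times> 'k \<Rightarrow> 'k \<times> 'k" where
  "vform q = (snd q, - fst q)"

definition same_point :: "'k::field \<times> 'k \<Rightarrow> 'k \<times> 'k \<Rightarrow> bool" where
  "same_point p q \<longleftrightarrow> fst p * snd q = snd p * fst q"

definition distinct_points :: "('n \<Rightarrow> 'k::field \<times> 'k) \<Rightarrow> bool" where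
  "distinct_points lam \<longleftrightarrow>
     (\<forall>i. lam i \<noteq> (0, 0)) \<and> (\<forall>i j. i \<noteq> j \<longrightarrow> \<not> same_point (lam i) (lam j))"

definition gmodule :: "('n::finite \<Rightarrow> 'k::field \<times> 'k) \<Rightarrow> chart \<Rightarrow> ('n, 'k) gmod \<Rightarrow> bool" where
  "gmodule lam j M \<longleftrightarrow>
     (\<forall>u. module.subspace asc (gsp M u)) \<and>
     (\<forall>i u. linear_between (gsp M u) (gsp M (u + px i)) (opt M i u)) \<and>
     (\<forall>u. linear_between (gsp M u) (gsp M (u + pc)) (opx0 M u)) \<and>
     (\<forall>u. linear_between (gsp M u) (gsp M (u + pc)) (opx1 M u)) \<and>
     (\<forall>u. \<forall>a\<in>gsp M u.
        opx0 M (u + pc) (opx1 M u a) = opx1 M (u + pc) (opx0 M u a) \<and>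
        (\<forall>i. opx0 M (u + px i) (opt M i u a) = opt M i (u + pc) (opx0 M u a) \<and>
             opx1 M (u + px i) (opt M i u a) = opt M i (u + pc) (opx1 M u a) \<and>
             opt M i (u + px i) (opt M i u a) = lmul M (vform (lam i)) u a) \<and>
        (\<forall>i k. opt M i (u + px k) (opt M k u a) = opt M k (u + px i) (opt M i u a))) \<and>
     (j \<noteq> U1 \<longrightarrow> (\<forall>u. bij_betw (opx0 M u) (gsp M u) (gsp M (u + pc)))) \<and>
     (j \<noteq> U0 \<longrightarrow> (\<forall>u. bij_betw (opx1 M u) (gsp M u) (gsp M (u + pc))))"

text \<open>Graded submodules over the localized ring: closed also under the inverse of \<open>X0\<close>, resp. \<open>X1\<close>.\<close>
definition gsubmodule ::
  "chart \<Rightarrow> ('n::finite, 'k::field) gmod \<Rightarrow> ('n pic \<Rightarrow> 'k amb set) \<Rightarrow> bool" where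
  "gsubmodule j M N \<longleftrightarrow>
     (\<forall>u. module.subspace asc (N u) \<and> N u \<subseteq> gsp M u) \<and>
     (\<forall>u. \<forall>a\<in>N u. (\<forall>i. opt M i u a \<in> N (u + px i)) \<and>
        opx0 M u a \<in> N (u + pc) \<and> opx1 M u a \<in> N (u + pc)) \<and>
     (j \<noteq> U1 \<longrightarrow> (\<forall>u. \<forall>a\<in>gsp M u. opx0 M u a \<in> N (u + pc) \<longrightarrow> a \<in> N u)) \<and>
     (j \<noteq> U0 \<longrightarrow> (\<forall>u. \<forall>a\<in>gsp M u. opx1 M u a \<in> N (u + pc) \<longrightarrow> a \<in> N u))"

definition generates ::
  "chart \<Rightarrow> ('n::finite, 'k::field) gmod \<Rightarrow> ('n pic \<times> 'k amb) set \<Rightarrow> bool" where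
  "generates j M G \<longleftrightarrow>
     (\<forall>(u, a)\<in>G. a \<in> gsp M u) \<and>
     (\<forall>N. gsubmodule j M N \<and> (\<forall>(u, a)\<in>G. a \<in> N u) \<longrightarrow> (\<forall>u. N u = gsp M u))"

definition ghom ::
  "('n::finite, 'k::field) gmod \<Rightarrow> ('n, 'k) gmod \<Rightarrow> ('n pic \<Rightarrow> 'k amb \<Rightarrow> 'k amb) \<Rightarrow> bool" where
  "ghom M N f \<longleftrightarrow>
     (\<forall>u. linear_between (gsp M u) (gsp N u) (f u)) \<and>
     (\<forall>u. \<forall>a\<in>gsp M u.
        (\<forall>i. f (u + px i) (opt M i u a) = opt N i u (f u a)) \<and>
        f (u + pc) (opx0 M u a) = opx0 N u (f u a) \<and>
        f (u + pc) (opx1 M u a) = opx1 N u (f u a))"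

text \<open>Homomorphisms normalized to vanish off the module, so that they form a vector space.\<close>
definition gHom ::
  "('n::finite, 'k::field) gmod \<Rightarrow> ('n, 'k) gmod \<Rightarrow> ('n pic \<Rightarrow> 'k amb \<Rightarrow> 'k amb) set" where
  "gHom M N = {f. ghom M N f \<and> (\<forall>u a. a \<notin> gsp M u \<longrightarrow> f u a = 0)}"

section \<open>Coherent sheaves\<close>

text \<open>\<open>res sh j\<close> is the restriction from \<open>j \<in> {U0, U1}\<close> to \<open>U01\<close>.\<close>
record ('n, 'k) sheaf =
  ch :: "chart \<Rightarrow> ('n, 'k) gmod"
  res :: "chart \<Rightarrow> 'n pic \<Rightarrow> 'k amb \<Rightarrow> 'k amb"

text \<open>\<open>f : M \<rightarrow> M'\<close> exhibits \<open>M'\<close> as the localization of \<open>M\<close> at the linear form \<open>l\<close>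
  (given that \<open>l\<close> is invertible on \<open>M'\<close>).\<close>
definition localizes ::
  "'k \<times> 'k \<Rightarrow> ('n::finite, 'k::field) gmod \<Rightarrow> ('n, 'k) gmod \<Rightarrow> ('n pic \<Rightarrow> 'k amb \<Rightarrow> 'k amb) \<Rightarrow> bool" where
  "localizes l M M' f \<longleftrightarrow> ghom M M' f \<and>
     (\<forall>u. \<forall>a\<in>gsp M u. f u a = 0 \<longrightarrow> (\<exists>m. snd (lmuls M (replicate m l) (u, a)) = 0)) \<and>
     (\<forall>u. \<forall>b\<in>gsp M' u. \<exists>m v a. a \<in> gsp M v \<and> (v, f v a) = lmuls M' (replicate m l) (u, b))"

definition coherent :: "('n::finite \<Rightarrow> 'k::field \<times> 'k) \<Rightarrow> ('n, 'k) sheaf \<Rightarrow> bool" where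
  "coherent lam F \<longleftrightarrow>
     (\<forall>j. gmodule lam j (ch F j) \<and> (\<exists>G. finite G \<and> generates j (ch F j) G)) \<and>
     localizes (0, 1) (ch F U0) (ch F U01) (res F U0) \<and>
     localizes (1, 0) (ch F U1) (ch F U01) (res F U1)"

type_synonym ('n, 'k) shmap = "chart \<Rightarrow> 'n pic \<Rightarrow> 'k amb \<Rightarrow> 'k amb"

definition Hom :: "('n::finite, 'k::field) sheaf \<Rightarrow> ('n, 'k) sheaf \<Rightarrow> ('n, 'k) shmap set" where
  "Hom E F = {f. (\<forall>j. f j \<in> gHom (ch E j) (ch F j)) \<and>
     (\<forall>j\<in>{U0, U1}. \<forall>u. \<forall>a\<in>gsp (ch E j) u. f U01 u (res E j u a) = res F j u (f j u a))}"

definition scalar_map :: "('n::finite, 'k::field) sheaf \<Rightarrow> 'k \<Rightarrow> ('n, 'k) shmap" where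
  "scalar_map E c j u a = (if a \<in> gsp (ch E j) u then asc c a else 0)"

definition short_exact ::
  "('n::finite \<Rightarrow> 'k::field \<times> 'k) \<Rightarrow> ('n, 'k) sheaf \<Rightarrow> ('n, 'k) shmap \<Rightarrow> ('n, 'k) sheaf \<Rightarrow>
   ('n, 'k) shmap \<Rightarrow> ('n, 'k) sheaf \<Rightarrow> bool" where
  "short_exact lam E f F g G \<longleftrightarrow>
     coherent lam E \<and> coherent lam F \<and> coherent lam G \<and> f \<in> Hom E F \<and> g \<in> Hom F G \<and>
     (\<forall>j u. inj_on (f j u) (gsp (ch E j) u) \<and>
        f j u ` gsp (ch E j) u = {b\<in>gsp (ch F j) u. g j u b = 0} \<and>
        g j u ` gsp (ch F j) u = gsp (ch G j) u)"

section \<open>Line bundles and the simple sheaves\<close>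

text \<open>The degree \<open>u\<close> part of \<open>S\<close> localized on the chart \<open>j\<close>. It is spanned by the elements
  \<open>X0^(m - n) X1^n * (product of t_i over podd u)\<close> with \<open>m = pmul u\<close>; an element is encoded by
  its coefficients as a function of \<open>n\<close>.\<close>
definition ring_part :: "chart \<Rightarrow> 'n::finite pic \<Rightarrow> 'k::field amb set" where
  "ring_part j u = {p. finite {n. p n \<noteq> 0} \<and>
     (j = U0 \<longrightarrow> (\<forall>n<0. p n = 0)) \<and> (j = U1 \<longrightarrow> (\<forall>n>pmul u. p n = 0))}"

definition shift1 :: "'k amb \<Rightarrow> 'k amb" where
  "shift1 p = (\<lambda>n. p (n - 1))"

definition O_chart :: "('n::finite \<Rightarrow> 'k::field \<times> 'k) \<Rightarrow> 'n pic \<Rightarrow> chart \<Rightarrow> ('n, 'k) gmod" where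
  "O_chart lam u j = \<lparr>
     gsp = (\<lambda>v. ring_part j (u + v)),
     opt = (\<lambda>i v p. if i \<in> podd (u + v)
              then asc (fst (vform (lam i))) p + asc (snd (vform (lam i))) (shift1 p) else p),
     opx0 = (\<lambda>v p. p),
     opx1 = (\<lambda>v p. shift1 p) \<rparr>"

definition O_sheaf :: "('n::finite \<Rightarrow> 'k::field \<times> 'k) \<Rightarrow> 'n pic \<Rightarrow> ('n, 'k) sheaf" where
  "O_sheaf lam u = \<lparr> ch = O_chart lam u, res = (\<lambda>j v p. p) \<rparr>"

text \<open>Multiplication by \<open>t_i\<close>, from \<open>O(u)\<close> to \<open>O(u + x_i)\<close>.\<close>
definition t_map :: "('n::finite \<Rightarrow> 'k::field \<times> 'k) \<Rightarrow> 'n \<Rightarrow> 'n pic \<Rightarrow> ('n, 'k) shmap" where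
  "t_map lam i u j v p =
     (if p \<in> gsp (O_chart lam u j) v then opt (O_chart lam u j) i v p else 0)"

definition S_sheaf :: "('n::finite \<Rightarrow> 'k::field \<times> 'k) \<Rightarrow> 'n \<Rightarrow> ('n, 'k) sheaf" where
  "S_sheaf lam i = (SOME F. \<exists>q.
     short_exact lam (O_sheaf lam (- px i)) (t_map lam i (- px i)) (O_sheaf lam 0) q F)"

definition S'_sheaf :: "('n::finite \<Rightarrow> 'k::field \<times> 'k) \<Rightarrow> 'n \<Rightarrow> ('n, 'k) sheaf" where
  "S'_sheaf lam i = (SOME F. \<exists>q.
     short_exact lam (O_sheaf lam 0) (t_map lam i 0) (O_sheaf lam (px i)) q F)"

section \<open>Vector bundles\<close>

text \<open>Every point \<open>p\<close> of the projective line has an open neighbourhood, the complement of a finite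
  set \<open>Q\<close>, on which \<open>V\<close> is isomorphic to a direct sum of \<open>r\<close> line bundles \<open>O(us ! k)\<close>. After
  multiplication by forms that are invertible off \<open>Q\<close>, the isomorphism extends to a map \<open>\<phi>\<close> on a
  chart containing \<open>p\<close>, with kernel zero (line bundles have no torsion) and cokernel supported
  on \<open>Q\<close>.\<close>
definition vector_bundle ::
  "('n::finite \<Rightarrow> 'k::field \<times> 'k) \<Rightarrow> nat \<Rightarrow> ('n, 'k) sheaf \<Rightarrow> bool" where
  "vector_bundle lam r V \<longleftrightarrow> coherent lam V \<and>
     (\<forall>p. \<forall>j. (j = U0 \<and> fst p \<noteq> 0) \<or> (j = U1 \<and> snd p \<noteq> 0) \<longrightarrow>
       (\<exists>us \<phi> Q. length us = r \<and> finite Q \<and> (\<forall>q\<in>Q. \<not> same_point p q) \<and>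
         (\<forall>k<r. ghom (O_chart lam (us ! k) j) (ch V j) (\<phi> k)) \<and>
         (\<forall>v s. (\<forall>k<r. s k \<in> gsp (O_chart lam (us ! k) j) v) \<and> (\<Sum>k<r. \<phi> k v (s k)) = 0 \<longrightarrow>
            (\<forall>k<r. s k = 0)) \<and>
         (\<forall>v. \<forall>a\<in>gsp (ch V j) v. \<exists>qs w s. set qs \<subseteq> Q \<and>
            (\<forall>k<r. s k \<in> gsp (O_chart lam (us ! k) j) w) \<and>
            lmuls (ch V j) (map vform qs) (v, a) = (w, \<Sum>k<r. \<phi> k w (s k)))))"

definition is_bundle :: "('n::finite \<Rightarrow> 'k::field \<times> 'k) \<Rightarrow> ('n, 'k) sheaf \<Rightarrow> bool" where
  "is_bundle lam V \<longleftrightarrow> (\<exists>r. vector_bundle lam r V)"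

subsection \<open>Determinant and degree\<close>

definition homog_lists :: "('n, 'k) gmod \<Rightarrow> nat \<Rightarrow> ('n pic \<times> 'k amb) list set" where
  "homog_lists M r = {xs. length xs = r \<and> (\<forall>(u, a)\<in>set xs. a \<in> gsp M u)}"

definition deg_sum :: "('n::finite pic \<times> 'a) list \<Rightarrow> 'n pic" where
  "deg_sum xs = sum_list (map fst xs)"

text \<open>Alternating \<open>r\<close>-linear maps \<open>M^r \<rightarrow> N\<close> of graded modules, given on homogeneous elements.\<close>
definition alternating ::
  "nat \<Rightarrow> ('n::finite, 'k::field) gmod \<Rightarrow> ('n, 'k) gmod \<Rightarrow> (('n pic \<times> 'k amb) list \<Rightarrow> 'k amb) \<Rightarrow> bool" where
  "alternating r M N w \<longleftrightarrow>
     (\<forall>xs\<in>homog_lists M r. w xs \<in> gsp N (deg_sum xs)) \<and>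
     (\<forall>xs\<in>homog_lists M r. \<forall>k<r. \<forall>v. \<forall>a\<in>gsp M v.
        (\<forall>b\<in>gsp M v. w (xs[k := (v, a + b)]) = w (xs[k := (v, a)]) + w (xs[k := (v, b)])) \<and>
        (\<forall>c. w (xs[k := (v, asc c a)]) = asc c (w (xs[k := (v, a)]))) \<and>
        (\<forall>i. w (xs[k := (v + px i, opt M i v a)]) =
               opt N i (deg_sum (xs[k := (v, a)])) (w (xs[k := (v, a)]))) \<and>
        w (xs[k := (v + pc, opx0 M v a)]) =
               opx0 N (deg_sum (xs[k := (v, a)])) (w (xs[k := (v, a)])) \<and>
        w (xs[k := (v + pc, opx1 M v a)]) =
               opx1 N (deg_sum (xs[k := (v, a)])) (w (xs[k := (v, a)]))) \<and>
     (\<forall>xs\<in>homog_lists M r. \<forall>k<r. \<forall>l<r. k \<noteq> l \<longrightarrow>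
        (xs ! k = xs ! l \<longrightarrow> w xs = 0) \<and> w (xs[k := xs ! l, l := xs ! k]) = - w xs)"

text \<open>The top exterior power of the rank \<open>r\<close> bundle \<open>V\<close> is isomorphic to \<open>O(u)\<close>: a map from it
  to \<open>O(u)\<close> is an alternating form, and a map of line bundles is an isomorphism iff it is
  surjective.\<close>
definition det_iso ::
  "('n::finite \<Rightarrow> 'k::field \<times> 'k) \<Rightarrow> nat \<Rightarrow> ('n, 'k) sheaf \<Rightarrow> 'n pic \<Rightarrow> bool" where
  "det_iso lam r V u \<longleftrightarrow> (\<exists>w.
     (\<forall>j. alternating r (ch V j) (O_chart lam u j) (w j) \<and>
        generates j (O_chart lam u j) {(deg_sum xs, w j xs) |xs. xs \<in> homog_lists (ch V j) r}) \<and>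
     (\<forall>j\<in>{U0, U1}. \<forall>xs\<in>homog_lists (ch V j) r.
        w U01 (map (\<lambda>(v, a). (v, res V j v a)) xs) =
        res (O_sheaf lam u) j (deg_sum xs) (w j xs)))"

definition bundle_degree :: "('n::finite \<Rightarrow> 'k::field \<times> 'k) \<Rightarrow> ('n, 'k) sheaf \<Rightarrow> int" where
  "bundle_degree lam V = pdeg (THE u. \<exists>r. vector_bundle lam r V \<and> det_iso lam r V u)"

section \<open>Ext from vector bundles, exceptional and omnipresent bundles\<close>

text \<open>For a bundle \<open>V\<close>, \<open>RHom(V, F)\<close> is the cohomology of the sheaf of homomorphisms from \<open>V\<close> to
  \<open>F\<close>, computed by the Cech complex of the cover \<open>{U0, U1}\<close>,
  \<open>Hom(V|U0, F|U0) \<times> Hom(V|U1, F|U1) \<rightarrow> Hom(V|U01, F|U01)\<close>, which lives in degrees 0 and 1. Its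
  kernel is \<open>Hom V F\<close>. The following are the terms in degree 1 and the image of the
  differential \<open>(f0, f1) \<mapsto> f1 - f0\<close>.\<close>
definition cech1 ::
  "('n::finite, 'k::field) sheaf \<Rightarrow> ('n, 'k) sheaf \<Rightarrow> ('n pic \<Rightarrow> 'k amb \<Rightarrow> 'k amb) set" where
  "cech1 V F = gHom (ch V U01) (ch F U01)"

definition restricts ::
  "('n::finite, 'k::field) sheaf \<Rightarrow> ('n, 'k) sheaf \<Rightarrow> chart \<Rightarrow> ('n pic \<Rightarrow> 'k amb \<Rightarrow> 'k amb) \<Rightarrow>
   ('n pic \<Rightarrow> 'k amb \<Rightarrow> 'k amb) \<Rightarrow> bool" where
  "restricts V F j f g \<longleftrightarrow>
     f \<in> gHom (ch V j) (ch F j) \<and> g \<in> gHom (ch V U01) (ch F U01) \<and>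
     (\<forall>u. \<forall>a\<in>gsp (ch V j) u. g u (res V j u a) = res F j u (f u a))"

definition cech_boundaries ::
  "('n::finite, 'k::field) sheaf \<Rightarrow> ('n, 'k) sheaf \<Rightarrow> ('n pic \<Rightarrow> 'k amb \<Rightarrow> 'k amb) set" where
  "cech_boundaries V F =
     {g1 - g0 |g0 g1. (\<exists>f0. restricts V F U0 f0 g0) \<and> (\<exists>f1. restricts V F U1 f1 g1)}"

text \<open>Dimension of \<open>W / U\<close>, when it is finite.\<close>
definition quot_dim :: "('k::field \<Rightarrow> 'v::ab_group_add \<Rightarrow> 'v) \<Rightarrow> 'v set \<Rightarrow> 'v set \<Rightarrow> nat" where
  "quot_dim sc U W =
     (LEAST m. \<exists>B. finite B \<and> card B = m \<and> B \<subseteq> W \<and> W \<subseteq> module.span sc (U \<union> B))"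

definition dim_Hom :: "('n::finite, 'k::field) sheaf \<Rightarrow> ('n, 'k) sheaf \<Rightarrow> nat" where
  "dim_Hom V F = quot_dim (\<lambda>c f j u a. asc c (f j u a)) {0} (Hom V F)"

definition dim_Ext1 :: "('n::finite, 'k::field) sheaf \<Rightarrow> ('n, 'k) sheaf \<Rightarrow> nat" where
  "dim_Ext1 V F = quot_dim (\<lambda>c f u a. asc c (f u a)) (cech_boundaries V F) (cech1 V F)"

definition exceptional_bundle :: "('n::finite \<Rightarrow> 'k::field \<times> 'k) \<Rightarrow> ('n, 'k) sheaf \<Rightarrow> bool" where
  "exceptional_bundle lam V \<longleftrightarrow> is_bundle lam V \<and>
     Hom V V = range (scalar_map V) \<and> scalar_map V 1 \<noteq> 0 \<and>
     cech1 V V = cech_boundaries V V"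

definition omnipresent :: "('n::finite \<Rightarrow> 'k::field \<times> 'k) \<Rightarrow> ('n, 'k) sheaf \<Rightarrow> bool" where
  "omnipresent lam V \<longleftrightarrow> exceptional_bundle lam V \<and>
     (\<forall>i. Hom V (S_sheaf lam i) \<noteq> {0} \<and> Hom V (S'_sheaf lam i) \<noteq> {0})"

section \<open>The Grothendieck group with rational coefficients\<close>

text \<open>\<open>K_0\<close> tensored with the rationals, as the rational vector space on coherent sheaves modulo
  the relations \<open>[F] = [E] + [G]\<close> for short exact sequences. Its elements are cosets of formal sums.\<close>
type_synonym ('n, 'k) fsum = "('n, 'k) sheaf \<Rightarrow> rat"

definition fsc :: "rat \<Rightarrow> ('n, 'k) fsum \<Rightarrow> ('n, 'k) fsum" where
  "fsc c x = (\<lambda>F. c * x F)"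

definition gen :: "('n, 'k) sheaf \<Rightarrow> ('n, 'k) fsum" where
  "gen F = (\<lambda>E. if E = F then 1 else 0)"

definition K_free :: "('n::finite \<Rightarrow> 'k::field \<times> 'k) \<Rightarrow> ('n, 'k) fsum set" where
  "K_free lam = module.span fsc {gen F |F. coherent lam F}"

definition K_rel :: "('n::finite \<Rightarrow> 'k::field \<times> 'k) \<Rightarrow> ('n, 'k) fsum set" where
  "K_rel lam = module.span fsc {gen F - gen E - gen G |E F G. \<exists>f g. short_exact lam E f F g G}"

definition K_class :: "('n::finite \<Rightarrow> 'k::field \<times> 'k) \<Rightarrow> ('n, 'k) fsum \<Rightarrow> ('n, 'k) fsum set" where
  "K_class lam x = {y \<in> K_free lam. y - x \<in> K_rel lam}"

definition K0 :: "('n::finite \<Rightarrow> 'k::field \<times> 'k) \<Rightarrow> ('n, 'k) fsum set set" where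
  "K0 lam = K_class lam ` K_free lam"

definition sheaf_class :: "('n::finite \<Rightarrow> 'k::field \<times> 'k) \<Rightarrow> ('n, 'k) sheaf \<Rightarrow> ('n, 'k) fsum set" where
  "sheaf_class lam F = K_class lam (gen F)"

definition K_add :: "('n, 'k) fsum set \<Rightarrow> ('n, 'k) fsum set \<Rightarrow> ('n, 'k) fsum set" where
  "K_add X Y = {x + y |x y. x \<in> X \<and> y \<in> Y}"

text \<open>Adding \<open>K_rel\<close> only matters for \<open>c = 0\<close>.\<close>
definition K_scale ::
  "('n::finite \<Rightarrow> 'k::field \<times> 'k) \<Rightarrow> rat \<Rightarrow> ('n, 'k) fsum set \<Rightarrow> ('n, 'k) fsum set" where
  "K_scale lam c X = {fsc c x + y |x y. x \<in> X \<and> y \<in> K_rel lam}"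

definition K_linear ::
  "('n::finite \<Rightarrow> 'k::field \<times> 'k) \<Rightarrow> (('n, 'k) fsum set \<Rightarrow> rat) \<Rightarrow> bool" where
  "K_linear lam h \<longleftrightarrow>
     (\<forall>X\<in>K0 lam. \<forall>Y\<in>K0 lam. h (K_add X Y) = h X + h Y) \<and>
     (\<forall>c. \<forall>X\<in>K0 lam. h (K_scale lam c X) = c * h X)"

text \<open>Every coherent sheaf has a finite resolution by vector bundles, so the classes of bundles
  span \<open>K_0\<close> and the following properties determine rank, degree and Euler form on \<open>K0 lam\<close>.\<close>
definition K_rank :: "('n::finite \<Rightarrow> 'k::field \<times> 'k) \<Rightarrow> ('n, 'k) fsum set \<Rightarrow> rat" where
  "K_rank lam = (SOME h. K_linear lam h \<and>
     (\<forall>r V. vector_bundle lam r V \<longrightarrow> h (sheaf_class lam V) = of_nat r))"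

definition K_degree :: "('n::finite \<Rightarrow> 'k::field \<times> 'k) \<Rightarrow> ('n, 'k) fsum set \<Rightarrow> rat" where
  "K_degree lam = (SOME h. K_linear lam h \<and>
     (\<forall>V. is_bundle lam V \<longrightarrow> h (sheaf_class lam V) = of_int (bundle_degree lam V)))"

definition euler_form ::
  "('n::finite \<Rightarrow> 'k::field \<times> 'k) \<Rightarrow> ('n, 'k) fsum set \<Rightarrow> ('n, 'k) fsum set \<Rightarrow> rat" where
  "euler_form lam = (SOME b.
     (\<forall>X\<in>K0 lam. K_linear lam (b X) \<and> K_linear lam (\<lambda>Y. b Y X)) \<and>
     (\<forall>V F. is_bundle lam V \<and> coherent lam F \<longrightarrow>
        b (sheaf_class lam V) (sheaf_class lam F) = of_nat (dim_Hom V F) - of_nat (dim_Ext1 V F)))"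

definition Lambda :: "('n::finite \<Rightarrow> 'k::field \<times> 'k) \<Rightarrow> ('n, 'k) fsum set set" where
  "Lambda lam = {X \<in> K0 lam. K_rank lam X = 0 \<and> K_degree lam X = 0}"

definition Lambda_perp :: "('n::finite \<Rightarrow> 'k::field \<times> 'k) \<Rightarrow> ('n, 'k) fsum set set" where
  "Lambda_perp lam = {X \<in> K0 lam. \<forall>Y\<in>Lambda lam. euler_form lam X Y = 0 \<and> euler_form lam Y X = 0}"

definition Lambda_proj ::
  "('n::finite \<Rightarrow> 'k::field \<times> 'k) \<Rightarrow> ('n, 'k) fsum set \<Rightarrow> ('n, 'k) fsum set" where
  "Lambda_proj lam X = (THE Y. Y \<in> Lambda lam \<and> (\<exists>Z\<in>Lambda_perp lam. X = K_add Y Z))"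

text \<open>The class of \<open>\<Sum>i. a i * \<epsilon>_i\<close>.\<close>
definition eps_comb ::
  "('n::finite \<Rightarrow> 'k::field \<times> 'k) \<Rightarrow> ('n \<Rightarrow> rat) \<Rightarrow> ('n, 'k) fsum set" where
  "eps_comb lam a = K_class lam (\<Sum>i\<in>UNIV. fsc (a i)
     (gen (S_sheaf lam i) + fsc (1/2) (gen (O_sheaf lam (- pc)) - gen (O_sheaf lam 0))))"

text \<open>\<open>W(D_n)\<close>: the pair \<open>(\<sigma>, s)\<close> maps \<open>\<epsilon>_i\<close> to \<open>s i * \<epsilon>_(\<sigma> i)\<close>.\<close>
definition weyl_D :: "(('n::finite \<Rightarrow> 'n) \<times> ('n \<Rightarrow> rat)) set" where
  "weyl_D = {(\<sigma>, s). bij \<sigma> \<and> (\<forall>i. s i \<in> {1, -1}) \<and> even (card {i. s i = -1})}"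

definition weyl_orbit ::
  "('n::finite \<Rightarrow> 'k::field \<times> 'k) \<Rightarrow> ('n, 'k) fsum set \<Rightarrow> ('n, 'k) fsum set set" where
  "weyl_orbit lam X =
     {eps_comb lam b |a b \<sigma> s. X = eps_comb lam a \<and> (\<sigma>, s) \<in> weyl_D \<and> (\<forall>i. b (\<sigma> i) = s i * a i)}"

end

theory Submission imports Defs "Jordan_Normal_Form.Determinant" begin

text \<open>A vector bundle is filtered by line bundles, so its Euler pairings are determined by its rank \<open>r\<close>, its
degree \<open>d\<close> and the integers \<open>tau i\<close>, twice the coordinates of its projection to the root lattice. For an exceptional
bundle, \<open>chi(V, V) = 1\<close> says that the sum of the \<open>(tau i)^2\<close> is \<open>r^2 + 4\<close>; omnipresence gives \<open>\<bar>tau i\<bar> <= r - 2\<close>.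
Since \<open>V\<close> is simple of rank at least 2, a line bundle \<open>L\<close> of degree 0 cannot have nonzero maps both to and from
\<open>V\<close>, so \<open>chi(V, L)\<close> or \<open>chi(L, V)\<close> is nonpositive; this bounds every sum of the \<open>tau i\<close> with an even number of signs
changed by \<open>r - 2 d\<close>. These inequalities and \<open>r > (- d + 1)^2\<close> only leave \<open>r = 11\<close>, \<open>d = -2\<close>, \<open>\<bar>tau i\<bar> = 5\<close>.\<close>

text \<open>Rank, degree and Euler form are chosen by description in the statement, so each needs a
  concrete candidate and a uniqueness proof. The candidates come from the numbers
  \<open>chs F v\<close>, the Euler characteristics of the twists F(v): these are additive and known
  on line bundles, whose classes span \<open>K_0\<close>. Rank \<open>rho\<close>, degree
  \<open>dlt\<close> and the \<open>tau i\<close> are linear combinations of them. Two points need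
  geometry. Nonzero ideal sheaves in line bundles are line bundles, which yields an induction over
  coherent sheaves and the filtrations of bundles. The determinant of a filtered bundle is the
  product of the factors, which identifies \<open>dlt\<close> with the degree. With five points,
  chi(V, V) = (sum of (tau i)^2 - r^2) / 4, whence r^2 + 4. If S is the signed sum of the
  \<open>tau i\<close> given by the parities of L, then chi(V, L) = (S - r - 2 d) / 4 and chi(L, V)
  = (S - r + 2 d) / 4; as d < 0, the second gives the weaker bound. The final case is tight: 11^2 +
  4 is five times 5^2.\<close>

abbreviation "Oc == O_chart"
abbreviation "Os == O_sheaf"
abbreviation "Rp == ring_part"
abbreviation "sx V j == gsp (ch V j)"
abbreviation adp :: "('n::finite => 'k::alg_closed_field \<times> 'k) => bool" where "adp == distinct_points"
abbreviation iff' (infixr "<->" 25) where "A <-> B == (A :: bool) = B"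
abbreviation "Hl == homog_lists"
abbreviation "dsum == deg_sum"
abbreviation "cohr == coherent"
abbreviation "gsub == gsubmodule"
abbreviation "gmd == gmodule"
abbreviation "qd == quot_dim"
abbreviation "gnr == generates"
abbreviation "Kc == K_class"
abbreviation "sexact == short_exact"
abbreviation "scl == sheaf_class"
abbreviation "lbet == linear_between"
lemmas fun0 = zero_fun_apply and funp = plus_fun_apply and asimps = algebra_simps and Rp_def = ring_part_def
type_synonym ('n,'k) mp = "'n pic => 'k amb => 'k amb"

section \<open>Dimensions of quotients and additivity of the index\<close>

definition lin_on :: "('k => 'a => 'a) => ('k => 'b => 'b) => 'a::plus set => ('a => 'b::plus) => bool" where
 "lin_on s1 s2 W f <-> (ALL a:W. ALL b:W. f (a + b) = f a + f b) & (ALL c. ALL a:W. f (s1 c a) = s2 c (f a))"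

text \<open>\<open>quot_dim\<close> is a \<open>LEAST\<close> and means something only when a finite
  spanning set exists; this predicate is the witness that the dimension counts carry along.\<close>

definition finq :: "('k::field => 'v::ab_group_add => 'v) => 'v set => 'v set => bool" where
 "finq sc U W <-> (EX B. finite B & B <= W & W <= module.span sc (U Un B))"

lemma quot_dim_witness:
 assumes "finq sc U W"
 obtains B where "finite B" "card B = qd sc U W" "B <= W" "W <= module.span sc (U Un B)"
proof -
 obtain B where B: "finite B & B <= W & W <= module.span sc (U Un B)" using assms unfolding finq_def by blast
 have "EX B'. finite B' & card B' = qd sc U W & B' <= W & W <= module.span sc (U Un B')" unfolding quot_dim_def
  by (rule LeastI[where P = "%m. EX B. finite B & card B = m & B <= W & W <= module.span sc (U Un B)" and k = "card B"])
   (use B in blast)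
 thus thesis using that by blast
qed

lemma quot_dim_le:
 assumes "finite B" "B <= W" "W <= module.span sc (U Un B)"
 shows "qd sc U W <= card B" unfolding quot_dim_def by (rule Least_le) (use assms in blast)

lemma linear_on_subset: "lin_on s1 s2 W f ==> U <= W ==> lin_on s1 s2 U f" unfolding lin_on_def by (simp add: subset_iff)

context vector_space_pair
begin

lemma linear_on_sum:
 assumes "lin_on s1 s2 W f" "vs1.subspace W" "!!i. i : I ==> g i : W"
 shows "f (SUM i:I. g i) = (SUM i:I. f (g i))"
proof -
 have "f 0 = 0" using assms(1,2) vs1.subspace_0 unfolding lin_on_def by (metis vs1.scale_zero_left vs2.scale_zero_left)
 thus ?thesis using assms(3)
 proof (induction I rule: infinite_finite_induct)
  case (insert x F)
  have "(SUM i:F. g i) : W" by (rule vs1.subspace_sum[OF assms(2)]) (use insert in auto)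
  thus ?case using insert assms(1) unfolding lin_on_def by simp
 qed auto
qed

lemma linear_on_zero:
 assumes "lin_on s1 s2 W f" "vs1.subspace W" shows "f 0 = 0" using linear_on_sum[OF assms, of "{}"] by simp

lemma linear_on_diff:
 assumes f: "lin_on s1 s2 W f" and W: "vs1.subspace W" and "a : W" "b : W"
 shows "f (a - b) = f a - f b"
proof -
 have "f (a - b) + f b = f (a - b + b)" using f vs1.subspace_diff[OF W] assms(3,4) unfolding lin_on_def by metis
 thus ?thesis by (simp add: asimps)
qed

lemma image_on:
 assumes f: "lin_on s1 s2 W f" and W: "vs1.subspace W"
 shows "vs2.subspace (f ` W)"
proof (rule vs2.subspaceI)
 show "0 : f ` W" using linear_on_zero[OF assms] vs1.subspace_0[OF W] by (metis imageI)
 show "x + y : f ` W" if "x : f ` W" "y : f ` W" for x y using that f vs1.subspace_add[OF W] unfolding lin_on_def by (metis (no_types, lifting) image_iff)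
 show "s2 c x : f ` W" if "x : f ` W" for c x using that f vs1.subspace_scale[OF W] unfolding lin_on_def by (metis (no_types, lifting) image_iff)
qed

lemma subspace_preimage_on:
 assumes f: "lin_on s1 s2 W f" and W: "vs1.subspace W" and U: "vs2.subspace U"
 shows "vs1.subspace {a\<in>W. f a : U}"
proof (rule vs1.subspaceI)
 show "0 : {a\<in>W. f a : U}" using linear_on_zero[OF f W] vs1.subspace_0[OF W] vs2.subspace_0[OF U] by simp
 show "x + y : {a\<in>W. f a : U}" if "x : {a\<in>W. f a : U}" "y : {a\<in>W. f a : U}" for x y
  using that f vs1.subspace_add[OF W] vs2.subspace_add[OF U] unfolding lin_on_def by simp
 show "s1 c x : {a\<in>W. f a : U}" if "x : {a\<in>W. f a : U}" for c x using that f vs1.subspace_scale[OF W] vs2.subspace_scale[OF U] unfolding lin_on_def by simp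
qed

lemma subspace_kernel_on:
 assumes "lin_on s1 s2 W f" "vs1.subspace W" shows "vs1.subspace {a\<in>W. f a = 0}" using subspace_preimage_on[OF assms vs2.subspace_single_0] by simp

lemma span_image_on:
 assumes f: "lin_on s1 s2 W f" and W: "vs1.subspace W" and B: "B <= W"
 shows "f ` vs1.span B = vs2.span (f ` B)"
proof
 note sp = vs1.span_minimal[OF B W]
 have "vs1.span B <= {x\<in>W. f x : vs2.span (f ` B)}" by (rule vs1.span_minimal[OF _ subspace_preimage_on[OF f W vs2.subspace_span]]) (use B vs2.span_base in auto)
 thus "f ` vs1.span B <= vs2.span (f ` B)" by auto
 show "vs2.span (f ` B) <= f ` vs1.span B" by (rule vs2.span_minimal[OF image_mono[OF vs1.span_superset] image_on[OF linear_on_subset[OF f sp] vs1.subspace_span]])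
qed

text \<open>The hypotheses make \<open>f\<close> induce an isomorphism from W / U to W' / U',
  although no quotient space is formed. Spanning sets are pushed forward by \<open>f\<close> and
  pulled back by choosing preimages, and neither operation increases the cardinality.\<close>

lemma
 assumes f: "lin_on s1 s2 W f" and W: "vs1.subspace W" and U': "vs2.subspace U'"
  and im: "f ` W = W'" and U: "U = {a : W. f a : U'}" and sub: "U' <= W'"
 shows qd_iso: "qd s1 U W = qd s2 U' W'"
  and finq_iso: "finq s1 U W <-> finq s2 U' W'"
proof -
 have fU: "f ` U = U'" using U im sub by auto
 have UW: "U <= W" using U by auto
 have down: "EX B'. finite B' & card B' <= card B & B' <= W' & W' <= vs2.span (U' Un B')"
  if "finite B" "B <= W" "W <= vs1.span (U Un B)" for B using that im image_mono[OF that(3), of f] span_image_on[OF f W, of "U Un B"] UW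
  by (intro exI[of _ "f ` B"]) (auto simp: card_image_le image_Un fU)
 have up: "EX B. finite B & card B <= card B' & B <= W & W <= vs1.span (U Un B)"
  if B': "finite B'" "B' <= W'" "W' <= vs2.span (U' Un B')" for B'
 proof -
  obtain B where B: "B <= W" "finite B" "f ` B = B'" "card B <= card B'"
   using B'(1,2) im by (metis finite_subset_image card_image_le subset_image_inj card_image order_refl finite_imageD)
  have "x : vs1.span (U Un B)" if x: "x : W" for x
  proof -
   have "f x : vs2.span (f ` (U Un B))" using x im B' B(3) by (auto simp: image_Un fU)
   then obtain y where y: "y : vs1.span (U Un B)" "f x = f y" unfolding span_image_on[OF f W Un_least[OF UW B(1)], symmetric] by blast
   have yW: "y : W" using vs1.span_minimal[OF Un_least[OF UW B(1)] W] y(1) by blast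
   have "x - y : U" using linear_on_diff[OF f W x yW] y(2) vs1.subspace_diff[OF W x yW] vs2.subspace_0[OF U'] unfolding U by simp
   hence "(x - y) + y : vs1.span (U Un B)" by (intro vs1.span_add[OF vs1.span_base y(1)]) simp
   thus ?thesis by simp
  qed
  thus ?thesis using B by blast
 qed
 show fq: "finq s1 U W <-> finq s2 U' W'" unfolding finq_def using up down by meson
 show "qd s1 U W = qd s2 U' W'"
 proof (cases "finq s1 U W")
  case True
  obtain B where "finite B" "card B = qd s1 U W" "B <= W" "W <= vs1.span (U Un B)" using quot_dim_witness[OF True] .
  hence 1: "qd s2 U' W' <= qd s1 U W" using down quot_dim_le by (metis order_trans)
  obtain B where "finite B" "card B = qd s2 U' W'" "B <= W'" "W' <= vs2.span (U' Un B)" using quot_dim_witness True fq by metis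
  hence "qd s1 U W <= qd s2 U' W'" using up quot_dim_le by (metis order_trans)
  thus ?thesis using 1 by simp
 next
  case False
  hence "~ finq s2 U' W'" using fq by simp
  \<comment> \<open>Without a finite spanning set both \<open>Least\<close> range over the empty
    predicate, so the two meaningless values still agree.\<close>
  thus ?thesis using False unfolding finq_def quot_dim_def by (intro arg_cong[where f = Least] ext) blast
 qed
qed

end

context vector_space
begin

text \<open>The image of \<open>f\<close> is a complement of \<open>U\<close> in \<open>W\<close>
  and serves as a model of W / U inside the same space. A basis of \<open>U\<close> is extended to a
  basis of \<open>W\<close>; \<open>f\<close> kills the former and fixes the added vectors.\<close>

lemma complement_projection:
 assumes W: "subspace W" and U: "subspace U" "U <= W"
 obtains f where "lin_on scale scale W f" "f ` W <= W" "subspace (f ` W)"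
  "!!a. a : W ==> f a = 0 <-> a : U" "!!a. a : W ==> f (f a) = f a" "!!a. a : W ==> a - f a : U"
proof -
 obtain B where B: "B <= U" "independent B" "U <= span B" using maximal_independent_subset[of U] by blast
 obtain B' where B': "B <= B'" "B' <= W" "independent B'" "W <= span B'" using maximal_independent_subset_extend[of B W] B U by (metis order_trans)
 interpret vp: vector_space_pair scale scale ..
 define f where "f = vp.construct B' (%b. if b : B then 0 else b)"
 have lin: "Vector_Spaces.linear scale scale f" unfolding f_def by (rule vp.linear_construct[OF B'(3)])
 have fB: "f b = (if b : B then 0 else b)" if "b : B'" for b unfolding f_def using vp.construct_basis[OF B'(3) that] .
 have lo: "lin_on scale scale S f" for S using lin by (auto simp: lin_on_def vp.linear_add vp.linear_scale)
 have spW: "span B' = W" using B' W span_minimal by blast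
 have spU: "span B = U" using B U span_minimal by blast
 have fU: "f a = 0" if "a : U" for a
 proof (rule vp.linear_eq_0_on_span[OF lin])
  show "!!b. b : B ==> f b = 0" using fB B' by auto
  show "a : span B" using that spU by simp
 qed
 have diff: "a - f a : U" if "a : W" for a
 proof -
  have "a : span B'" using that spW by simp
  thus ?thesis
  proof (induction rule: span_induct_alt)
   case base thus ?case using subspace_0[OF U(1)] lin by (simp add: vp.linear_0)
  next
   case (step c x y)
   have "x - f x : U" using fB[OF step(1)] B subspace_0[OF U(1)] by auto
   hence "scale c (x - f x) + (y - f y) : U" using step U by (simp add: subspace_add subspace_scale)
   thus ?case using lin by (simp add: vp.linear_add vp.linear_scale scale_right_diff_distrib asimps)
  qed
 qed
 have inW: "f a : W" if "a : W" for a using subspace_diff[OF W that, of "a - f a"] diff[OF that] U by auto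
 show thesis
 proof (rule that[of f])
  show "subspace (f ` W)" by (rule vp.linear_subspace_image[OF lin W])
  show "f a = 0 <-> a : U" if "a : W" for a using fU diff[OF that] by auto
  show "f (f a) = f a" if "a : W" for a using fU[OF diff[OF that]] lin by (simp add: vp.linear_diff)
 qed (use lo inW diff in auto)
qed

lemma subspace_lincomb: "0 : S ==> (!!x y c. x : S ==> y : S ==> x + scale c y : S) ==> subspace S" by (rule subspaceI) (assumption, metis scale_one, metis add_0)

lemma quot_dim_0_independent:
 assumes "finite B" "independent B"
 shows "finq scale {0} (span B)" "qd scale {0} (span B) = card B"
proof -
 show fq: "finq scale {0} (span B)" unfolding finq_def by (rule exI[of _ B]) (use assms span_superset span_mono in auto)
 obtain C where C: "finite C" "card C = qd scale {0} (span B)" "C <= span B" "span B <= span ({0} Un C)" using quot_dim_witness[OF fq] .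
 have "B <= span C" using C(4) span_superset[of B] by (auto simp: span_insert_0)
 hence "card B <= card C" using independent_span_bound[OF C(1) assms(2)] by simp
 moreover have "qd scale {0} (span B) <= card B" by (rule quot_dim_le) (use assms span_superset span_mono in auto)
 ultimately show "qd scale {0} (span B) = card B" using C by simp
qed

lemma
 assumes X: "subspace X" and W: "subspace W" "W <= X"
 shows fin_quot_0_trans: "finq scale {0} X <-> finq scale {0} W & finq scale W X"
  and quot_dim_0_trans: "finq scale {0} X ==> qd scale {0} X = qd scale {0} W + qd scale W X"
proof -
 obtain B where B: "B <= W" "independent B" "W <= span B" using maximal_independent_subset[of W] by blast
 obtain B' where B': "B <= B'" "B' <= X" "independent B'" "X <= span B'" using maximal_independent_subset_extend[of B X] B W by (metis order_trans)
 have spW: "span B = W" by (rule span_subspace) (use B W in auto)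
 have spX: "span B' = X" by (rule span_subspace) (use B' X in auto)
 have split: "span (W Un C) = span (B Un C)" for C unfolding span_Un spW span_eq_iff[THEN iffD2, OF W(1)] ..
 have WX: "X <= span (W Un (B' - B))" unfolding split using B' by (simp add: Un_absorb1 Un_Diff_cancel)
 have fin: "finite B' & card B' <= card B + card C" if "finite B" "finite C" "C <= X" "X <= span (W Un C)" for C
 proof -
  have "B' <= span (B Un C)" using that B' unfolding split by auto
  hence "finite B' & card B' <= card (B Un C)" using independent_span_bound[of "B Un C" B'] that B' by auto
  thus ?thesis using card_Un_le[of B C] by linarith
 qed
 have finB: "finite B" if "finq scale {0} W"
 proof -
  obtain D where D: "finite D" "D <= W" "W <= span ({0} Un D)" using \<open>finq scale {0} W\<close> unfolding finq_def by auto
  have "B <= span D" using B D by (auto simp: span_insert_0)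
  thus ?thesis using independent_span_bound[OF D(1) B(2)] by simp
 qed
 have finB': "finite B'" if "finq scale {0} X"
 proof -
  obtain D where D: "finite D" "D <= X" "X <= span ({0} Un D)" using \<open>finq scale {0} X\<close> unfolding finq_def by auto
  have "B' <= span D" using B' D by (auto simp: span_insert_0)
  thus ?thesis using independent_span_bound[OF D(1) B'(3)] by simp
 qed
 have fWX: "finq scale W X" if "finite B'" unfolding finq_def using that B' WX by (intro exI[of _ "B' - B"]) auto
 show "finq scale {0} X <-> finq scale {0} W & finq scale W X"
 proof (intro iffI conjI)
  assume "finq scale {0} X"
  hence f: "finite B'" by (rule finB')
  hence "finite B" using B' finite_subset by blast
  thus "finq scale {0} W" using quot_dim_0_independent(1)[OF _ B(2)] spW by simp
  show "finq scale W X" using fWX f .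
 next
  assume a: "finq scale {0} W & finq scale W X"
  then obtain C where "finite C" "C <= X" "X <= span (W Un C)" unfolding finq_def by blast
  hence "finite B'" using fin[OF finB] a by blast
  thus "finq scale {0} X" using quot_dim_0_independent(1)[OF _ B'(3)] spX by simp
 qed
 assume "finq scale {0} X"
 hence f: "finite B'" by (rule finB')
 hence fB: "finite B" using B' finite_subset by blast
 obtain C where C: "finite C" "card C = qd scale W X" "C <= X" "X <= span (W Un C)" using quot_dim_witness[OF fWX[OF f]] .
 have "card B' <= card B + qd scale W X" using fin[OF fB C(1,3,4)] C(2) by simp
 moreover have "qd scale W X <= card (B' - B)" by (rule quot_dim_le) (use f B' WX in auto)
 moreover have "card (B' - B) + card B = card B'" using B' f fB by (simp add: card_Diff_subset card_mono)
 ultimately have "card B' = card B + qd scale W X" by linarith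
 thus "qd scale {0} X = qd scale {0} W + qd scale W X" using quot_dim_0_independent(2)[OF f B'(3)] quot_dim_0_independent(2)[OF fB B(2)] spX spW by simp
qed

text \<open>The projection with kernel \<open>U\<close> turns the pair \<open>W <= X\<close> modulo
  \<open>U\<close> into the pair of images modulo 0, where bases can be counted;
  \<open>qd_iso\<close> and \<open>finq_iso\<close> transport the result back.\<close>

lemma
 assumes X: "subspace X" and W: "subspace W" "W <= X" and U: "subspace U" "U <= W"
 shows fin_quot_trans: "finq scale U X <-> finq scale U W & finq scale W X"
  and quot_dim_trans: "finq scale U X ==> qd scale U X = qd scale U W + qd scale W X"
proof -
 interpret vp: vector_space_pair scale scale ..
 have UX: "U <= X" using U W by auto
 obtain f where f: "lin_on scale scale X f" "f ` X <= X" "subspace (f ` X)"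
  "!!a. a : X ==> f a = 0 <-> a : U" "!!a. a : X ==> f (f a) = f a" "!!a. a : X ==> a - f a : U" using complement_projection[OF X U(1) UX] by blast
 have lW: "lin_on scale scale W f" using f(1) W(2) unfolding lin_on_def by blast
 have f0: "f 0 = 0" using f(4)[OF subspace_0[OF X]] subspace_0[OF U(1)] by simp
 have sW: "subspace (f ` W)"
 proof (rule subspaceI)
  show "0 : f ` W" using f0 subspace_0[OF W(1)] by (metis imageI)
  show "x + y : f ` W" if "x : f ` W" "y : f ` W" for x y using that lW subspace_add[OF W(1)] unfolding lin_on_def by (metis (no_types, lifting) image_iff)
  show "scale c x : f ` W" if "x : f ` W" for c x using that lW subspace_scale[OF W(1)] unfolding lin_on_def by (metis (no_types, lifting) image_iff)
 qed
 have WW: "W = {a : X. f a : f ` W}"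
 proof (intro equalityI subsetI)
  fix a assume "a : {a : X. f a : f ` W}"
  then obtain b where b: "a : X" "b : W" "f a = f b" by auto
  have "a - f a : U" "b - f b : U" using f(6)[of a] f(6)[of b] b W by blast+
  hence "(a - f a) - (b - f b) + b : W" using U W b by (meson subsetD subspace_add subspace_diff)
  thus "a : W" using b by simp
 qed (use W in auto)
 have UU: "U = {a : X. f a : {0}}" "U = {a : W. f a : {0}}" using f(4) UX U W by auto
 have z: "{0} <= f ` X" "{0} <= f ` W" using f0 subspace_0[OF W(1)] subspace_0[OF X] by (metis imageI empty_subsetI insert_subset)+
 have WX: "f ` W <= f ` X" using W by auto
 note i = vp.qd_iso[OF f(1) X subspace_single_0 refl UU(1) z(1)] vp.finq_iso[OF f(1) X subspace_single_0 refl UU(1) z(1)]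
  vp.qd_iso[OF lW W(1) subspace_single_0 refl UU(2) z(2)] vp.finq_iso[OF lW W(1) subspace_single_0 refl UU(2) z(2)]
  vp.qd_iso[OF f(1) X sW refl WW WX] vp.finq_iso[OF f(1) X sW refl WW WX]
 show "finq scale U X <-> finq scale U W & finq scale W X" using fin_quot_0_trans[OF f(3) sW WX] i by simp
 show "finq scale U X ==> qd scale U X = qd scale U W + qd scale W X" using quot_dim_0_trans[OF f(3) sW WX] i by simp
qed

end

definition fredholm where
 "fredholm s1 s2 A B de <-> finq s1 {0} {a\<in>A. de a = 0} & finq s2 (de ` A) B"

text \<open>The Euler characteristic of the two-term complex \<open>de : A -> B\<close>.\<close>

definition index :: "('k::field => 'a::ab_group_add => 'a) => ('k => 'b::ab_group_add => 'b) => 'a set => 'b set => ('a => 'b) => int" where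
 "index s1 s2 A B de = int (qd s1 {0} {a\<in>A. de a = 0}) - int (qd s2 (de ` A) B)"

text \<open>The second isomorphism theorem, (I + B) / I = B / (I Int B): the projection with kernel
  \<open>I\<close> has the same image on \<open>J\<close> and on \<open>B\<close>.\<close>

lemma (in vector_space) quot_dim_inf:
 assumes J: "subspace J" and I: "subspace I" "I <= J" and B: "subspace B" "B <= J"
  and sum: "!!x. x : J ==> EX i:I. EX b:B. x = i + b"
 shows "qd scale I J = qd scale (I Int B) B"
  and "finq scale I J <-> finq scale (I Int B) B"
proof -
 interpret vp: vector_space_pair scale scale ..
 obtain p where p: "lin_on scale scale J p" "p ` J <= J" "subspace (p ` J)"
  "!!a. a : J ==> p a = 0 <-> a : I" "!!a. a : J ==> p (p a) = p a" "!!a. a : J ==> a - p a : I" using complement_projection[OF J I] by blast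
 have pB: "lin_on scale scale B p" by (rule linear_on_subset[OF p(1) B(2)])
 have im: "p ` B = p ` J"
 proof
  show "p ` J <= p ` B"
  proof
   fix y assume "y : p ` J"
   then obtain i b where ib: "i : I" "b : B" "y = p (i + b)" using sum by blast
   hence "y = p i + p b" using p(1) I B unfolding lin_on_def by blast
   moreover have "p i = 0" using ib(1) p(4)[of i] I by blast
   ultimately show "y : p ` B" using ib by simp
  qed
 qed (use B in auto)
 have z: "{0} <= p ` J" "{0} <= p ` J" using vp.linear_on_zero[OF p(1) J] subspace_0[OF J] by force+
 have 1: "I = {a\<in>J. p a : {0}}" "I Int B = {a\<in>B. p a : {0}}" using p(4) I B by auto
 show "qd scale I J = qd scale (I Int B) B" using vp.qd_iso[OF p(1) J subspace_single_0 refl 1(1) z(1)] vp.qd_iso[OF pB B(1) subspace_single_0 im 1(2) z(1)] by simp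
 show "finq scale I J <-> finq scale (I Int B) B"
  using vp.finq_iso[OF p(1) J subspace_single_0 refl 1(1) z(1)] vp.finq_iso[OF pB B(1) subspace_single_0 im 1(2) z(1)] by simp
qed

text \<open>A weak form of the snake lemma: the connecting homomorphism is only used through the
 dimension of its image, which is computed in two ways as \<open>L / M0\<close>.\<close>
lemma (in vector_space_pair) index_additive:
 assumes A1: "vs1.subspace A1" and A: "vs1.subspace A"
  and B1: "vs2.subspace B1" and B: "vs2.subspace B"
  and al: "lin_on s1 s1 A1 al" "al ` A1 = {a\<in>A. al2 a = 0}" "!!a. a : A1 ==> al a = 0 ==> a = 0"
  and al2: "lin_on s1 s1 A al2" "al2 ` A = A2"
  and be: "lin_on s2 s2 B1 be" "be ` B1 = {b\<in>B. be2 b = 0}" "!!b. b : B1 ==> be b = 0 ==> b = 0"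
  and be2: "lin_on s2 s2 B be2" "be2 ` B = B2"
  and de1: "lin_on s1 s2 A1 de1" "de1 ` A1 <= B1"
  and de: "lin_on s1 s2 A de" "de ` A <= B" and de2: "lin_on s1 s2 A2 de2"
  and c1: "!!a. a : A1 ==> de (al a) = be (de1 a)" and c2: "!!a. a : A ==> de2 (al2 a) = be2 (de a)"
  and f1: "fredholm s1 s2 A1 B1 de1"
 shows "fredholm s1 s2 A B de <-> fredholm s1 s2 A2 B2 de2"
  and "fredholm s1 s2 A B de ==> index s1 s2 A B de = index s1 s2 A1 B1 de1 + index s1 s2 A2 B2 de2"
proof -
 interpret p1: vector_space_pair s1 s1 ..
 interpret p2: vector_space_pair s2 s2 ..
 note s0 = vs1.subspace_single_0
 have A2: "vs1.subspace A2" using p1.image_on[OF al2(1) A] al2(2) by simp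
 define K1 where "K1 = {a\<in>A1. de1 a = 0}"
 define K where "K = {a\<in>A. de a = 0}"
 define K2 where "K2 = {a\<in>A2. de2 a = 0}"
 define I where "I = de ` A"
 define B' where "B' = be ` B1"
 define J where "J = {b\<in>B. be2 b : de2 ` A2}"
 define L where "L = {a\<in>A. al2 a : K2}"
 define M0 where "M0 = {a\<in>L. al2 a : al2 ` K}"
 have be0: "be 0 = 0" using p2.linear_on_zero[OF be(1) B1] .
 have sK1: "vs1.subspace K1" unfolding K1_def by (rule subspace_kernel_on[OF de1(1) A1])
 have sK: "vs1.subspace K" unfolding K_def by (rule subspace_kernel_on[OF de(1) A])
 have sK2: "vs1.subspace K2" unfolding K2_def by (rule subspace_kernel_on[OF de2 A2])
 have sI: "vs2.subspace I" unfolding I_def by (rule image_on[OF de(1) A])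
 have sB': "vs2.subspace B'" unfolding B'_def by (rule p2.image_on[OF be(1) B1])
 note sI2 = image_on[OF de2 A2]
 note sI1 = image_on[OF de1(1) A1]
 have sJ: "vs2.subspace J" unfolding J_def by (rule p2.subspace_preimage_on[OF be2(1) B sI2])
 have sL: "vs1.subspace L" unfolding L_def by (rule p1.subspace_preimage_on[OF al2(1) A sK2])
 have K1A1: "K1 <= A1" and KA: "K <= A" and LA: "L <= A" and JB: "J <= B" and K2A2: "K2 <= A2" unfolding K1_def K_def L_def J_def K2_def by auto
 have lalK: "lin_on s1 s1 K1 al" using linear_on_subset[OF al(1) K1A1] .
 have lal2K: "lin_on s1 s1 K al2" using linear_on_subset[OF al2(1) KA] .
 have lal2L: "lin_on s1 s1 L al2" using linear_on_subset[OF al2(1) LA] .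
 have ldeL: "lin_on s1 s2 L de" using linear_on_subset[OF de(1) LA] .
 note salK1 = p1.image_on[OF lalK sK1]
 note sal2K = p1.image_on[OF lal2K sK]
 have z: "!!S. vs1.subspace S ==> {0} <= S" "!!S. vs2.subspace S ==> {0} <= S" using vs1.subspace_0 vs2.subspace_0 by auto
 have al0: "al 0 = 0" using p1.linear_on_zero[OF al(1) A1] .
 have alK1: "al ` K1 = {a\<in>K. al2 a : {0}}"
 proof (intro equalityI subsetI)
  fix x assume "x : al ` K1"
  then obtain a where a: "a : A1" "de1 a = 0" "x = al a" unfolding K1_def by auto
  hence "x : al ` A1" by blast
  hence "x : A & al2 x = 0" unfolding al(2) by simp
  thus "x : {a\<in>K. al2 a : {0}}" using a c1[OF a(1)] be0 unfolding K_def by simp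
 next
  fix x assume x: "x : {a\<in>K. al2 a : {0}}"
  hence "x : al ` A1" unfolding al(2) K_def by simp
  then obtain a where a: "a : A1" "x = al a" by blast
  hence "be (de1 a) = 0" using c1[of a] x unfolding K_def by simp
  hence "de1 a = 0" using be(3) de1(2) a by blast
  thus "x : al ` K1" using a unfolding K1_def by auto
 qed
 have al2in: "al2 a : A2" if "a : A" for a using al2(2) that by blast
 have al2K: "al2 ` K <= K2"
 proof
  fix y assume "y : al2 ` K"
  then obtain a where a: "a : A" "de a = 0" "y = al2 a" unfolding K_def by blast
  thus "y : K2" using c2[OF a(1)] p2.linear_on_zero[OF be2(1) B] al2in unfolding K2_def by simp
 qed
 have K1z: "{0} = {a\<in>K1. al a : {0}}" using al(3) al0 K1A1 vs1.subspace_0[OF sK1] by auto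
 note e1 = p1.qd_iso[OF lalK sK1 s0 refl K1z z(1)[OF salK1]]
  p1.finq_iso[OF lalK sK1 s0 refl K1z z(1)[OF salK1]]
 have s1: "al ` K1 <= K" using alK1 by auto
 note e2 = vs1.quot_dim_trans[OF sK salK1 s1 s0 z(1)[OF salK1]]
   vs1.fin_quot_trans[OF sK salK1 s1 s0 z(1)[OF salK1]]
 note e3 = p1.qd_iso[OF lal2K sK s0 refl alK1 z(1)[OF sal2K]]
  p1.finq_iso[OF lal2K sK s0 refl alK1 z(1)[OF sal2K]]
 note e4 = vs1.quot_dim_trans[OF sK2 sal2K al2K s0 z(1)[OF sal2K]]
   vs1.fin_quot_trans[OF sK2 sal2K al2K s0 z(1)[OF sal2K]]
 have IJ: "I <= J" unfolding I_def J_def using de(2) c2[symmetric] al2in by auto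
 have B'J: "B' <= J" unfolding B'_def J_def be(2) using vs2.subspace_0[OF sI2] by auto
 have sumJ: "EX i:I. EX b:B'. x = i + b" if "x : J" for x
 proof -
  obtain a where a: "a : A" "be2 x = de2 (al2 a)" "x : B" using \<open>x : J\<close> unfolding J_def al2(2)[symmetric] by blast
  have dB: "de a : B" using de(2) a by auto
  have "be2 (x - de a) = 0" using p2.linear_on_diff[OF be2(1) B a(3) dB] a c2 by simp
  hence "x - de a : B'" unfolding B'_def be(2) using vs2.subspace_diff[OF B a(3) dB] by simp
  thus ?thesis unfolding I_def using a(1) by (metis add.commute diff_add_cancel imageI)
 qed
 note e5 = vs2.quot_dim_trans[OF B sJ JB sI IJ] vs2.fin_quot_trans[OF B sJ JB sI IJ]
 have I2: "de2 ` A2 <= B2" unfolding al2(2)[symmetric] be2(2)[symmetric] using c2 de(2) by auto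
 note e6 = p2.qd_iso[OF be2(1) B sI2 be2(2) J_def I2] p2.finq_iso[OF be2(1) B sI2 be2(2) J_def I2]
 note e7 = vs2.quot_dim_inf[OF sJ sI IJ sB' B'J sumJ]
 define I1 where "I1 = be ` de1 ` A1"
 have sI1': "vs2.subspace I1" unfolding I1_def by (rule p2.image_on[OF linear_on_subset[OF be(1) de1(2)] sI1])
 have I1B': "I1 <= B'" unfolding I1_def B'_def using de1(2) by auto
 have pre: "de1 ` A1 = {b\<in>B1. be b : I1}"
 proof (intro equalityI subsetI)
  fix b assume "b : {b\<in>B1. be b : I1}"
  then obtain c where c: "b : B1" "c : de1 ` A1" "be b = be c" unfolding I1_def by auto
  have cB: "c : B1" using c de1(2) by auto
  have "be (b - c) = 0" using p2.linear_on_diff[OF be(1) B1 c(1) cB] c by simp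
  hence "b - c = 0" using be(3) vs2.subspace_diff[OF B1 c(1) cB] by blast
  thus "b : de1 ` A1" using c by simp
 qed (use de1(2) I1_def in auto)
 note e8 = p2.qd_iso[OF be(1) B1 sI1' B'_def[symmetric] pre I1B'] p2.finq_iso[OF be(1) B1 sI1' B'_def[symmetric] pre I1B']
 note sIB = vs2.subspace_inter[OF sI sB']
 have I1s: "I1 <= I Int B'"
 proof -
  have "al a : A" if "a : A1" for a using al(2) that by blast
  hence "I1 <= I" unfolding I1_def I_def using c1[symmetric] by auto
  thus ?thesis using I1B' by auto
 qed
 note e9 = vs2.quot_dim_trans[OF sB' sIB Int_lower2 sI1' I1s] vs2.fin_quot_trans[OF sB' sIB Int_lower2 sI1' I1s]
 have deL: "de ` L = I Int B'"
 proof (intro equalityI subsetI)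
  fix y assume "y : de ` L"
  then obtain a where a: "a : A" "al2 a : K2" "y = de a" unfolding L_def by auto
  hence "be2 y = 0" using c2[of a] unfolding K2_def by simp
  thus "y : I Int B'" unfolding I_def B'_def be(2) using a de(2) by auto
 next
  fix y assume "y : I Int B'"
  then obtain a where a: "a : A" "y = de a" "be2 y = 0" unfolding I_def B'_def be(2) by auto
  hence "al2 a : K2" using c2[of a] al2(2) unfolding K2_def by auto
  thus "y : de ` L" using a unfolding L_def by auto
 qed
 have M0: "M0 = {a\<in>L. de a : I1}"
 proof (intro equalityI subsetI)
  fix a assume "a : M0"
  then obtain k where k: "a : L" "k : K" "al2 a = al2 k" unfolding M0_def by auto
  have aA: "a : A" "k : A" using k LA KA by auto
  have "al2 (a - k) = 0" using p1.linear_on_diff[OF al2(1) A aA] k by simp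
  then obtain a1 where a1: "a1 : A1" "a - k = al a1" using al(2) vs1.subspace_diff[OF A aA] by blast
  have "de a = de (a - k)" using linear_on_diff[OF de(1) A aA] k unfolding K_def by simp
  also have "... = be (de1 a1)" using a1 c1 by simp
  finally show "a : {a\<in>L. de a : I1}" using k a1 unfolding I1_def by auto
 next
  fix a assume "a : {a\<in>L. de a : I1}"
  then obtain a1 where a1: "a : L" "a1 : A1" "de a = de (al a1)" unfolding I1_def using c1 by auto
  have aA: "a : A" "al a1 : A" "al2 (al a1) = 0" using a1 LA al(2) by blast+
  have "a - al a1 : K" unfolding K_def using linear_on_diff[OF de(1) A aA(1,2)] a1 vs1.subspace_diff[OF A aA(1,2)] by simp
  moreover have "al2 (a - al a1) = al2 a" using p1.linear_on_diff[OF al2(1) A aA(1,2)] aA by simp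
  ultimately show "a : M0" unfolding M0_def using a1 by (metis (mono_tags, lifting) imageI mem_Collect_eq)
 qed
 note e10 = qd_iso[OF ldeL sL sI1' deL M0 I1s] finq_iso[OF ldeL sL sI1' deL M0 I1s]
 have al2L: "al2 ` L = K2" unfolding L_def using al2(2) K2A2 by auto
 note e11 = p1.qd_iso[OF lal2L sL sal2K al2L M0_def al2K] p1.finq_iso[OF lal2L sL sal2K al2L M0_def al2K]
 note F1 = f1[unfolded fredholm_def, folded K1_def]
 show eq: "fredholm s1 s2 A B de <-> fredholm s1 s2 A2 B2 de2" unfolding fredholm_def K_def[symmetric] K2_def[symmetric] I_def[symmetric]
  using F1 e1(2) e2(2) e3(2) e4(2) e5(2) e6(2) e7(2) e8(2) e9(2) e10(2) e11(2) by blast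
 assume fA: "fredholm s1 s2 A B de"
 hence fA2: "fredholm s1 s2 A2 B2 de2" using eq by simp
 have fin: "finq s1 {0} K" "finq s2 I B" "finq s1 {0} K2" "finq s2 I1 B'"
  using fA fA2 F1 e8(2) unfolding fredholm_def K_def[symmetric] K2_def[symmetric] I_def[symmetric] by auto
 \<comment> \<open>The dimension of \<open>L / M0\<close> enters once on the kernel side and once on
   the cokernel side, and cancels.\<close>
 show "index s1 s2 A B de = index s1 s2 A1 B1 de1 + index s1 s2 A2 B2 de2" unfolding index_def K_def[symmetric] K2_def[symmetric] I_def[symmetric] K1_def[symmetric]
  using e1(1) e2(1)[OF fin(1)] e3(1) e4(1)[OF fin(3)] e5(1)[OF fin(2)] e6(1) e7(1) e8(1) e9(1)[OF fin(4)] e10(1) e11(1) by linarith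
qed

declare funp [simp del] fun0 [simp del]
 minus_apply [simp del] uminus_apply [simp del]

section \<open>Arithmetic of the Picard group\<close>

lemma pdeg_add [simp]: "pdeg (u + v) = pdeg u + pdeg v" by transfer (simp add: sum.distrib)
lemma pdeg_diff [simp]: "pdeg (u - v) = pdeg u - pdeg v" by transfer (simp add: sum_subtractf)
lemma pdeg_minus [simp]: "pdeg (- u) = - pdeg u" by transfer (simp add: sum_negf)
lemma pdeg_0 [simp]: "pdeg 0 = 0" by transfer simp
lemma pdeg_px [simp]: "pdeg (px i) = 1" by transfer simp

lemma podd_add: "podd (u + v) = {i. (i : podd u) ~= (i : podd v)}" by transfer auto
lemma podd_diff: "podd (u - v) = {i. (i : podd u) ~= (i : podd v)}" by transfer auto
lemma podd_minus [simp]: "podd (- u) = podd u" by transfer auto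
lemma podd_0 [simp]: "podd 0 = {}" by transfer auto
lemma podd_px [simp]: "podd (px i) = {i}" by transfer auto

lemma pic_eqI: "podd u = podd v ==> pdeg u = pdeg v ==> u = v" by transfer (auto simp: set_eq_iff)

lemma px_double: "px i + px i = (px j + px j :: 'n::finite pic)" by (rule pic_eqI) (auto simp: podd_add)

lemma pc_eq: "pc = (px i + px i :: 'n::finite pic)"
proof -
 have "(THE u. ALL j. u = px j + px j) = (px i + px i :: 'n pic)"
 proof (rule the_equality)
  show "ALL j. px i + px i = (px j + px j :: 'n pic)" using px_double[of i] by (intro allI)
 qed simp
 thus ?thesis by (simp only: pc_def)
qed

lemma pdeg_pc [simp]: "pdeg (pc :: 'n::finite pic) = 2" unfolding pc_eq[of "undefined :: 'n"] by simp
lemma podd_pc [simp]: "podd (pc :: 'n::finite pic) = {}" unfolding pc_eq[of "undefined :: 'n"] by (simp add: podd_add)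

lemma pdeg_parity: "even (pdeg u - int (card (podd u)))"
proof (transfer)
 fix a :: "'a => int"
 have "(SUM i:UNIV. a i) - int (card {i. odd (a i)}) = (SUM i:UNIV. a i - (if odd (a i) then 1 else 0))" by (simp add: sum_subtractf sum.If_cases)
 moreover have "even (SUM i:UNIV. a i - (if odd (a i) then 1 else 0))" by (rule dvd_sum) auto
 ultimately show "even (sum a UNIV - int (card {i. odd (a i)}))" by simp
qed

lemma pdeg_eq: "pdeg u = 2 * pmul u + int (card (podd u))" using pdeg_parity[of u] unfolding pmul_def by auto

lemma pmul_eqI: "pdeg u = 2 * m + int (card (podd u)) ==> pmul u = m" using pdeg_eq[of u] by simp

lemma pmul_pc [simp]: "pmul (u + pc) = pmul u + 1" by (rule pmul_eqI) (simp add: pdeg_eq[of u] podd_add)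

lemma pmul_0 [simp]: "pmul 0 = 0" by (rule pmul_eqI) simp

lemma pmul_add_px: "pmul (u + px i) = (if i : podd u then pmul u + 1 else pmul u)"
proof (rule pmul_eqI)
 have "podd (u + px i) = (if i : podd u then podd u - {i} else insert i (podd u))" by (auto simp: podd_add)
 thus "pdeg (u + px i) = 2 * (if i : podd u then pmul u + 1 else pmul u) + int (card (podd (u + px i)))" using card_Suc_Diff1[of "podd u" i] by (auto simp: pdeg_eq[of u])
qed

lemma pmul_diff_px: "pmul (u - px i) = (if i : podd u then pmul u else pmul u - 1)" using pmul_add_px[of "u - px i" i] by (auto simp: podd_diff)

text \<open>The multiple \<open>k\<close> of the class \<open>c\<close>. It is supported on the
  arbitrary index \<open>undefined\<close>; in the quotient the choice disappears because all
  \<open>2 x_i\<close> agree.\<close>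

lift_definition kc :: "int => 'n::finite pic" is "%k j. if j = undefined then 2 * k else 0" .

abbreviation "kn m == kc (int m)"
abbreviation "kl xs == kn (length xs)"

lemma kc_0 [simp]: "kc 0 = 0" by transfer auto
lemma pdeg_kc [simp]: "pdeg (kc k) = 2 * k" by transfer simp
lemma podd_kc [simp]: "podd (kc k) = {}" by transfer simp
lemma kc_1 [simp]: "kc 1 = (pc :: 'n::finite pic)" by (rule pic_eqI) auto
lemma kc_add: "kc (k + l) = kc k + kc l" by (rule pic_eqI) (auto simp: podd_add)
lemma kc_diff: "kc (k - l) = kc k - kc l" by (rule pic_eqI) (auto simp: podd_diff)
lemma kc_minus: "kc (- l) = - kc l" by (rule pic_eqI) auto
lemma kc_Suc: "kc (int (Suc m)) = kn m + pc" by (rule pic_eqI) (auto simp: podd_add)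
lemma pmul_kc [simp]: "pmul (u + kc k) = pmul u + k" by (rule pmul_eqI) (simp add: pdeg_eq[of u] podd_add)

definition psum :: "'n::finite set => 'n pic" where "psum A = (SUM i:A. px i)"

lemma psum_empty [simp]: "psum {} = 0" by (simp add: psum_def)
lemma psum_insert: "i ~: A ==> psum (insert i A) = psum A + px i" by (simp add: psum_def add.commute)
lemma podd_psum [simp]: "podd (psum A) = A"
proof (induction A rule: finite_induct[OF finite])
 case (2 i A) thus ?case by (auto simp: psum_insert podd_add)
qed simp
lemma pdeg_psum [simp]: "pdeg (psum A) = int (card A)"
proof (induction A rule: finite_induct[OF finite])
 case (2 i A) thus ?case by (auto simp: psum_insert)
qed simp
lemma pic_normal_form: "psum (podd u) + kc (pmul u) = u" by (rule pic_eqI) (auto simp: podd_add pdeg_eq[of u])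

text \<open>Every class is a sum of distinct \<open>x_i\<close> plus a multiple of \<open>c\<close>,
  and a step by \<open>c\<close> is two steps by one \<open>x_i\<close>.\<close>

lemma pic_induct [case_names 0 add diff]:
 assumes "P 0" "!!u i. P u ==> P (u + px i)" "!!u i. P u ==> P (u - px i)"
 shows "P (u :: 'n::finite pic)"
proof -
 let ?i = "undefined :: 'n"
 have k: "P (kc k + v)" if "P v" for k v
 proof (induction k rule: int_induct[where k = 0])
  case base thus ?case using that by simp
 next
  case (step1 i)
  have "kc (i + 1) + v = kc i + v + px ?i + px ?i" by (simp add: kc_add pc_eq[of ?i] asimps)
  thus ?case using assms(2) step1 by metis
 next
  case (step2 i)
  have "kc (i - 1) + v = kc i + v - px ?i - px ?i" by (simp add: kc_diff pc_eq[of ?i] asimps)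
  thus ?case using assms(3) step2 by metis
 qed
 have "P (psum A)" for A
 proof (induction A rule: finite_induct[OF finite])
  case (2 i A) thus ?case using assms(2) by (simp add: psum_insert)
 qed (simp add: assms(1))
 from k[OF this] show ?thesis by (metis pic_normal_form add.commute)
qed

section \<open>Graded modules and their homomorphisms\<close>

interpretation asc: vector_space asc by standard (auto simp: asc_def asimps funp)

interpretation asc2: vector_space_pair asc asc ..

lemma asc_0 [simp]: "asc c 0 = 0" "asc 0 a = 0" by (auto simp: asc_def fun0)
lemma asc_1 [simp]: "asc 1 a = a" by (auto simp: asc_def fun0)
lemma asc_asc [simp]: "asc c (asc d a) = asc (c * d) a" by (auto simp: asc_def asimps)

lemma linear_between_on: "lbet U W f <-> lin_on asc asc U f & f ` U <= W" unfolding linear_between_def lin_on_def by auto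

text \<open>\<open>False\<close> names \<open>X0\<close> and \<open>True\<close> names
  \<open>X1\<close>, so that one statement covers both coordinates. Accordingly,
  \<open>inv_on b j\<close> below says that coordinate \<open>b\<close> is invertible on chart
  \<open>j\<close>.\<close>

definition xop :: "bool => ('n::finite, 'k::field) gmod => ('n,'k) mp" where
 "xop b M = (if b then opx1 M else opx0 M)"

definition inv_on :: "bool => chart => bool" where
 "inv_on b j <-> (if b then j ~= U0 else j ~= U1)"

lemma linear_betweenI:
 assumes U: "asc.subspace U" and f: "!!a. a : U ==> f a : W"
  and l: "!!a b c. a : U ==> b : U ==> f (a + asc c b) = f a + asc c (f b)"
 shows "lbet U W f"
proof -
 note 0 = asc.subspace_0[OF U]
 have "f 0 = 0" using l[OF 0 0, of "- 1"] by simp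
 thus ?thesis unfolding linear_between_def using f l[of _ _ 1] l[OF 0] by simp
qed

text \<open>The operators \<open>t_i\<close>, \<open>X0\<close> and \<open>X1\<close> of a graded module, and their degrees.\<close>
definition hop :: "('n::finite, 'k::field) gmod => 'n + bool => ('n,'k) mp" where
 "hop M s = case_sum (opt M) (%b. xop b M) s"

definition dg :: "'n::finite + bool => 'n pic" where "dg s = case_sum px (%_. pc) s"

lemma hop_simps [simp]: "hop M (Inl i) = opt M i" "hop M (Inr b) = xop b M" "dg (Inl i) = px i" "dg (Inr b) = pc" by (simp_all add: hop_def dg_def)

lemma xop_simps: "xop False M = opx0 M" "xop True M = opx1 M" by (simp_all add: xop_def)

lemma inv_on_simps: "inv_on False j <-> j ~= U1" "inv_on True j <-> j ~= U0" by (simp_all add: inv_on_def)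

lemma lmul_xop: "lmul M l u a = asc (fst l) (xop False M u a) + asc (snd l) (xop True M u a)" by (simp add: lmul_def xop_def)

lemma gmoduleI:
 assumes "!!u. asc.subspace (gsp M u)"
  and l: "!!s u. lbet (gsp M u) (gsp M (u + dg s)) (hop M s u)"
  and c: "!!s s' u a. a : gsp M u ==> hop M s (u + dg s') (hop M s' u a) = hop M s' (u + dg s) (hop M s u a)"
  and "!!i u a. a : gsp M u ==> opt M i (u + px i) (opt M i u a) = lmul M (vform (Z i)) u a"
  and bij: "!!b u. inv_on b j ==> bij_betw (xop b M u) (gsp M u) (gsp M (u + pc))"
 shows "gmd Z j M" unfolding gmodule_def by (intro conjI allI ballI impI)
  (use assms(1,4) l[of _ "Inl _"] l[of _ "Inr False"] l[of _ "Inr True"] c[of _ _ "Inl _" "Inl _"]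
   c[of _ _ "Inr False" "Inr True"] c[of _ _ "Inr False" "Inl _"] c[of _ _ "Inr True" "Inl _"]
   bij[of False] bij[of True] in "simp_all add: xop_simps inv_on_simps")

lemma
 assumes "gmd Z j M"
 shows gm_subspace: "asc.subspace (gsp M u)"
  and gm_op_between: "lbet (gsp M u) (gsp M (u + dg s)) (hop M s u)"
  and gm_t_sq: "a : gsp M u ==> opt M i (u + px i) (opt M i u a) = lmul M (vform (Z i)) u a"
  and gm_bij: "inv_on b j ==> bij_betw (xop b M u) (gsp M u) (gsp M (u + pc))"
 using assms unfolding gmodule_def xop_def inv_on_def hop_def dg_def by (cases b; auto split: sum.splits)+

lemma gm_op_op:
 assumes "gmd Z j M" and "a : gsp M u"
 shows "hop M s (u + dg s') (hop M s' u a) = hop M s' (u + dg s) (hop M s u a)" using assms unfolding gmodule_def by (cases s; cases s') (auto simp: xop_def)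

lemma
 assumes "gmd Z j M"
 shows gm_op: "lin_on asc asc (gsp M u) (hop M s u)"
  and gm_op_in: "a : gsp M u ==> hop M s u a : gsp M (u + dg s)" using gm_op_between[OF assms] unfolding linear_between_on by blast+

lemmas gm_t = gm_op[of _ _ _ _ "Inl _", unfolded hop_simps] and gm_x = gm_op[of _ _ _ _ "Inr _", unfolded hop_simps]
 and gm_t_in = gm_op_in[of _ _ _ _ _ "Inl _", unfolded hop_simps] and gm_x_in = gm_op_in[of _ _ _ _ _ "Inr _", unfolded hop_simps]
 and gm_x_x = gm_op_op[of _ _ _ _ _ "Inr _" "Inr _", unfolded hop_simps] and gm_x_t = gm_op_op[of _ _ _ _ _ "Inr _" "Inl _", unfolded hop_simps]
 and gm_t_t = gm_op_op[of _ _ _ _ _ "Inl _" "Inl _", unfolded hop_simps]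

lemma gsubmoduleI:
 assumes "!!u. asc.subspace (N u)" "!!u. N u <= gsp M u"
  and x: "!!u a s. a : N u ==> hop M s u a : N (u + dg s)"
  and inv: "!!b u a. inv_on b j ==> a : gsp M u ==> xop b M u a : N (u + pc) ==> a : N u"
 shows "gsub j M N" unfolding gsubmodule_def by (intro conjI allI ballI impI)
  (use assms(1,2) x[of _ _ "Inl _"] x[of _ _ "Inr False"] x[of _ _ "Inr True"] inv[of False] inv[of True] in "simp_all add: xop_simps inv_on_simps")

lemma
 assumes "gsub j M N"
 shows gs_subspace: "asc.subspace (N u)" and gs_sub: "N u <= gsp M u"
  and gs_t: "a : N u ==> opt M i u a : N (u + px i)"
  and gs_x: "a : N u ==> xop b M u a : N (u + pc)"
  and gs_inv: "inv_on b j ==> a : gsp M u ==> xop b M u a : N (u + pc) ==> a : N u"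
 using assms unfolding gsubmodule_def xop_def inv_on_def by (cases b; simp only: if_True if_False; blast)+

lemma gs_op: "gsub j M N ==> a : N u ==> hop M s u a : N (u + dg s)" by (cases s) (simp_all add: gs_t gs_x)

lemma ghomI:
 assumes "!!u. lbet (gsp M u) (gsp N u) (f u)"
  and x: "!!u a s. a : gsp M u ==> f (u + dg s) (hop M s u a) = hop N s u (f u a)"
 shows "ghom M N f" unfolding ghom_def by (intro conjI allI ballI impI)
  (use assms(1) x[of _ _ "Inl _"] x[of _ _ "Inr False"] x[of _ _ "Inr True"] in "simp_all add: xop_simps")

lemma
 assumes "ghom M N f"
 shows ghom_between: "lbet (gsp M u) (gsp N u) (f u)"
  and ghom_op: "a : gsp M u ==> f (u + dg s) (hop M s u a) = hop N s u (f u a)" using assms unfolding ghom_def xop_def hop_def dg_def by (auto split: sum.splits)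

lemmas ghom_x = ghom_op[of _ _ _ _ _ "Inr _", unfolded hop_simps]

lemma ghom_lin: "ghom M N f ==> lin_on asc asc (gsp M u) (f u)"
 and gin: "ghom M N f ==> a : gsp M u ==> f u a : gsp N u" using ghom_between unfolding linear_between_on by blast+

lemma gm_0: "gmd Z j M ==> 0 : gsp M u" using gm_subspace asc.subspace_0 by blast
lemma gm_add: "gmd Z j M ==> a : gsp M u ==> b : gsp M u ==> a + b : gsp M u" using gm_subspace asc.subspace_add by blast
lemma gm_diff: "gmd Z j M ==> a : gsp M u ==> b : gsp M u ==> a - b : gsp M u" using gm_subspace asc.subspace_diff by blast
lemma gm_asc: "gmd Z j M ==> a : gsp M u ==> asc c a : gsp M u" using gm_subspace asc.subspace_scale by blast

lemma lin_add: "lin_on s1 s2 W f ==> a : W ==> b : W ==> f (a + b) = f a + f b" by (simp add: lin_on_def)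
lemma lin_scale: "lin_on s1 s2 W f ==> a : W ==> f (s1 c a) = s2 c (f a)" by (simp add: lin_on_def)

primrec xpow :: "bool => ('n::finite, 'k::field) gmod => nat => ('n,'k) mp" where
 "xpow b M 0 u a = a"
| "xpow b M (Suc m) u a = xop b M (u + kn m) (xpow b M m u a)"

lemma xpow_in: "gmd Z j M ==> a : gsp M u ==> xpow b M m u a : gsp M (u + kn m)" by (induction m) (auto simp: kc_Suc add.assoc[symmetric] gm_x_in simp del: of_nat_Suc)

lemma xpow_linear:
 assumes M: "gmd Z j M" shows "lin_on asc asc (gsp M u) (xpow b M m u)" unfolding lin_on_def
proof (induction m)
 case (Suc m)
 note l = gm_x[OF M, of "u + kn m" b]
 show ?case using Suc lin_add[OF l] lin_scale[OF l] xpow_in[OF M] by auto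
qed auto

lemma xpow_add: "xpow b M (m + k) u a = xpow b M m (u + kn k) (xpow b M k u a)" by (induction m) (auto simp: kc_add asimps)

lemma xpow_Suc_left: "xpow b M (Suc m) u a = xpow b M m (u + pc) (xop b M u a)" using xpow_add[of b M m 1 u a] by simp

lemma xpow_op:
 assumes M: "gmd Z j M" and a: "a : gsp M u"
 shows "xpow b M m (u + dg s) (hop M s u a) = hop M s (u + kn m) (xpow b M m u a)"
proof (induction m)
 case (Suc m)
 show ?case using Suc gm_op_op[OF M xpow_in[OF M a], where s = "Inr b" and s' = s] by (simp add: kc_add asimps)
qed simp

lemmas xpow_xop = xpow_op[of _ _ _ _ _ _ _ "Inr _", unfolded hop_simps]

lemma xpow_bij:
 assumes M: "gmd Z j M" and b: "inv_on b j"
 shows "bij_betw (xpow b M m u) (gsp M u) (gsp M (u + kn m))"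
proof (induction m)
 case (Suc m)
 have "bij_betw (xop b M (u + kn m) \<circ> xpow b M m u) (gsp M u) (gsp M (u + kn m + pc))" by (rule bij_betw_trans[OF Suc gm_bij[OF M b]])
 thus ?case by (simp add: kc_add asimps comp_def)
qed (simp add: bij_betw_def inj_on_def)

lemma ghom_xpow:
 assumes "gmd Z j M" "ghom M N f" "a : gsp M u"
 shows "f (u + kn m) (xpow b M m u a) = xpow b N m u (f u a)"
proof (induction m)
 case (Suc m)
 thus ?case using ghom_x[OF assms(2) xpow_in[OF assms(1,3)]] by (simp add: kc_add asimps)
qed simp

lemma ghom_0: "gmd Z j M ==> ghom M N f ==> f u 0 = 0" using asc2.linear_on_zero[OF ghom_lin gm_subspace] .
lemma ghom_add: "ghom M N f ==> a : gsp M u ==> b : gsp M u ==> f u (a + b) = f u a + f u b" using lin_add[OF ghom_lin] .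
lemma ghom_asc: "ghom M N f ==> a : gsp M u ==> f u (asc c a) = asc c (f u a)" using lin_scale[OF ghom_lin] .
lemma ghom_diff: "gmd Z j M ==> ghom M N f ==> a : gsp M u ==> b : gsp M u ==> f u (a - b) = f u a - f u b" using asc2.linear_on_diff[OF ghom_lin gm_subspace] .
lemma ghom_comp: "ghom M N f ==> ghom N P g ==> ghom M P (%u a. g u (f u a))" by (rule ghomI) (auto simp: linear_between_def gin ghom_add ghom_asc ghom_op)
lemma ghom_id: "ghom M M (%u a. a)" by (rule ghomI) (auto simp: linear_between_def)

lemma ghom_lincomb:
 assumes N: "gmd Z j N" and f: "ghom M N f" and g: "ghom M N g"
 shows "ghom M N (%u a. f u a + asc c (g u a))"
proof (rule ghomI)
 show "lbet (gsp M u) (gsp N u) (%a. f u a + asc c (g u a))" for u unfolding linear_between_def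
  by (auto simp: ghom_add[OF f] ghom_add[OF g] ghom_asc[OF f] ghom_asc[OF g] gm_add[OF N] gm_asc[OF N] gin[OF f] gin[OF g]
    asc.scale_right_distrib mult.commute add_ac)
 show "f (u + dg s) (hop M s u a) + asc c (g (u + dg s) (hop M s u a)) = hop N s u (f u a + asc c (g u a))" if "a : gsp M u" for u a s
  using that by (simp add: ghom_op[OF f] ghom_op[OF g] lin_add[OF gm_op[OF N]] lin_scale[OF gm_op[OF N]] gm_asc[OF N] gin[OF f] gin[OF g])
qed

text \<open>Two values related to the same element differ by a value related to 0, so any choice of
  values is forced to be linear and compatible with the operators. Maps defined through lifts or
  denominators are built this way.\<close>

lemma ghom_of_rel:
 assumes M: "gmd Z j M" and ex: "!!v x. x : gsp M v ==> EX y. R v x y" and un: "!!v y. R v 0 y ==> y = 0"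
  and mem: "!!v x y. R v x y ==> y : gsp N v"
  and lin: "!!v x x' y y' c. x : gsp M v ==> x' : gsp M v ==> R v x y ==> R v x' y' ==> R v (x + asc c x') (y + asc c y')"
  and op: "!!v x y s. x : gsp M v ==> R v x y ==> R (v + dg s) (hop M s v x) (hop N s v y)"
 shows "EX f. ghom M N f & (ALL v. ALL x:gsp M v. R v x (f v x))"
proof -
 define f where "f v x = (SOME y. R v x y)" for v x
 have f: "R v x (f v x)" if "x : gsp M v" for v x unfolding f_def by (rule someI_ex[OF ex[OF that]])
 have fI: "f v x = y" if x: "x : gsp M v" and "R v x y" for v x y using un[of v "y + asc (- 1) (f v x)"] lin[OF x x that(2) f[OF x], of "- 1"] by simp
 have "ghom M N f"
 proof (rule ghomI)
  show "lbet (gsp M v) (gsp N v) (f v)" for v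
  proof (rule linear_betweenI[OF gm_subspace[OF M] mem[OF f]])
   show "f v (x + asc c y) = f v x + asc c (f v y)" if x: "x : gsp M v" and y: "y : gsp M v" for x y c
    by (rule fI[OF gm_add[OF M x gm_asc[OF M y]] lin[OF x y f[OF x] f[OF y]]])
  qed
  show "f (v + dg s) (hop M s v x) = hop N s v (f v x)" if x: "x : gsp M v" for v x s by (rule fI[OF gm_op_in[OF M x] op[OF x f[OF x]]])
 qed
 thus ?thesis using f by blast
qed

subsection \<open>Charts of line bundles\<close>

definition one :: "'k::field amb" where "one = (%n. if n = 0 then 1 else 0)"

lemma ring_part_finite: "p : Rp j u ==> finite {n. p n ~= 0}" by (simp add: Rp_def)

text \<open>\<open>n\<close> is the exponent of \<open>X1\<close> and \<open>m - n\<close> that of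
  \<open>X0\<close>: a monomial lies on the chart if every negative exponent belongs to an
  invertible coordinate.\<close>

definition cone :: "chart => int => int => bool" where
 "cone j m n <-> (n >= 0 | inv_on True j) & (n <= m | inv_on False j)"

lemma ring_part_cone: "Rp j u = {p. finite {n. p n ~= 0} & (ALL n. p n ~= 0 --> cone j (pmul u) n)}"
 unfolding Rp_def cone_def inv_on_def by (cases j) (auto simp: not_le not_less)

lemma shift1_supp: "{n. shift1 p n ~= 0} = (%n. n + 1) ` {n. p n ~= 0}" unfolding shift1_def image_def by (auto intro: exI[of _ "_ - 1"])

lemma finite_supp_shift: "finite {n. shift1 p n ~= 0} <-> finite {n. p n ~= 0}" unfolding shift1_supp by (simp add: finite_image_iff inj_on_def)

lemma finite_supp_add: "finite {n. p n ~= 0} ==> finite {n. q n ~= 0} ==> finite {n. (p + q) n ~= (0::'k::field)}"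
 by (rule finite_subset[of _ "{n. p n ~= 0} Un {n. q n ~= 0}"]) (auto simp: funp)
lemma finite_supp_asc: "finite {n. p n ~= 0} ==> finite {n. asc c p n ~= 0}" by (rule finite_subset[of _ "{n. p n ~= 0}"]) (auto simp: asc_def)

lemma sub_Rp: "asc.subspace (Rp j u)"
proof (rule asc.subspaceI)
 show "x + y : Rp j u" if "x : Rp j u" "y : Rp j u" for x y using that finite_supp_add[of x y] unfolding Rp_def by (auto simp: funp)
 show "asc c x : Rp j u" if "x : Rp j u" for c x using that finite_supp_asc[of x c] unfolding Rp_def by (auto simp: asc_def)
qed (auto simp: Rp_def fun0)

lemma shift1_linear: "shift1 (a + b) = shift1 a + shift1 b" "shift1 (asc c a) = asc c (shift1 a)" by (auto simp: shift1_def asc_def funp)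

lemma O_simps [simp]:
 "gsp (Oc Z u j) v = Rp j (u + v)"
 "opt (Oc Z u j) i v p = (if i : podd (u + v)
       then asc (fst (vform (Z i))) p + asc (snd (vform (Z i))) (shift1 p) else p)"
 "xop b (Oc Z u j) v p = (if b then shift1 p else p)" by (auto simp: O_chart_def xop_def)

lemma ring_part_shift: "p : Rp j u ==> shift1 p : Rp j (u + pc)" unfolding Rp_def by (auto simp: finite_supp_shift) (auto simp: shift1_def)

lemma ring_part_subset: "pmul u <= pmul v ==> Rp j u <= Rp j v" unfolding Rp_def by auto

lemma ring_part_t:
 assumes "p : Rp j w" and that: "w = u + v"
 shows "opt (Oc Z u j) i v p : Rp j (w + px i)"
proof (cases "i : podd w")
 case True
 have "p : Rp j (w + px i)" "shift1 p : Rp j (w + px i)"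
  using ring_part_subset[of w "w + px i" j] ring_part_subset[of "w + pc" "w + px i" j] ring_part_shift[OF assms(1)] assms(1) True by (auto simp: pmul_add_px)
 thus ?thesis using that True by (simp add: asc.subspace_add[OF sub_Rp] asc.subspace_scale[OF sub_Rp])
next
 case False
 thus ?thesis using that assms ring_part_subset[of w "w + px i" j] by (auto simp: pmul_add_px)
qed

lemma gm_O: "gmd Z j (Oc Z u j)"
proof (rule gmoduleI)
 have t: "lbet (gsp (Oc Z u j) v) (gsp (Oc Z u j) (v + px i)) (opt (Oc Z u j) i v)" for i v
 proof -
  have 1: "opt (Oc Z u j) i v p : Rp j (u + (v + px i))" if "p : Rp j (u + v)" for p using ring_part_t[OF that refl, of Z i] by (simp add: add.assoc)
  have 2: "opt (Oc Z u j) i v (a + b) = opt (Oc Z u j) i v a + opt (Oc Z u j) i v b"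
   "opt (Oc Z u j) i v (asc c a) = asc c (opt (Oc Z u j) i v a)" for a b c by (auto simp: shift1_linear asc.scale_right_distrib mult.commute)
  show ?thesis unfolding linear_between_def using 1 2 by (simp del: O_simps(2))
 qed
 have "lbet (gsp (Oc Z u j) v) (gsp (Oc Z u j) (v + pc)) (xop b (Oc Z u j) v)" for b v using ring_part_shift[of _ j "u + v"] ring_part_subset[of "u + v" "u + v + pc" j]
  unfolding linear_between_def by (auto simp: add.assoc[symmetric] shift1_linear)
 thus "lbet (gsp (Oc Z u j) v) (gsp (Oc Z u j) (v + dg s)) (hop (Oc Z u j) s v)" for s v using t by (cases s) (simp_all del: O_simps)
 show "bij_betw (xop b (Oc Z u j) v) (gsp (Oc Z u j) v) (gsp (Oc Z u j) (v + pc))" if "inv_on b j" for b v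
 proof (cases b)
  case True
  show ?thesis
  proof (rule bij_betwI[where g = "%p n. p (n + 1)"])
   show "xop b (Oc Z u j) v : gsp (Oc Z u j) v \<rightarrow> gsp (Oc Z u j) (v + pc)" using True ring_part_shift[of _ j "u + v"] by (auto simp: add.assoc[symmetric])
   show "(%p n. p (n + 1)) : gsp (Oc Z u j) (v + pc) \<rightarrow> gsp (Oc Z u j) v"
   proof
    fix p assume p: "p : gsp (Oc Z u j) (v + pc)"
    have "shift1 (%n. p (n + 1)) = p" by (auto simp: shift1_def)
    hence "finite {n. p (n + 1) ~= 0}" using p finite_supp_shift[of "%n. p (n + 1)"] by (auto simp: Rp_def)
    moreover have "pmul (u + (v + pc)) = pmul (u + v) + 1" using pmul_pc[of "u + v"] by (simp only: add.assoc)
    ultimately show "(%n. p (n + 1)) : gsp (Oc Z u j) v" using p that True by (auto simp: Rp_def inv_on_def)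
   qed
  qed (use True in "auto simp: shift1_def")
 next
  case False
  have "Rp j (u + (v + pc)) = Rp j (u + v)" using that False by (auto simp: Rp_def inv_on_def)
  thus ?thesis using False by (auto simp: bij_betw_def inj_on_def)
 qed
 show "hop (Oc Z u j) s (v + dg s') (hop (Oc Z u j) s' v a) = hop (Oc Z u j) s' (v + dg s) (hop (Oc Z u j) s v a)" for s s' v a by (cases s; cases s'; cases "s = s'")
   (simp_all add: podd_add shift1_linear asc.scale_right_distrib mult.commute add.commute add.left_commute)
 show "opt (Oc Z u j) i (v + px i) (opt (Oc Z u j) i v a) = lmul (Oc Z u j) (vform (Z i)) v a" for i v a by (simp add: podd_add lmul_xop)
qed (simp_all add: sub_Rp podd_add shift1_linear)

lemma gs_unit_power:
 assumes N: "gsub j M N" and M: "gmd Z j M" and a: "a : gsp M u" and b: "inv_on b j"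
  and "xpow b M m u a : N (u + kn m)"
 shows "a : N u" using assms(5)
proof (induction m)
 case (Suc m)
 have "xop b M (u + kn m) (xpow b M m u a) : N (u + kn m + pc)" using Suc.prems by (simp add: kc_add ac_simps)
 from gs_inv[OF N b xpow_in[OF M a] this] show ?case by (rule Suc.IH)
qed simp

lemma gs_xpow:
 assumes N: "gsub j M N" and "a : N u"
 shows "xpow b M m u a : N (u + kn m)"
proof (induction m)
 case (Suc m)
 thus ?case using gs_x[OF N Suc] by (simp add: kc_add ac_simps)
qed (simp add: assms)

lemma gs_full: "gmd Z j M ==> gsub j M (gsp M)" by (rule gsubmoduleI) (auto simp: gm_subspace gm_op_in)

definition delta :: "int => 'k::field amb" where "delta m = (%n. if n = m then 1 else 0)"

lemma one_delta: "one = delta 0" by (simp add: one_def delta_def)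

lemma shift1_delta: "shift1 (delta m) = delta (m + 1)" by (auto simp: shift1_def delta_def)

lemma delta_sum:
 assumes "finite S" "!!n. p n ~= 0 ==> n : S"
 shows "p = (SUM n:S. asc (p n) (delta n))"
proof
 fix m
 have app: "(SUM n:S. f n) m = (SUM n:S. f n m)" for f :: "int => 'a amb" by (induction S rule: infinite_finite_induct) (auto simp: funp fun0)
 have "(SUM n:S. asc (p n) (delta n)) m = (SUM n:S. if n = m then p n else 0)" unfolding app by (rule sum.cong) (auto simp: asc_def delta_def)
 also have "... = p m" using assms(1) assms(2)[of m] by (auto simp: sum.delta')
 finally show "p m = (SUM n:S. asc (p n) (delta n)) m" by simp
qed

lemma delta_in: "delta n : Rp j u <-> cone j (pmul u) n" unfolding ring_part_cone by (auto simp: delta_def)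

lemma one_in: "one : gsp (Oc Z u j) (- u)" by (simp add: one_delta delta_in cone_def)

lemma gs_psum:
 assumes N: "gsub j (Oc Z u j) N" and p: "p : N v" and "podd (u + v) = {}"
 shows "p : N (v + psum A)"
proof (induction A rule: finite_induct[OF finite])
 case (2 i A)
 have "i ~: podd (u + (v + psum A))" using assms(3) 2 by (simp add: podd_add set_eq_iff)
 thus ?case using gs_t[OF N 2(3), of i] 2(2) by (simp add: psum_insert ac_simps)
qed (simp add: p)

text \<open>Products of distinct \<open>t_i\<close> lead from the unit to every degree modulo
  \<open>c\<close>; within such a class the monomials are reached by the coordinates and, where they
  exist, their inverses.\<close>

lemma O_generated:
 assumes N: "gsub j (Oc Z u j) N" and "one : N (- u)"
 shows "N v = Rp j (u + v)"
proof
 show "N v <= Rp j (u + v)" using gs_sub[OF N, of v] by simp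
 define m where "m = pmul (u + v)"
 define w where "w = - u + psum (podd (u + v))"
 have v: "v = w + kc m" unfolding w_def m_def using pic_normal_form[of "u + v"] by (simp add: asimps)
 have w: "delta 0 : N w" unfolding w_def using gs_psum[OF N assms(2)] by (simp add: one_delta)
 have pmw: "pmul (u + w) = 0" unfolding w_def by (rule pmul_eqI) (simp add: podd_add)
 have pm: "pmul (u + (w + kc k)) = k" for k using pmul_kc[of "u + w" k] pmw by (simp add: add.assoc)
 have X: "delta (n + 1) : N (w + kc (k + 1))" if "delta n : N (w + kc k)" for n k using gs_x[OF N that, of True] by (simp add: shift1_delta kc_add ac_simps)
 have Y: "p : N (w + kc (k + 1))" if "p : N (w + kc k)" for p k using gs_x[OF N that, of False] by (simp add: kc_add ac_simps)
 have X': "delta n : N (w + kc k)" if "delta (n + 1) : N (w + kc (k + 1))" "inv_on True j" "cone j k n" for n k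
  using gs_inv[OF N that(2), of "delta n" "w + kc k"] that by (simp add: delta_in pm shift1_delta kc_add ac_simps)
 have Y': "delta n : N (w + kc k)" if "delta n : N (w + kc (k + 1))" "inv_on False j" "cone j k n" for n k
  using gs_inv[OF N that(2), of "delta n" "w + kc k"] that by (simp add: delta_in pm kc_add ac_simps)
 \<comment> \<open>In these degrees the exponent of \<open>X0\<close> is 0, and \<open>X1\<close>
   alone moves between the monomials; \<open>mono\<close> then changes the exponent of
   \<open>X0\<close>.\<close>
 have base: "delta n : N (w + kc n)" if "cone j n n" for n
 proof (cases "n >= 0")
  case True
  thus ?thesis by (induction n rule: int_ge_induct) (use w X in auto)
 next
  case False
  hence inv: "inv_on True j" using that by (simp add: cone_def)
  have "n <= 0" using False by simp
  thus ?thesis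
  proof (induction n rule: int_le_induct)
   case base thus ?case using w by simp
  next
   case (step i)
   show ?case using X'[of "i - 1" "i - 1"] step inv by (simp add: cone_def)
  qed
 qed
 have mono: "delta n : N (w + kc m)" if "cone j m n" for n
 proof -
  have b: "delta n : N (w + kc n)" using base that by (simp add: cone_def)
  show ?thesis
  proof (cases "n <= m")
   case True
   thus ?thesis by (induction m rule: int_ge_induct) (use b Y in auto)
  next
   case False
   hence inv: "inv_on False j" using that by (simp add: cone_def)
   have "m <= n" using False by simp
   thus ?thesis
   proof (induction m rule: int_le_induct)
    case base thus ?case using b by simp
   next
    case (step i)
    show ?case using Y'[of n "i - 1"] step inv that by (simp add: cone_def)
   qed
  qed
 qed
 show "Rp j (u + v) <= N v"
 proof
  fix p :: "'b amb" assume p: "p : Rp j (u + v)"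
  note fin = ring_part_finite[OF p]
  have "p = (SUM n:{n. p n ~= 0}. asc (p n) (delta n))" by (rule delta_sum[OF fin]) simp
  also have "... : N v"
  proof (rule asc.subspace_sum[OF gs_subspace[OF N]])
   fix n assume "n : {n. p n ~= 0}"
   hence "cone j m n" using p unfolding ring_part_cone m_def by auto
   thus "asc (p n) (delta n) : N v" using mono v asc.subspace_scale[OF gs_subspace[OF N]] by simp
  qed
  finally show "p : N v" .
 qed
qed

section \<open>Integer powers of the coordinates and freeness of line bundles\<close>

definition zpow :: "bool => ('n::finite, 'k::field) gmod => int => ('n,'k) mp" where
 "zpow b M k u a = (if k >= 0 then xpow b M (nat k) u a
   else (THE c. c : gsp M (u + kc k) & xpow b M (nat (- k)) (u + kc k) c = a))"

lemma kc_inverse [simp]: "u + kc k + kc (- k) = u" by (simp add: kc_minus)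

lemma zpow_neg:
 assumes M: "gmd Z j M" and b: "inv_on b j" and a: "a : gsp M u" and k: "k < 0"
 shows "zpow b M k u a : gsp M (u + kc k)" "xpow b M (nat (- k)) (u + kc k) (zpow b M k u a) = a"
  and zpow_neg_unique: "c : gsp M (u + kc k) ==> xpow b M (nat (- k)) (u + kc k) c = a ==> zpow b M k u a = c"
proof -
 have bij: "bij_betw (xpow b M (nat (- k)) (u + kc k)) (gsp M (u + kc k)) (gsp M u)" using xpow_bij[OF M b, of "nat (- k)" "u + kc k"] k by simp
 obtain c where c: "c : gsp M (u + kc k)" "xpow b M (nat (- k)) (u + kc k) c = a" using a bij unfolding bij_betw_def by (metis imageE)
 have uniq: "c' = c" if "c' : gsp M (u + kc k)" "xpow b M (nat (- k)) (u + kc k) c' = a" for c'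
  using inj_onD[OF bij_betw_imp_inj_on[OF bij] _ that(1) c(1)] that(2) c(2) by simp
 have the: "(THE c. c : gsp M (u + kc k) & xpow b M (nat (- k)) (u + kc k) c = a) = c"
 proof (rule the_equality)
  show "c' = c" if "c' : gsp M (u + kc k) & xpow b M (nat (- k)) (u + kc k) c' = a" for c' using uniq[of c'] that by (elim conjE)
 qed (intro conjI c)
 have zc: "zpow b M k u a = c" unfolding zpow_def the using k by simp
 thus "zpow b M k u a : gsp M (u + kc k)" "xpow b M (nat (- k)) (u + kc k) (zpow b M k u a) = a" using c by simp_all
 show "c' : gsp M (u + kc k) ==> xpow b M (nat (- k)) (u + kc k) c' = a ==> zpow b M k u a = c'" for c' using uniq[of c'] zc by metis
qed

lemma zpow_in:
 assumes M: "gmd Z j M" and b: "inv_on b j | k >= 0" and a: "a : gsp M u"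
 shows "zpow b M k u a : gsp M (u + kc k)" using zpow_neg(1)[OF M _ a, of b k] xpow_in[OF M a, of b "nat k"] b by (cases "k >= 0") (auto simp: zpow_def)

lemma zpow_Suc:
 assumes M: "gmd Z j M" and b: "inv_on b j | k >= 0" and a: "a : gsp M u"
 shows "xop b M (u + kc k) (zpow b M k u a) = zpow b M (k + 1) u a"
proof (cases "k >= 0")
 case True
 hence "nat (k + 1) = Suc (nat k)" by simp
 thus ?thesis using True by (simp add: zpow_def)
next
 case False
 hence b: "inv_on b j" and k: "k < 0" using b by auto
 note z = zpow_neg[OF M b a k]
 have n: "nat (- k) = Suc (nat (- (k + 1)))" using k by simp
 have u: "u + kc k + pc = u + kc (k + 1)" by (simp add: kc_add ac_simps)
 have eq: "xpow b M (nat (- (k + 1))) (u + kc (k + 1)) (xop b M (u + kc k) (zpow b M k u a)) = a" using z(2) unfolding n xpow_Suc_left u .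
 have inn: "xop b M (u + kc k) (zpow b M k u a) : gsp M (u + kc (k + 1))" using gm_x_in[OF M z(1), of b] unfolding u .
 show ?thesis
 proof (cases "k + 1 < 0")
  case True
  from zpow_neg_unique[OF M b a True inn eq] show ?thesis by simp
 next
  case False
  hence "k + 1 = 0" using k by simp
  thus ?thesis using eq by (simp add: zpow_def)
 qed
qed

lemma zpow_commute:
 assumes M: "gmd Z j M" and b: "inv_on b j | k >= 0" and a: "a : gsp M u"
  and h: "!!v c. c : gsp M v ==> h v c : gsp M (v + d)"
  and hx: "!!v c. c : gsp M v ==> h (v + pc) (xop b M v c) = xop b M (v + d) (h v c)"
 shows "h (u + kc k) (zpow b M k u a) = zpow b M k (u + d) (h u a)"
proof -
 have hp: "h (v + kn m) (xpow b M m v c) = xpow b M m (v + d) (h v c)" if c: "c : gsp M v" for v c m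
 proof (induction m)
  case (Suc m)
  thus ?case using hx[OF xpow_in[OF M c, of b m]] by (simp add: kc_add ac_simps)
 qed simp
 show ?thesis
 proof (cases "k >= 0")
  case True
  thus ?thesis using hp[OF a, of "nat k"] by (simp add: zpow_def)
 next
  case False
  hence b: "inv_on b j" and k: "k < 0" using b by auto
  note z = zpow_neg[OF M b a k]
  have u: "u + kc k + d = u + d + kc k" by (simp add: ac_simps)
  have "h (u + kc k) (zpow b M k u a) : gsp M (u + d + kc k)" using h[OF z(1)] unfolding u .
  moreover have "xpow b M (nat (- k)) (u + d + kc k) (h (u + kc k) (zpow b M k u a)) = h u a" using hp[OF z(1), of "nat (- k)"] k z(2) unfolding u by simp
  ultimately show ?thesis using zpow_neg_unique[OF M b h[OF a] k] by simp
 qed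
qed

text \<open>\<open>y A\<close> is the product of the \<open>t_i\<close> with \<open>i\<close> in
  \<open>A\<close>, applied to \<open>a\<close>; since the \<open>t_i\<close> commute, the order of
  insertion does not matter.\<close>

lemma t_family:
 assumes M: "gmd Z j M" and a: "a : gsp M v"
 obtains y where "y {} = a" "!!A. y A : gsp M (v + psum A)"
  "!!i A. i ~: A ==> y (insert i A) = opt M i (v + psum A) (y A)"
proof -
 have "EX y. y {} = a & (ALL A. A <= S --> y A : gsp M (v + psum A)) &
   (ALL A i. A <= S --> i : S --> i ~: A --> y (insert i A) = opt M i (v + psum A) (y A))" for S
 proof (induction S rule: finite_induct[OF finite])
  case 1
  show ?case by (rule exI[of _ "%_. a"]) (use a in auto)
 next
  case (2 i0 S)
  then obtain y where y: "y {} = a" "!!A. A <= S ==> y A : gsp M (v + psum A)"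
   "!!A i. A <= S ==> i : S ==> i ~: A ==> y (insert i A) = opt M i (v + psum A) (y A)" by auto
  \<comment> \<open>The new index \<open>i0\<close> is applied last in the product, so any other
    index inserted later has to be commuted past it.\<close>
  define y' where "y' A = (if i0 : A then opt M i0 (v + psum (A - {i0})) (y (A - {i0})) else y A)" for A
  show ?case
  proof (intro exI[of _ y'] conjI allI impI)
   show "y' {} = a" using y by (simp add: y'_def)
  next
   fix A assume A: "A <= insert i0 S"
   hence A0: "A - {i0} <= S" by auto
   have "i0 : A ==> psum A = psum (A - {i0}) + px i0" using psum_insert[of i0 "A - {i0}"] by (simp add: insert_absorb)
   thus "y' A : gsp M (v + psum A)" using gm_t_in[OF M y(2)[OF A0], of i0] y(2)[of A] A by (auto simp: y'_def ac_simps)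
  next
   fix A i assume A: "A <= insert i0 S" and i: "i : insert i0 S" "i ~: A"
   show "y' (insert i A) = opt M i (v + psum A) (y' A)"
   proof (cases "i = i0")
    case True
    thus ?thesis using i by (simp add: y'_def)
   next
    case False
    show ?thesis
    proof (cases "i0 : A")
     case True
     define B where "B = A - {i0}"
     have B: "B <= S" "i : S" "i ~: B" "i0 ~: B" "A = insert i0 B" "insert i A - {i0} = insert i B" using A i True False unfolding B_def by auto
     have "y' (insert i A) = opt M i0 (v + psum B + px i) (opt M i (v + psum B) (y B))" using True B y(3)[of B i] by (simp add: y'_def psum_insert ac_simps)
     also have "... = opt M i (v + psum B + px i0) (opt M i0 (v + psum B) (y B))" using gm_t_t[OF M y(2)[OF B(1)]] .
     also have "... = opt M i (v + psum A) (y' A)" using True B(4) by (simp add: y'_def B_def[symmetric] B(5) psum_insert ac_simps)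
     finally show ?thesis .
    next
     case nA: False
     hence "A <= S" "i : S" using A i False by auto
     thus ?thesis using y(3) i nA False by (simp add: y'_def)
    qed
   qed
  qed
 qed
 from this[of UNIV] that show thesis by auto
qed

text \<open>\<open>Y w n\<close> is the monomial of degree \<open>w - v\<close> with exponent
  \<open>n\<close> of \<open>X1\<close>, applied to \<open>a\<close>. The rule for
  \<open>t_i\<close> when \<open>i\<close> is already in \<open>podd (w - v)\<close> can be
  recovered from the formula for the square of \<open>t_i\<close>.\<close>

lemma monomials_ex:
 assumes M: "gmd Z j M" and a: "a : gsp M v"
 obtains Y where "Y v 0 = a"
  "!!w n. cone j (pmul (w - v)) n ==> Y w n : gsp M w"
  "!!w n. cone j (pmul (w - v)) n ==> xop False M w (Y w n) = Y (w + pc) n"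
  "!!w n. cone j (pmul (w - v)) n ==> xop True M w (Y w n) = Y (w + pc) (n + 1)"
  "!!w n i. cone j (pmul (w - v)) n ==> i ~: podd (w - v) ==> opt M i w (Y w n) = Y (w + px i) n"
proof -
 obtain y where y: "y {} = a" "!!A. y A : gsp M (v + psum A)"
  "!!i A. i ~: A ==> y (insert i A) = opt M i (v + psum A) (y A)" using t_family[OF M a] by blast
 define E where "E A n = zpow True M n (v + psum A) (y A)" for A n
 define Y where "Y w n = zpow False M (pmul (w - v) - n) (v + psum (podd (w - v)) + kc n) (E (podd (w - v)) n)" for w n
 have E: "E A n : gsp M (v + psum A + kc n)" if "n >= 0 | inv_on True j" for A n unfolding E_def using zpow_in[OF M _ y(2)] that by blast
 have nf: "v + psum (podd (w - v)) + kc n + kc (pmul (w - v) - n) = w" for w n using pic_normal_form[of "w - v"] by (simp add: kc_diff asimps)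
 have c: "inv_on True j | n >= 0" "n >= 0 | inv_on True j" "inv_on False j | m - n >= 0" if "cone j m n" for m n using that by (auto simp: cone_def)
 have p1: "podd (w + pc - v) = podd (w - v)" "pmul (w + pc - v) = pmul (w - v) + 1" for w using pmul_pc[of "w - v"] by (auto simp: podd_diff podd_add asimps)
 show thesis
 proof (rule that[of Y])
  show "Y v 0 = a" by (simp add: Y_def E_def zpow_def y)
  show "Y w n : gsp M w" if "cone j (pmul (w - v)) n" for w n using zpow_in[OF M c(3)[OF that] E[OF c(2)[OF that]], of "podd (w - v)"] unfolding nf Y_def .
  show "xop False M w (Y w n) = Y (w + pc) n" if "cone j (pmul (w - v)) n" for w n
   using zpow_Suc[OF M c(3)[OF that] E[OF c(2)[OF that]], of "podd (w - v)"] unfolding nf Y_def p1 by (simp add: asimps)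
  show "xop True M w (Y w n) = Y (w + pc) (n + 1)" if cn: "cone j (pmul (w - v)) n" for w n
  proof -
   let ?A = "podd (w - v)"
   have "xop True M w (Y w n) = zpow False M (pmul (w - v) - n) (v + psum ?A + kc n + pc) (xop True M (v + psum ?A + kc n) (E ?A n))"
    using zpow_commute[OF M c(3)[OF cn] E[OF c(2)[OF cn]], of "xop True M" pc ?A] gm_x_in[OF M] gm_x_x[OF M] unfolding nf Y_def by simp
   also have "xop True M (v + psum ?A + kc n) (E ?A n) = E ?A (n + 1)" unfolding E_def by (rule zpow_Suc[OF M c(1)[OF cn] y(2)])
   finally show ?thesis unfolding Y_def p1 by (simp add: kc_add ac_simps)
  qed
  show "opt M i w (Y w n) = Y (w + px i) n" if cn: "cone j (pmul (w - v)) n" and i: "i ~: podd (w - v)" for w n i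
  proof -
   let ?A = "podd (w - v)"
   have p2: "podd (w + px i - v) = insert i ?A" "pmul (w + px i - v) = pmul (w - v)" using i pmul_add_px[of "w - v" i] by (auto simp: podd_diff podd_add asimps)
   have "opt M i w (Y w n) = zpow False M (pmul (w - v) - n) (v + psum ?A + kc n + px i) (opt M i (v + psum ?A + kc n) (E ?A n))"
    using zpow_commute[OF M c(3)[OF cn] E[OF c(2)[OF cn]], of "opt M i" "px i" ?A] gm_t_in[OF M] gm_x_t[OF M] unfolding nf Y_def by simp
   also have "opt M i (v + psum ?A + kc n) (E ?A n) = E (insert i ?A) n"
    unfolding E_def using zpow_commute[OF M c(1)[OF cn] y(2), of "opt M i" "px i" ?A] gm_t_in[OF M] gm_x_t[OF M] y(3)[OF i] i by (simp add: psum_insert ac_simps)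
   finally show ?thesis unfolding Y_def p2 using i by (simp add: psum_insert ac_simps)
  qed
 qed
qed

text \<open>The chart of O(- v) is free on the generator \<open>one\<close> of degree
  \<open>v\<close>: its monomials form a basis, and their images have to be the monomials applied to
  \<open>a\<close>.\<close>

lemma O_hom_ex:
 assumes M: "gmd Z j M" and a: "a : gsp M v"
 obtains f where "ghom (Oc Z (- v) j) M f" "f v one = a"
proof -
 obtain Y where Y: "Y v 0 = a"
  "!!w n. cone j (pmul (w - v)) n ==> Y w n : gsp M w"
  "!!w n. cone j (pmul (w - v)) n ==> xop False M w (Y w n) = Y (w + pc) n"
  "!!w n. cone j (pmul (w - v)) n ==> xop True M w (Y w n) = Y (w + pc) (n + 1)"
  "!!w n i. cone j (pmul (w - v)) n ==> i ~: podd (w - v) ==> opt M i w (Y w n) = Y (w + px i) n" using monomials_ex[OF M a] by blast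
 define f where "f w p = (SUM n | p n ~= 0. asc (p n) (Y w n))" for w p
 have f: "f w p = (SUM n:S. asc (p n) (Y w n))" if "finite S" "!!n. p n ~= 0 ==> n : S" for w p S unfolding f_def by (rule sum.mono_neutral_left) (use that in auto)
 have rp: "finite {n. p n ~= 0}" "p n ~= 0 ==> cone j (pmul (w - v)) n" if "p : Rp j (- v + w)" for p w n using that by (auto simp: ring_part_cone)
 have f_in: "f w p : gsp M w" if "p : Rp j (- v + w)" for p w
  unfolding f_def by (rule asc.subspace_sum[OF gm_subspace[OF M]]) (use rp(2)[OF that] Y(2) gm_asc[OF M] in auto)
 have f_add: "f w (p + q) = f w p + f w q" if "finite {n. p n ~= 0}" "finite {n. q n ~= 0}" for p q w
 proof -
  let ?S = "{n. p n ~= 0} Un {n. q n ~= 0}"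
  have "finite ?S" using that by auto
  moreover from this have "f w (p + q) = (SUM n:?S. asc ((p + q) n) (Y w n))" by (rule f) (auto simp: funp)
  ultimately show ?thesis using f[of ?S p w] f[of ?S q w] by (simp add: funp sum.distrib[symmetric] asc.scale_left_distrib)
 qed
 have f_asc: "f w (asc c p) = asc c (f w p)" if "finite {n. p n ~= 0}" for p c w
 proof -
  have "f w (asc c p) = (SUM n | p n ~= 0. asc (asc c p n) (Y w n))" by (rule f[OF that]) (auto simp: asc_def)
  also have "... = (SUM n | p n ~= 0. asc c (asc (p n) (Y w n)))" by (rule sum.cong) (simp, simp, simp add: asc_def)
  finally show ?thesis unfolding f_def asc.scale_sum_right .
 qed
 have f_shift: "f w (shift1 p) = (SUM n | p n ~= 0. asc (p n) (Y w (n + 1)))" if "finite {n. p n ~= 0}" for p w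
  unfolding f_def shift1_supp by (simp add: sum.reindex inj_on_def shift1_def)
 have lin: "h (f w p) = (SUM n | p n ~= 0. asc (p n) (h (Y w n)))"
  if "p : Rp j (- v + w)" "lin_on asc asc (gsp M w) h" for p w h
 proof -
  have "h (f w p) = (SUM n | p n ~= 0. h (asc (p n) (Y w n)))"
   unfolding f_def by (rule asc2.linear_on_sum[OF that(2) gm_subspace[OF M]]) (use rp(2)[OF that(1)] Y(2) gm_asc[OF M] in auto)
  also have "... = (SUM n | p n ~= 0. asc (p n) (h (Y w n)))" by (rule sum.cong) (use rp(2)[OF that(1)] Y(2) lin_scale[OF that(2)] in auto)
  finally show ?thesis .
 qed
 have "ghom (Oc Z (- v) j) M f"
 proof (rule ghomI)
  show "lbet (gsp (Oc Z (- v) j) w) (gsp M w) (f w)" for w unfolding linear_between_def O_simps(1) by (intro conjI ballI allI f_in f_add f_asc; (erule rp(1))?)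
  have x: "f (w + pc) (xop b (Oc Z (- v) j) w p) = xop b M w (f w p)" if "p : gsp (Oc Z (- v) j) w" for w p b
  proof -
   have p: "p : Rp j (- v + w)" using that by simp
   have "xop b M w (f w p) = (SUM n | p n ~= 0. asc (p n) (xop b M w (Y w n)))" by (rule lin[OF p gm_x[OF M]])
   also have "... = f (w + pc) (if b then shift1 p else p)"
   proof (cases b)
    case True
    thus ?thesis using f_shift[OF rp(1)[OF p]] Y(4)[OF rp(2)[OF p]] by simp
   next
    case False
    thus ?thesis using Y(3)[OF rp(2)[OF p]] by (simp add: f_def)
   qed
   finally show ?thesis by simp
  qed
  have t: "f (w + px i) (opt (Oc Z (- v) j) i w p) = opt M i w (f w p)" if "p : gsp (Oc Z (- v) j) w" for w p i
  proof -
   have p: "p : Rp j (- v + w)" using that by simp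
   note e = lin[OF p gm_t[OF M]]
   show ?thesis
   proof (cases "i : podd (w - v)")
    case False
    thus ?thesis using Y(5)[OF rp(2)[OF p]] e by (simp add: f_def)
   next
    case True
    let ?l = "vform (Z i)"
    \<comment> \<open>The factor \<open>t_i\<close> already occurs in the monomial; it is split off,
      and the square of \<open>t_i\<close> is replaced by its linear form.\<close>
    let ?w = "w - px i"
    have pm: "pmul (?w - v) = pmul (w - v)" "i ~: podd (?w - v)"
     using True pmul_diff_px[of "w - v" i] unfolding diff_diff_eq[of w "px i" v] add.commute[of "px i" v] diff_diff_eq[symmetric] by (auto simp: podd_diff)
    have wp: "?w + pc = w + px i" by (simp add: pc_eq[of i])
    have "opt M i w (Y w n) = asc (fst ?l) (Y (w + px i) n) + asc (snd ?l) (Y (w + px i) (n + 1))" if "p n ~= 0" for n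
    proof -
     have cn: "cone j (pmul (?w - v)) n" using rp(2)[OF p that] pm by simp
     have 1: "opt M i ?w (Y ?w n) = Y w n" using Y(5)[OF cn pm(2)] by simp
     have "opt M i (?w + px i) (opt M i ?w (Y ?w n)) = lmul M ?l ?w (Y ?w n)" by (rule gm_t_sq[OF M Y(2)[OF cn]])
     thus ?thesis unfolding 1 lmul_xop Y(3)[OF cn] Y(4)[OF cn] wp by simp
    qed
    hence "opt M i w (f w p) = (SUM n | p n ~= 0. asc (p n) (asc (fst ?l) (Y (w + px i) n) + asc (snd ?l) (Y (w + px i) (n + 1))))" using e by simp
    also have "... = (SUM n | p n ~= 0. asc (fst ?l) (asc (p n) (Y (w + px i) n)) + asc (snd ?l) (asc (p n) (Y (w + px i) (n + 1))))"
     by (rule sum.cong) (simp_all add: asc.scale_right_distrib mult.commute)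
    also have "... = asc (fst ?l) (f (w + px i) p) + asc (snd ?l) (f (w + px i) (shift1 p))"
     using f_shift[OF rp(1)[OF p]] by (simp add: f_def sum.distrib asc.scale_sum_right)
    also have "... = f (w + px i) (asc (fst ?l) p + asc (snd ?l) (shift1 p))" using rp(1)[OF p] by (simp add: f_add f_asc finite_supp_asc finite_supp_shift)
    finally show ?thesis using True by simp
   qed
  qed
  show "f (w + dg s) (hop (Oc Z (- v) j) s w p) = hop M s w (f w p)" if "p : gsp (Oc Z (- v) j) w" for w p s
   using x[OF that] t[OF that] by (cases s) (simp_all del: O_simps)
 qed
 moreover have "f v one = a"
 proof -
  have "f v one = (SUM n:{0}. asc (one n) (Y v n))" by (rule f) (auto simp: one_def split: if_splits)
  thus ?thesis using Y(1) by (simp add: one_def)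
 qed
 ultimately show thesis by (rule that)
qed

subsection \<open>Submodules, images and quotients\<close>

lemma gs_0: "gsub j M N ==> 0 : N u" using gs_subspace asc.subspace_0 by blast
lemma gs_add: "gsub j M N ==> a : N u ==> b : N u ==> a + b : N u" using gs_subspace asc.subspace_add by blast
lemma gs_diff: "gsub j M N ==> a : N u ==> b : N u ==> a - b : N u" using gs_subspace asc.subspace_diff by blast
lemma gs_asc: "gsub j M N ==> a : N u ==> asc c a : N u" using gs_subspace asc.subspace_scale by blast
lemma gs_in: "gsub j M N ==> a : N u ==> a : gsp M u" using gs_sub by blast

lemma gs_preimage:
 assumes M: "gmd Z j M" and f: "ghom M M' f" and N: "gsub j M' N"
 shows "gsub j M (%u. {a : gsp M u. f u a : N u})"
proof (rule gsubmoduleI)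
 show "asc.subspace {a : gsp M u. f u a : N u}" for u by (rule asc2.subspace_preimage_on[OF ghom_lin[OF f] gm_subspace[OF M] gs_subspace[OF N]])
 show "hop M s u a : {a : gsp M (u + dg s). f (u + dg s) a : N (u + dg s)}" if "a : {a : gsp M u. f u a : N u}" for u a s
  using that gm_op_in[OF M, of a u s] ghom_op[OF f, of a u s] gs_op[OF N, of "f u a" u s] by simp
 show "a : {a : gsp M u. f u a : N u}"
  if "inv_on b j" "a : gsp M u" "xop b M u a : {a : gsp M (u + pc). f (u + pc) a : N (u + pc)}" for b u a
  using that ghom_x[OF f that(2), of b] gs_inv[OF N that(1) gin[OF f that(2)]] by simp
qed auto

lemma gm_x_inj:
 assumes M: "gmd Z j M" and b: "inv_on b j" and "a : gsp M u" "c : gsp M u" "xop b M u a = xop b M u c"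
 shows "a = c" using inj_onD[OF bij_betw_imp_inj_on[OF gm_bij[OF M b, of u]] assms(5,3,4)] .

lemma gm_x_surj:
 assumes M: "gmd Z j M" and b: "inv_on b j" and "y : gsp M (u + pc)"
 obtains a where "a : gsp M u" "xop b M u a = y"
proof -
 have "y : xop b M u ` gsp M u" using bij_betw_imp_surj_on[OF gm_bij[OF M b, of u]] assms(3) by simp
 thus thesis using that by (elim imageE) simp
qed

lemma gm_op_0:
 assumes M: "gmd Z j M"
 shows "hop M s u 0 = 0" "xop b M u 0 = 0" "xpow b M m u 0 = 0"
 using asc2.linear_on_zero[OF gm_op[OF M] gm_subspace[OF M]] asc2.linear_on_zero[OF gm_x[OF M] gm_subspace[OF M]]
  asc2.linear_on_zero[OF xpow_linear[OF M] gm_subspace[OF M]] by auto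

lemma gs_zero: "gmd Z j M ==> gsub j M (%u. {0})"
proof (rule gsubmoduleI)
 fix b u a assume M: "gmd Z j M" and b: "inv_on b j" and a: "a : gsp M u" and x: "xop b M u a : {0}"
 thus "a : {0}" using gm_x_inj[OF M b a gm_0[OF M]] gm_op_0(2)[OF M] by simp
qed (auto simp: gm_0 gm_op_0)

lemma gs_kernel:
 assumes M: "gmd Z j M" and M': "gmd Z j M'" and f: "ghom M M' f"
 shows "gsub j M (%u. {a : gsp M u. f u a = 0})" using gs_preimage[OF M f gs_zero[OF M']] by simp

text \<open>The kernel of the difference is a submodule containing the generator, hence everything.
  For this reason identities between maps out of line bundles are checked on \<open>one\<close>
  only.\<close>

lemma O_hom_unique:
 assumes M: "gmd Z j M" and f: "ghom (Oc Z u j) M f" and g: "ghom (Oc Z u j) M g"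
  and eq: "f (- u) one = g (- u) one" and p: "p : Rp j (u + v)"
 shows "f v p = g v p"
proof -
 have "{q : gsp (Oc Z u j) v. f v q + asc (- 1) (g v q) = 0} = Rp j (u + v)"
  by (rule O_generated[OF gs_kernel[OF gm_O M ghom_lincomb[OF M f g]]]) (use one_in[of Z u j] eq in simp)
 hence "f v p + asc (- 1) (g v p) = 0" using p by blast
 thus ?thesis by simp
qed

lemma ghom_factor:
 assumes A: "gmd Z j A" and M: "gmd Z j' M" and g: "ghom A B g" and h: "ghom M B h"
  and inj: "!!v y. y : gsp A v ==> g v y = 0 ==> y = 0"
  and im: "!!v x. x : gsp M v ==> h v x : g v ` gsp A v"
 shows "EX p. ghom M A p & (ALL v. ALL x:gsp M v. g v (p v x) = h v x)"
proof -
 let ?R = "%v x y. y : gsp A v & g v y = h v x"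
 have "EX p. ghom M A p & (ALL v. ALL x:gsp M v. ?R v x (p v x))"
 proof (rule ghom_of_rel[OF M, where R = ?R and N = A])
  fix v x assume x: "x : gsp M v"
  show "EX y. ?R v x y" using im[OF x] by (elim imageE) (rule exI, rule conjI, assumption, rule sym)
  show "?R v (x + asc c x') (y + asc c y')" if "x' : gsp M v" "?R v x y" "?R v x' y'" for x' y y' c
   using that x by (simp add: gm_add[OF A] gm_asc[OF A] ghom_add[OF g] ghom_add[OF h] ghom_asc[OF g] ghom_asc[OF h] gm_asc[OF M])
  show "?R (v + dg s) (hop M s v x) (hop A s v y)" if "?R v x y" for y s using that x by (simp add: gm_op_in[OF A] ghom_op[OF g] ghom_op[OF h])
 qed (use inj ghom_0[OF M h] in auto)
 thus ?thesis by blast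
qed

lemma gs_image:
 assumes M: "gmd Z j M" and M': "gmd Z j M'" and f: "ghom M M' f" and N: "gsub j M N"
 shows "gsub j M' (%u. f u ` N u)"
proof (rule gsubmoduleI)
 show "asc.subspace (f u ` N u)" for u by (rule asc2.image_on[OF linear_on_subset[OF ghom_lin[OF f] gs_sub[OF N]] gs_subspace[OF N]])
 show "f u ` N u <= gsp M' u" for u using gin[OF f] gs_in[OF N] by blast
next
 fix u y s assume "y : f u ` N u"
 then obtain a where a: "a : N u" "y = f u a" by blast
 show "hop M' s u y : f (u + dg s) ` N (u + dg s)" unfolding a(2) ghom_op[OF f gs_in[OF N a(1)], symmetric] by (rule imageI[OF gs_op[OF N a(1)]])
next
 fix b u y assume b: "inv_on b j" and y: "y : gsp M' u" and "xop b M' u y : f (u + pc) ` N (u + pc)"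
 then obtain n where n: "n : N (u + pc)" "xop b M' u y = f (u + pc) n" by blast
 obtain a where a: "a : gsp M u" "xop b M u a = n" by (rule gm_x_surj[OF M b gs_in[OF N n(1)]])
 have aN: "a : N u" using gs_inv[OF N b a(1)] a(2) n(1) by simp
 have "y = f u a" by (rule gm_x_inj[OF M' b y gin[OF f a(1)]]) (use n a ghom_x[OF f a(1), of b] in simp)
 thus "y : f u ` N u" using aN by blast
qed

lemma generatesD:
 "gnr j M G ==> (u, a) : G ==> a : gsp M u"
 "gnr j M G ==> gsub j M N ==> (!!u a. (u, a) : G ==> a : N u) ==> N u = gsp M u" unfolding generates_def by blast+

lemma generatesI:
 assumes "!!u a. (u, a) : G ==> a : gsp M u"
  "!!N u a. gsub j M N ==> (!!u a. (u, a) : G ==> a : N u) ==> a : gsp M u ==> a : N u"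
 shows "gnr j M G" unfolding generates_def
proof (intro conjI allI impI)
 show "ALL (u, a):G. a : gsp M u" using assms(1) by blast
 fix N u assume N: "gsub j M N & (ALL (u, a):G. a : N u)"
 show "N u = gsp M u"
 proof
  show "N u <= gsp M u" using gs_sub N by blast
  show "gsp M u <= N u"
  proof
   fix a assume "a : gsp M u"
   thus "a : N u" using assms(2)[of N a u] N by blast
  qed
 qed
qed

lemma generates_image:
 assumes M: "gmd Z j M" and f: "ghom M M' f" and surj: "!!u. f u ` gsp M u = gsp M' u"
  and G: "gnr j M G"
 shows "gnr j M' ((%(u, a). (u, f u a)) ` G)"
proof (rule generatesI)
 show "a : gsp M' u" if "(u, a) : (%(u, a). (u, f u a)) ` G" for u a using that generatesD(1)[OF G] gin[OF f] by auto
 fix N u a assume N: "gsub j M' N" and G': "!!u a. (u, a) : (%(u, a). (u, f u a)) ` G ==> a : N u" and a: "a : gsp M' u"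
 have "{a : gsp M u. f u a : N u} = gsp M u"
 proof (rule generatesD(2)[OF G gs_preimage[OF M f N]])
  fix v c assume c: "(v, c) : G"
  hence "(v, f v c) : (%(u, a). (u, f u a)) ` G" by force
  thus "c : {a : gsp M v. f v a : N v}" using G' generatesD(1)[OF G c] by simp
 qed
 moreover obtain x where "x : gsp M u" "a = f u x" using a unfolding surj[of u, symmetric] by (elim imageE)
 ultimately show "a : N u" by auto
qed

lemma generates_O: "gnr j (Oc Z u j) {(- u, one)}"
proof (rule generatesI)
 show "a : gsp (Oc Z u j) v" if "(v, a) : {(- u, one)}" for v a using that one_in by auto
 show "a : N v" if "gsub j (Oc Z u j) N" "!!v a. (v, a) : {(- u, one)} ==> a : N v"
  "a : gsp (Oc Z u j) v" for N v a using O_generated[OF that(1) that(2)[of "- u" one], of v] that(3) by simp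
qed

lemma gsp_update_ops [simp]: "hop (M(|gsp := N|)) s = hop M s" "xop b (M(|gsp := N|)) = xop b M" by (auto simp: hop_def xop_def split: sum.splits)

lemma gmodule_sub:
 assumes M: "gmd Z j M" and N: "gsub j M N"
 shows "gmd Z j (M(|gsp := N|))"
proof (rule gmoduleI, simp_all)
 show "asc.subspace (N u)" for u by (rule gs_subspace[OF N])
 show "lbet (N u) (N (u + dg s)) (hop M s u)" for s u using gm_op_between[OF M, of u s] gs_sub[OF N, of u] gs_op[OF N] unfolding linear_between_def by blast
 show "a : N u ==> hop M s (u + dg s') (hop M s' u a) = hop M s' (u + dg s) (hop M s u a)" for a u s s' by (rule gm_op_op[OF M gs_in[OF N]])
 show "a : N u ==> opt M i (u + px i) (opt M i u a) = lmul (M(|gsp := N|)) (vform (Z i)) u a" for a u i using gm_t_sq[OF M gs_in[OF N]] by (simp add: lmul_def)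
 show "bij_betw (xop b M u) (N u) (N (u + pc))" if b: "inv_on b j" for b u unfolding bij_betw_def
 proof
  show "inj_on (xop b M u) (N u)" using bij_betw_imp_inj_on[OF gm_bij[OF M b]] gs_sub[OF N] inj_on_subset by blast
  show "xop b M u ` N u = N (u + pc)"
  proof (intro equalityI subsetI)
   fix y assume y: "y : N (u + pc)"
   obtain a where a: "a : gsp M u" "xop b M u a = y" by (rule gm_x_surj[OF M b gs_in[OF N y]])
   thus "y : xop b M u ` N u" using gs_inv[OF N b a(1)] y by blast
  qed (use gs_x[OF N] in blast)
 qed
qed

lemma ghom_sub: "gsub j M N ==> ghom (M(|gsp := N|)) M (%u a. a)" by (rule ghomI) (auto simp: linear_between_def dest: gs_in)

text \<open>Every module has to live in the fixed ambient space, so a quotient is modelled by the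
  image of a projection with kernel \<open>N u\<close>, chosen separately in each degree.\<close>

definition qproj :: "('n::finite, 'k::field) gmod => ('n pic => 'k amb set) => ('n,'k) mp" where
 "qproj M N u = (SOME f. lin_on asc asc (gsp M u) f & f ` gsp M u <= gsp M u & asc.subspace (f ` gsp M u) &
   (ALL a:gsp M u. (f a = 0 <-> a : N u) & a - f a : N u))"

lemma
 assumes M: "gmd Z j M" and N: "gsub j M N"
 shows qproj_lin: "lin_on asc asc (gsp M u) (qproj M N u)"
  and qproj_in: "a : gsp M u ==> qproj M N u a : gsp M u"
  and qproj_subspace: "asc.subspace (qproj M N u ` gsp M u)"
  and qproj_0: "a : gsp M u ==> qproj M N u a = 0 <-> a : N u"
  and qproj_diff: "a : gsp M u ==> a - qproj M N u a : N u"
proof -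
 obtain f where f: "lin_on asc asc (gsp M u) f" "f ` gsp M u <= gsp M u" "asc.subspace (f ` gsp M u)"
  "!!a. a : gsp M u ==> f a = 0 <-> a : N u" "!!a. a : gsp M u ==> f (f a) = f a" "!!a. a : gsp M u ==> a - f a : N u"
  using asc.complement_projection[OF gm_subspace[OF M] gs_subspace[OF N] gs_sub[OF N]] by blast
 let ?P = "%f. lin_on asc asc (gsp M u) f & f ` gsp M u <= gsp M u & asc.subspace (f ` gsp M u) &
   (ALL a:gsp M u. (f a = 0 <-> a : N u) & a - f a : N u)"
 have "?P f" using f by simp
 hence P: "?P (qproj M N u)" unfolding qproj_def by (rule someI[where P = ?P])
 show "lin_on asc asc (gsp M u) (qproj M N u)" using P by (elim conjE)
 show "asc.subspace (qproj M N u ` gsp M u)" using P by (elim conjE)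
 show "a : gsp M u ==> qproj M N u a : gsp M u" using P by blast
 show "a : gsp M u ==> qproj M N u a = 0 <-> a : N u" using P by blast
 show "a : gsp M u ==> a - qproj M N u a : N u" using P by blast
qed

definition quot_gm :: "('n::finite, 'k::field) gmod => ('n pic => 'k amb set) => ('n, 'k) gmod" where
 "quot_gm M N = (| gsp = (%u. qproj M N u ` gsp M u),
   opt = (%i u a. qproj M N (u + px i) (opt M i u a)),
   opx0 = (%u a. qproj M N (u + pc) (opx0 M u a)),
   opx1 = (%u a. qproj M N (u + pc) (opx1 M u a)) |)"

lemma quot_gm_simps [simp]:
 "gsp (quot_gm M N) u = qproj M N u ` gsp M u"
 "opt (quot_gm M N) i u a = qproj M N (u + px i) (opt M i u a)"
 "xop b (quot_gm M N) u a = qproj M N (u + pc) (xop b M u a)"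
 "hop (quot_gm M N) s u a = qproj M N (u + dg s) (hop M s u a)" by (simp_all add: quot_gm_def xop_def hop_def dg_def split: sum.splits)

lemma qproj_eq:
 assumes M: "gmd Z j M" and N: "gsub j M N" and "a : gsp M u" "b : gsp M u"
 shows "qproj M N u a = qproj M N u b <-> a - b : N u"
 using asc2.linear_on_diff[OF qproj_lin[OF M N] gm_subspace[OF M] assms(3,4)] qproj_0[OF M N gm_diff[OF M assms(3,4)]] by simp

text \<open>A map that sends \<open>N\<close> to \<open>N'\<close> descends to the quotients:
  passing to the chosen representative changes the result only inside \<open>N'\<close>. Operators
  and restriction maps of quotients are treated this way.\<close>

lemma qproj_compat:
 assumes M: "gmd Z j M" and N: "gsub j M N" and a: "a : gsp M u"
  and h: "lin_on asc asc (gsp M u) h" "!!a. a : gsp M u ==> h a : gsp M' v" "!!a. a : N u ==> h a : N' v"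
  and M': "gmd Z j' M'" and N': "gsub j' M' N'"
 shows "qproj M' N' v (h (qproj M N u a)) = qproj M' N' v (h a)"
proof -
 have "h (a - qproj M N u a) : N' v" by (rule h(3)[OF qproj_diff[OF M N a]])
 moreover have "h (a - qproj M N u a) = h a - h (qproj M N u a)" by (rule asc2.linear_on_diff[OF h(1) gm_subspace[OF M] a qproj_in[OF M N a]])
 ultimately show ?thesis using qproj_eq[OF M' N' h(2)[OF a] h(2)[OF qproj_in[OF M N a]]] by simp
qed

lemma
 assumes M: "gmd Z j M" and N: "gsub j M N"
 shows ghom_qproj: "ghom M (quot_gm M N) (qproj M N)"
  and gmodule_quot: "gmd Z j (quot_gm M N)"
proof -
 let ?q = "qproj M N" and ?Q = "quot_gm M N"
 note lin = qproj_lin[OF M N] and inM = qproj_in[OF M N] and in_op = gm_op_in[OF M] and in_x = gm_x_in[OF M]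
 have q: "?q (u + dg s) (hop M s u (?q u a)) = ?q (u + dg s) (hop M s u a)" if "a : gsp M u" for u s a
  by (rule qproj_compat[OF M N that gm_op[OF M] in_op gs_op[OF N] M N])
 note qx = q[of _ _ "Inr _", unfolded hop_simps] and qt = q[of _ _ "Inl _", unfolded hop_simps]
 show h: "ghom M ?Q ?q" by (rule ghomI) (auto simp: linear_between_on lin q)
 show "gmd Z j ?Q"
 proof (rule gmoduleI)
  show sub: "asc.subspace (gsp ?Q u)" for u using qproj_subspace[OF M N] by simp
  show "lbet (gsp ?Q u) (gsp ?Q (u + dg s)) (hop ?Q s u)" for u s
  proof (rule linear_betweenI[OF sub])
   show "hop ?Q s u y : gsp ?Q (u + dg s)" if "y : gsp ?Q u" for y using that by (auto simp: inM in_op)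
   show "hop ?Q s u (y + asc c z) = hop ?Q s u y + asc c (hop ?Q s u z)" if "y : gsp ?Q u" "z : gsp ?Q u" for y z c
    using that by (auto simp: lin_add[OF gm_op[OF M]] lin_scale[OF gm_op[OF M]] lin_add[OF lin] lin_scale[OF lin] gm_asc[OF M] in_op inM)
  qed
 next
  fix u y assume "y : gsp ?Q u"
  then obtain a where a: "a : gsp M u" "y = ?q u a" by auto
  have e: "u + dg s + dg s' = u + dg s' + dg s" for s s' :: "'a + bool" by (simp add: ac_simps)
  show "hop ?Q s (u + dg s') (hop ?Q s' u y) = hop ?Q s' (u + dg s) (hop ?Q s u y)" for s s'
   unfolding a(2) quot_gm_simps q[OF a(1)] q[OF in_op[OF a(1)]] unfolding gm_op_op[OF M a(1), of s s'] e[of s s'] ..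
  have "opt ?Q i (u + px i) (opt ?Q i u y) = ?q (u + px i + px i) (lmul M (vform (Z i)) u a)" for i
   unfolding a(2) quot_gm_simps using qt[OF a(1)] qt[OF gm_t_in[OF M a(1)]] gm_t_sq[OF M a(1), of i] by simp
  also have "u + px i + px i = u + pc" for i by (simp add: pc_eq[of i] add.assoc)
  also have "?q (u + pc) (lmul M (vform (Z i)) u a) = lmul ?Q (vform (Z i)) u y" for i
   unfolding lmul_xop a(2) quot_gm_simps using in_x[OF a(1)] qx[OF a(1)] by (simp add: lin_add[OF lin] lin_scale[OF lin] gm_asc[OF M])
  finally show "opt ?Q i (u + px i) (opt ?Q i u y) = lmul ?Q (vform (Z i)) u y" for i .
 next
  fix b u assume b: "inv_on b j"
  show "bij_betw (xop b ?Q u) (gsp ?Q u) (gsp ?Q (u + pc))" unfolding bij_betw_def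
  proof
   show "inj_on (xop b ?Q u) (gsp ?Q u)"
   proof (rule inj_onI)
    fix y z assume "y : gsp ?Q u" "z : gsp ?Q u" and eq: "xop b ?Q u y = xop b ?Q u z"
    then obtain a c where a: "a : gsp M u" "y = ?q u a" and c: "c : gsp M u" "z = ?q u c" by auto
    have "xop b M u a - xop b M u c : N (u + pc)" using eq unfolding a(2) c(2) quot_gm_simps qx[OF a(1)] qx[OF c(1)] qproj_eq[OF M N in_x[OF a(1)] in_x[OF c(1)]] .
    hence "xop b M u (a - c) : N (u + pc)" using asc2.linear_on_diff[OF gm_x[OF M] gm_subspace[OF M] a(1) c(1)] by simp
    hence "a - c : N u" by (rule gs_inv[OF N b gm_diff[OF M a(1) c(1)]])
    thus "y = z" unfolding a(2) c(2) qproj_eq[OF M N a(1) c(1)] .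
   qed
   have "?q (u + pc) ` xop b M u ` gsp M u = xop b ?Q u ` ?q u ` gsp M u" unfolding image_image by (rule image_cong[OF refl]) (simp add: qx)
   thus "xop b ?Q u ` gsp ?Q u = gsp ?Q (u + pc)" unfolding bij_betw_imp_surj_on[OF gm_bij[OF M b]] by simp
  qed
 qed
qed

subsection \<open>Coherent sheaves\<close>

lemma lmuls_replicate:
 "lmuls M (replicate m (if b then (0, 1) else (1, 0))) (u, a) = (u + kn m, xpow b M m u a)"
proof (induction m arbitrary: u a)
 case (Suc m)
 have "lmul M (if b then (0, 1) else (1, 0)) u a = xop b M u a" by (simp add: lmul_xop)
 hence "lmuls M (replicate (Suc m) (if b then (0, 1) else (1, 0))) (u, a) = lmuls M (replicate m (if b then (0, 1) else (1, 0))) (u + pc, xop b M u a)" by simp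
 also have "... = (u + pc + kn m, xpow b M m (u + pc) (xop b M u a))" by (rule Suc)
 finally show ?case by (simp only: xpow_Suc_left kc_Suc ac_simps)
qed simp

lemma localizes_iff:
 "localizes (if b then (0, 1) else (1, 0)) M M' f <-> ghom M M' f &
   (ALL u. ALL a:gsp M u. f u a = 0 --> (EX m. xpow b M m u a = 0)) &
   (ALL u. ALL c:gsp M' u. EX m. EX a:gsp M (u + kn m). f (u + kn m) a = xpow b M' m u c)"
proof -
 have "(EX m v a. a : gsp M v & (v, f v a) = (u + kn m, X m)) <->
   (EX m. EX a:gsp M (u + kn m). f (u + kn m) a = X m)" for u X by blast
 thus ?thesis unfolding localizes_def lmuls_replicate by simp
qed

text \<open>The coordinate inverted in passing from \<open>j\<close> to \<open>U01\<close> is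
  \<open>X1\<close> for \<open>U0\<close> and \<open>X0\<close> for \<open>U1\<close>. In the sequel
  the Boolean \<open>j = U0\<close> names the coordinate to be inverted, and \<open>j ~= U0\<close>
  the one already invertible on \<open>j\<close>.\<close>

lemma coherent_iff:
 "cohr Z F <-> (ALL j. gmd Z j (ch F j)) & (ALL j. EX G. finite G & gnr j (ch F j) G) &
   (ALL j. j ~= U01 --> localizes (if j = U0 then (0, 1) else (1, 0)) (ch F j) (ch F U01) (res F j))"
proof -
 have *: "(ALL j. j ~= U01 --> P j) <-> P U0 & P U1" for P by (metis chart.exhaust chart.distinct)
 show ?thesis unfolding coherent_def * by auto
qed

lemma
 assumes "cohr Z F"
 shows cgm: "gmd Z j (ch F j)"
  and coh_fg: "EX G. finite G & gnr j (ch F j) G"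
  and coh_res: "j ~= U01 ==> ghom (ch F j) (ch F U01) (res F j)"
  and coh_ker: "j ~= U01 ==> a : sx F j u ==> res F j u a = 0 ==> EX m. xpow (j = U0) (ch F j) m u a = 0"
  and coh_ext: "j ~= U01 ==> c : sx F U01 u ==>
   EX m. EX a:sx F j (u + kn m). res F j (u + kn m) a = xpow (j = U0) (ch F U01) m u c" using assms unfolding coherent_iff localizes_iff by blast+

lemma coherentI:
 assumes "!!j. gmd Z j (ch F j)" "!!j. EX G. finite G & gnr j (ch F j) G"
  "!!j. j ~= U01 ==> ghom (ch F j) (ch F U01) (res F j)"
  "!!j a u. j ~= U01 ==> a : sx F j u ==> res F j u a = 0 ==> EX m. xpow (j = U0) (ch F j) m u a = 0"
  "!!j c u. j ~= U01 ==> c : sx F U01 u ==>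
   EX m. EX a:sx F j (u + kn m). res F j (u + kn m) a = xpow (j = U0) (ch F U01) m u c"
 shows "cohr Z F" unfolding coherent_iff localizes_iff using assms by blast

lemma inv_on_U01 [simp]: "inv_on b U01" by (cases b) (auto simp: inv_on_def)
lemma inv_on_other: "j ~= U01 ==> inv_on (j ~= U0) j" by (cases j) (auto simp: inv_on_def)

text \<open>The last clause says that \<open>N U01\<close> is the localization of
  \<open>N j\<close>; the other half of the localization property, on elements with zero
  restriction, is inherited from \<open>F\<close>.\<close>

definition subsheaf :: "('n::finite, 'k::field) sheaf => (chart => 'n pic => 'k amb set) => bool" where
 "subsheaf F N <-> (ALL j. gsub j (ch F j) (N j)) &
   (ALL j. j ~= U01 --> (ALL u. ALL a:N j u. res F j u a : N U01 u)) &
   (ALL j. j ~= U01 --> (ALL u. ALL c:N U01 u. EX m. EX a:N j (u + kn m).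
    res F j (u + kn m) a = xpow (j = U0) (ch F U01) m u c))"

lemma
 assumes "subsheaf F N"
 shows ss_gs: "gsub j (ch F j) (N j)"
  and ss_res: "j ~= U01 ==> a : N j u ==> res F j u a : N U01 u"
  and ss_ext: "j ~= U01 ==> c : N U01 u ==> EX m. EX a:N j (u + kn m).
    res F j (u + kn m) a = xpow (j = U0) (ch F U01) m u c" using assms unfolding subsheaf_def by blast+

definition sub_sheaf :: "('n::finite, 'k::field) sheaf => (chart => 'n pic => 'k amb set) => ('n, 'k) sheaf" where
 "sub_sheaf F N = (| ch = (%j. (ch F j)(|gsp := N j|)), res = res F |)"

definition qsh :: "('n::finite, 'k::field) sheaf => (chart => 'n pic => 'k amb set) => ('n, 'k) sheaf" where
 "qsh F N = (| ch = (%j. quot_gm (ch F j) (N j)), res = (%j u a. qproj (ch F U01) (N U01) u (res F j u a)) |)"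

lemma xpow_sub [simp]: "xpow b (M(|gsp := N|)) m u a = xpow b M m u a" by (induction m) simp_all

text \<open>Finite generation of the submodules is a hypothesis. It is supplied by presenting them
  as images of coherent sheaves, or as direct summands on every chart.\<close>

lemma coherent_sub:
 assumes F: "cohr Z F" and N: "subsheaf F N"
  and fg: "!!j. EX G. finite G & gnr j ((ch F j)(|gsp := N j|)) G"
 shows "cohr Z (sub_sheaf F N)"
proof (rule coherentI, simp_all add: sub_sheaf_def fg gmodule_sub[OF cgm[OF F] ss_gs[OF N]] ss_ext[OF N] coh_ker[OF F _ gs_in[OF ss_gs[OF N]]])
 show "ghom ((ch F j)(|gsp := N j|)) ((ch F U01)(|gsp := N U01|)) (res F j)" if j: "j ~= U01" for j
  by (rule ghomI) (use linear_on_subset[OF ghom_lin[OF coh_res[OF F j]] gs_sub[OF ss_gs[OF N]]] ss_res[OF N j]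
   ghom_op[OF coh_res[OF F j] gs_in[OF ss_gs[OF N]]] in "auto simp: linear_between_on")
qed

lemma coherent_quot:
 assumes F: "cohr Z F" and N: "subsheaf F N"
 shows "cohr Z (qsh F N)"
proof (rule coherentI)
 note gm = cgm[OF F] and gs = ss_gs[OF N] and gh = ghom_qproj[OF cgm[OF F] ss_gs[OF N]]
 let ?Q = "%j. quot_gm (ch F j) (N j)" and ?q = "%j. qproj (ch F j) (N j)"
 have ch: "ch (qsh F N) j = ?Q j" "res (qsh F N) j u a = ?q U01 u (res F j u a)" for j u a by (simp_all add: qsh_def)
 show "gmd Z j (ch (qsh F N) j)" for j unfolding ch by (rule gmodule_quot[OF gm gs])
 show "EX G. finite G & gnr j (ch (qsh F N) j) G" for j
 proof -
  obtain G where G: "finite G" "gnr j (ch F j) G" using coh_fg[OF F] by blast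
  show ?thesis unfolding ch using generates_image[OF gm gh _ G(2)] G(1) by auto
 qed
 fix j :: chart assume j: "j ~= U01"
 note r = coh_res[OF F j]
 have q: "?q U01 u (res F j u (?q j u a)) = ?q U01 u (res F j u a)" if "a : sx F j u" for u a
  by (rule qproj_compat[OF gm gs that ghom_lin[OF r] gin[OF r] ss_res[OF N j] gm gs])
 have sub: "gsp (?Q j) u <= sx F j u" for u using qproj_in[OF gm gs] by auto
 show "ghom (ch (qsh F N) j) (ch (qsh F N) U01) (res (qsh F N) j)"
 proof (rule ghomI)
  note g = ghom_comp[OF r gh]
  show "lbet (gsp (ch (qsh F N) j) u) (gsp (ch (qsh F N) U01) u) (res (qsh F N) j u)" for u
   using linear_on_subset[OF ghom_lin[OF g] sub] gin[OF g] sub q unfolding linear_between_on by (auto simp: qsh_def)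
  fix u a s assume "a : gsp (ch (qsh F N) j) u"
  hence a: "a : sx F j u" using sub unfolding ch by blast
  show "res (qsh F N) j (u + dg s) (hop (ch (qsh F N) j) s u a) = hop (ch (qsh F N) U01) s u (res (qsh F N) j u a)"
   using q[OF gm_op_in[OF gm a]] ghom_op[OF g a] by (simp add: ch)
 qed
 show "EX m. xpow (j = U0) (ch (qsh F N) j) m u y = 0"
  if y: "y : gsp (ch (qsh F N) j) u" and 0: "res (qsh F N) j u y = 0" for y u
 proof -
  obtain a where a: "a : sx F j u" "y = ?q j u a" using y by (auto simp: ch)
  have "?q U01 u (res F j u a) = 0" using 0 q[OF a(1)] by (simp add: ch a(2))
  hence "res F j u a : N U01 u" using qproj_0[OF gm gs gin[OF r a(1)]] by simp
  \<comment> \<open>After multiplication by a power of the coordinate, a section that restricts into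
    \<open>N U01\<close> agrees with a section of \<open>N j\<close> up to torsion; a further power
    kills the torsion.\<close>
  then obtain m n where n: "n : N j (u + kn m)" "res F j (u + kn m) n = xpow (j = U0) (ch F U01) m u (res F j u a)" using ss_ext[OF N j] by blast
  let ?x = "xpow (j = U0) (ch F j) m u a"
  have x: "?x : sx F j (u + kn m)" "n : sx F j (u + kn m)" using xpow_in[OF gm a(1)] gs_in[OF gs n(1)] by auto
  have "res F j (u + kn m) (?x - n) = 0" using ghom_diff[OF gm r x] ghom_xpow[OF gm r a(1)] n(2) by simp
  then obtain k where k: "xpow (j = U0) (ch F j) k (u + kn m) (?x - n) = 0" using coh_ker[OF F j gm_diff[OF gm x]] by blast
  have "xpow (j = U0) (ch F j) (k + m) u a = xpow (j = U0) (ch F j) k (u + kn m) n"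
   using k asc2.linear_on_diff[OF xpow_linear[OF gm] gm_subspace[OF gm] x] by (simp add: xpow_add)
  hence "xpow (j = U0) (ch F j) (k + m) u a : N j (u + kc (int (k + m)))" using gs_xpow[OF gs n(1), of "j = U0" k] by (simp add: kc_add ac_simps)
  hence "?q j (u + kc (int (k + m))) (xpow (j = U0) (ch F j) (k + m) u a) = 0" using qproj_0[OF gm gs xpow_in[OF gm a(1)]] by blast
  hence "xpow (j = U0) (?Q j) (k + m) u y = 0" using ghom_xpow[where b = "j = U0" and m = "k + m", OF gm gh a(1)] unfolding a(2) by simp
  thus ?thesis unfolding ch by blast
 qed
 show "EX m. EX a:gsp (ch (qsh F N) j) (u + kn m).
    res (qsh F N) j (u + kn m) a = xpow (j = U0) (ch (qsh F N) U01) m u y"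
  if y: "y : gsp (ch (qsh F N) U01) u" for y u
 proof -
  obtain c where c: "c : sx F U01 u" "y = ?q U01 u c" using y by (auto simp: ch)
  obtain m a where a: "a : sx F j (u + kn m)" "res F j (u + kn m) a = xpow (j = U0) (ch F U01) m u c" using coh_ext[OF F j c(1)] by blast
  have "?q U01 (u + kn m) (res F j (u + kn m) (?q j (u + kn m) a)) = xpow (j = U0) (?Q U01) m u y"
   using q[OF a(1)] a(2) ghom_xpow[where b = "j = U0" and m = m, OF gm gh c(1)] by (simp add: c(2))
  thus ?thesis unfolding ch using a(1) by (intro exI bexI[of _ "?q j (u + kn m) a"]) auto
 qed
qed

lemma
 assumes "f : Hom E F"
 shows Hom_g: "ghom (ch E j) (ch F j) (f j)"
  and Hom_outside: "a ~: sx E j u ==> f j u a = 0"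
  and Hom_res: "j ~= U01 ==> a : sx E j u ==> f U01 u (res E j u a) = res F j u (f j u a)"
proof -
 have f: "!!j. f j : gHom (ch E j) (ch F j)"
  and r: "!!j u a. j : {U0, U1} ==> a : sx E j u ==> f U01 u (res E j u a) = res F j u (f j u a)" using assms unfolding Hom_def by blast+
 show "ghom (ch E j) (ch F j) (f j)" "a ~: sx E j u ==> f j u a = 0" using f[of j] unfolding gHom_def by blast+
 show "j ~= U01 ==> a : sx E j u ==> f U01 u (res E j u a) = res F j u (f j u a)" using r by (cases j) auto
qed

lemma HomI:
 assumes "!!j. ghom (ch E j) (ch F j) (f j)" "!!j u a. a ~: sx E j u ==> f j u a = 0"
  "!!j u a. j ~= U01 ==> a : sx E j u ==> f U01 u (res E j u a) = res F j u (f j u a)"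
 shows "f : Hom E F" unfolding Hom_def gHom_def using assms by blast

definition cut :: "('n::finite, 'k::field) sheaf => (chart => ('n,'k) mp) => ('n, 'k) shmap" where
 "cut E f j u a = (if a : sx E j u then f j u a else 0)"

lemma ghom_cong:
 assumes M: "gmd Z j M" and f: "ghom M N f" and eq: "!!u a. a : gsp M u ==> g u a = f u a"
 shows "ghom M N g"
proof (rule ghomI)
 show "lbet (gsp M u) (gsp N u) (g u)" for u using ghom_between[OF f, of u] eq gm_add[OF M] gm_asc[OF M] unfolding linear_between_def by simp
 show "g (u + dg s) (hop M s u a) = hop N s u (g u a)" if a: "a : gsp M u" for u a s using ghom_op[OF f a] eq[OF a] eq[OF gm_op_in[OF M a]] by simp
qed

lemma cut_Hom:
 assumes E: "cohr Z E" and f: "!!j. ghom (ch E j) (ch F j) (f j)"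
  and r: "!!j u a. j ~= U01 ==> a : sx E j u ==> f U01 u (res E j u a) = res F j u (f j u a)"
 shows "cut E f : Hom E F"
proof (rule HomI)
 show "ghom (ch E j) (ch F j) (cut E f j)" for j by (rule ghom_cong[OF cgm[OF E] f]) (simp add: cut_def)
 show "cut E f U01 u (res E j u a) = res F j u (cut E f j u a)" if "j ~= U01" "a : sx E j u" for j u a
  using r[OF that] that gin[OF coh_res[OF E that(1)] that(2)] by (simp add: cut_def)
qed (simp add: cut_def)

lemma short_exactI:
 assumes "cohr Z E" "cohr Z F" "cohr Z G" "f : Hom E F" "g : Hom F G"
  and inj: "!!j u a. a : sx E j u ==> f j u a = 0 ==> a = 0"
  and ex: "!!j u. f j u ` sx E j u = {b\<in>sx F j u. g j u b = 0}"
  and surj: "!!j u. g j u ` sx F j u = sx G j u"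
 shows "sexact Z E f F g G"
proof -
 have "inj_on (f j u) (sx E j u)" for j u
 proof (rule inj_onI)
  fix a b assume ab: "a : sx E j u" "b : sx E j u" "f j u a = f j u b"
  have "f j u (a - b) = 0" using ghom_diff[OF cgm[OF assms(1)] Hom_g[OF assms(4)] ab(1,2)] ab(3) by simp
  thus "a = b" using inj[OF gm_diff[OF cgm[OF assms(1)] ab(1,2)]] by simp
 qed
 thus ?thesis unfolding short_exact_def by (intro conjI allI assms)
qed

lemma
 assumes "sexact Z E f F g G"
 shows ses_coh: "cohr Z E" "cohr Z F" "cohr Z G"
  and ses_Hom: "f : Hom E F" "g : Hom F G"
  and ses_inj: "a : sx E j u ==> f j u a = 0 ==> a = 0"
  and ses_ex: "f j u ` sx E j u = {b\<in>sx F j u. g j u b = 0}"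
  and ses_surj: "g j u ` sx F j u = sx G j u"
proof -
 show coh: "cohr Z E" "cohr Z F" "cohr Z G" and h: "f : Hom E F" "g : Hom F G" using assms unfolding short_exact_def by blast+
 have "ALL j u. inj_on (f j u) (sx E j u) &
    f j u ` sx E j u = {b\<in>sx F j u. g j u b = 0} &
    g j u ` sx F j u = sx G j u" using assms unfolding short_exact_def by (elim conjE)
 note all = this[rule_format, of j u]
 show "f j u ` sx E j u = {b\<in>sx F j u. g j u b = 0}" by (rule all[THEN conjunct2, THEN conjunct1])
 show "g j u ` sx F j u = sx G j u" by (rule all[THEN conjunct2, THEN conjunct2])
 note inj = all[THEN conjunct1]
 show "a = 0" if "a : sx E j u" "f j u a = 0" using inj_onD[OF inj _ that(1) gm_0[OF cgm[OF coh(1)]]] that(2) ghom_0[OF cgm[OF coh(1)] Hom_g[OF h(1)]] by simp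
qed

lemma subsheaf_image:
 assumes E: "cohr Z E" and F: "cohr Z F" and f: "f : Hom E F"
 shows "subsheaf F (%j u. f j u ` sx E j u)" unfolding subsheaf_def
proof (intro conjI allI impI ballI)
 show "gsub j (ch F j) (%u. f j u ` sx E j u)" for j by (rule gs_image[OF cgm[OF E] cgm[OF F] Hom_g[OF f] gs_full[OF cgm[OF E]]])
 show "res F j u b : f U01 u ` sx E U01 u" if j: "j ~= U01" and b: "b : f j u ` sx E j u" for j u b
 proof -
  obtain a where a: "a : sx E j u" "b = f j u a" using b by blast
  have "res F j u b = f U01 u (res E j u a)" using Hom_res[OF f j a(1)] a(2) by simp
  thus ?thesis using gin[OF coh_res[OF E j] a(1)] by blast
 qed
 show "EX m. EX b:f j (u + kn m) ` sx E j (u + kn m). res F j (u + kn m) b = xpow (j = U0) (ch F U01) m u c"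
  if j: "j ~= U01" and c: "c : f U01 u ` sx E U01 u" for j u c
 proof -
  obtain a where a: "a : sx E U01 u" "c = f U01 u a" using c by blast
  obtain m b where b: "b : sx E j (u + kn m)" "res E j (u + kn m) b = xpow (j = U0) (ch E U01) m u a" using coh_ext[OF E j a(1)] by blast
  have "res F j (u + kn m) (f j (u + kn m) b) = xpow (j = U0) (ch F U01) m u c" using Hom_res[OF f j b(1)] b(2) ghom_xpow[OF cgm[OF E] Hom_g[OF f] a(1)] a(2) by simp
  thus ?thesis using b(1) by blast
 qed
qed

lemma subsheaf_kernel:
 assumes E: "cohr Z E" and F: "cohr Z F" and f: "f : Hom E F"
 shows "subsheaf E (%j u. {a : sx E j u. f j u a = 0})" unfolding subsheaf_def
proof (intro conjI allI impI ballI)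
 show "gsub j (ch E j) (%u. {a : sx E j u. f j u a = 0})" for j by (rule gs_kernel[OF cgm[OF E] cgm[OF F] Hom_g[OF f]])
 show "res E j u a : {a : sx E U01 u. f U01 u a = 0}" if j: "j ~= U01" and a: "a : {a : sx E j u. f j u a = 0}" for j u a
  using Hom_res[OF f j, of a u] a gin[OF coh_res[OF E j]] ghom_0[OF cgm[OF F] coh_res[OF F j]] by simp
 show "EX m. EX b:{a : sx E j (u + kn m). f j (u + kn m) a = 0}. res E j (u + kn m) b = xpow (j = U0) (ch E U01) m u c"
  if j: "j ~= U01" and c: "c : {a : sx E U01 u. f U01 u a = 0}" for j u c
 proof -
  let ?b = "j = U0"
  note gE = cgm[OF E] and gF = cgm[OF F] and rE = coh_res[OF E j] and hf = Hom_g[OF f]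
  have c': "c : sx E U01 u" "f U01 u c = 0" using c by auto
  obtain m a where a: "a : sx E j (u + kn m)" "res E j (u + kn m) a = xpow ?b (ch E U01) m u c" using coh_ext[OF E j c'(1)] by blast
  let ?v = "u + kn m"
  have "res F j ?v (f j ?v a) = 0" using Hom_res[OF f j a(1)] a(2) ghom_xpow[OF gE hf c'(1)] c'(2) gm_op_0(3)[OF gF] by simp
  \<comment> \<open>The lift \<open>a\<close> is mapped to a section that vanishes on
    \<open>U01\<close>, so a power of the coordinate moves \<open>a\<close> into the kernel.\<close>
  then obtain k where k: "xpow ?b (ch F j) k ?v (f j ?v a) = 0" using coh_ker[OF F j gin[OF hf a(1)]] by blast
  have v: "?v + kn k = u + kc (int (k + m))" by (simp add: kc_add ac_simps)
  have "f j (?v + kn k) (xpow ?b (ch E j) k ?v a) = 0" using ghom_xpow[OF gE hf a(1)] k by simp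
  hence 1: "xpow ?b (ch E j) k ?v a : {a : sx E j (u + kc (int (k + m))). f j (u + kc (int (k + m))) a = 0}"
   using xpow_in[where b = ?b and m = k, OF gE a(1)] unfolding v by blast
  have "res E j (?v + kn k) (xpow ?b (ch E j) k ?v a) = xpow ?b (ch E U01) (k + m) u c" using ghom_xpow[OF gE rE a(1)] a(2) by (simp add: xpow_add)
  thus ?thesis using 1 unfolding v by blast
 qed
qed

lemma quot_sheaf_simps:
 "ch (qsh F N) j = quot_gm (ch F j) (N j)"
 "res (qsh F N) j u a = qproj (ch F U01) (N U01) u (res F j u a)" by (simp_all add: qsh_def)

lemma sub_simps:
 "ch (sub_sheaf F N) j = (ch F j)(|gsp := N j|)" "res (sub_sheaf F N) j u a = res F j u a" by (simp_all add: sub_sheaf_def)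

lemma quot_Hom:
 assumes F: "cohr Z F" and N: "subsheaf F N"
 shows "cut F (%j. qproj (ch F j) (N j)) : Hom F (qsh F N)"
proof (rule cut_Hom[OF F])
 note gm = cgm[OF F] and gs = ss_gs[OF N]
 show "ghom (ch F j) (ch (qsh F N) j) (qproj (ch F j) (N j))" for j unfolding quot_sheaf_simps by (rule ghom_qproj[OF gm gs])
 show "qproj (ch F U01) (N U01) u (res F j u a) = res (qsh F N) j u (qproj (ch F j) (N j) u a)"
  if "j ~= U01" "a : sx F j u" for j u a unfolding quot_sheaf_simps
  by (rule qproj_compat[OF gm gs that(2) ghom_lin[OF coh_res[OF F that(1)]] gin[OF coh_res[OF F that(1)]] ss_res[OF N that(1)] gm gs, symmetric])
qed

lemma ses_quot:
 assumes E: "cohr Z E" and F: "cohr Z F" and f: "f : Hom E F"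
  and inj: "!!j u a. a : sx E j u ==> f j u a = 0 ==> a = 0"
  and N: "subsheaf F N" and im: "!!j u. f j u ` sx E j u = N j u"
 shows "sexact Z E f F (cut F (%j. qproj (ch F j) (N j))) (qsh F N)"
proof (rule short_exactI[OF E F coherent_quot[OF F N] f quot_Hom[OF F N] inj])
 note gm = cgm[OF F] and gs = ss_gs[OF N]
 show "f j u ` sx E j u = {b : sx F j u. cut F (%j. qproj (ch F j) (N j)) j u b = 0}" for j u unfolding im by (auto simp: cut_def qproj_0[OF gm gs] dest: gs_in[OF gs])
 show "cut F (%j. qproj (ch F j) (N j)) j u ` sx F j u = gsp (ch (qsh F N) j) u" for j u by (auto simp: cut_def quot_sheaf_simps)
qed

lemma ses_sub:
 assumes F: "cohr Z F" and N: "subsheaf F N"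
  and fg: "!!j. EX G. finite G & gnr j ((ch F j)(|gsp := N j|)) G"
 shows "sexact Z (sub_sheaf F N) (cut (sub_sheaf F N) (%j u a. a)) F (cut F (%j. qproj (ch F j) (N j))) (qsh F N)"
proof (rule ses_quot[OF coherent_sub[OF F N fg] F _ _ N])
 show "cut (sub_sheaf F N) (%j u a. a) : Hom (sub_sheaf F N) F" by (rule cut_Hom[OF coherent_sub[OF F N fg]]) (simp_all add: sub_simps ghom_sub[OF ss_gs[OF N]])
qed (auto simp: cut_def sub_simps)

lemma generates_sub_image:
 assumes M: "gmd Z j M" and M': "gmd Z j M'" and f: "ghom M M' f" and G: "gnr j M G"
 shows "gnr j (M'(|gsp := %u. f u ` gsp M u|)) ((%(u, a). (u, f u a)) ` G)"
proof (rule generates_image[OF M _ _ G])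
 show "ghom M (M'(|gsp := %u. f u ` gsp M u|)) f" by (rule ghomI) (use ghom_between[OF f] ghom_op[OF f] in "simp_all add: linear_between_def")
qed simp

text \<open>Replacing the target by the image of \<open>g\<close> gives exactness on the right, and
  the images of generators of \<open>E\<close> generate the new target.\<close>

lemma ses_onto_image:
 assumes D: "cohr Z D" and E: "cohr Z E" and F: "cohr Z F" and f: "f : Hom D E" and g: "g : Hom E F"
  and inj: "!!j u a. a : sx D j u ==> f j u a = 0 ==> a = 0"
  and ex: "!!j u. f j u ` sx D j u = {b\<in>sx E j u. g j u b = 0}"
 shows "sexact Z D f E g (sub_sheaf F (%j u. g j u ` sx E j u))"
proof (rule short_exactI[OF D E _ f _ inj ex])
 let ?N = "%j u. g j u ` sx E j u"
 have fg: "EX G. finite G & gnr j ((ch F j)(|gsp := ?N j|)) G" for j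
 proof -
  obtain G where G: "finite G" "gnr j (ch E j) G" using coh_fg[OF E] by blast
  show ?thesis using generates_sub_image[OF cgm[OF E] cgm[OF F] Hom_g[OF g] G(2)] G(1) by blast
 qed
 show "cohr Z (sub_sheaf F ?N)" by (rule coherent_sub[OF F subsheaf_image[OF E F g] fg])
 show "g : Hom E (sub_sheaf F ?N)"
 proof (rule HomI)
  show "ghom (ch E j) (ch (sub_sheaf F ?N) j) (g j)" for j
   by (rule ghomI) (use ghom_between[OF Hom_g[OF g]] ghom_op[OF Hom_g[OF g]] in "simp_all add: sub_simps linear_between_def")
 qed (use Hom_outside[OF g] Hom_res[OF g] in "simp_all add: sub_simps")
qed (simp_all add: sub_simps)

subsection \<open>Line bundles and global sections\<close>

lemma xpow_O: "xpow b (Oc Z u j) m v p = (if b then (%n. p (n - int m)) else p)" by (induction m) (auto simp: shift1_def asimps)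

lemma ring_part_U01: "Rp j u <= Rp U01 u" by (auto simp: Rp_def)

lemma O_U01_ops:
 "opt (Oc Z u j) = opt (Oc Z u U01)" "xop b (Oc Z u j) = xop b (Oc Z u U01)"
 "hop (Oc Z u j) s = hop (Oc Z u U01) s" "xpow b (Oc Z u j) = xpow b (Oc Z u U01)" by (cases s; intro ext; simp add: xpow_O)+

lemma ghom_O_U01: "ghom (Oc Z u j) (Oc Z u U01) (%v p. p)" by (rule ghomI) (use ring_part_U01 in "auto simp: linear_between_def O_U01_ops(3)[of Z u j]")

lemma O_sheaf_simps [simp]: "ch (Os Z u) j = Oc Z u j" "res (Os Z u) j v p = p" by (simp_all add: O_sheaf_def)

lemma coh_O: "cohr Z (Os Z u)"
proof (rule coherentI)
 show "gmd Z j (ch (Os Z u) j)" for j by (simp add: gm_O)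
 show "EX G. finite G & gnr j (ch (Os Z u) j) G" for j using generates_O[of j Z u] by (intro exI[of _ "{(- u, one)}"]) simp
 show "ghom (ch (Os Z u) j) (ch (Os Z u) U01) (res (Os Z u) j)" for j using ghom_O_U01[of Z u j] by (simp add: O_sheaf_def)
 show "EX m. xpow (j = U0) (ch (Os Z u) j) m v a = 0" if "res (Os Z u) j v a = 0" for j v a using that by (intro exI[of _ 0]) simp
 show "EX m. EX a:gsp (ch (Os Z u) j) (v + kn m). res (Os Z u) j (v + kn m) a = xpow (j = U0) (ch (Os Z u) U01) m v c"
  if j: "j ~= U01" and c: "c : gsp (ch (Os Z u) U01) v" for j v c
 proof -
  have fin: "finite {n. c n ~= 0}" using c by (simp add: Rp_def)
  define K where "K = Max (abs ` {n. c n ~= 0})"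
  have K: "\<bar>n\<bar> <= K" if "c n ~= 0" for n unfolding K_def using fin that by (intro Max_ge) auto
  define m where "m = nat (max (\<bar>K\<bar>) (\<bar>K\<bar> - pmul (u + v)))"
  have m: "int m >= \<bar>K\<bar>" "int m >= \<bar>K\<bar> - pmul (u + v)" by (auto simp: m_def)
  have pm: "pmul (u + (v + kn m)) = pmul (u + v) + int m" using pmul_kc[of "u + v"] by (simp add: add.assoc)
  have "{n. c (n - int m) ~= 0} = (%n. n + int m) ` {n. c n ~= 0}" by (auto simp: image_iff) (metis diff_add_cancel)
  hence fin': "finite {n. c (n - int m) ~= 0}" using fin by simp
  have "xpow (j = U0) (Oc Z u U01) m v c : Rp j (u + (v + kn m))"
  proof (cases "j = U0")
   case True
   have "c (n - int m) = 0" if "n < 0" for n using K[of "n - int m"] m that by force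
   thus ?thesis using True fin' by (simp add: xpow_O Rp_def)
  next
   case False
   have "c n = 0" if "n > pmul (u + v) + int m" for n using K[of n] m that by force
   thus ?thesis using False j fin by (simp add: xpow_O Rp_def pm)
  qed
  thus ?thesis by (intro exI[of _ m] bexI[of _ "xpow (j = U0) (Oc Z u U01) m v c"]) simp_all
 qed
qed

text \<open>Forgetting an inverse turns a module over \<open>U01\<close> into one over a chart
  \<open>j\<close>, so that two maps from \<open>j\<close> into \<open>U01\<close> can be compared
  on the generator.\<close>

lemma gmodule_weaken: "gmd Z U01 M ==> gmd Z j M" by (rule gmoduleI) (auto intro: gm_subspace gm_op_between gm_op_op gm_t_sq gm_bij inv_on_U01)

lemma gsubmodule_weaken: "gsub U01 M N ==> gsub j M N" by (rule gsubmoduleI) (auto intro: gs_subspace gs_in gs_op gs_inv inv_on_U01)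

definition is_section :: "('n::finite, 'k::field) sheaf => 'n pic => (chart => 'k amb) => bool" where
 "is_section F v s <-> (ALL j. s j : sx F j v) & (ALL j. j ~= U01 --> res F j v (s j) = s U01)"

text \<open>The maps on the charts exist by freeness of line bundles, and they agree on
  \<open>U01\<close> because they agree on \<open>one\<close>.\<close>

lemma section_hom:
 assumes F: "cohr Z F" and s: "is_section F v s"
 obtains f where "f : Hom (Os Z (- v)) F" "!!j. f j v one = s j"
proof -
 have sj: "s j : sx F j v" for j using s by (simp add: is_section_def)
 have "EX f. ghom (Oc Z (- v) j) (ch F j) f & f v one = s j" for j using O_hom_ex[OF cgm[OF F] sj] by metis
 then obtain f where f: "!!j. ghom (Oc Z (- v) j) (ch F j) (f j)" "!!j. f j v one = s j" by metis
 have one: "one : gsp (Oc Z (- v) j) v" for j using one_in[of Z "- v" j] by simp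
 have "cut (Os Z (- v)) f : Hom (Os Z (- v)) F"
 proof (rule cut_Hom[OF coh_O])
  show "ghom (ch (Os Z (- v)) j) (ch F j) (f j)" for j using f(1)[of j] by simp
  show "f U01 u (res (Os Z (- v)) j u a) = res F j u (f j u a)"
   if j: "j ~= U01" and a: "a : gsp (ch (Os Z (- v)) j) u" for j u a
  proof -
   have "f U01 u a = res F j u (f j u a)"
   proof (rule O_hom_unique[where f = "f U01" and g = "%u a. res F j u (f j u a)", OF gmodule_weaken[OF cgm[OF F, of U01]]])
    show "ghom (Oc Z (- v) j) (ch F U01) (f U01)" using ghom_comp[OF ghom_O_U01 f(1)] .
    show "ghom (Oc Z (- v) j) (ch F U01) (%u a. res F j u (f j u a))" by (rule ghom_comp[OF f(1) coh_res[OF F j]])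
    show "f U01 (- (- v)) one = res F j (- (- v)) (f j (- (- v)) one)" using f(2) s j by (simp add: is_section_def)
    show "a : Rp j (- v + u)" using a by simp
   qed
   thus ?thesis by simp
  qed
 qed
 moreover have "cut (Os Z (- v)) f j v one = s j" for j using one f(2) by (simp add: cut_def)
 ultimately show thesis by (rule that)
qed

text \<open>Multiplication by a power of the coordinate that is invertible on \<open>j\<close>
  clears the pole on the other chart, and it can be undone on \<open>j\<close>.\<close>

lemma section_ex:
 assumes F: "cohr Z F" and j: "j ~= U01" and a: "a : sx F j u"
 obtains m s where "is_section F (u + kn m) s" "s j = xpow (j ~= U0) (ch F j) m u a"
proof -
 define i where "i = (if j = U0 then U1 else U0)"
 have i: "i ~= U01" "i ~= j" "(i = U0) = (j ~= U0)" "!!k. k = i | k = j | k = U01" unfolding i_def using j by (auto, (metis chart.exhaust)+)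
 note gm = cgm[OF F]
 obtain m c where c: "c : sx F i (u + kn m)" "res F i (u + kn m) c = xpow (i = U0) (ch F U01) m u (res F j u a)"
  using coh_ext[OF F i(1) gin[OF coh_res[OF F j] a]] by blast
 let ?x = "xpow (j ~= U0) (ch F j) m u a"
 note x = xpow_in[OF gm a]
 have rx: "res F j (u + kn m) ?x = res F i (u + kn m) c" using ghom_xpow[OF gm coh_res[OF F j] a] c(2) i(3) by simp
 define s where "s k = (if k = j then ?x else if k = i then c else res F i (u + kn m) c)" for k
 have "is_section F (u + kn m) s" unfolding is_section_def
 proof (intro conjI allI impI)
  show "s k : sx F k (u + kn m)" for k using i(4)[of k] x c(1) gin[OF coh_res[OF F i(1)] c(1)] j i(1,2) by (auto simp: s_def)
  show "res F k (u + kn m) (s k) = s U01" if "k ~= U01" for k using i(4)[of k] that rx j i(1,2) by (auto simp: s_def)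
 qed
 thus thesis by (rule that) (simp add: s_def)
qed

lemma full_on_U01:
 assumes F: "cohr Z F" and N: "gsub U01 (ch F U01) N" and j: "j ~= U01"
  and sub: "!!u a. a : sx F j u ==> res F j u a : N u" and c: "c : sx F U01 u"
 shows "c : N u"
proof -
 obtain m a where a: "a : sx F j (u + kn m)" "res F j (u + kn m) a = xpow (j = U0) (ch F U01) m u c" using coh_ext[OF F j c] by blast
 have "xpow (j = U0) (ch F U01) m u c : N (u + kn m)" using sub[OF a(1)] a(2) by simp
 thus ?thesis by (rule gs_unit_power[OF N cgm[OF F] c inv_on_U01])
qed

text \<open>Serre's theorem on generation by twisted global sections: a generator on a chart becomes
  global after multiplication by a power of a coordinate that is invertible there, and submodules
  over the chart are closed under the inverse.\<close>

lemma generating_sections: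
 assumes F: "cohr Z F"
 obtains S where "finite S" "!!v s. (v, s) : S ==> is_section F v s"
  "!!j. gnr j (ch F j) ((%(v, s). (v, s j)) ` S)"
proof -
 note gm = cgm[OF F]
 have "EX G. finite G & gnr j (ch F j) G" for j by (rule coh_fg[OF F])
 then obtain G where G: "!!j. finite (G j)" "!!j. gnr j (ch F j) (G j)" by metis
 define good where "good j u a p <-> is_section F (fst p) (snd p) &
  (ALL N. gsub j (ch F j) N --> snd p j : N (fst p) --> a : N u)" for j u a p
 define W where "W j u a = (SOME p. good j u a p)" for j u a
 have "good j u a (W j u a)"
  if j: "j ~= U01" and ua: "(u, a) : G j" for j u a
 proof -
  have a: "a : sx F j u" by (rule generatesD(1)[OF G(2) ua])
  obtain m s where s: "is_section F (u + kn m) s" "s j = xpow (j ~= U0) (ch F j) m u a" by (rule section_ex[OF F j a])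
  have "a : N u" if N: "gsub j (ch F j) N" "s j : N (u + kn m)" for N by (rule gs_unit_power[OF N(1) gm a inv_on_other[OF j]]) (use N(2) s(2) in simp)
  hence "good j u a (u + kn m, s)" using s(1) by (simp add: good_def)
  thus ?thesis unfolding W_def by (rule someI)
 qed
 hence W: "!!j u a. j ~= U01 ==> (u, a) : G j ==> is_section F (fst (W j u a)) (snd (W j u a))"
  "!!j u a N. j ~= U01 ==> (u, a) : G j ==> gsub j (ch F j) N ==> snd (W j u a) j : N (fst (W j u a)) ==> a : N u" unfolding good_def by blast+
 define S where "S = (\<Union>j\<in>{U0, U1}. (%(u, a). W j u a) ` G j)"
 have Sin: "(fst (W j u a), snd (W j u a)) : S" if "j ~= U01" "(u, a) : G j" for j u a
 proof -
  have "W j u a : (%(u, a). W j u a) ` G j" by (rule image_eqI[of _ _ "(u, a)"]) (use that in auto)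
  moreover have "j : {U0, U1}" using that(1) by (cases j) auto
  ultimately have "W j u a : S" unfolding S_def by blast
  thus ?thesis by simp
 qed
 have S: "is_section F v s" if vs: "(v, s) : S" for v s
 proof -
  obtain j u a where jua: "j : {U0, U1}" "(u, a) : G j" "W j u a = (v, s)" using vs unfolding S_def by fastforce
  hence "j ~= U01" by auto
  thus ?thesis using W(1)[OF _ jua(2)] unfolding jua(3) by simp
 qed
 have main: "a : N u" if j: "j ~= U01" and N: "gsub j (ch F j) N" "!!u a. (u, a) : (%(v, s). (v, s j)) ` S ==> a : N u"
  and a: "a : sx F j u" for j N u a
 proof -
  have "N u = sx F j u"
  proof (rule generatesD(2)[OF G(2) N(1)])
   fix v c assume c: "(v, c) : G j"
   have "(fst (W j v c), snd (W j v c) j) : (%(v, s). (v, s j)) ` S" using Sin[OF j c] by force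
   thus "c : N v" using W(2)[OF j c N(1)] N(2) by blast
  qed
  thus ?thesis using a by simp
 qed
 show thesis
 proof (rule that)
  show "finite S" unfolding S_def using G(1) by simp
  show "(v, s) : S ==> is_section F v s" for v s by (rule S)
  show "gnr j (ch F j) ((%(v, s). (v, s j)) ` S)" for j
  proof (rule generatesI)
   show "a : sx F j u" if "(u, a) : (%(v, s). (v, s j)) ` S" for u a using that S by (auto simp: is_section_def)
   fix N u a assume N: "gsub j (ch F j) N" "!!u a. (u, a) : (%(v, s). (v, s j)) ` S ==> a : N u"
    and a: "a : sx F j u"
   show "a : N u"
   proof (cases "j = U01")
    case False
    thus ?thesis using main N a by blast
   next
    case True
    have N': "gsub U01 (ch F U01) N" using N(1) True by simp
    \<comment> \<open>\<open>U01\<close> is generated by restrictions from \<open>U0\<close>, so the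
      submodule is pulled back to \<open>U0\<close>, where the claim is known.\<close>
    note pre = gs_preimage[OF gm[of U0] coh_res[OF F chart.distinct(3)] gsubmodule_weaken[OF N']]
    have "c : {a : sx F U0 w. res F U0 w a : N w}" if c: "c : sx F U0 w" for w c
    proof (rule main[OF chart.distinct(3) pre _ c])
     fix v b assume "(v, b) : (%(v, s). (v, s U0)) ` S"
     then obtain s where s: "(v, s) : S" "b = s U0" by auto
     have "(v, s U01) : (%(v, s). (v, s j)) ` S" using s(1) True by force
     hence "s U01 : N v" by (rule N(2))
     thus "b : {a : sx F U0 v. res F U0 v a : N v}" using S[OF s(1)] s(2) by (auto simp: is_section_def)
    qed
    thus ?thesis using full_on_U01[OF F N' chart.distinct(3)] a True by blast
   qed
  qed
 qed
qed

subsection \<open>Ideal sheaves in line bundles\<close>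

text \<open>Coordinates of degree \<open>u\<close> elements on the charts \<open>U0\<close>, \<open>U1\<close>: polynomials in \<open>X1 / X0\<close>, resp. \<open>X0 / X1\<close>.\<close>
definition fn :: "chart => 'n::finite pic => 'k::field poly => 'k amb" where
 "fn j u P = (%n. let m = (if j = U0 then n else pmul u - n) in if m >= 0 then coeff P (nat m) else 0)"

definition lin :: "chart => 'k * 'k => 'k::field poly" where
 "lin j l = (if j = U0 then [:fst l, snd l:] else [:snd l, fst l:])"

lemma fn_in: assumes "j ~= U01" shows "fn j u P : Rp j u"
proof -
 have "finite {m::int. m >= 0 & coeff P (nat m) ~= 0}"
 proof (rule finite_subset)
  show "{m::int. m >= 0 & coeff P (nat m) ~= 0} <= {0..int (degree P)}" using le_degree by (auto simp: nat_le_iff[symmetric])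
 qed simp
 hence fin: "finite {m::int. m >= 0 & coeff P (nat m) ~= 0}" .
 have "finite {n. fn j u P n ~= 0}"
 proof (cases "j = U0")
  case True
  have "{n. fn j u P n ~= 0} <= {m. m >= 0 & coeff P (nat m) ~= 0}" using True by (auto simp: fn_def Let_def split: if_splits)
  thus ?thesis by (rule finite_subset[OF _ fin])
 next
  case False
  have "{n. fn j u P n ~= 0} <= (%m. pmul u - m) ` {m. m >= 0 & coeff P (nat m) ~= 0}"
  proof
   fix n assume "n : {n. fn j u P n ~= 0}"
   hence "pmul u - n : {m. m >= 0 & coeff P (nat m) ~= 0}" using False by (auto simp: fn_def Let_def split: if_splits)
   hence "pmul u - (pmul u - n) : (%m. pmul u - m) ` {m. m >= 0 & coeff P (nat m) ~= 0}" by (rule imageI)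
   thus "n : (%m. pmul u - m) ` {m. m >= 0 & coeff P (nat m) ~= 0}" by simp
  qed
  thus ?thesis by (rule finite_subset[OF _ finite_imageI[OF fin]])
 qed
 thus ?thesis using assms by (cases j) (auto simp: Rp_def fn_def)
qed

lemma fn_surj:
 assumes "j ~= U01" and p: "p : Rp j u"
 obtains P where "p = fn j u P"
proof -
 define f where "f n = (if j = U0 then p (int n) else p (pmul u - int n))" for n
 note fin = ring_part_finite[OF p]
 have "finite {n. f n ~= 0}"
 proof (cases "j = U0")
  case True
  have "{n. f n ~= 0} = int -` {n. p n ~= 0}" using True by (auto simp: f_def)
  thus ?thesis using finite_vimageI[OF fin, of int] by simp
 next
  case False
  have "{n. f n ~= 0} = (%n. pmul u - int n) -` {n. p n ~= 0}" using False by (auto simp: f_def)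
  thus ?thesis using finite_vimageI[OF fin, of "%n. pmul u - int n"] by (simp add: inj_on_def)
 qed
 then obtain K where "!!n. f n ~= 0 ==> n <= K" unfolding finite_nat_set_iff_bounded_le by blast
 hence z: "f n = 0" if "n > K" for n using that by (meson not_le)
 have c: "coeff (Abs_poly f) = f" using coeff_Abs_poly[of K f, OF z] by blast
 have "p = fn j u (Abs_poly f)" using p assms(1) by (cases j) (auto simp: fn_def c f_def Rp_def Let_def)
 thus thesis by (rule that)
qed

lemma fn_coeff: "j ~= U01 ==> coeff P n = fn j u P (if j = U0 then int n else pmul u - int n)" by (auto simp: fn_def)

lemma fn_add: "fn j u (P + Q) = fn j u P + fn j u Q" by (auto simp: fn_def funp Let_def)
lemma fn_smult: "fn j u (Polynomial.smult c P) = asc c (fn j u P)" by (auto simp: fn_def asc_def Let_def)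
lemma fn_0: "fn j u 0 = 0" by (auto simp: fn_def fun0)

lemma coeff_pCons_nat: "coeff (pCons 0 P) (nat m) = (if m >= 1 then coeff P (nat (m - 1)) else 0)"
proof (cases "m >= 1")
 case True
 hence "nat m = Suc (nat (m - 1))" by simp
 thus ?thesis using True by simp
qed simp

text \<open>In the affine coordinate of the chart the invertible variable acts as 1; by
  \<open>fn_coord\<close> below, the other one acts as the polynomial variable.\<close>

lemma fn_unit: assumes "j ~= U01" shows "(if j ~= U0 then shift1 (fn j u P) else fn j u P) = fn j (u + pc) P"
 using assms by (cases "j = U0") (auto simp: fn_def shift1_def Let_def fun_eq_iff intro!: arg_cong[of _ _ "%k. coeff P (nat k)"])

lemma fn_coord: assumes "j ~= U01" shows "(if j = U0 then shift1 (fn j u P) else fn j u P) = fn j (u + pc) (pCons 0 P)"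
proof -
 have "pmul u + 1 - n - 1 = pmul u - n" for n by simp
 thus ?thesis using assms by (cases "j = U0") (auto simp: fn_def shift1_def Let_def coeff_pCons_nat)
qed

lemma fn_px: "i ~: podd u ==> fn j (u + px i) P = fn j u P" by (cases "j = U0") (auto simp: fn_def pmul_add_px)

lemma fn_px_odd: "i : podd u ==> fn j (u + px i) P = fn j (u + pc) P" by (cases "j = U0") (auto simp: fn_def pmul_add_px)

lemma fn_lmul: assumes "j ~= U01"
 shows "asc (fst l) (fn j u P) + asc (snd l) (shift1 (fn j u P)) = fn j (u + pc) (lin j l * P)"
proof -
 have eq: "lin j l * P = Polynomial.smult (if j = U0 then fst l else snd l) P + Polynomial.smult (if j = U0 then snd l else fst l) (pCons 0 P)" by (auto simp: lin_def)
 show ?thesis unfolding eq fn_add fn_smult using fn_unit[OF assms, of u P] fn_coord[OF assms, of u P] by (cases "j = U0") (simp_all add: add.commute)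
qed

lemma fn_t:
 assumes "j ~= U01"
 shows "opt (Oc Z u j) i v (fn j (u + v) P) = fn j (u + (v + px i)) ((if i : podd (u + v) then lin j (vform (Z i)) else 1) * P)"
proof (cases "i : podd (u + v)")
 case True
 thus ?thesis using fn_lmul[OF assms, of "vform (Z i)" "u + v" P] fn_px_odd[OF True, of j "lin j (vform (Z i)) * P"] True by (simp add: add.assoc)
next
 case False
 thus ?thesis using fn_px[OF False, of j P] False by (simp add: add.assoc)
qed

definition in_chart :: "chart => 'k::field * 'k => bool" where
 "in_chart j q <-> (if j = U0 then fst q ~= 0 else snd q ~= 0)"

lemma lin_vform_in: "in_chart j q ==> EX c z. c ~= 0 & lin j (vform q) = Polynomial.smult c [:- z, 1:]"
proof (cases "j = U0")
 case True
 assume "in_chart j q"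
 thus ?thesis using True by (intro exI[of _ "- fst q"] exI[of _ "snd q / fst q"]) (auto simp: in_chart_def lin_def vform_def)
next
 case False
 assume "in_chart j q"
 thus ?thesis using False by (intro exI[of _ "snd q"] exI[of _ "fst q / snd q"]) (auto simp: in_chart_def lin_def vform_def)
qed

lemma lin_vform_out:
 assumes "~ in_chart j q" "q ~= (0, 0)" obtains c where "c ~= 0" "lin j (vform q) = [:c:]"
proof (cases "j = U0")
 case True
 thus ?thesis using assms by (intro that[of "snd q"]) (auto simp: in_chart_def lin_def vform_def prod_eq_iff)
next
 case False
 thus ?thesis using assms by (intro that[of "- fst q"]) (auto simp: in_chart_def lin_def vform_def prod_eq_iff)
qed

locale chart_ideal =
 fixes Z :: "'n::finite => 'k::alg_closed_field * 'k" and u :: "'n pic" and j :: chart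
  and N :: "'n pic => 'k amb set"
 assumes j: "j ~= U01" and N: "gsub j (Oc Z u j) N" and Z: "distinct_points Z"
begin

lemma unit_iff: "fn j (u + w) P : N w <-> fn j (u + (w + pc)) P : N (w + pc)"
proof -
 have x: "xop (j ~= U0) (Oc Z u j) w (fn j (u + w) P) = fn j (u + (w + pc)) P" using fn_unit[OF j, of "u + w" P] by (simp add: add.assoc)
 show ?thesis using gs_x[OF N, of "fn j (u + w) P" w "j ~= U0"] gs_inv[OF N inv_on_other[OF j], of "fn j (u + w) P" w] fn_in[OF j, of "u + w" P] unfolding x by auto
qed

lemma ideal_mult: "fn j (u + w) X : N w ==> fn j (u + w) (P * X) : N w"
proof (induction P)
 case 0 thus ?case using gs_0[OF N] by (simp add: fn_0)
next
 case (pCons a P)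
 have "xop (j = U0) (Oc Z u j) w (fn j (u + w) (P * X)) = fn j (u + (w + pc)) (pCons 0 (P * X))" using fn_coord[OF j, of "u + w" "P * X"] by (simp add: add.assoc)
 hence "fn j (u + (w + pc)) (pCons 0 (P * X)) : N (w + pc)" using gs_x[OF N pCons(2)[OF pCons(3)], of "j = U0"] by simp
 hence "fn j (u + w) (pCons 0 (P * X)) : N w" by (simp only: unit_iff[symmetric])
 moreover have "fn j (u + w) (Polynomial.smult a X) : N w" using gs_asc[OF N pCons(3)] by (simp add: fn_smult)
 ultimately show ?case using gs_add[OF N] by (simp add: fn_add)
qed

lemma ideal_add: "fn j (u + w) P : N w ==> fn j (u + w) Q : N w ==> fn j (u + w) (P + Q) : N w" unfolding fn_add by (rule gs_add[OF N])

lemma ideal_diff: "fn j (u + w) P : N w ==> fn j (u + w) Q : N w ==> fn j (u + w) (P - Q) : N w" using ideal_add[of w P "[:-1:] * Q"] ideal_mult[of w Q "[:-1:]"] by simp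

text \<open>An element of least degree divides all others, because remainders stay in the
  ideal.\<close>

lemma ideal_principal:
 assumes "fn j (u + w) P0 : N w" "P0 ~= 0"
 obtains G where "G ~= 0" "fn j (u + w) G : N w" "!!P. fn j (u + w) P : N w ==> G dvd P"
proof -
 obtain G where G: "G ~= 0" "fn j (u + w) G : N w" "!!P. P ~= 0 ==> fn j (u + w) P : N w ==> degree G <= degree P"
  using ex_has_least_nat[of "%P. P ~= 0 & fn j (u + w) P : N w" P0 degree] assms by blast
 have "G dvd P" if P: "fn j (u + w) P : N w" for P
 proof -
  have "fn j (u + w) (P - (P div G) * G) : N w" by (rule ideal_diff[OF P ideal_mult[OF G(2)]])
  hence "fn j (u + w) (P mod G) : N w" by (simp add: minus_div_mult_eq_mod)
  hence "P mod G = 0" using G(3)[of "P mod G"] degree_mod_less'[of G P] G(1) by (meson leD)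
  thus ?thesis by (simp add: mod_eq_0_iff_dvd)
 qed
 thus thesis using that G by blast
qed

lemma t_in:
 assumes "fn j (u + w) P : N w"
 shows "fn j (u + (w + px i)) ((if i : podd (u + w) then lin j (vform (Z i)) else 1) * P) : N (w + px i)" using gs_t[OF N assms, of i] unfolding fn_t[OF j] .

lemma linear_bezout:
 assumes "in_chart j q" "~ lin j (vform q) dvd Q"
 obtains A B where "A * Q + B * lin j (vform q) = 1"
proof -
 obtain c z where c: "c ~= 0" "lin j (vform q) = Polynomial.smult c [:- z, 1:]" using lin_vform_in[OF assms(1)] by blast
 have "~ [:- z, 1:] dvd Q" using assms(2) smult_dvd[of "[:- z, 1:]" Q c] c by metis
 hence nz: "poly Q z ~= 0" by (simp only: poly_eq_0_iff_dvd not_False_eq_True)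
 have "poly (Q - [:poly Q z:]) z = 0" by simp
 then obtain Q' where Q': "Q - [:poly Q z:] = [:- z, 1:] * Q'" unfolding poly_eq_0_iff_dvd by (elim dvdE)
 define X where "X = [:- z, 1:]"
 define k where "k = poly Q z"
 have Q: "Q = X * Q' + [:k:]" unfolding X_def k_def Q'[symmetric] by simp
 define d where "d = inverse k * inverse c"
 have kc: "inverse k * k = 1" "d * c = inverse k" using nz c(1) by (simp_all add: k_def d_def)
 have "(- Polynomial.smult d Q') * Polynomial.smult c X = - Polynomial.smult (d * c) (X * Q')" by (simp add: mult.commute)
 hence "[:inverse k:] * Q + (- Polynomial.smult d Q') * Polynomial.smult c X = 1" unfolding Q kc(2) using kc(1) by (simp add: smult_add_right one_pCons)
 thus thesis using that unfolding c(2) X_def by blast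
qed

text \<open>An indivisible element \<open>s\<close> generates the ideal in its own degree and in the adjacent ones.\<close>
context
 fixes v :: "'n pic" and p :: "'k poly"
 assumes s: "fn j (u + v) p : N v" and p0: "p ~= 0"
  and h1: "!!q P. in_chart j q ==> fn j (u + (v - pc)) P : N (v - pc) ==> lin j (vform q) * P ~= p"
  and h2: "!!i P. in_chart j (Z i) ==> fn j (u + (v - px i)) P : N (v - px i) ==>
   (if i : podd (u + v) then 1 else lin j (vform (Z i))) * P ~= p"
begin

text \<open>Let \<open>G\<close> generate the ideal in this degree. A root of the cofactor of
  \<open>G\<close> in \<open>p\<close> is a point of the chart whose form divides \<open>p\<close>
  inside the ideal, contrary to \<open>h1\<close>.\<close>

lemma gen_same: assumes "fn j (u + v) P : N v" shows "p dvd P"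
proof -
 obtain G where G: "G ~= 0" "fn j (u + v) G : N v" "!!P. fn j (u + v) P : N v ==> G dvd P" using ideal_principal[OF s p0] by blast
 obtain H where H: "p = G * H" using G(3)[OF s] by (elim dvdE)
 have "degree H = 0"
 proof (rule ccontr)
  assume "degree H ~= 0"
  then obtain z where "poly H z = 0" using alg_closed_imp_poly_has_root[of H] by auto
  then obtain H' where H': "H = [:- z, 1:] * H'" unfolding poly_eq_0_iff_dvd by (elim dvdE)
  \<comment> \<open>The coordinates of the point are normalized so that its form is exactly the
    monic factor of \<open>H\<close>.\<close>
  define q where "q = (if j = U0 then (-1, - z) else (z, 1))"
  have q: "in_chart j q" "lin j (vform q) = [:- z, 1:]" by (auto simp: q_def in_chart_def lin_def vform_def)
  have "fn j (u + (v - pc)) (H' * G) : N (v - pc)" using ideal_mult[OF G(2), of H'] unit_iff[of "v - pc" "H' * G"] by simp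
  moreover have "lin j (vform q) * (H' * G) = p" unfolding q(2) H H' by (simp only: ac_simps)
  ultimately show False using h1[OF q(1)] by blast
 qed
 then obtain c where c: "H = [:c:]" by (elim degree_eq_zeroE)
 have "c ~= 0" using p0 H c by auto
 hence "p dvd G" unfolding H c by (simp add: smult_dvd)
 thus ?thesis using G(3)[OF assms] dvd_trans by blast
qed

text \<open>A second multiplication by \<open>t_i\<close> leads to degree \<open>v + pc\<close>,
  where \<open>gen_same\<close> applies, but it may cost a factor \<open>?L\<close>. If the factor
  were lost, a Bezout relation would put \<open>p\<close>, or \<open>p\<close> divided by
  \<open>?L\<close>, into degree \<open>v - px i\<close>, contrary to \<open>h2\<close>.\<close>

lemma gen_adjacent:
 assumes P: "fn j (u + (v + px i)) P : N (v + px i)"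
 shows "(if i : podd (u + v) then lin j (vform (Z i)) else 1) * p dvd P"
proof -
 let ?L = "lin j (vform (Z i))"
 have vv: "v + px i + px i = v + pc" by (simp add: pc_eq[of i] add.assoc)
 have vm: "v - px i + pc = v + px i" by (simp add: pc_eq[of i])
 have odd: "i : podd (u + (v + px i)) <-> i ~: podd (u + v)" by (auto simp: podd_add)
 have "fn j (u + (v + pc)) ((if i : podd (u + v) then 1 else ?L) * P) : N (v + pc)" using t_in[OF P, of i] unfolding vv odd by (simp split: if_splits)
 hence d: "p dvd (if i : podd (u + v) then 1 else ?L) * P" using gen_same unfolding unit_iff[symmetric] by blast
 note ts = t_in[OF s]
 have down: "fn j (u + (v - px i)) X : N (v - px i)" if "fn j (u + (v + px i)) X : N (v + px i)" for X using unit_iff[of "v - px i" X] that unfolding vm by simp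
 have ne: "Z i ~= (0, 0)" using Z by (simp add: distinct_points_def)
 show ?thesis
 proof (cases "in_chart j (Z i)")
  case False
  then obtain c where c: "c ~= 0" "?L = [:c:]" by (rule lin_vform_out[OF _ ne])
  show ?thesis using d c by (auto simp: dvd_smult_iff smult_dvd_iff split: if_splits)
 next
  case True
  show ?thesis
  proof (cases "i : podd (u + v)")
   case odd: True
   then obtain Q where Q: "P = p * Q" using d by (auto elim: dvdE)
   show ?thesis
   proof (rule ccontr)
    assume n: "~ ?thesis"
    hence "~ ?L dvd Q" unfolding Q using odd by (simp add: mult.commute[of p Q] mult_dvd_mono)
    then obtain A B where AB: "A * Q + B * ?L = 1" using linear_bezout[OF True] by blast
    have "fn j (u + (v + px i)) (A * P + B * (?L * p)) : N (v + px i)" using ideal_add[OF ideal_mult[OF P] ideal_mult[OF ts]] odd by simp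
    also have "A * P + B * (?L * p) = p * (A * Q + B * ?L)" unfolding Q by (simp add: asimps)
    finally have "fn j (u + (v + px i)) p : N (v + px i)" unfolding AB by simp
    from h2[OF True down[OF this]] odd show False by simp
   qed
  next
   case even: False
   hence d': "p dvd ?L * P" using d by simp
   show ?thesis
   proof (rule ccontr)
    assume n: "~ ?thesis"
    hence np: "~ p dvd P" using even by simp
    have "?L dvd p"
    proof (rule ccontr)
     assume "~ ?L dvd p"
     then obtain A B where AB: "A * p + B * ?L = 1" using linear_bezout[OF True] by blast
     have "P = (A * p + B * ?L) * P" by (simp add: AB)
     also have "... = p * (A * P) + B * (?L * P)" by (simp add: asimps)
     finally have "p dvd P" using d' by (metis dvd_add dvd_mult dvd_triv_left)
     thus False using np by simp
    qed
    then obtain p' where p': "p = ?L * p'" by (elim dvdE)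
    have L0: "?L ~= 0" using p' p0 by auto
    have "p' dvd P" using d' L0 unfolding p' by simp
    then obtain Q where Q: "P = p' * Q" by (elim dvdE)
    have "~ ?L dvd Q" using np unfolding p' Q by (auto simp: mult.commute[of p'] mult_dvd_mono)
    then obtain A B where AB: "A * Q + B * ?L = 1" using linear_bezout[OF True] by blast
    have "fn j (u + (v + px i)) (A * P + B * p) : N (v + px i)" using ideal_add[OF ideal_mult[OF P] ideal_mult[OF ts]] even by simp
    also have "A * P + B * p = p' * (A * Q + B * ?L)" unfolding Q p' by (simp add: asimps)
    finally have "fn j (u + (v + px i)) p' : N (v + px i)" unfolding AB by simp
    from h2[OF True down[OF this]] even p' show False by simp
   qed
  qed
 qed
qed

end

end

section \<open>From ideals on the charts to ideal sheaves\<close>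

lemma ring_part_inv:
 assumes "c : Rp U01 (u + w)" "inv_on b j" "xop b (Oc Z u j) w c : Rp j (u + (w + pc))"
 shows "c : Rp j (u + w)"
proof -
 have O: "gmd Z j (Oc Z u j)" for j by (rule gm_O)
 obtain d where d: "d : gsp (Oc Z u j) w" "xop b (Oc Z u j) w d = xop b (Oc Z u j) w c" using gm_x_surj[OF O assms(2), of "xop b (Oc Z u j) w c" w] assms(3) by auto
 have "d = c" by (rule gm_x_inj[OF O[of U01] inv_on_U01[of b], of _ w]) (use d assms(1) ring_part_U01 in auto)
 thus ?thesis using d by simp
qed

text \<open>The coordinate that is not invertible on \<open>i\<close> vanishes only outside
  \<open>j\<close>, hence not at \<open>q\<close>. Together with the form of \<open>q\<close> it
  generates the invertible coordinate of \<open>i\<close>, so the powers of it in front of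
  \<open>s\<close> can be removed one at a time.\<close>

lemma coprime_forms_transfer:
 assumes N: "subsheaf (Os Z u) N" and j: "j ~= U01" "i ~= U01" "i ~= j" and q: "in_chart j q"
  and s: "s : N j w" and l: "lmul (Oc Z u i) (vform q) w s : N i (w + pc)"
 shows "s : N i w"
proof -
 let ?b = "i = U0"
 have gs: "gsub k (Oc Z u k) (N k)" for k using ss_gs[OF N, of k] by simp
 have O: "gmd Z k (Oc Z u k)" for k by (rule gm_O)
 have s01: "s : N U01 w" using ss_res[OF N j(1) s] by simp
 have xp: "xpow b (Oc Z u i) = xpow b (Oc Z u U01)" for b by (intro ext) (simp add: xpow_O)
 obtain m where m: "xpow ?b (Oc Z u i) m w s : N i (w + kn m)" using ss_ext[OF N j(2) s01] xp by auto
 define al where "al = (if ?b then fst (vform q) else snd (vform q))"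
 define be where "be = (if ?b then snd (vform q) else fst (vform q))"
 have al: "al ~= 0" using q j by (cases i; cases j) (auto simp: al_def in_chart_def vform_def)
 have lmul: "lmul (Oc Z u i) (vform q) x c = asc al (xop (~ ?b) (Oc Z u i) x c) + asc be (xop ?b (Oc Z u i) x c)" for x c
  by (simp add: lmul_xop al_def be_def add.commute)
 from m show ?thesis
 proof (induction m)
  case (Suc m)
  let ?y = "xpow ?b (Oc Z u i) m w s" and ?x = "w + kn m"
  have sg: "s : gsp (Oc Z u U01) w" using gs_in[OF gs s01] .
  have y01: "?y : gsp (Oc Z u U01) ?x" using xpow_in[OF O[of U01] sg, of ?b m] unfolding xp .
  have xy: "xop ?b (Oc Z u i) ?x ?y : N i (?x + pc)" using Suc.prems by (simp add: kc_Suc add.assoc del: of_nat_Suc)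
  have "xpow ?b (Oc Z u i) m (w + pc) (lmul (Oc Z u i) (vform q) w s) : N i (w + pc + kn m)" by (rule gs_xpow[OF gs l])
  also have "xpow ?b (Oc Z u i) m (w + pc) (lmul (Oc Z u i) (vform q) w s) = lmul (Oc Z u i) (vform q) ?x ?y"
   unfolding lmul_xop by (cases ?b) (simp_all add: xpow_O shift1_def asc_def funp fun_eq_iff plus_fun_def asimps)
  also have "w + pc + kn m = ?x + pc" by (simp add: ac_simps)
  finally have "asc (inverse al) (lmul (Oc Z u i) (vform q) ?x ?y - asc be (xop ?b (Oc Z u i) ?x ?y)) : N i (?x + pc)"
   using gs_asc[OF gs gs_diff[OF gs _ gs_asc[OF gs xy]]] by blast
  hence uy: "xop (~ ?b) (Oc Z u i) ?x ?y : N i (?x + pc)" unfolding lmul using al by simp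
  have "?y : Rp i (u + ?x)" by (rule ring_part_inv[OF _ inv_on_other[OF j(2)]]) (use y01 gs_in[OF gs uy] in simp_all)
  hence "?y : N i ?x" using gs_inv[OF gs inv_on_other[OF j(2)] _ uy] by simp
  thus ?case by (rule Suc.IH)
 qed simp
qed

lemma shift1_0 [simp]: "shift1 0 = 0" by (simp add: shift1_def zero_fun_def)

lemma forms_span:
 assumes M: "gmd Z j M" and N: "gsub j M N" and b: "b : gsp M w"
  and l: "lmul M (vform p) w b : N (w + pc)" "lmul M (vform q) w b : N (w + pc)" and pq: "~ same_point p q"
 shows "xop c M w b : N (w + pc)"
proof -
 define D where "D = fst p * snd q - snd p * fst q"
 have D: "D ~= 0" using pq by (simp add: D_def same_point_def)
 let ?x = "xop False M w b" and ?y = "xop True M w b"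
 let ?lp = "asc (snd p) ?x - asc (fst p) ?y" and ?lq = "asc (snd q) ?x - asc (fst q) ?y"
 have l': "?lp : N (w + pc)" "?lq : N (w + pc)" using l by (simp_all add: lmul_xop vform_def)
 have "asc (inverse D) (asc (fst p) ?lq - asc (fst q) ?lp) : N (w + pc)"
  "asc (inverse D) (asc (snd p) ?lq - asc (snd q) ?lp) : N (w + pc)" using gs_asc[OF N] gs_diff[OF N] l' by blast+
 moreover have "asc (fst p) ?lq - asc (fst q) ?lp = asc D ?x" by (simp add: D_def asc.scale_right_diff_distrib asc.scale_left_diff_distrib asimps)
 moreover have "asc (snd p) ?lq - asc (snd q) ?lp = asc D ?y" by (simp add: D_def asc.scale_right_diff_distrib asc.scale_left_diff_distrib asimps)
 ultimately show ?thesis using D by (cases c) simp_all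
qed

lemma gm_lmul_t:
 assumes M: "gmd Z j M" and b: "b : gsp M w"
 shows "lmul M l (w + px k) (opt M k w b) = opt M k (w + pc) (lmul M l w b)" unfolding lmul_xop
 using gm_x_t[OF M b] lin_add[OF gm_t[OF M] gm_asc[OF M gm_x_in[OF M b]] gm_asc[OF M gm_x_in[OF M b]]]
  lin_scale[OF gm_t[OF M] gm_x_in[OF M b]] by simp

lemma gm_lmul_in: "gmd Z j M ==> a : gsp M w ==> lmul M l w a : gsp M (w + pc)" unfolding lmul_xop by (intro gm_add gm_asc gm_x_in)

lemma ghom_lmul: "gmd Z j M ==> ghom M M' f ==> a : gsp M w ==> f (w + pc) (lmul M l w a) = lmul M' l w (f w a)"
 unfolding lmul_xop by (simp add: ghom_add gm_asc gm_x_in ghom_asc ghom_x)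

lemma gs_lmul: "gsub j M N ==> a : N w ==> lmul M l w a : N (w + pc)" unfolding lmul_xop by (intro gs_add gs_asc gs_x)

lemma psum_double: "psum A + psum A = kc (int (card A))" by (rule pic_eqI) (auto simp: podd_add)

text \<open>Modulo \<open>c\<close> every degree is \<open>v + psum A\<close>, and \<open>A\<close>
  is built up index by index. For a new index \<open>i\<close>, applying \<open>t_i\<close> twice
  brings the form of \<open>i\<close> times the element into \<open>N'\<close>. \<open>peel\<close>
  does the same for another index, and the forms of two distinct points generate the invertible
  coordinate.\<close>

lemma (in chart_ideal) generated_by:
 assumes N': "gsub j (Oc Z u j) N'" and sub: "!!w. N' w <= N w"
  and v: "N v <= N' v" and vi: "!!i. N (v + px i) <= N' (v + px i)"
 shows "N w = N' w"
proof -
 note O = gm_O[of Z j u]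
 have pc: "N (w + pc) <= N' (w + pc) <-> N w <= N' w" for w
 proof
  assume h: "N (w + pc) <= N' (w + pc)"
  show "N w <= N' w"
  proof
   fix b assume b: "b : N w"
   have "xop (j ~= U0) (Oc Z u j) w b : N' (w + pc)" using gs_x[OF N b] h by blast
   thus "b : N' w" by (rule gs_inv[OF N' inv_on_other[OF j] gs_in[OF N b]])
  qed
 next
  assume h: "N w <= N' w"
  show "N (w + pc) <= N' (w + pc)"
  proof
   fix b assume b: "b : N (w + pc)"
   obtain a where a: "a : gsp (Oc Z u j) w" "xop (j ~= U0) (Oc Z u j) w a = b" by (rule gm_x_surj[OF O inv_on_other[OF j] gs_in[OF N b]])
   have "a : N w" by (rule gs_inv[OF N inv_on_other[OF j] a(1)]) (use a(2) b in simp)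
   thus "b : N' (w + pc)" using gs_x[OF N', of a w "j ~= U0"] h a(2) by auto
  qed
 qed
 have kc: "N (w + kc k) <= N' (w + kc k) <-> N w <= N' w" for w k
 proof (induction k rule: int_induct[where k = 0])
  case (step1 i)
  thus ?case using pc[of "w + kc i"] by (simp add: kc_add add.assoc)
 next
  case (step2 i)
  thus ?case using pc[of "w + kc (i - 1)"] by (simp add: kc_diff asimps)
 qed simp
 have peel: "b : N' w" if "b : N w" "i ~: B" "lmul (Oc Z u j) (vform (Z i)) w b : N' (w + pc)"
  "N (w + psum B) <= N' (w + psum B)" for i B w b using that
 proof (induction B arbitrary: w b rule: finite_induct[OF finite])
  case (2 k B)
  note b = gs_in[OF N 2(4)]
  have e: "w + px k + pc = w + pc + px k" "w + px k + px k = w + pc" "w + px k + psum B = w + psum (insert k B)"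
   using 2(2) by (simp_all add: pc_eq[of k] psum_insert ac_simps)
  have t: "opt (Oc Z u j) k w b : N' (w + px k)"
  proof (rule 2(3))
   show "opt (Oc Z u j) k w b : N (w + px k)" by (rule gs_t[OF N 2(4)])
   show "i ~: B" using 2(5) by simp
   show "lmul (Oc Z u j) (vform (Z i)) (w + px k) (opt (Oc Z u j) k w b) : N' (w + px k + pc)" unfolding gm_lmul_t[OF O b] e by (rule gs_t[OF N' 2(6)])
   show "N (w + px k + psum B) <= N' (w + px k + psum B)" using 2(7) unfolding e .
  qed
  have "lmul (Oc Z u j) (vform (Z k)) w b : N' (w + pc)" using gs_t[OF N' t, of k] unfolding gm_t_sq[OF O b] e .
  moreover have "~ same_point (Z i) (Z k)" using Z 2(5) by (auto simp: distinct_points_def)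
  ultimately have "xop (j ~= U0) (Oc Z u j) w b : N' (w + pc)" using forms_span[OF O N' b 2(6)] by blast
  thus ?case by (rule gs_inv[OF N' inv_on_other[OF j] b])
 qed auto
 have A: "N (v + psum A) <= N' (v + psum A)" for A
 proof (induction A rule: finite_induct[OF finite])
  case 1
  thus ?case using v by simp
 next
  case (2 i A)
  let ?w = "v + psum (insert i A)"
  \<comment> \<open>Adding \<open>psum A\<close> once more gives \<open>v + px i\<close> up to a
    multiple of \<open>c\<close>, a degree in which the inclusion is assumed.\<close>
  have e: "?w + px i = v + psum A + pc" "?w + psum A = v + px i + kc (int (card A))" using 2(2) psum_double[of A] by (simp_all add: pc_eq[of i] psum_insert ac_simps)
  show ?case
  proof
   fix b assume b: "b : N ?w"
   note bg = gs_in[OF N b]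
   have "opt (Oc Z u j) i ?w b : N (v + psum A + pc)" using gs_t[OF N b, of i] unfolding e .
   hence "opt (Oc Z u j) i ?w b : N' (?w + px i)" using pc[THEN iffD2, OF 2(3)] unfolding e by blast
   hence "lmul (Oc Z u j) (vform (Z i)) ?w b : N' (?w + px i + px i)" using gs_t[OF N'] unfolding gm_t_sq[OF O bg, symmetric] by blast
   hence l: "lmul (Oc Z u j) (vform (Z i)) ?w b : N' (?w + pc)" by (simp add: pc_eq[of i] add.assoc)
   have "N (?w + psum A) <= N' (?w + psum A)" unfolding e kc by (rule vi)
   thus "b : N' ?w" by (rule peel[OF b 2(2) l])
  qed
 qed
 have "w = v + psum (podd (w - v)) + kc (pmul (w - v))" using pic_normal_form[of "w - v"] by (simp add: asimps)
 hence "N w <= N' w" using A kc by metis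
 thus ?thesis using sub by blast
qed

lemma image_sub:
 assumes N: "gsub j (Oc Z u j) N" and f: "ghom (Oc Z (- v) j) (Oc Z u j) f" and s: "f v one : N v"
 shows "f w ` Rp j (- v + w) <= N w"
proof -
 have "{a : gsp (Oc Z (- v) j) w. f w a : N w} = Rp j (- v + w)" by (rule O_generated[OF gs_preimage[OF gm_O f N]]) (use s one_in[of Z "- v" j] in simp)
 thus ?thesis by auto
qed

text \<open>The submodule generated by \<open>s\<close> is the image of the map that sends
  \<open>one\<close> to \<open>s\<close>. Indivisibility of the section is translated into the
  polynomial conditions of \<open>gen_same\<close> and \<open>gen_adjacent\<close>.\<close>

lemma (in chart_ideal) generated_by_section:
 assumes s: "s : N v" "s ~= 0"
  and h1: "!!q s'. in_chart j q ==> s' : N (v - pc) ==> lmul (Oc Z u j) (vform q) (v - pc) s' ~= s"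
  and h2: "!!i s'. in_chart j (Z i) ==> s' : N (v - px i) ==> opt (Oc Z u j) i (v - px i) s' ~= s"
  and f: "ghom (Oc Z (- v) j) (Oc Z u j) f" "f v one = s"
 shows "N w = f w ` Rp j (- v + w)"
proof -
 note O = gm_O[of Z j]
 obtain p where p: "s = fn j (u + v) p" using fn_surj[OF j] gs_in[OF N s(1)] by (metis O_simps(1))
 have p0: "p ~= 0" using s(2) unfolding p by (auto simp: fn_0)
 have sp: "fn j (u + v) p : N v" using s p by simp
 have g1: "lin j (vform q) * P ~= p" if "in_chart j q" "fn j (u + (v - pc)) P : N (v - pc)" for q P
 proof -
  have "lmul (Oc Z u j) (vform q) (v - pc) (fn j (u + (v - pc)) P) = fn j (u + v) (lin j (vform q) * P)"
   using fn_lmul[OF j, of "vform q" "u + (v - pc)" P] by (simp add: lmul_xop add.assoc)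
  thus ?thesis using h1[OF that] p by auto
 qed
 have g2: "(if i : podd (u + v) then 1 else lin j (vform (Z i))) * P ~= p"
  if "in_chart j (Z i)" "fn j (u + (v - px i)) P : N (v - px i)" for i P
 proof -
  have e: "i : podd (u + (v - px i)) <-> i ~: podd (u + v)" by (auto simp: podd_add podd_diff)
  have "opt (Oc Z u j) i (v - px i) (fn j (u + (v - px i)) P) = fn j (u + v) ((if i : podd (u + v) then 1 else lin j (vform (Z i))) * P)"
   using fn_t[OF j, of Z u i "v - px i" P] unfolding e by (simp del: O_simps split: if_splits)
  thus ?thesis using h2[OF that] p by metis
 qed
 define N' where "N' = (%w. f w ` Rp j (- v + w))"
 have N': "gsub j (Oc Z u j) N'" using gs_image[OF O O f(1) gs_full[OF O]] by (simp add: N'_def)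
 interpret I': chart_ideal Z u j N' by standard (use j N' Z in auto)
 have sN': "fn j (u + v) p : N' v" unfolding N'_def p[symmetric] f(2)[symmetric] using one_in[of Z "- v" j] by (intro imageI) simp
 have sub: "N' w <= N w" for w unfolding N'_def by (rule image_sub[OF N f(1)]) (use s f(2) in simp)
 have "N w = N' w"
 proof (rule generated_by[OF N' sub])
  show "N v <= N' v"
  proof
   fix b assume b: "b : N v"
   obtain P where P: "b = fn j (u + v) P" using fn_surj[OF j] gs_in[OF N b] by (metis O_simps(1))
   have "p dvd P" by (rule gen_same[OF sp p0 g1 g2]) (use b P in simp_all)
   then obtain Q where "P = p * Q" by (elim dvdE)
   thus "b : N' v" unfolding P using I'.ideal_mult[OF sN', of Q] by (simp add: mult.commute)
  qed
  show "N (v + px i) <= N' (v + px i)" for i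
  proof
   fix b assume b: "b : N (v + px i)"
   obtain P where P: "b = fn j (u + (v + px i)) P" using fn_surj[OF j] gs_in[OF N b] by (metis O_simps(1))
   have "(if i : podd (u + v) then lin j (vform (Z i)) else 1) * p dvd P" by (rule gen_adjacent[OF sp p0 g1 g2]) (use b P in simp_all)
   then obtain Q where "P = (if i : podd (u + v) then lin j (vform (Z i)) else 1) * p * Q" by (elim dvdE)
   thus "b : N' (v + px i)" unfolding P using I'.ideal_mult[OF I'.t_in[OF sN', of i], of Q] by (simp only: mult.commute)
  qed
 qed
 thus ?thesis by (simp add: N'_def)
qed

lemma global_section_degree:
 assumes "s : Rp U0 u" "s : Rp U1 u" "s ~= 0"
 shows "pmul u >= 0" "pdeg u >= 0"
proof -
 obtain n where "s n ~= 0" using assms(3) by (metis ext fun0)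
 hence "0 <= n" "n <= pmul u" using assms by (auto simp: Rp_def not_less[symmetric])
 thus "pmul u >= 0" "pdeg u >= 0" by (auto simp: pdeg_eq)
qed

text \<open>A nonzero global section of \<open>N\<close> of least degree generates: a proper local
  divisor of it would extend to a global section of smaller degree. The minimum exists because a
  nonzero global section of a line bundle forces nonnegative degree.\<close>

theorem ideal_sheaf:
 fixes Z :: "'n::finite => 'k::alg_closed_field * 'k"
 assumes Z: "distinct_points Z" and N: "subsheaf (Os Z u) N" and c: "c : N j0 w0" "c ~= 0"
 obtains v s where "s ~= 0" "!!j. s : N j v"
  "!!j f w. ghom (Oc Z (- v) j) (Oc Z u j) f ==> f v one = s ==> N j w = f w ` Rp j (- v + w)"
proof -
 have gs: "gsub k (Oc Z u k) (N k)" for k using ss_gs[OF N, of k] by simp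
 have O: "gmd Z k (Oc Z u k)" for k by (rule gm_O)
 define glob where "glob v s <-> s ~= 0 & (ALL j. s : N j v)" for v s
 have to01: "s : N U01 w" if "s : N j w" for j s w using ss_res[OF N, of j s w] that by (cases "j = U01") auto
 have globI: "glob v s" if "s ~= 0" "s : N U0 v" "s : N U1 v" for v s unfolding glob_def using that to01 by (metis chart.exhaust)
 have ex: "EX v s. glob v s"
 proof -
  \<comment> \<open>Suitable powers of \<open>X1\<close> and \<open>X0\<close> clear the poles of
    \<open>c\<close> on \<open>U0\<close> and on \<open>U1\<close>.\<close>
  obtain m where m: "xpow True (Oc Z u U01) m w0 c : N U0 (w0 + kn m)" using ss_ext[OF N _ to01[OF c(1)], of U0] by auto
  obtain k where k: "c : N U1 (w0 + kn k)" using ss_ext[OF N _ to01[OF c(1)], of U1] by (auto simp: xpow_O)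
  define s where "s = (%n. c (n - int m))"
  have "s n ~= 0" if "c (n - int m) ~= 0" for n using that by (simp add: s_def)
  moreover obtain n where "c n ~= 0" using c(2) by (metis ext fun0)
  ultimately have "s (n + int m) ~= 0" by simp
  hence s0: "s ~= 0" by (metis fun0)
  have "s : N U0 (w0 + kn m + kn k)" using gs_xpow[OF gs m, of False k] by (simp add: xpow_O s_def)
  moreover have "s : N U1 (w0 + kn k + kn m)" using gs_xpow[OF gs k, of True m] by (simp add: xpow_O s_def)
  ultimately have "glob (w0 + kn m + kn k) s" using globI[OF s0] by (simp add: ac_simps)
  thus ?thesis by blast
 qed
 have deg: "pdeg (u + v) >= 0" if "glob v s" for v s
 proof -
  have "s : Rp U0 (u + v)" "s : Rp U1 (u + v)" "s ~= 0" using that gs_in[OF gs[of U0]] gs_in[OF gs[of U1]] unfolding glob_def by auto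
  thus ?thesis by (rule global_section_degree(2))
 qed
 obtain vs where vs: "glob (fst vs) (snd vs)"
  "!!ws. glob (fst ws) (snd ws) ==> nat (pdeg (u + fst vs)) <= nat (pdeg (u + fst ws))"
  using ex ex_has_least_nat[of "%ws. glob (fst ws) (snd ws)" _ "%ws. nat (pdeg (u + fst ws))"] by (metis fst_conv snd_conv)
 define v where "v = fst vs"
 define s where "s = snd vs"
 have vs_glob: "glob v s" and least: "!!w t. glob w t ==> pdeg (u + v) <= pdeg (u + w)"
 proof -
  show "glob v s" using vs(1) by (simp add: v_def s_def)
  show "pdeg (u + v) <= pdeg (u + w)" if "glob w t" for w t using vs(2)[of "(w, t)"] that deg[OF that] by (simp add: v_def)
 qed
 have sN: "s : N j v" "s ~= 0" for j using vs_glob by (auto simp: glob_def)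
 \<comment> \<open>If the form of a point of chart \<open>j\<close> carries \<open>s'\<close> into
   \<open>N\<close> on every chart, then \<open>s'\<close> is itself global, in a degree below the
   minimum.\<close>
 have no_div: False if w: "pdeg w > 0" and j: "j ~= U01" and q: "in_chart j q" and s': "s' : N j (v - w)" "s' ~= 0"
  and l: "!!i. lmul (Oc Z u i) (vform q) (v - w) s' : N i (v - w + pc)" for w j s' and q :: "'k * 'k"
 proof -
  have "s' : N i (v - w)" if "i ~= U01" "i ~= j" for i by (rule coprime_forms_transfer[OF N j that q s'(1) l])
  hence "s' : N U0 (v - w)" "s' : N U1 (v - w)" using s'(1) by (metis chart.distinct(3,5))+
  hence "glob (v - w) s'" by (rule globI[OF s'(2)])
  from least[OF this] w show False by simp
 qed
 have lm: "lmul (Oc Z u i) = lmul (Oc Z u j)" for i j by (intro ext) (simp add: lmul_def O_chart_def)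
 have op: "opt (Oc Z u i) = opt (Oc Z u j)" for i j by (intro ext) (simp add: O_chart_def)
 have main: "N j w = f w ` Rp j (- v + w)"
  if j: "j ~= U01" and f: "ghom (Oc Z (- v) j) (Oc Z u j) f" "f v one = s" for j f w
 proof -
  interpret chart_ideal Z u j "N j" by standard (use j gs Z in auto)
  show ?thesis
  proof (rule generated_by_section[OF sN(1) sN(2) _ _ f])
   fix q :: "'k * 'k" and s' assume q: "in_chart j q" and s': "s' : N j (v - pc)"
   show "lmul (Oc Z u j) (vform q) (v - pc) s' ~= s"
   proof
    assume eq: "lmul (Oc Z u j) (vform q) (v - pc) s' = s"
    have "s' ~= 0" using eq sN(2) gm_op_0(2)[OF O[of j]] by (auto simp: lmul_xop)
    moreover have "lmul (Oc Z u i) (vform q) (v - pc) s' : N i (v - pc + pc)" for i using eq sN(1) lm[of i j] by simp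
    ultimately show False using no_div[OF _ j q s'] by simp
   qed
  next
   fix i s' assume q: "in_chart j (Z i)" and s': "s' : N j (v - px i)"
   show "opt (Oc Z u j) i (v - px i) s' ~= s"
   proof
    assume eq: "opt (Oc Z u j) i (v - px i) s' = s"
    have "s' ~= 0" using eq sN(2) gm_op_0(1)[OF O[of j]] by auto
    moreover have "lmul (Oc Z u k) (vform (Z i)) (v - px i) s' : N k (v - px i + pc)" for k
    proof -
     note s'g = gs_in[OF gs s']
     have "lmul (Oc Z u k) (vform (Z i)) (v - px i) s' = opt (Oc Z u k) i v s" using gm_t_sq[OF O s'g, of i] eq lm[of k j] op[of k j] by (simp del: O_simps(2))
     moreover have "v - px i + pc = v + px i" by (simp add: pc_eq[of i])
     ultimately show ?thesis using gs_t[OF gs[of k] sN(1), of i] by (simp only:)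
    qed
    ultimately show False using no_div[OF _ j q s'] by simp
   qed
  qed
 qed
 have main01: "N U01 w = f w ` Rp U01 (- v + w)"
  if f: "ghom (Oc Z (- v) U01) (Oc Z u U01) f" "f v one = s" for f w
 proof
  show "f w ` Rp U01 (- v + w) <= N U01 w" by (rule image_sub[OF gs f(1)]) (use f(2) sN in simp)
  show "N U01 w <= f w ` Rp U01 (- v + w)"
  proof
   fix c assume c: "c : N U01 w"
   note sg = gs_in[OF gs sN(1)]
   obtain f0 where f0: "ghom (Oc Z (- v) U0) (Oc Z u U0) f0" "f0 v one = s" by (rule O_hom_ex[OF O sg])
   obtain m where m: "xpow True (Oc Z u U01) m w c : N U0 (w + kn m)" using ss_ext[OF N _ c, of U0] by auto
   then obtain p where p: "p : Rp U0 (- v + (w + kn m))" "xpow True (Oc Z u U01) m w c = f0 (w + kn m) p" using main[OF _ f0, of "w + kn m"] by auto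
   have "f0 (w + kn m) p = f (w + kn m) p" by (rule O_hom_unique[OF gmodule_weaken[OF O[of U01]], of "- v" U0])
     (use ghom_comp[OF f0(1) ghom_O_U01] ghom_comp[OF ghom_O_U01 f(1)] f0(2) f(2) p(1) in simp_all)
   hence "xpow True (Oc Z u U01) m w c : f (w + kn m) ` Rp U01 (- v + (w + kn m))" using p ring_part_U01 by auto
   moreover have "gsub U01 (Oc Z u U01) (%w. f w ` Rp U01 (- v + w))" using gs_image[OF gm_O gm_O f(1) gs_full[OF gm_O]] by simp
   ultimately show "c : f w ` Rp U01 (- v + w)" using gs_unit_power[OF _ O gs_in[OF gs c] inv_on_U01] by blast
  qed
 qed
 show thesis
 proof (rule that[OF sN(2) sN(1)])
  fix j f w assume f: "ghom (Oc Z (- v) j) (Oc Z u j) f" "f v one = s"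
  show "N j w = f w ` Rp j (- v + w)"
  proof (cases "j = U01")
   case True
   thus ?thesis using main01 f by blast
  qed (rule main[OF _ f])
 qed
qed

subsection \<open>Evaluation at points\<close>

text \<open>Over a finite field the product of all \<open>X - a\<close>, increased by 1, would have
  no root.\<close>

lemma infinite_alg_closed: "infinite (UNIV :: 'k::alg_closed_field set)"
proof
 assume fin: "finite (UNIV :: 'k set)"
 define P where "P = (PROD a:(UNIV :: 'k set). [:- a, 1:]) + 1"
 have "degree (PROD a:(UNIV :: 'k set). [:- a, 1:]) = card (UNIV :: 'k set)" by (subst degree_prod_eq_sum_degree) auto
 moreover have "card (UNIV :: 'k set) > 0" using fin by (simp add: card_gt_0_iff)
 ultimately have "degree P > 0" unfolding P_def by (subst degree_add_eq_left) simp_all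
 then obtain a where "poly P a = 0" using alg_closed_imp_poly_has_root by blast
 moreover have "poly (PROD a:(UNIV :: 'k set). [:- a, 1:]) a = 0" using fin by (simp add: poly_prod prod_zero_iff)
 ultimately show False by (simp add: P_def)
qed

definition lval :: "('n => 'k::field * 'k) => 'n => 'k => 'k" where
 "lval Z i z = fst (vform (Z i)) + snd (vform (Z i)) * z"

text \<open>A value of \<open>t_i\<close> at a point above \<open>[1 : z]\<close>, where
  \<open>lval\<close> is the value of the form of the marked point. Any choice of the square roots
  gives a point of the cover.\<close>

definition root :: "('n => 'k::alg_closed_field * 'k) => 'n => 'k => 'k" where
 "root Z i z = (SOME t. t ^ 2 = lval Z i z)"

lemma root_sq: "root Z i z * root Z i z = lval Z i z"
proof -
 obtain t where "t ^ 2 = lval Z i z" using nth_root_exists[of 2 "lval Z i z"] by auto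
 hence "root Z i z ^ 2 = lval Z i z" unfolding root_def by (rule someI)
 thus ?thesis by (simp add: power2_eq_square)
qed

text \<open>At these points \<open>X1\<close> and all \<open>t_i\<close> take nonzero values;
  \<open>X0\<close> has the value 1.\<close>

definition genpts :: "('n => 'k::alg_closed_field * 'k) => 'k set" where
 "genpts Z = {z. z ~= 0 & (ALL i. lval Z i z ~= 0)}"

lemma infinite_genpts:
 assumes "adp Z" shows "infinite (genpts Z)"
proof
 assume fin: "finite (genpts Z)"
 have "finite {z. lval Z i z = 0}" for i
 proof -
  have "[:fst (vform (Z i)), snd (vform (Z i)):] ~= 0" using assms by (auto simp: distinct_points_def vform_def prod_eq_iff)
  hence "finite {z. poly [:fst (vform (Z i)), snd (vform (Z i)):] z = 0}" by (rule poly_roots_finite)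
  thus ?thesis by (simp add: lval_def mult.commute)
 qed
 hence "finite (genpts Z Un ({0} Un (\<Union>i. {z. lval Z i z = 0})))" using fin by simp
 moreover have "genpts Z Un ({0} Un (\<Union>i. {z. lval Z i z = 0})) = UNIV" by (auto simp: genpts_def)
 ultimately show False using infinite_alg_closed by metis
qed

definition laurent :: "'k::field amb => 'k => 'k" where
 "laurent p z = (SUM n | p n ~= 0. p n * z powi n)"

lemma laurent_eq: "finite S ==> (!!n. p n ~= 0 ==> n : S) ==> laurent p z = (SUM n:S. p n * z powi n)" unfolding laurent_def by (rule sum.mono_neutral_left) auto

lemma laurent_add:
 assumes "finite {n. p n ~= 0}" "finite {n. q n ~= 0}"
 shows "laurent (p + q) z = laurent p z + laurent q z"
proof -
 let ?S = "{n. p n ~= 0} Un {n. q n ~= 0}"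
 have S: "finite ?S" using assms by simp
 have "laurent (p + q) z = (SUM n:?S. (p + q) n * z powi n)" by (rule laurent_eq[OF S]) (auto simp: funp)
 thus ?thesis using laurent_eq[OF S, of p z] laurent_eq[OF S, of q z] by (simp add: funp distrib_right sum.distrib)
qed

lemma laurent_asc:
 assumes "finite {n. p n ~= 0}" shows "laurent (asc c p) z = c * laurent p z"
proof -
 have "laurent (asc c p) z = (SUM n | p n ~= 0. asc c p n * z powi n)" by (rule laurent_eq[OF assms]) (auto simp: asc_def)
 thus ?thesis by (simp add: laurent_def asc_def sum_distrib_left mult.assoc)
qed

lemma laurent_shift:
 assumes "z ~= 0" shows "laurent (shift1 p) z = z * laurent p z"
 unfolding laurent_def shift1_supp using assms by (simp add: sum.reindex inj_on_def shift1_def power_int_add sum_distrib_left ac_simps)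

lemma laurent_zeros:
 assumes fin: "finite {n. p n ~= 0}" and p: "p ~= 0"
 shows "finite {z. z ~= 0 & laurent p z = 0}"
proof -
 define K where "K = Max (abs ` {n. p n ~= 0})"
 have K: "\<bar>n\<bar> <= K" if "p n ~= 0" for n unfolding K_def using fin that by (intro Max_ge) auto
 define P where "P = (SUM n | p n ~= 0. Polynomial.monom (p n) (nat (n + K)))"
 obtain m where m: "p m ~= 0" using p by (metis ext fun0)
 have "coeff P (nat (m + K)) = (SUM n | p n ~= 0. if n = m then p m else 0)" unfolding P_def coeff_sum
 proof (rule sum.cong)
  fix n assume n: "n : {n. p n ~= 0}"
  have "nat (n + K) = nat (m + K) <-> n = m" using K[of n] K[OF m] n by auto
  thus "coeff (Polynomial.monom (p n) (nat (n + K))) (nat (m + K)) = (if n = m then p m else 0)" by auto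
 qed simp
 also have "... = p m" using fin m by simp
 finally have "P ~= 0" using m by auto
 have ev: "poly P z = z powi K * laurent p z" if z: "z ~= 0" for z
 proof -
  have "poly P z = (SUM n | p n ~= 0. p n * z ^ nat (n + K))" by (simp add: P_def poly_sum poly_monom)
  also have "... = (SUM n | p n ~= 0. z powi K * (p n * z powi n))"
  proof (rule sum.cong)
   fix n assume n: "n : {n. p n ~= 0}"
   have "z ^ nat (n + K) = z powi (n + K)" using K[of n] n by (simp add: power_int_def)
   thus "p n * z ^ nat (n + K) = z powi K * (p n * z powi n)" using z by (simp add: power_int_add ac_simps)
  qed simp
  finally show ?thesis by (simp add: laurent_def sum_distrib_left)
 qed
 have "{z. z ~= 0 & laurent p z = 0} <= {z. poly P z = 0}" using ev by auto
 thus ?thesis by (rule finite_subset) (rule poly_roots_finite[OF \<open>P ~= 0\<close>])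
qed

text \<open>Evaluation at X0 = 1, X1 = z and t_i = \<open>root Z i z\<close>. It turns
  multiplication in the graded ring into multiplication in the field, and the infinitely many
  generic points determine an element of given degree.\<close>

definition ev :: "('n::finite => 'k::alg_closed_field * 'k) => 'n pic => 'k amb => 'k => 'k" where
 "ev Z u p z = laurent p z * (PROD i:podd u. root Z i z)"

lemma root_nz: "z : genpts Z ==> root Z i z ~= 0" using root_sq[of Z i z] by (auto simp: genpts_def)

lemma ev_add: "p : Rp j u ==> q : Rp j u ==> ev Z u (p + q) z = ev Z u p z + ev Z u q z" by (simp add: ev_def laurent_add Rp_def distrib_right)

lemma ev_asc: "p : Rp j u ==> ev Z u (asc c p) z = c * ev Z u p z" by (simp add: ev_def laurent_asc Rp_def)

lemma ev_0 [simp]: "ev Z u 0 z = 0" by (simp add: ev_def laurent_def fun0)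

lemma podd_add_pc [simp]: "podd (u + pc) = podd u" by (simp add: podd_add)

lemma podd_add_px: "podd (u + px i) = (if i : podd u then podd u - {i} else insert i (podd u))" by (auto simp: podd_add)

lemma ev_x:
 assumes "z : genpts Z" shows "ev Z (u + v + pc) (xop b (Oc Z u j) v p) z = (if b then z else 1) * ev Z (u + v) p z"
 using assms laurent_shift[of z p] by (auto simp: ev_def genpts_def)

lemma ev_t:
 assumes z: "z : genpts Z" and p: "p : Rp j (u + v)"
 shows "ev Z (u + v + px i) (opt (Oc Z u j) i v p) z = root Z i z * ev Z (u + v) p z"
proof (cases "i : podd (u + v)")
 case False
 thus ?thesis by (simp add: ev_def podd_add_px)
next
 case True
 note fin = ring_part_finite[OF p]
 have "laurent (opt (Oc Z u j) i v p) z = lval Z i z * laurent p z"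
  using True z fin by (simp add: laurent_add laurent_asc laurent_shift finite_supp_asc finite_supp_shift genpts_def lval_def asimps)
 moreover have "(PROD k:podd (u + v). root Z k z) = root Z i z * (PROD k:podd (u + v) - {i}. root Z k z)" using True by (simp add: prod.remove)
 ultimately show ?thesis using True by (simp add: ev_def podd_add_px root_sq[symmetric] del: O_simps(2))
qed

lemma ev_zeros:
 assumes "p : Rp j u" "p ~= 0" shows "finite {z : genpts Z. ev Z u p z = 0}"
proof (rule finite_subset)
 show "{z : genpts Z. ev Z u p z = 0} <= {z. z ~= 0 & laurent p z = 0}" using root_nz[of _ Z] by (auto simp: ev_def genpts_def[of Z])
 show "finite {z. z ~= 0 & laurent p z = 0}" by (rule laurent_zeros) (use assms in "auto simp: Rp_def")
qed

lemma ev_inj: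
 assumes Z: "distinct_points Z" and "p : Rp j u" "q : Rp j u" "!!z. z : genpts Z ==> ev Z u p z = ev Z u q z"
 shows "p = q"
proof (rule ccontr)
 assume "p ~= q"
 have mq: "asc (-1) q : Rp j u" using assms(3) asc.subspace_scale[OF sub_Rp] by blast
 have e: "p - q = p + asc (-1) q" by (simp add: asc.scale_minus_left)
 have "p + asc (-1) q : Rp j u" using assms(2) mq asc.subspace_add[OF sub_Rp] by blast
 moreover have "p + asc (-1) q ~= 0" using \<open>p ~= q\<close> e by (metis right_minus_eq)
 ultimately have "finite {z : genpts Z. ev Z u (p + asc (-1) q) z = 0}" by (rule ev_zeros)
 moreover have "{z : genpts Z. ev Z u (p + asc (-1) q) z = 0} = genpts Z" using ev_add[OF assms(2) mq] ev_asc[OF assms(3), of Z "-1"] assms(4) by auto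
 ultimately show False using infinite_genpts[OF Z] by simp
qed

lemma ev_mult_0:
 assumes Z: "distinct_points Z" and "p : Rp j u" "q : Rp i v" "!!z. z : genpts Z ==> ev Z u p z * ev Z v q z = 0"
 shows "p = 0 | q = 0"
proof (rule ccontr)
 assume "~ (p = 0 | q = 0)"
 hence "finite ({z : genpts Z. ev Z u p z = 0} Un {z : genpts Z. ev Z v q z = 0})" using ev_zeros assms(2,3) by auto
 moreover have "genpts Z <= {z : genpts Z. ev Z u p z = 0} Un {z : genpts Z. ev Z v q z = 0}" using assms(4) by auto
 ultimately show False using infinite_genpts[OF Z] finite_subset by blast
qed

lemma ev_one [simp]: "ev Z u one z = (PROD i:podd u. root Z i z)"
proof -
 have "laurent one z = (SUM n:{0}. one n * z powi n)" by (rule laurent_eq) (auto simp: one_def split: if_splits)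
 thus ?thesis by (simp add: ev_def one_def)
qed

definition op_value :: "('n::finite => 'k::alg_closed_field * 'k) => 'n + bool => 'k => 'k" where
 "op_value Z s z = case_sum (%i. root Z i z) (%b. if b then z else 1) s"

lemma ev_op:
 assumes "z : genpts Z" "p : Rp j (u + v)"
 shows "ev Z (u + v + dg s) (hop (Oc Z u j) s v p) z = op_value Z s z * ev Z (u + v) p z"
 using ev_t[OF assms] ev_x[OF assms(1)] by (cases s) (simp_all add: op_value_def del: O_simps)

text \<open>A map between line bundles is multiplication by the image of \<open>one\<close>: the
  elements satisfying the identity form a submodule that contains \<open>one\<close>.\<close>

lemma ev_hom:
 assumes f: "ghom (Oc Z u j) (Oc Z w j) f" and p: "p : Rp j (u + v)" and z: "z : genpts Z"
 shows "ev Z (w + v) (f v p) z = ev Z (u + v) p z * ev Z (w - u) (f (- u) one) z"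
proof -
 note O = gm_O[of Z j]
 let ?s = "ev Z (w - u) (f (- u) one) z"
 define N where "N v = {p : Rp j (u + v). ev Z (w + v) (f v p) z = ev Z (u + v) p z * ?s}" for v
 have fin: "f v p : Rp j (w + v)" if "p : Rp j (u + v)" for v p using gin[OF f, of p v] that by simp
 have op: "ev Z (x + (v + dg s)) (hop (Oc Z x j) s v a) z = op_value Z s z * ev Z (x + v) a z" if "a : Rp j (x + v)" for x v a s
  using ev_op[OF z that, of s] by (simp add: add.assoc)
 have opf: "ev Z (w + (v + dg s)) (f (v + dg s) (hop (Oc Z u j) s v a)) z = op_value Z s z * ev Z (w + v) (f v a) z"
  if "a : Rp j (u + v)" for v a s using ghom_op[OF f, of a v s] op[OF fin[OF that], of s] that by simp
 have "gsub j (Oc Z u j) N"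
 proof (rule gsubmoduleI)
  note r = asc.subspace_add[OF sub_Rp] asc.subspace_scale[OF sub_Rp]
  show "asc.subspace (N v)" for v
  proof (rule asc.subspace_lincomb)
   show "0 : N v" using ghom_0[OF O f, of v] asc.subspace_0[OF sub_Rp] by (simp add: N_def)
   show "x + asc c y : N v" if "x : N v" "y : N v" for x y c using that ghom_add[OF f, of x v "asc c y"] ghom_asc[OF f, of y v c]
     ev_add[of x j "u + v" "asc c y" Z z] ev_asc[of y j "u + v" Z c z] by (simp add: N_def r ev_add[OF fin r(2)[OF fin]] ev_asc[OF fin] distrib_right)
  qed
  show "N v <= gsp (Oc Z u j) v" for v by (auto simp: N_def)
  show "hop (Oc Z u j) s v a : N (v + dg s)" if "a : N v" for v a s using that op[of a u v s] opf[of a v s] gm_op_in[OF O, of a u v s] by (simp add: N_def)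
  show "a : N v" if "inv_on b j" "a : gsp (Oc Z u j) v" "xop b (Oc Z u j) v a : N (v + pc)" for b v a
  proof -
   have "z ~= 0" using z by (simp add: genpts_def)
   thus ?thesis using that(2,3) op[of a u v "Inr b"] opf[of a v "Inr b"] by (simp add: N_def op_value_def del: O_simps(3) split: if_splits)
  qed
 qed
 moreover have "one : N (- u)" using one_in[of Z u j] by (simp add: N_def)
 ultimately have "N v = Rp j (u + v)" by (rule O_generated)
 thus ?thesis using p by (auto simp: N_def)
qed

lemma O_hom_inj:
 assumes Z: "adp Z" and f: "ghom (Oc Z u j) (Oc Z w j) f" and s: "f (- u) one ~= 0"
  and p: "p : Rp j (u + v)" and 0: "f v p = 0"
 shows "p = 0"
proof -
 have "f (- u) one : Rp j (w - u)" using gin[OF f, of one "- u"] one_in[of Z u j] by simp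
 moreover have "ev Z (u + v) p z * ev Z (w - u) (f (- u) one) z = 0" if "z : genpts Z" for z using ev_hom[OF f p that] 0 by simp
 ultimately show ?thesis using ev_mult_0[OF Z p] s by blast
qed

text \<open>The product is obtained without a multiplication on coefficients: it is the image of
  \<open>p\<close> under the homomorphism that sends \<open>one\<close> to \<open>q\<close>.\<close>

lemma ring_mult_ex:
 fixes Z :: "'n::finite => 'k::alg_closed_field * 'k"
 assumes p: "p : Rp j u" and q: "q : Rp j v"
 obtains t where "t : Rp j (u + v)" "!!z. z : genpts Z ==> ev Z (u + v) t z = ev Z u p z * ev Z v q z"
proof -
 have "q : gsp (Oc Z 0 j) v" using q by simp
 then obtain f where f: "ghom (Oc Z (- v) j) (Oc Z 0 j) f" "f v one = q" by (rule O_hom_ex[OF gm_O])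
 have p': "p : Rp j (- v + (u + v))" using p by simp
 have "f (u + v) p : Rp j (u + v)" using gin[OF f(1), of p "u + v"] p' by simp
 moreover have "ev Z (u + v) (f (u + v) p) z = ev Z u p z * ev Z v q z" if "z : genpts Z" for z using ev_hom[OF f(1) p' that] f(2) by simp
 ultimately show thesis by (rule that)
qed

lemma ideal_sheaf_hom:
 assumes Z: "adp Z" and N: "subsheaf (Os Z u) N" and c: "c : N j0 w0" "c ~= 0"
 shows "EX v g s. g : Hom (Os Z (- v)) (Os Z u) & (ALL j w. g j w ` Rp j (- v + w) = N j w) &
  s ~= 0 & (ALL j. g j v one = s)"
proof (rule ideal_sheaf[OF Z N c])
 fix v s assume s: "s ~= 0" "!!j. s : N j v"
  and gen: "!!j f w. ghom (Oc Z (- v) j) (Oc Z u j) f ==> f v one = s ==> N j w = f w ` Rp j (- v + w)"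
 have "s : gsp (ch (Os Z u) j) v" for j by (rule gs_in[OF ss_gs[OF N] s(2)])
 hence "is_section (Os Z u) v (%_. s)" unfolding is_section_def by simp
 then obtain g where g: "g : Hom (Os Z (- v)) (Os Z u)" "!!j. g j v one = s" using section_hom[OF coh_O] by blast
 have "g j w ` Rp j (- v + w) = N j w" for j w by (rule gen[symmetric]) (use Hom_g[OF g(1), of j] g(2) in simp_all)
 thus ?thesis using g s(1) by blast
qed

subsection \<open>Induction over coherent sheaves\<close>

text \<open>The induction is on the number of global sections that generate \<open>F\<close>. The
  first one gives a map from a line bundle, and modulo its image one section fewer is needed. The
  image is the line bundle itself or its quotient by a nonzero ideal sheaf, and such an ideal sheaf
  is again a line bundle.\<close>

theorem coherent_induct:
 assumes Z: "adp Z"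
  and line: "!!u. P (Os Z u)"
  and zero: "!!F. cohr Z F ==> (!!j u. sx F j u = {0}) ==> P F"
  and ext: "!!E f F g G. sexact Z E f F g G ==> P E ==> P G ==> P F"
  and cok: "!!E f F g G. sexact Z E f F g G ==> P E ==> P F ==> P G"
  and F: "cohr Z F"
 shows "P F"
proof -
 have main: "P F" if "cohr Z F" "!!v s. (v, s) : set xs ==> is_section F v s"
  "!!j. gnr j (ch F j) ((%(v, s). (v, s j)) ` set xs)" for xs F using that
 proof (induction xs arbitrary: F rule: measure_induct_rule[of length])
  case (less xs)
  note F = less(2) and sects = less(3) and gens = less(4)
  show ?case
  proof (cases xs)
  case Nil
  have "{0} = sx F j u" for j u by (rule generatesD(2)[OF gens gs_zero[OF cgm[OF F]]]) (simp add: Nil)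
  thus ?thesis using zero[OF F] by blast
 next
  case (Cons vs ys)
  obtain v s where vs: "vs = (v, s)" by (cases vs)
  note O = coh_O[of Z "- v"]
  have sec: "is_section F v s" using sects Cons vs by simp
  obtain f where f: "f : Hom (Os Z (- v)) F" "!!j. f j v one = s j" using section_hom[OF F sec] by blast
  let ?N = "%j u. f j u ` gsp (ch (Os Z (- v)) j) u"
  have N: "subsheaf F ?N" by (rule subsheaf_image[OF O F f(1)])
  define pr where "pr = cut F (%j. qproj (ch F j) (?N j))"
  define Q where "Q = qsh F ?N"
  have pr: "pr : Hom F Q" unfolding pr_def Q_def by (rule quot_Hom[OF F N])
  have Q: "cohr Z Q" unfolding Q_def by (rule coherent_quot[OF F N])
  have prsurj: "pr j u ` sx F j u = sx Q j u" for j u by (auto simp: pr_def Q_def cut_def quot_sheaf_simps)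
  have pr0: "pr j v (s j) = 0" for j
  proof -
   have sj: "s j : sx F j v" using sec by (simp add: is_section_def)
   have "s j : ?N j v" using f(2)[of j] one_in[of Z "- v" j] by (intro image_eqI[of _ _ one]) simp_all
   thus ?thesis using qproj_0[OF cgm[OF F] ss_gs[OF N] sj] by (simp add: pr_def cut_def)
  qed
  define zs where "zs = map (%(w, t). (w, %j. pr j w (t j))) ys"
  have sT: "is_section Q w t" if wt: "(w, t) : set zs" for w t
  proof -
   obtain t' where t': "(w, t') : set ys" "t = (%j. pr j w (t' j))" using wt by (auto simp: zs_def)
   have "is_section F w t'" using sects t'(1) Cons by simp
   thus ?thesis unfolding t'(2) is_section_def using gin[OF Hom_g[OF pr]] Hom_res[OF pr] by metis
  qed
  have "P Q"
  proof -
   have gen: "gnr j (ch Q j) ((%(v, s). (v, s j)) ` set zs)" for j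
   proof (rule generatesI)
    show "a : sx Q j u" if "(u, a) : (%(v, s). (v, s j)) ` set zs" for u a using that sT by (fastforce simp: is_section_def)
    fix M u a assume M: "gsub j (ch Q j) M" "!!u a. (u, a) : (%(v, s). (v, s j)) ` set zs ==> a : M u" and a: "a : sx Q j u"
    have full: "{a : sx F j u. pr j u a : M u} = sx F j u"
    proof (rule generatesD(2)[OF gens gs_preimage[OF cgm[OF F] Hom_g[OF pr] M(1)]])
     fix w b assume "(w, b) : (%(v, s). (v, s j)) ` set xs"
     then consider "w = v" "b = s j" | t where "(w, t) : set ys" "b = t j" using vs Cons by auto
     thus "b : {a : sx F j w. pr j w a : M w}"
     proof cases
      case 1
      thus ?thesis using pr0[of j] gs_0[OF M(1)] sec by (simp add: is_section_def)
     next
      case 2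
      hence "(w, pr j w b) : (%(v, s). (v, s j)) ` set zs" by (force simp: zs_def image_image)
      thus ?thesis using M(2) sects[of w t] 2 Cons by (simp add: is_section_def)
     qed
    qed
    obtain b where "b : sx F j u" "a = pr j u b" using a unfolding prsurj[symmetric] by (elim imageE)
    thus "a : M u" using full by blast
   qed
   show ?thesis by (rule less(1)[OF _ Q sT gen]) (simp add: zs_def Cons)
  qed
  let ?O = "Os Z (- v)"
  show ?thesis
  proof (cases "ALL j u. ALL a:gsp (ch ?O j) u. f j u a = 0 --> a = 0")
   case True
   hence inj: "!!j u a. a : gsp (ch ?O j) u ==> f j u a = 0 ==> a = 0" by blast
   have "sexact Z ?O f F pr Q" unfolding pr_def Q_def by (rule ses_quot[OF O F f(1) inj N refl])
   thus ?thesis by (rule ext[OF _ line \<open>P Q\<close>])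
  next
   case False
   let ?K = "%j u. {a : gsp (ch ?O j) u. f j u a = 0}"
   obtain j0 w0 c where c: "c : ?K j0 w0" "c ~= 0" using False by blast
   have K: "subsheaf ?O ?K" by (rule subsheaf_kernel[OF O F f(1)])
   obtain v' g s' where g: "g : Hom (Os Z (- v')) ?O" "ALL j w. g j w ` Rp j (- v' + w) = ?K j w"
    "s' ~= 0" "ALL j. g j v' one = s'" using ideal_sheaf_hom[OF Z K c] by (elim exE conjE)
   have gj: "ghom (Oc Z (- v') j) (Oc Z (- v) j) (g j)" for j using Hom_g[OF g(1), of j] by simp
   have "sexact Z (Os Z (- v')) g ?O f (sub_sheaf F ?N)"
   proof (rule ses_onto_image[OF coh_O O F g(1) f(1)])
    show "a = 0" if "a : gsp (ch (Os Z (- v')) j) u" "g j u a = 0" for j u a by (rule O_hom_inj[where v = u, OF Z gj[of j]]) (use that g(3,4) in simp_all)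
    show "g j u ` gsp (ch (Os Z (- v')) j) u = ?K j u" for j u using g(2) by simp
   qed
   hence sub: "P (sub_sheaf F ?N)" by (rule cok[OF _ line line])
   have fg: "EX G. finite G & gnr j ((ch F j)(|gsp := ?N j|)) G" for j
   proof -
    obtain G where G: "finite G" "gnr j (ch ?O j) G" using coh_fg[OF O] by blast
    show ?thesis using generates_sub_image[OF cgm[OF O] cgm[OF F] Hom_g[OF f(1)] G(2)] G(1) by blast
   qed
   show ?thesis by (rule ext[OF ses_sub[OF F N fg] sub]) (use \<open>P Q\<close> in "simp add: Q_def")
  qed
 qed
 qed
 obtain S where S: "finite S" "!!v s. (v, s) : S ==> is_section F v s"
  "!!j. gnr j (ch F j) ((%(v, s). (v, s j)) ` S)" using generating_sections[OF F] by blast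
 obtain xs where xs: "set xs = S" using finite_list[OF S(1)] by blast
 show ?thesis by (rule main[OF F, of xs]) (use S xs in simp_all)
qed

subsection \<open>The Cech complexes as two-term complexes\<close>

lemma vector_space_fun:
 assumes "vector_space s" shows "vector_space (%c f x. s c (f x))"
proof -
 interpret vector_space s by (rule assms)
 show ?thesis by standard (auto simp: funp scale_right_distrib scale_left_distrib fun_eq_iff)
qed

lemma vector_space_asc: "vector_space asc" ..

abbreviation hsc :: "'k::field => (('n,'k) mp) => ('n,'k) mp" where
 "hsc \<equiv> (%c f u a. asc c (f u a))"
abbreviation msc :: "'k::field => ('i => ('n,'k) mp) => 'i => ('n,'k) mp" where
 "msc \<equiv> (%c f j u a. asc c (f j u a))"
abbreviation ysc :: "'k::field => (bool => bool => ('n,'k) mp) => bool => bool => ('n,'k) mp" where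
 "ysc \<equiv> (%c f i j u a. asc c (f i j u a))"
abbreviation xsc :: "'k::field => (bool => 'k amb) => bool => 'k amb" where
 "xsc \<equiv> (%c x i. asc c (x i))"

lemmas vs_hsc = vector_space_fun[OF vector_space_fun[OF vector_space_asc]]
lemmas vs_msc = vector_space_fun[OF vs_hsc]
lemmas vs_ysc = vector_space_fun[OF vs_msc]
lemmas vs_xsc = vector_space_fun[OF vector_space_asc]

interpretation hs: vector_space "hsc :: 'k::field => (('n,'k) mp) => _" by (rule vs_hsc)
interpretation ms: vector_space "msc :: 'k::field => ('i => ('n,'k) mp) => _" by (rule vs_msc)
interpretation ys: vector_space "ysc :: 'k::field => (bool => bool => ('n,'k) mp) => _" by (rule vs_ysc)
interpretation xs: vector_space "xsc :: 'k::field => (bool => 'k amb) => _" by (rule vs_xsc)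

interpretation yh: vector_space_pair "ysc :: 'k::field => (bool => bool => ('n,'k) mp) => _"
 "hsc :: 'k::field => (('n,'k) mp) => _" ..
interpretation ym: vector_space_pair "ysc :: 'k::field => (bool => bool => ('n,'k) mp) => _"
 "msc :: 'k::field => (chart => ('n,'k) mp) => _" ..
interpretation ha: vector_space_pair "hsc :: 'k::field => (('n,'k) mp) => _" "asc :: 'k::field => _" ..
interpretation xa: vector_space_pair "xsc :: 'k::field => (bool => 'k amb) => _" "asc :: 'k::field => _" ..

lemma gHomI: "ghom M N f ==> (!!u a. a ~: gsp M u ==> f u a = 0) ==> f : gHom M N" by (simp add: gHom_def)

lemma gHom_cut:
 assumes "gmd Z j M" "ghom M N f"
 shows "(%u a. if a : gsp M u then f u a else 0) : gHom M N" by (rule gHomI[OF ghom_cong[OF assms]]) simp_all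

lemma gHom_eqI: "f : gHom M N ==> g : gHom M N ==> (!!u a. a : gsp M u ==> f u a = g u a) ==> f = g"
 unfolding gHom_def by (intro ext) (metis (mono_tags, lifting) mem_Collect_eq)

lemma ghom_zero: "gmd Z j N ==> ghom M N (%u a. 0)" by (rule ghomI) (auto simp: linear_between_def gm_0 gm_op_0)

lemma subspace_gHom:
 assumes N: "gmd Z j N" shows "hs.subspace (gHom M N)"
proof (rule hs.subspace_lincomb)
 show "0 : gHom M N" using ghom_zero[OF N, of M] unfolding gHom_def by (simp add: zero_fun_def)
 show "f + hsc c g : gHom M N" if "f : gHom M N" "g : gHom M N" for f g c
 proof -
  have e: "f + hsc c g = (%u a. f u a + asc c (g u a))" by (simp add: fun_eq_iff funp)
  show ?thesis unfolding e using that ghom_lincomb[OF N, of M f g c] by (simp add: gHom_def)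
 qed
qed

definition hc :: "bool => chart" where "hc i = (if i then U1 else U0)"

lemma hchart_U01 [simp]: "hc i ~= U01" by (simp add: hc_def)

text \<open>An element of the source records homomorphisms on \<open>U0\<close> and \<open>U1\<close> (index \<open>False\<close>) together with
 their restrictions to \<open>U01\<close> (index \<open>True\<close>).\<close>
definition csrc :: "('n::finite, 'k::field) sheaf => ('n, 'k) sheaf => (bool => bool => ('n,'k) mp) set" where
 "csrc V F = {y. ALL i. restricts V F (hc i) (y i False) (y i True)}"

definition cdiff :: "(bool => bool => 'n pic => 'k::field amb => 'k amb) => ('n,'k) mp" where
 "cdiff y = y True True - y False True"

definition fredholm_pair :: "('n::finite, 'k::field) sheaf => ('n, 'k) sheaf => bool" where
 "fredholm_pair V F <-> fredholm ysc hsc (csrc V F) (cech1 V F) cdiff"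

lemma cdiff_image: "cdiff ` csrc V F = cech_boundaries V F"
proof (intro equalityI subsetI)
 fix g assume "g : cdiff ` csrc V F"
 then obtain y where y: "ALL i. restricts V F (hc i) (y i False) (y i True)" "g = y True True - y False True" by (auto simp: csrc_def cdiff_def)
 have "restricts V F U0 (y False False) (y False True)" "restricts V F U1 (y True False) (y True True)"
  using y(1)[rule_format, of False] y(1)[rule_format, of True] by (simp_all add: hc_def)
 thus "g : cech_boundaries V F" unfolding cech_boundaries_def using y(2) by blast
next
 fix g assume "g : cech_boundaries V F"
 then obtain f0 g0 f1 g1 where g: "restricts V F U0 f0 g0" "restricts V F U1 f1 g1" "g = g1 - g0" unfolding cech_boundaries_def by blast
 define y where "y i k = (if i then if k then g1 else f1 else if k then g0 else f0)" for i k :: bool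
 have "y : csrc V F" using g(1,2) by (auto simp: csrc_def y_def hc_def)
 moreover have "cdiff y = g" using g(3) by (simp add: cdiff_def y_def)
 ultimately show "g : cdiff ` csrc V F" by blast
qed

lemma resD:
 assumes "restricts V F j f g"
 shows "f : gHom (ch V j) (ch F j)" "g : gHom (ch V U01) (ch F U01)"
  "a : sx V j u ==> g u (res V j u a) = res F j u (f u a)" using assms by (auto simp: restricts_def)

lemma subspace_csrc:
 assumes F: "cohr Z F" shows "ys.subspace (csrc V F)"
proof (rule ys.subspace_lincomb)
 note sub = subspace_gHom[OF cgm[OF F]] and r = coh_res[OF F hchart_U01]
 show "0 : csrc V F" unfolding csrc_def restricts_def using hs.subspace_0[OF sub] ghom_0[OF cgm[OF F] r] by (simp add: fun0)
 show "x + ysc c y : csrc V F" if "x : csrc V F" "y : csrc V F" for x y c unfolding csrc_def restricts_def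
 proof (intro CollectI allI conjI ballI)
  fix i
  have x: "restricts V F (hc i) (x i False) (x i True)" and y: "restricts V F (hc i) (y i False) (y i True)" using that by (auto simp: csrc_def)
  have e: "(x + ysc c y) i k = x i k + hsc c (y i k)" for k by (simp add: funp)
  show "(x + ysc c y) i False : gHom (ch V (hc i)) (ch F (hc i))" "(x + ysc c y) i True : gHom (ch V U01) (ch F U01)"
   unfolding e by (rule hs.subspace_add[OF sub resD(1)[OF x] hs.subspace_scale[OF sub resD(1)[OF y]]],
    rule hs.subspace_add[OF sub resD(2)[OF x] hs.subspace_scale[OF sub resD(2)[OF y]]])
  fix u a assume a: "a : gsp (ch V (hc i)) u"
  have "x i False u a : gsp (ch F (hc i)) u" "y i False u a : gsp (ch F (hc i)) u" using resD(1)[OF x] resD(1)[OF y] gin a unfolding gHom_def by blast+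
  thus "(x + ysc c y) i True u (res V (hc i) u a) = res F (hc i) u ((x + ysc c y) i False u a)"
   unfolding e funp[of "x i _"] funp[of "x i _ u"] resD(3)[OF x a] resD(3)[OF y a] by (simp add: ghom_add[OF r] ghom_asc[OF r] gm_asc[OF cgm[OF F]])
 qed
qed

lemma linear_cdiff: "lin_on ysc hsc W cdiff" unfolding lin_on_def cdiff_def by (auto simp: funp fun_eq_iff minus_apply asc_def asimps)

lemma cdiff_in:
 assumes F: "cohr Z F" shows "cdiff ` csrc V F <= cech1 V F"
proof
 fix g assume "g : cdiff ` csrc V F"
 then obtain y where y: "y : csrc V F" "g = y True True - y False True" by (auto simp: cdiff_def)
 have "y i True : gHom (ch V U01) (ch F U01)" for i using y(1) resD(2) unfolding csrc_def by blast
 thus "g : cech1 V F" unfolding y(2) cech1_def using hs.subspace_diff[OF subspace_gHom[OF cgm[OF F]]] by blast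
qed

lemma Hom_kernel:
 "(%y j. if j = U01 then y True True else y (j = U1) False) ` {y : csrc V F. cdiff y = 0} = Hom V F" (is "?ps ` _ = _")
proof (intro equalityI subsetI)
 fix f assume "f : ?ps ` {y : csrc V F. cdiff y = 0}"
 then obtain y where y: "!!i. restricts V F (hc i) (y i False) (y i True)" and eq: "y True True = y False True" and f: "f = ?ps y" by (auto simp: csrc_def cdiff_def)
 have r: "restricts V F j (f j) (f U01)" if "j ~= U01" for j using y[of "j = U1"] that eq by (cases j) (simp_all add: f hc_def)
 show "f : Hom V F"
 proof (rule HomI)
  have "f j : gHom (ch V j) (ch F j)" for j using resD(1)[OF r, of j] resD(2)[OF y, of True] by (cases "j = U01") (auto simp: f)
  thus "ghom (ch V j) (ch F j) (f j)" "a ~: sx V j u ==> f j u a = 0" for j u a unfolding gHom_def by blast+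
  show "f U01 u (res V j u a) = res F j u (f j u a)" if "j ~= U01" "a : sx V j u" for j u a by (rule resD(3)[OF r[OF that(1)] that(2)])
 qed
next
 fix f assume f: "f : Hom V F"
 let ?y = "%i k. f (if k then U01 else hc i)"
 have "restricts V F (hc i) (f (hc i)) (f U01)" for i unfolding restricts_def using Hom_res[OF f] f by (auto simp: Hom_def)
 hence y: "?y : {y : csrc V F. cdiff y = 0}" by (simp add: csrc_def cdiff_def)
 have "f j = ?ps ?y j" for j by (cases j) (simp_all add: hc_def)
 hence "f = ?ps ?y" by (rule ext)
 thus "f : ?ps ` {y : csrc V F. cdiff y = 0}" by (rule image_eqI[OF _ y])
qed

lemma linear_Hom_kernel: "lin_on ysc msc W (%y j. if j = U01 then y True True else y (j = U1) False)" by (auto simp: lin_on_def plus_fun_def)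

lemma subspace_cdiff_kernel: "cohr Z F ==> ys.subspace {y : csrc V F. cdiff y = 0}" by (rule yh.subspace_kernel_on[OF linear_cdiff subspace_csrc])

lemma subspace_Hom: "cohr Z F ==> ms.subspace (Hom V F)" using ym.image_on[OF linear_Hom_kernel subspace_cdiff_kernel] unfolding Hom_kernel .

text \<open>On the kernel of \<open>cdiff\<close> the two components over \<open>U01\<close>
  coincide; keeping one of them identifies the kernel with \<open>Hom V F\<close>. The cokernel is
  the quotient measured by \<open>dim_Ext1\<close>.\<close>

lemma index_csrc:
 assumes F: "cohr Z F"
 shows "index ysc hsc (csrc V F) (cech1 V F) cdiff = int (dim_Hom V F) - int (dim_Ext1 V F)"
proof -
 let ?ps = "%y j. if j = U01 then y True True else y (j = U1) False"
 note K = subspace_cdiff_kernel[OF F, of V]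
 have "y = 0" if "cdiff y = 0" "?ps y = 0" for y :: "bool => bool => 'a pic => 'b amb => 'b amb"
 proof (intro ext)
  fix i k
  have ps: "?ps y j = 0" for j using fun_cong[OF that(2), of j] by (simp add: fun0)
  have "y i k = 0" using ps[of U01] ps[of "hc i"] that(1) by (cases i; cases k) (simp_all add: cdiff_def hc_def)
  thus "y i k u a n = 0 i k u a n" for u a n by (simp add: fun0)
 qed
 moreover have "?ps 0 = 0" by (auto simp: zero_fun_def)
 ultimately have ker: "{0} = {y : {y : csrc V F. cdiff y = 0}. ?ps y : {0}}" using ys.subspace_0[OF K] by auto
 have sub0: "{0} <= Hom V F" using ms.subspace_0[OF subspace_Hom[OF F]] by simp
 have "qd ysc {0} {y : csrc V F. cdiff y = 0} = dim_Hom V F" unfolding dim_Hom_def by (rule ym.qd_iso[OF linear_Hom_kernel K ms.subspace_single_0 Hom_kernel ker sub0])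
 thus ?thesis unfolding index_def dim_Ext1_def cdiff_image by simp
qed

subsection \<open>Homomorphisms from line bundles\<close>

lemma gHom_O_ex:
 assumes N: "gmd Z j N" and a: "a : gsp N (- w)"
 obtains f where "f : gHom (Oc Z w j) N" "f (- w) one = a"
proof -
 obtain f where f: "ghom (Oc Z (- (- w)) j) N f" "f (- w) one = a" by (rule O_hom_ex[OF N a])
 have "(%u x. if x : gsp (Oc Z w j) u then f u x else 0) : gHom (Oc Z w j) N" by (rule gHom_cut[OF gm_O]) (use f(1) in simp)
 moreover have "(if one : gsp (Oc Z w j) (- w) then f (- w) one else 0) = a" using one_in[of Z w j] f(2) by simp
 ultimately show thesis using that by blast
qed

lemma gHom_O_eq:
 assumes N: "gmd Z j N" and f: "f : gHom (Oc Z w j) N" and g: "g : gHom (Oc Z w j) N"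
  and eq: "f (- w) one = g (- w) one"
 shows "f = g"
proof (rule gHom_eqI[OF f g])
 fix u a assume "a : gsp (Oc Z w j) u"
 thus "f u a = g u a" using O_hom_unique[where f = f and g = g and u = w and v = u and p = a, OF N] eq f g by (simp add: gHom_def)
qed

lemma gHom_g: "f : gHom M N ==> ghom M N f" by (simp add: gHom_def)
lemma gHom_out: "f : gHom M N ==> a ~: gsp M u ==> f u a = 0" by (simp add: gHom_def)

lemma restricts_O_ex:
 assumes F: "cohr Z F" and j: "j ~= U01" and a: "a : sx F j (- w)"
 obtains f h where "restricts (Os Z w) F j f h" "f (- w) one = a" "h (- w) one = res F j (- w) a"
proof -
 note gm = cgm[OF F]
 obtain f where f: "f : gHom (Oc Z w j) (ch F j)" "f (- w) one = a" by (rule gHom_O_ex[OF gm a])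
 note ra = gin[OF coh_res[OF F j] a]
 obtain h where h: "h : gHom (Oc Z w U01) (ch F U01)" "h (- w) one = res F j (- w) a" by (rule gHom_O_ex[OF gm ra])
 have "h u p = res F j u (f u p)" if p: "p : Rp j (w + u)" for u p by (rule O_hom_unique[where f = h and g = "%u p. res F j u (f u p)", OF gmodule_weaken[OF gm] _ _ _ p])
   (use ghom_comp[OF ghom_O_U01 gHom_g[OF h(1)]] ghom_comp[OF gHom_g[OF f(1)] coh_res[OF F j]] f(2) h(2) in simp_all)
 hence "restricts (Os Z w) F j f h" unfolding restricts_def using f(1) h(1) by simp
 thus thesis using that f(2) h(2) by blast
qed

definition ssrc :: "('n::finite, 'k::field) sheaf => 'n pic => (bool => 'k amb) set" where
 "ssrc F v = {x. ALL i. x i : gsp (ch F (hc i)) v}"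

definition sdiff :: "('n::finite, 'k::field) sheaf => 'n pic => (bool => 'k amb) => 'k amb" where
 "sdiff F v x = res F U1 v (x True) - res F U0 v (x False)"

definition fredholm_sec :: "('n::finite, 'k::field) sheaf => 'n pic => bool" where
 "fredholm_sec F v <-> fredholm xsc asc (ssrc F v) (sx F U01 v) (sdiff F v)"

text \<open>The Euler characteristic of the twist F(v), read off from the Cech complex of sections
  of degree \<open>v\<close>.\<close>

definition chs :: "('n::finite, 'k::field) sheaf => 'n pic => int" where
 "chs F v = index xsc asc (ssrc F v) (sx F U01 v) (sdiff F v)"

lemma subspace_ssrc:
 assumes F: "cohr Z F" shows "xs.subspace (ssrc F v)" by (rule xs.subspaceI)
  (auto simp: ssrc_def funp fun0 intro: gm_0[OF cgm[OF F]] gm_add[OF cgm[OF F]] gm_asc[OF cgm[OF F]])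

lemma linear_sdiff:
 assumes F: "cohr Z F" shows "lin_on xsc asc (ssrc F v) (sdiff F v)"
proof -
 have "x i : gsp (ch F (hc i)) v" if "x : ssrc F v" for x i using that by (simp add: ssrc_def)
 from this[of _ True] this[of _ False] have *: "x True : sx F U1 v" "x False : sx F U0 v" if "x : ssrc F v" for x using that by (auto simp: hc_def)
 show ?thesis unfolding lin_on_def sdiff_def using * ghom_add[OF coh_res[OF F chart.distinct(5)]] ghom_add[OF coh_res[OF F chart.distinct(3)]]
   ghom_asc[OF coh_res[OF F chart.distinct(5)]] ghom_asc[OF coh_res[OF F chart.distinct(3)]] by (simp add: funp[of "_ :: bool => _"] asc.scale_right_diff_distrib)
qed

lemma sdiff_in:
 assumes F: "cohr Z F" shows "sdiff F v ` ssrc F v <= sx F U01 v"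
proof
 fix y assume "y : sdiff F v ` ssrc F v"
 then obtain x where x: "!!i. x i : gsp (ch F (hc i)) v" "y = res F U1 v (x True) - res F U0 v (x False)" by (auto simp: ssrc_def sdiff_def)
 show "y : sx F U01 v" unfolding x(2) using x(1)[of True] x(1)[of False] gin[OF coh_res[OF F chart.distinct(5)]] gin[OF coh_res[OF F chart.distinct(3)]]
  by (intro gm_diff[OF cgm[OF F]]) (simp_all add: hc_def)
qed

interpretation yx: vector_space_pair "ysc :: 'k::field => (bool => bool => ('n,'k) mp) => _"
 "xsc :: 'k::field => (bool => 'k amb) => _" ..

text \<open>Evaluation at \<open>one\<close> identifies the complex of homomorphisms from O(w) with
  the complex of sections of degree \<open>- w\<close>.\<close>

lemma
 assumes F: "cohr Z F"
 shows fredholm_O: "fredholm_pair (Os Z w) F <-> fredholm_sec F (- w)"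
  and index_O: "index ysc hsc (csrc (Os Z w) F) (cech1 (Os Z w) F) cdiff = chs F (- w)"
proof -
 note gm = cgm[OF F]
 let ?V = "Os Z w"
 define e where "e y = (%i. y i False (- w) one)" for y :: "bool => bool => 'a pic => 'b amb => 'b amb"
 define e' where "e' f = f (- w) one" for f :: "'a pic => 'b amb => 'b amb"
 let ?A = "csrc ?V F" and ?A' = "ssrc F (- w)"
 have one: "one : gsp (Oc Z w j) (- w)" for j by (rule one_in)
 have le: "lin_on ysc xsc W e" for W unfolding lin_on_def e_def by (auto simp: funp fun_eq_iff)
 have le': "lin_on hsc asc W e'" for W unfolding lin_on_def e'_def by (auto simp: funp fun_eq_iff)
 have y: "y i False : gHom (Oc Z w (hc i)) (ch F (hc i))" "y i True : gHom (Oc Z w U01) (ch F U01)"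
  "y i True (- w) one = res F (hc i) (- w) (y i False (- w) one)" if "y : ?A" for y i
 proof -
  have r: "restricts ?V F (hc i) (y i False) (y i True)" using that by (simp add: csrc_def)
  show "y i False : gHom (Oc Z w (hc i)) (ch F (hc i))" "y i True : gHom (Oc Z w U01) (ch F U01)" using resD(1,2)[OF r] by simp_all
  show "y i True (- w) one = res F (hc i) (- w) (y i False (- w) one)" using resD(3)[OF r, of one "- w"] one[of "hc i"] by simp
 qed
 have eA: "e y : ?A'" if "y : ?A" for y unfolding ssrc_def e_def using gin[OF gHom_g[OF y(1)[OF that]] one] by simp
 have d: "e' (cdiff y) = sdiff F (- w) (e y)" if "y : ?A" for y
  using y(3)[OF that, of True] y(3)[OF that, of False] by (simp add: e'_def cdiff_def sdiff_def e_def hc_def minus_apply[of "y True True"] minus_apply[of "y True True _"])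
 have surj: "EX y:?A. e y = x" if x: "x : ?A'" for x
 proof -
  have "EX f h. restricts ?V F (hc i) f h & f (- w) one = x i" for i using restricts_O_ex[where w = w and a = "x i", OF F hchart_U01[of i]] x unfolding ssrc_def by blast
  then obtain f h where fh: "!!i. restricts ?V F (hc i) (f i) (h i)" "!!i. f i (- w) one = x i" by metis
  have "(%i k. if k then h i else f i) : ?A" using fh(1) by (simp add: csrc_def)
  moreover have "e (%i k. if k then h i else f i) = x" using fh(2) by (simp add: e_def)
  ultimately show ?thesis by blast
 qed
 have e'_inj: "g = h" if "g : cech1 ?V F" "h : cech1 ?V F" "e' g = e' h" for g h using gHom_O_eq[OF gm, of g w U01 h] that by (simp add: cech1_def e'_def)
 have e'surj: "e' ` cech1 ?V F = sx F U01 (- w)"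
 proof (intro equalityI subsetI)
  fix a assume "a : sx F U01 (- w)"
  then obtain f where "f : gHom (Oc Z w U01) (ch F U01)" "f (- w) one = a" by (rule gHom_O_ex[OF gm])
  thus "a : e' ` cech1 ?V F" by (auto simp: e'_def cech1_def)
 next
  fix a assume "a : e' ` cech1 ?V F"
  then obtain f where f: "f : gHom (Oc Z w U01) (ch F U01)" "a = f (- w) one" by (auto simp: e'_def cech1_def)
  thus "a : sx F U01 (- w)" using gin[OF gHom_g[OF f(1)] one] by simp
 qed
 have sB: "hs.subspace (cech1 ?V F)" unfolding cech1_def by (rule subspace_gHom[OF gm])
 note sI' = xa.image_on[OF linear_sdiff[OF F] subspace_ssrc[OF F]]
 have coker: "cdiff ` ?A = {g : cech1 ?V F. e' g : sdiff F (- w) ` ?A'}"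
 proof (intro equalityI subsetI)
  fix g assume "g : cdiff ` ?A"
  then obtain y where y: "y : ?A" "g = cdiff y" by blast
  thus "g : {g : cech1 ?V F. e' g : sdiff F (- w) ` ?A'}" using d[OF y(1)] eA[OF y(1)] cdiff_in[OF F] by auto
 next
  fix g assume "g : {g : cech1 ?V F. e' g : sdiff F (- w) ` ?A'}"
  then obtain x where x: "g : cech1 ?V F" "x : ?A'" "e' g = sdiff F (- w) x" by blast
  obtain y where y: "y : ?A" "e y = x" using surj[OF x(2)] by blast
  have "cdiff y : cech1 ?V F" using cdiff_in[OF F] y(1) by blast
  hence "g = cdiff y" using e'_inj[OF x(1)] x(3) d[OF y(1)] y(2) by simp
  thus "g : cdiff ` ?A" using y(1) by blast
 qed
 have e'0: "e' g = 0 <-> g = 0" if "g : cech1 ?V F" for g using e'_inj[OF that hs.subspace_0[OF sB]] by (auto simp: e'_def fun0)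
 have e_inj: "y = 0" if yA: "y : ?A" and e0: "e y = 0" for y
 proof (intro ext)
  fix i k
  have z: "0 : gHom (Oc Z w j) (ch F j)" for j using hs.subspace_0[OF subspace_gHom[OF gm]] .
  have 1: "y i False (- w) one = 0" using e0 unfolding e_def by (metis fun0)
  have 2: "y i True (- w) one = 0" using y(3)[OF yA, of i] 1 ghom_0[OF gm coh_res[OF F hchart_U01]] by simp
  have "y i False = 0" by (rule gHom_O_eq[OF gm y(1)[OF yA] z]) (simp add: 1 fun0)
  moreover have "y i True = 0" by (rule gHom_O_eq[OF gm y(2)[OF yA] z]) (simp add: 2 fun0)
  ultimately have "y i k = 0" by (cases k) simp_all
  thus "y i k u a n = 0 i k u a n" for u a n by (simp add: fun0)
 qed
 have ker: "e ` {y : ?A. cdiff y = 0} = {x : ?A'. sdiff F (- w) x = 0}"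
 proof (intro equalityI subsetI)
  fix x assume "x : {x : ?A'. sdiff F (- w) x = 0}"
  hence x: "x : ?A'" "sdiff F (- w) x = 0" by auto
  obtain y where y: "y : ?A" "e y = x" using surj[OF x(1)] by blast
  have "cdiff y = 0" using e'0[of "cdiff y"] cdiff_in[OF F] y d[OF y(1)] x(2) by auto
  thus "x : e ` {y : ?A. cdiff y = 0}" using y by blast
 next
  fix x assume "x : e ` {y : ?A. cdiff y = 0}"
  then obtain y where y: "y : ?A" "cdiff y = 0" "x = e y" by blast
  have "e' (cdiff y) = 0" unfolding y(2) by (simp add: e'_def zero_fun_def)
  thus "x : {x : ?A'. sdiff F (- w) x = 0}" using eA[OF y(1)] d[OF y(1)] y(3) by simp
 qed
 note sK = yh.subspace_kernel_on[OF linear_cdiff subspace_csrc[OF F]]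
 have k0: "{0} = {y : {y : ?A. cdiff y = 0}. e y : {0}}" using e_inj ys.subspace_0[OF sK] by (auto simp: e_def zero_fun_def)
 have z0: "{0} <= {x : ?A'. sdiff F (- w) x = 0}" using xs.subspace_0[OF xa.subspace_kernel_on[OF linear_sdiff[OF F] subspace_ssrc[OF F]]] by auto
 note k = yx.qd_iso[OF le sK xs.subspace_single_0 ker k0 z0] yx.finq_iso[OF le sK xs.subspace_single_0 ker k0 z0]
 note c = ha.qd_iso[OF le' sB sI' e'surj coker sdiff_in[OF F]] ha.finq_iso[OF le' sB sI' e'surj coker sdiff_in[OF F]]
 show "fredholm_pair ?V F <-> fredholm_sec F (- w)" unfolding fredholm_pair_def fredholm_sec_def fredholm_def using k(2) c(2) by simp
 show "index ysc hsc ?A (cech1 ?V F) cdiff = chs F (- w)" unfolding chs_def index_def using k(1) c(1) by simp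
qed

lemma
 assumes ses: "sexact Z E f F g G" and fE: "fredholm_sec E v"
 shows fredholm_sec_ses: "fredholm_sec F v <-> fredholm_sec G v"
  and chi_sec_ses: "fredholm_sec F v ==> chs F v = chs E v + chs G v"
proof -
 note E = ses_coh(1)[OF ses] and F = ses_coh(2)[OF ses] and G = ses_coh(3)[OF ses]
 note f = ses_Hom(1)[OF ses] and g = ses_Hom(2)[OF ses]
 interpret xx: vector_space_pair "xsc :: 'b => (bool => 'b amb) => _" "xsc :: 'b => (bool => 'b amb) => _" ..
 define al where "al x = (%i. f (hc i) v (x i))" for x
 define ga where "ga x = (%i. g (hc i) v (x i))" for x
 have xin: "x i : gsp (ch H (hc i)) v" if "x : ssrc H v" for x i and H :: "('a, 'b) sheaf" using that by (simp add: ssrc_def)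
 have lal: "lin_on xsc xsc (ssrc E v) al" unfolding lin_on_def al_def using xin ghom_add[OF Hom_g[OF f]] ghom_asc[OF Hom_g[OF f]]
  by (auto simp: plus_fun_def[of "_ :: bool => _"])
 have lga: "lin_on xsc xsc (ssrc F v) ga" unfolding lin_on_def ga_def using xin ghom_add[OF Hom_g[OF g]] ghom_asc[OF Hom_g[OF g]]
  by (auto simp: plus_fun_def[of "_ :: bool => _"])
 have im: "al ` ssrc E v = {x : ssrc F v. ga x = 0}"
 proof (intro equalityI subsetI)
  fix x assume "x : al ` ssrc E v"
  then obtain y where y: "y : ssrc E v" "x = al y" by blast
  have "x i : {b : gsp (ch F (hc i)) v. g (hc i) v b = 0}" for i unfolding ses_ex[OF ses, symmetric] y(2) al_def using xin[OF y(1)] by blast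
  thus "x : {x : ssrc F v. ga x = 0}" by (auto simp: ssrc_def ga_def zero_fun_def)
 next
  fix x assume x: "x : {x : ssrc F v. ga x = 0}"
  have "g (hc i) v (x i) = 0" for i using x unfolding ga_def by (metis (mono_tags, lifting) mem_Collect_eq fun0)
  hence "x i : f (hc i) v ` gsp (ch E (hc i)) v" for i unfolding ses_ex[OF ses] using x by (auto simp: ssrc_def)
  hence "EX y. y : gsp (ch E (hc i)) v & x i = f (hc i) v y" for i by blast
  then obtain y where "!!i. y i : gsp (ch E (hc i)) v & x i = f (hc i) v (y i)" by metis
  hence "y : ssrc E v" "x = al y" by (auto simp: ssrc_def al_def)
  thus "x : al ` ssrc E v" by blast
 qed
 have inj: "x = 0" if "x : ssrc E v" "al x = 0" for x
 proof
  fix i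
  have "f (hc i) v (x i) = 0" using that(2) unfolding al_def by (metis fun0)
  thus "x i = 0 i" using ses_inj[OF ses xin[OF that(1)]] by (simp add: fun0)
 qed
 have surj: "ga ` ssrc F v = ssrc G v"
 proof (intro equalityI subsetI)
  fix x assume "x : ga ` ssrc F v"
  thus "x : ssrc G v" using gin[OF Hom_g[OF g]] by (auto simp: ssrc_def ga_def)
 next
  fix x assume "x : ssrc G v"
  hence "x i : g (hc i) v ` gsp (ch F (hc i)) v" for i unfolding ses_surj[OF ses] by (rule xin)
  hence "EX y. y : gsp (ch F (hc i)) v & x i = g (hc i) v y" for i by blast
  then obtain y where "!!i. y i : gsp (ch F (hc i)) v & x i = g (hc i) v (y i)" by metis
  hence "y : ssrc F v" "x = ga y" by (auto simp: ssrc_def ga_def)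
  thus "x : ga ` ssrc F v" by blast
 qed
 have x2: "x True : sx H U1 v" "x False : sx H U0 v" if "x : ssrc H v" for x and H :: "('a, 'b) sheaf"
  using xin[OF that, of True] xin[OF that, of False] by (simp_all add: hc_def)
 have cE: "sdiff F v (al x) = f U01 v (sdiff E v x)" if "x : ssrc E v" for x
  using Hom_res[OF f chart.distinct(5) x2(1)[OF that]] Hom_res[OF f chart.distinct(3) x2(2)[OF that]]
   ghom_diff[OF cgm[OF E] Hom_g[OF f] gin[OF coh_res[OF E chart.distinct(5)] x2(1)[OF that]] gin[OF coh_res[OF E chart.distinct(3)] x2(2)[OF that]]]
  by (simp add: sdiff_def al_def hc_def)
 have cF: "sdiff G v (ga x) = g U01 v (sdiff F v x)" if "x : ssrc F v" for x
  using Hom_res[OF g chart.distinct(5) x2(1)[OF that]] Hom_res[OF g chart.distinct(3) x2(2)[OF that]]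
   ghom_diff[OF cgm[OF F] Hom_g[OF g] gin[OF coh_res[OF F chart.distinct(5)] x2(1)[OF that]] gin[OF coh_res[OF F chart.distinct(3)] x2(2)[OF that]]]
  by (simp add: sdiff_def ga_def hc_def)
 note add = xa.index_additive[OF subspace_ssrc[OF E] subspace_ssrc[OF F] gm_subspace[OF cgm[OF E]] gm_subspace[OF cgm[OF F]]
  lal im inj lga surj ghom_lin[OF Hom_g[OF f]] ses_ex[OF ses] ses_inj[OF ses] ghom_lin[OF Hom_g[OF g]] ses_surj[OF ses]
  linear_sdiff[OF E] sdiff_in[OF E] linear_sdiff[OF F] sdiff_in[OF F] linear_sdiff[OF G] cE cF fE[unfolded fredholm_sec_def]]
 show "fredholm_sec F v <-> fredholm_sec G v" unfolding fredholm_sec_def by (rule add(1))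
 show "fredholm_sec F v ==> chs F v = chs E v + chs G v" unfolding fredholm_sec_def chs_def by (rule add(2))
qed

subsection \<open>Cohomology of line bundles\<close>

definition supported :: "int set => 'k::field amb set" where "supported S = {p. ALL n. p n ~= 0 --> n : S}"

lemma subspace_supported: "asc.subspace (supported S)" by (rule asc.subspaceI) (auto simp: supported_def asc_def funp fun0, metis add_0)

lemma dim_supported:
 assumes "finite S"
 shows "finq asc {0} (supported S :: 'k::field amb set)" "qd asc {0} (supported S :: 'k amb set) = card S"
proof -
 let ?B = "(delta :: int => 'k amb) ` S"
 have inj: "inj (delta :: int => 'k amb)" by (rule injI) (metis delta_def zero_neq_one)
 have sp: "asc.span ?B = supported S"
 proof
  show "asc.span ?B <= supported S" by (rule asc.span_minimal[OF _ subspace_supported]) (auto simp: supported_def delta_def split: if_splits)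
  show "supported S <= asc.span ?B"
  proof
   fix p :: "'k amb" assume "p : supported S"
   hence "p = (SUM n:S. asc (p n) (delta n))" using delta_sum[OF assms, of p] by (simp add: supported_def)
   also have "... : asc.span ?B" by (rule asc.span_sum) (auto intro: asc.span_scale asc.span_base)
   finally show "p : asc.span ?B" .
  qed
 qed
 have "asc.independent ?B" unfolding asc.dependent_def
 proof (intro notI, elim bexE)
  fix b assume b: "b : ?B" "b : asc.span (?B - {b})"
  then obtain n where n: "n : S" "b = delta n" by blast
  have "?B - {b} <= supported (S - {n})" using n by (auto simp: supported_def delta_def split: if_splits)
  hence "asc.span (?B - {b}) <= supported (S - {n})" by (rule asc.span_minimal[OF _ subspace_supported])
  from subsetD[OF this b(2)] have "ALL k. (delta n :: 'k amb) k ~= 0 --> k : S - {n}" unfolding n(2) by (simp add: supported_def)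
  from this[rule_format, of n] show False by (simp add: delta_def)
 qed
 thus "finq asc {0} (supported S :: 'k amb set)" "qd asc {0} (supported S :: 'k amb set) = card S"
  using asc.quot_dim_0_independent[of ?B] assms card_image[OF inj_on_subset[OF inj], of S] sp by simp_all
qed

text \<open>The kernel has the monomials with \<open>0 <= n <= m\<close> as a basis, the cokernel
  those with \<open>m < n < 0\<close>. The difference of the two numbers is \<open>m + 1\<close>,
  whatever the sign of \<open>m\<close>.\<close>

lemma
 shows fredholm_sec_O: "fredholm_sec (Os Z u :: ('n::finite, 'k::field) sheaf) v"
  and chi_sec_O: "chs (Os Z u :: ('n, 'k) sheaf) v = pmul (u + v) + 1"
proof -
 let ?F = "Os Z u :: ('n, 'k) sheaf"
 define m where "m = pmul (u + v)"
 note F = coh_O[of Z u]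
 let ?A = "ssrc ?F v" and ?d = "sdiff ?F v"
 let ?R = "%j. Rp j (u + v) :: 'k amb set"
 have A: "x : ?A <-> x False : ?R U0 & x True : ?R U1" for x unfolding ssrc_def by (simp add: hc_def) (metis (full_types))
 have d: "?d x = x True - x False" for x by (simp add: sdiff_def)
 have fin: "finite {n. p n ~= (0::'k)}" if "p : supported S" "finite S" for p S using that by (auto simp: supported_def intro: finite_subset)
 note sK = xa.subspace_kernel_on[OF linear_sdiff[OF F] subspace_ssrc[OF F]]
 have lin: "lin_on xsc asc W (%x. x True)" for W by (auto simp: lin_on_def funp)
 have im: "(%x. x True) ` {x : ?A. ?d x = 0} = supported {0..m}"
 proof (intro equalityI subsetI)
  fix p :: "'k amb" assume "p : (%x. x True) ` {x : ?A. ?d x = 0}"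
  hence "p : ?R U0" "p : ?R U1" by (auto simp: A d)
  thus "p : supported {0..m}" by (auto simp: Rp_def supported_def m_def not_less[symmetric])
 next
  fix p :: "'k amb" assume p: "p : supported {0..m}"
  hence "(%_. p) : {x : ?A. ?d x = 0}" using fin[OF p] by (auto simp: A d Rp_def supported_def m_def)
  thus "p : (%x. x True) ` {x : ?A. ?d x = 0}" by force
 qed
 have k0: "{0} = {x : {x : ?A. ?d x = 0}. x True : {0}}"
 proof -
  have "x = 0" if "x True = 0" "x True - x False = 0" for x :: "bool => 'k amb"
  proof
   show "x i = 0 i" for i using that by (cases i) (auto simp: fun0)
  qed
  thus ?thesis using xs.subspace_0[OF sK] by (auto simp: d fun0)
 qed
 have z: "{0} <= (supported S :: 'k amb set)" for S using asc.subspace_0[OF subspace_supported] by auto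
 note k = xa.qd_iso[OF lin sK asc.subspace_single_0 im k0 z] xa.finq_iso[OF lin sK asc.subspace_single_0 im k0 z]
 \<comment> \<open>The exponents strictly between \<open>m\<close> and 0 are those that occur on
   neither \<open>U0\<close> nor \<open>U1\<close>.\<close>
 define pr where "pr p = (%n. if m < n & n < 0 then p n else 0)" for p :: "'k amb"
 have lp: "lin_on asc asc W pr" for W by (auto simp: lin_on_def pr_def plus_fun_def asc_def)
 have imp: "pr ` ?R U01 = supported {m<..<0}"
 proof (intro equalityI subsetI)
  fix p :: "'k amb" assume p: "p : supported {m<..<0}"
  hence "pr p = p" by (auto simp: pr_def supported_def fun_eq_iff)
  moreover have "p : ?R U01" using fin[OF p] by (simp add: Rp_def)
  ultimately show "p : pr ` ?R U01" by (metis imageI)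
 qed (auto simp: pr_def supported_def split: if_splits)
 have ker: "?d ` ?A = {p : ?R U01. pr p : {0}}"
 proof (intro equalityI subsetI)
  fix p :: "'k amb" assume "p : ?d ` ?A"
  then obtain x where x: "x False : ?R U0" "x True : ?R U1" "p = x True - x False" by (auto simp: A d)
  have "p : ?R U01" using sdiff_in[OF F, of v] \<open>p : ?d ` ?A\<close> by auto
  moreover have "pr p = 0" using x by (auto simp: pr_def Rp_def m_def zero_fun_def minus_apply)
  ultimately show "p : {p : ?R U01. pr p : {0}}" by simp
 next
  fix p :: "'k amb" assume p: "p : {p : ?R U01. pr p : {0}}"
  hence fp: "finite {n. p n ~= 0}" by (simp add: Rp_def)
  have p0: "p n = 0" if "m < n" "n < 0" for n using p that unfolding pr_def by (auto simp: zero_fun_def fun_eq_iff) metis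
  define x where "x i = (if i then (%n. if n >= 0 then 0 else p n) else (%n. if n >= 0 then - p n else 0))" for i :: bool
  have f1: "finite {n. x i n ~= 0}" for i by (rule finite_subset[OF _ fp]) (auto simp: x_def split: if_splits)
  have "x True n = 0" if "n > m" for n using p0[of n] that by (auto simp: x_def)
  hence "x : ?A" using f1[of True] f1[of False] by (auto simp: A Rp_def m_def) (auto simp: x_def)
  moreover have "?d x = p" unfolding d by (auto simp: x_def minus_apply)
  ultimately show "p : ?d ` ?A" by blast
 qed
 note c = asc2.qd_iso[OF lp sub_Rp asc.subspace_single_0 imp ker z] asc2.finq_iso[OF lp sub_Rp asc.subspace_single_0 imp ker z]
 show "fredholm_sec ?F v" unfolding fredholm_sec_def fredholm_def using k(2) c(2) dim_supported(1)[where 'k = 'k and S = "{0..m}"] dim_supported(1)[where 'k = 'k and S = "{m<..<0}"] by simp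
 show "chs ?F v = pmul (u + v) + 1"
  unfolding chs_def index_def using k(1) c(1) dim_supported(2)[where 'k = 'k and S = "{0..m}"] dim_supported(2)[where 'k = 'k and S = "{m<..<0}"] by (simp add: m_def)
qed

subsection \<open>Extensions by line bundles\<close>

definition cmp :: "(('n,'k) mp) => (('n,'k) mp) => ('n,'k) mp" where
 "cmp h f = (%u x. h u (f u x))"

lemma cmp_0: "cmp h f = 0 ==> h u (f u y) = 0" by (drule fun_cong[of _ _ u], drule fun_cong[of _ _ y]) (simp add: cmp_def zero_fun_def)

lemma cmp_gHom:
 assumes M: "gmd Z j M'" and f: "f : gHom M M'" and h: "h : gHom M' N"
 shows "cmp h f : gHom M N" unfolding cmp_def by (rule gHomI[OF ghom_comp[OF gHom_g[OF f] gHom_g[OF h]]])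
  (simp add: gHom_out[OF f] ghom_0[OF M gHom_g[OF h]])

text \<open>Every extension of a line bundle splits on a chart, because the section \<open>one\<close> lifts.\<close>
locale csplit =
 fixes Z :: "'n::finite => 'k::field * 'k" and j :: chart
  and M' M :: "('n, 'k) gmod" and f g :: "('n,'k) mp" and a :: "'n pic" and e :: "'k amb"
 assumes M': "gmd Z j M'" and M: "gmd Z j M"
  and f: "f : gHom M' M" and g: "g : gHom M (Oc Z a j)"
  and inj: "!!u x. x : gsp M' u ==> f u x = 0 ==> x = 0"
  and ex: "!!u. f u ` gsp M' u = {x : gsp M u. g u x = 0}"
  and e: "e : gsp M (- a)" "g (- a) e = one"
begin

lemma gf_0: "y : gsp M' u ==> g u (f u y) = 0" using imageI[of y "gsp M' u" "f u"] unfolding ex by simp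

text \<open>\<open>P\<close> sends the generator to the lift \<open>e\<close>, and \<open>p\<close>
  is the complementary retraction onto \<open>M'\<close>: it divides \<open>x - P (g x)\<close>,
  which lies in the kernel of \<open>g\<close>, by the injection \<open>f\<close>.\<close>

lemma split_ex: "EX P p. ghom (Oc Z a j) M P & P (- a) one = e & ghom M M' p &
  (ALL u. ALL x:gsp M u. x = f u (p u x) + P u (g u x)) & (ALL u. ALL c:Rp j (a + u). g u (P u c) = c)"
proof -
 note O = gm_O[of Z j a] and gf = gHom_g[OF f] and gg = gHom_g[OF g]
 obtain P where P: "ghom (Oc Z (- (- a)) j) M P" "P (- a) one = e" by (rule O_hom_ex[OF M e(1)])
 have P1: "ghom (Oc Z a j) M P" using P(1) by simp
 have gP: "g u (P u c) = c" if c: "c : Rp j (a + u)" for u c by (rule O_hom_unique[where f = "%u x. g u (P u x)" and g = "%u x. x", OF O _ _ _ c])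
   (use ghom_comp[OF P1 gg] P(2) e(2) ghom_id in simp_all)
 note h = ghom_lincomb[OF M ghom_id ghom_comp[OF gg P1], of "- 1"]
 have im: "x + asc (- 1) (P u (g u x)) : f u ` gsp M' u" if x: "x : gsp M u" for u x
 proof -
  note gx = gin[OF gg x] and Pin = gin[OF P1 gin[OF gg x]]
  have "g u (x + asc (- 1) (P u (g u x))) = 0" unfolding ghom_add[OF gg x gm_asc[OF M Pin]] ghom_asc[OF gg Pin] using gP[of "g u x" u] gx by simp
  thus ?thesis unfolding ex using gin[OF h x] by simp
 qed
 have "EX p. ghom M M' p & (ALL u. ALL x:gsp M u. f u (p u x) = x + asc (- 1) (P u (g u x)))" by (rule ghom_factor[OF M' M gf h inj im])
 then obtain p where "ghom M M' p" "!!u x. x : gsp M u ==> f u (p u x) = x + asc (- 1) (P u (g u x))" by blast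
 thus ?thesis using P1 P(2) gP by (intro exI[of _ P] exI[of _ p]) simp
qed

lemma split_unique:
 assumes N: "gmd Z j N" and h: "ghom M N h" and k: "ghom M N k"
  and eqf: "!!u y. y : gsp M' u ==> h u (f u y) = k u (f u y)" and eqe: "h (- a) e = k (- a) e" and x: "x : gsp M u"
 shows "h u x = k u x"
proof -
 obtain P p where P: "ghom (Oc Z a j) M P" "P (- a) one = e" and p: "ghom M M' p"
  and dec: "ALL u. ALL x:gsp M u. x = f u (p u x) + P u (g u x)" using split_ex by (elim exE conjE)
 note gx = gin[OF gHom_g[OF g] x]
 have 1: "h u (P u (g u x)) = k u (P u (g u x))"
  by (rule O_hom_unique[where f = "%u x. h u (P u x)" and g = "%u x. k u (P u x)", OF N ghom_comp[OF P(1) h] ghom_comp[OF P(1) k]])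
   (use P(2) eqe gx in simp_all)
 have in1: "f u (p u x) : gsp M u" "P u (g u x) : gsp M u" using gin[OF gHom_g[OF f] gin[OF p x]] gin[OF P(1) gx] by auto
 have d: "x = f u (p u x) + P u (g u x)" using dec x by blast
 have "h u (f u (p u x) + P u (g u x)) = k u (f u (p u x) + P u (g u x))" unfolding ghom_add[OF h in1] ghom_add[OF k in1] 1 eqf[OF gin[OF p x]] ..
 thus ?thesis unfolding d[symmetric] .
qed

lemma split_extend:
 assumes N: "gmd Z j N" and h: "h : gHom M' N"
 obtains k where "k : gHom M N" "cmp k f = h" "k (- a) e = 0"
proof -
 obtain P p where P: "ghom (Oc Z a j) M P" "P (- a) one = e" and p: "ghom M M' p"
  and dec: "ALL u. ALL x:gsp M u. x = f u (p u x) + P u (g u x)" using split_ex by (elim exE conjE)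
 note gf = gHom_g[OF f] and gg = gHom_g[OF g] and gh = gHom_g[OF h]
 define k where "k = (%u x. if x : gsp M u then h u (p u x) else 0)"
 have k: "k : gHom M N" unfolding k_def by (rule gHom_cut[OF M ghom_comp[OF p gh]])
 have pf: "p u (f u y) = y" if y: "y : gsp M' u" for u y
 proof -
  note fy = gin[OF gf y]
  have "g u (f u y) = 0" by (rule gf_0[OF y])
  hence "P u (g u (f u y)) = 0" using ghom_0[OF gm_O P(1)] by simp
  hence "f u y = f u (p u (f u y))" using dec[rule_format, OF fy] by simp
  hence "f u (y - p u (f u y)) = 0" using ghom_diff[OF M' gf y gin[OF p fy]] by simp
  thus ?thesis using inj[OF gm_diff[OF M' y gin[OF p fy]]] by simp
 qed
 have "cmp k f = h"
 proof (rule gHom_eqI[OF cmp_gHom[OF M f k] h])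
  show "cmp k f u y = h u y" if "y : gsp M' u" for u y using gin[OF gf that] pf[OF that] by (simp add: cmp_def k_def)
 qed
 moreover have "k (- a) e = 0"
 proof -
  have "e = f (- a) (p (- a) e) + P (- a) (g (- a) e)" using dec e(1) by blast
  hence "f (- a) (p (- a) e) = 0" using e(2) P(2) by simp
  hence "p (- a) e = 0" using inj[OF gin[OF p e(1)]] by simp
  thus ?thesis using ghom_0[OF M' gh] by (simp add: k_def)
 qed
 ultimately show thesis using k that by blast
qed

lemma split_factor:
 assumes N: "gmd Z j N" and h: "h : gHom M N" and h0: "cmp h f = 0"
  and q: "q : gHom (Oc Z a j) N" "q (- a) one = h (- a) e"
 shows "cmp q g = h"
proof (rule gHom_eqI[OF cmp_gHom[OF gm_O g q(1)] h])
 fix u x assume x: "x : gsp M u"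
 show "cmp q g u x = h u x" unfolding cmp_def
 proof (rule split_unique[where h = "%u x. q u (g u x)" and k = h, OF N ghom_comp[OF gHom_g[OF g] gHom_g[OF q(1)]] gHom_g[OF h] _ _ x])
  fix u y assume y: "y : gsp M' u"
  have "g u (f u y) = 0" by (rule gf_0[OF y])
  moreover have "h u (f u y) = 0" by (rule cmp_0[OF h0])
  ultimately show "q u (g u (f u y)) = h u (f u y)" using ghom_0[OF gm_O gHom_g[OF q(1)]] by simp
 qed (use e(2) q(2) in simp)
qed

lemma g_surj: "c : Rp j (a + u) ==> EX x:gsp M u. g u x = c"
proof -
 obtain P p where P: "ghom (Oc Z a j) M P" "ALL u. ALL c:Rp j (a + u). g u (P u c) = c" using split_ex by (elim exE conjE)
 show "c : Rp j (a + u) ==> EX x:gsp M u. g u x = c" using P(2) gin[OF P(1), of c u] by (intro bexI[of _ "P u c"]) simp_all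
qed

lemma cmp_g_inj:
 assumes N: "gmd Z j N" and q: "q : gHom (Oc Z a j) N" and 0: "cmp q g = 0"
 shows "q = 0"
proof (rule gHom_eqI[OF q hs.subspace_0[OF subspace_gHom[OF N]]])
 fix u c assume "c : gsp (Oc Z a j) u"
 hence "EX x:gsp M u. g u x = c" by (intro g_surj) simp
 then obtain x where x: "x : gsp M u" "g u x = c" by (elim bexE)
 have "q u (g u x) = 0" by (rule cmp_0[OF 0])
 thus "q u c = 0 u c" using x(2) by (simp add: fun0[of u] fun0[of c])
qed

end

definition pull :: "('n, 'k) shmap => (bool => bool => ('n,'k) mp) => bool => bool => ('n,'k) mp" where
 "pull ph y = (%i k. cmp (y i k) (ph (if k then U01 else hc i)))"

lemma pull_eq: "pull f y = z <-> (ALL i k. cmp (y i k) (f (if k then U01 else hc i)) = z i k)"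
 by (simp only: pull_def fun_eq_iff[where f = "%i k. cmp (y i k) (f (if k then U01 else hc i))"]
  fun_eq_iff[where f = "%k. cmp (y _ k) (f (if k then U01 else hc _))"])

lemma pull_0: "pull f y = 0 <-> (ALL i k. cmp (y i k) (f (if k then U01 else hc i)) = 0)" unfolding pull_eq by (simp add: fun0[where x = "_::bool"])

lemma Hom_gHom: "f : Hom E F ==> f j : gHom (ch E j) (ch F j)" by (simp add: Hom_def)

lemma pull_csrc:
 assumes W: "cohr Z W" and V: "cohr Z V" and ph: "ph : Hom V W" and y: "y : csrc W F"
 shows "pull ph y : csrc V F" unfolding csrc_def
proof (intro CollectI allI)
 fix i
 have r: "restricts W F (hc i) (y i False) (y i True)" using y by (simp add: csrc_def)
 note P = Hom_gHom[OF ph]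
 show "restricts V F (hc i) (pull ph y i False) (pull ph y i True)" unfolding restricts_def
 proof (intro conjI allI ballI)
  show "pull ph y i False : gHom (ch V (hc i)) (ch F (hc i))" using cmp_gHom[OF cgm[OF W] P resD(1)[OF r]] by (simp add: pull_def)
  show "pull ph y i True : gHom (ch V U01) (ch F U01)" using cmp_gHom[OF cgm[OF W] P resD(2)[OF r]] by (simp add: pull_def)
  show "pull ph y i True u (res V (hc i) u x) = res F (hc i) u (pull ph y i False u x)" if x: "x : gsp (ch V (hc i)) u" for u x
   using Hom_res[OF ph hchart_U01 x] resD(3)[OF r gin[OF Hom_g[OF ph] x]] by (simp add: pull_def cmp_def)
 qed
qed

lemma cdiff_pull: "cdiff (pull ph y) = cmp (cdiff y) (ph U01)" by (simp add: cdiff_def pull_def cmp_def fun_eq_iff minus_apply)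

lemma linear_pull: "lin_on ysc ysc W (pull ph)" by (auto simp: lin_on_def pull_def cmp_def plus_fun_def fun_eq_iff)

lemma linear_cmp: "lin_on hsc hsc W (%h. cmp h f)" by (auto simp: lin_on_def cmp_def plus_fun_def fun_eq_iff)

text \<open>On each chart the sequence splits, so homomorphisms into \<open>F\<close> form short
  exact sequences there, and so do the Cech complexes. The functor is contravariant, which puts the
  line bundle in the first place of \<open>index_additive\<close>.\<close>

lemma
 fixes Z :: "'n::finite => 'k::field * 'k"
 assumes ses: "sexact Z V' f V g (Os Z a)" and F: "cohr Z F"
  and fO: "fredholm_pair (Os Z a) F"
 shows fredholm_ext: "fredholm_pair V F <-> fredholm_pair V' F"
  and index_ext: "fredholm_pair V F ==> int (dim_Hom V F) - int (dim_Ext1 V F) =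
   chs F (- a) + (int (dim_Hom V' F) - int (dim_Ext1 V' F))"
proof -
 note V' = ses_coh(1)[OF ses] and V = ses_coh(2)[OF ses] and O = ses_coh(3)[OF ses]
 note f = ses_Hom(1)[OF ses] and g = ses_Hom(2)[OF ses] and gm = cgm[OF F]
 let ?O = "Os Z a"
 have "EX e. e : gsp (ch V (hc i)) (- a) & g (hc i) (- a) e = one" for i
 proof -
  have "one : g (hc i) (- a) ` gsp (ch V (hc i)) (- a)" unfolding ses_surj[OF ses] using one_in[of Z a "hc i"] by simp
  thus ?thesis by (elim imageE) (rule exI, rule conjI, assumption, rule sym)
 qed
 then obtain e where e: "!!i. e i : gsp (ch V (hc i)) (- a)" "!!i. g (hc i) (- a) (e i) = one" by metis
 \<comment> \<open>The lifts of \<open>one\<close> on the two charts may restrict to different lifts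
   on \<open>U01\<close>. The two copies of homomorphisms over \<open>U01\<close> are therefore
   normalized on different elements, which makes the extensions compatible with restriction.\<close>
 define e' where "e' i = res V (hc i) (- a) (e i)" for i
 have split: "csplit Z j (ch V' j) (ch V j) (f j) (g j) a x"
  if "x : sx V j (- a)" "g j (- a) x = one" for j x by (rule csplit.intro[OF cgm[OF V'] cgm[OF V] Hom_gHom[OF f] _ ses_inj[OF ses] ses_ex[OF ses] that])
   (use Hom_gHom[OF g, of j] in simp_all)
 have sp: "csplit Z (hc i) (ch V' (hc i)) (ch V (hc i)) (f (hc i)) (g (hc i)) a (e i)" for i by (rule split[OF e])
 have e'1: "e' i : sx V U01 (- a)" "g U01 (- a) (e' i) = one" for i
  using gin[OF coh_res[OF V hchart_U01] e(1)] Hom_res[OF g hchart_U01 e(1)] e(2) by (simp_all add: e'_def)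
 have sp01: "csplit Z U01 (ch V' U01) (ch V U01) (f U01) (g U01) a (e' i)" for i by (rule split[OF e'1])
 have gf: "g j u (f j u y) = 0" if "y : sx V' j u" for j u y using imageI[OF that, of "f j u"] unfolding ses_ex[OF ses] by simp
 have yin: "y i False : gHom (ch W (hc i)) (ch F (hc i))" "y i True : gHom (ch W U01) (ch F U01)"
  if "y : csrc W F" for y i and W :: "('n, 'k) sheaf" using that resD(1,2) unfolding csrc_def by blast+
 have cmp00: "cmp (cmp q (g j)) (f j) = 0" if "q : gHom (ch ?O j) N" for q j and N :: "('n, 'k) gmod"
 proof (intro ext)
  fix u y n
  show "cmp (cmp q (g j)) (f j) u y n = 0 u y n"
  proof (cases "y : sx V' j u")
   case True
   thus ?thesis using gf[OF True] ghom_0[OF cgm[OF O] gHom_g[OF that]] by (simp add: cmp_def fun0)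
  next
   case False
   thus ?thesis using Hom_outside[OF f False] ghom_0[OF cgm[OF V] Hom_g[OF g]] ghom_0[OF cgm[OF O] gHom_g[OF that]] by (simp add: cmp_def fun0)
  qed
 qed
 have ex1: "pull g ` csrc ?O F = {y : csrc V F. pull f y = 0}"
 proof (intro equalityI subsetI)
  fix y assume "y : pull g ` csrc ?O F"
  then obtain z where z: "z : csrc ?O F" "y = pull g z" by blast
  have "cmp (y i k) (f (if k then U01 else hc i)) = 0" for i k
   unfolding z(2) pull_def using cmp00[OF yin(1)[OF z(1), of i]] cmp00[OF yin(2)[OF z(1), of i]] by (cases k) simp_all
  hence "pull f y = 0" unfolding pull_0 by simp
  thus "y : {y : csrc V F. pull f y = 0}" using pull_csrc[OF O V g z(1)] z(2) by simp
 next
  fix y assume "y : {y : csrc V F. pull f y = 0}"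
  hence y: "y : csrc V F" and y0: "!!i k. cmp (y i k) (f (if k then U01 else hc i)) = 0" unfolding pull_0 by simp_all
  have r: "restricts V F (hc i) (y i False) (y i True)" for i using y by (simp add: csrc_def)
  have "EX q h. restricts ?O F (hc i) q h & q (- a) one = y i False (- a) (e i) & h (- a) one = y i True (- a) (e' i)" for i
  proof -
   have "y i False (- a) (e i) : gsp (ch F (hc i)) (- a)" by (rule gin[OF gHom_g[OF yin(1)[OF y]] e(1)])
   from restricts_O_ex[OF F hchart_U01 this] obtain q h where "restricts ?O F (hc i) q h" "q (- a) one = y i False (- a) (e i)"
    "h (- a) one = res F (hc i) (- a) (y i False (- a) (e i))" by blast
   thus ?thesis using resD(3)[OF r e(1)] by (auto simp: e'_def)
  qed
  then obtain q h where qh: "!!i. restricts ?O F (hc i) (q i) (h i)" "!!i. q i (- a) one = y i False (- a) (e i)"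
   "!!i. h i (- a) one = y i True (- a) (e' i)" by metis
  define z where "z i k = (if k then h i else q i)" for i k
  have z: "z : csrc ?O F" using qh(1) by (simp add: csrc_def z_def)
  have "cmp (q i) (g (hc i)) = y i False" for i by (rule csplit.split_factor[where h = "y i False" and q = "q i", OF sp[of i] gm yin(1)[OF y, of i] _ _ qh(2)[of i]])
    (use y0[of i False] resD(1)[OF qh(1), of i] in simp_all)
  moreover have "cmp (h i) (g U01) = y i True" for i
   by (rule csplit.split_factor[where h = "y i True" and q = "h i", OF sp01[of i] gm yin(2)[OF y, of i] _ _ qh(3)[of i]])
    (use y0[of i True] resD(2)[OF qh(1), of i] in simp_all)
  ultimately have "pull g z i k = y i k" for i k by (cases k) (simp_all add: pull_def z_def)
  hence "y = pull g z" by (intro ext) (simp only:)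
  thus "y : pull g ` csrc ?O F" using z by blast
 qed
 have inj1: "y = 0" if y: "y : csrc ?O F" and y0: "pull g y = 0" for y
 proof -
  have c: "cmp (y i k) (g (if k then U01 else hc i)) = 0" for i k using y0 unfolding pull_0 by blast
  have "y i False = 0" "y i True = 0" for i using csplit.cmp_g_inj[where q = "y i False", OF sp[of i] gm] csplit.cmp_g_inj[where q = "y i True", OF sp01[of i] gm]
    c[of i False] c[of i True] yin[OF y, of i] by simp_all
  hence "y i k = 0" for i k by (cases k) simp_all
  thus "y = 0" by (intro ext) (simp add: fun0)
 qed
 have surj1: "pull f ` csrc V F = csrc V' F"
 proof (intro equalityI subsetI)
  fix y assume "y : pull f ` csrc V F"
  thus "y : csrc V' F" using pull_csrc[OF V V' f] by blast
 next
  fix y assume y: "y : csrc V' F"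
  have r: "restricts V' F (hc i) (y i False) (y i True)" for i using y by (simp add: csrc_def)
  have "EX h k. h : gHom (ch V (hc i)) (ch F (hc i)) & cmp h (f (hc i)) = y i False & h (- a) (e i) = 0 &
    k : gHom (ch V U01) (ch F U01) & cmp k (f U01) = y i True & k (- a) (e' i) = 0" for i
  proof -
   obtain h where h: "h : gHom (ch V (hc i)) (ch F (hc i))" "cmp h (f (hc i)) = y i False" "h (- a) (e i) = 0"
    using csplit.split_extend[OF sp[of i] gm yin(1)[OF y, of i]] by blast
   obtain k where k: "k : gHom (ch V U01) (ch F U01)" "cmp k (f U01) = y i True" "k (- a) (e' i) = 0"
    using csplit.split_extend[OF sp01[of i] gm yin(2)[OF y, of i]] by blast
   show ?thesis using h k by blast
  qed
  then obtain h k where hk: "!!i. h i : gHom (ch V (hc i)) (ch F (hc i))" "!!i. cmp (h i) (f (hc i)) = y i False"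
   "!!i. h i (- a) (e i) = 0" "!!i. k i : gHom (ch V U01) (ch F U01)" "!!i. cmp (k i) (f U01) = y i True" "!!i. k i (- a) (e' i) = 0" by metis
  define z where "z i l = (if l then k i else h i)" for i l
  have "restricts V F (hc i) (h i) (k i)" for i unfolding restricts_def
  proof (intro conjI allI ballI hk(1) hk(4))
   fix u x assume x: "x : gsp (ch V (hc i)) u"
   show "k i u (res V (hc i) u x) = res F (hc i) u (h i u x)"
   proof (rule csplit.split_unique[where h = "%u x. k i u (res V (hc i) u x)" and k = "%u x. res F (hc i) u (h i u x)",
     OF sp[of i] gmodule_weaken[OF gm] _ _ _ _ x])
    show "ghom (ch V (hc i)) (ch F U01) (%u x. k i u (res V (hc i) u x))" by (rule ghom_comp[OF coh_res[OF V hchart_U01] gHom_g[OF hk(4)]])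
    show "ghom (ch V (hc i)) (ch F U01) (%u x. res F (hc i) u (h i u x))" by (rule ghom_comp[OF gHom_g[OF hk(1)] coh_res[OF F hchart_U01]])
    show "k i (- a) (res V (hc i) (- a) (e i)) = res F (hc i) (- a) (h i (- a) (e i))" using hk(3,6) ghom_0[OF gm coh_res[OF F hchart_U01]] by (simp add: e'_def)
    fix v x assume x: "x : gsp (ch V' (hc i)) v"
    have "k i v (res V (hc i) v (f (hc i) v x)) = cmp (k i) (f U01) v (res V' (hc i) v x)" using Hom_res[OF f hchart_U01 x] by (simp add: cmp_def)
    also have "... = res F (hc i) v (cmp (h i) (f (hc i)) v x)" unfolding hk(5) hk(2) by (rule resD(3)[OF r x])
    finally show "k i v (res V (hc i) v (f (hc i) v x)) = res F (hc i) v (h i v (f (hc i) v x))" by (simp add: cmp_def)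
   qed
  qed
  hence z: "z : csrc V F" by (simp add: csrc_def z_def)
  have "pull f z i l = y i l" for i l using hk(2,5) by (cases l) (simp_all add: pull_def z_def)
  hence "y = pull f z" by (intro ext) (simp only:)
  thus "y : pull f ` csrc V F" using z by blast
 qed
 have inj2: "q = 0" if "q : cech1 ?O F" "cmp q (g U01) = 0" for q using csplit.cmp_g_inj[OF sp01[of False] gm, of q] that by (simp add: cech1_def)
 have ex2: "(%h. cmp h (g U01)) ` cech1 ?O F = {h : cech1 V F. cmp h (f U01) = 0}"
 proof (intro equalityI subsetI)
  fix h assume "h : (%h. cmp h (g U01)) ` cech1 ?O F"
  then obtain q where q: "q : gHom (ch ?O U01) (ch F U01)" "h = cmp q (g U01)" by (auto simp: cech1_def)
  show "h : {h : cech1 V F. cmp h (f U01) = 0}" unfolding q(2) cech1_def using cmp_gHom[OF cgm[OF O] Hom_gHom[OF g] q(1)] cmp00[OF q(1)] by simp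
 next
  fix h assume "h : {h : cech1 V F. cmp h (f U01) = 0}"
  hence h: "h : gHom (ch V U01) (ch F U01)" "cmp h (f U01) = 0" by (auto simp: cech1_def)
  obtain q where q: "q : gHom (Oc Z a U01) (ch F U01)" "q (- a) one = h (- a) (e' False)" by (rule gHom_O_ex[OF gm gin[OF gHom_g[OF h(1)] e'1(1)]])
  have "cmp q (g U01) = h" by (rule csplit.split_factor[OF sp01[of False] gm h q])
  thus "h : (%h. cmp h (g U01)) ` cech1 ?O F" using q(1) by (auto simp: cech1_def)
 qed
 have surj2: "(%h. cmp h (f U01)) ` cech1 V F = cech1 V' F"
 proof (intro equalityI subsetI)
  fix h assume h: "h : cech1 V' F"
  obtain k where "k : gHom (ch V U01) (ch F U01)" "cmp k (f U01) = h" using csplit.split_extend[OF sp01[of False] gm] h unfolding cech1_def by blast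
  thus "h : (%h. cmp h (f U01)) ` cech1 V F" by (auto simp: cech1_def)
 next
  fix h assume "h : (%h. cmp h (f U01)) ` cech1 V F"
  thus "h : cech1 V' F" using cmp_gHom[OF cgm[OF V] Hom_gHom[OF f]] by (auto simp: cech1_def)
 qed
 have sB: "hs.subspace (cech1 W F)" for W unfolding cech1_def by (rule subspace_gHom[OF gm])
 note facts = subspace_csrc[OF F] sB linear_pull ex1 surj1 linear_cmp ex2 surj2 linear_cdiff cdiff_in[OF F]
  cdiff_pull fO[unfolded fredholm_pair_def]
 note add = yh.index_additive[where al = "pull g" and ?al2.0 = "pull f" and be = "%h. cmp h (g U01)" and ?be2.0 = "%h. cmp h (f U01)"
  and de = cdiff and ?de1.0 = cdiff and ?de2.0 = cdiff and ?A1.0 = "csrc ?O F" and A = "csrc V F" and ?A2.0 = "csrc V' F"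
  and ?B1.0 = "cech1 ?O F" and B = "cech1 V F" and ?B2.0 = "cech1 V' F"]
 show "fredholm_pair V F <-> fredholm_pair V' F" unfolding fredholm_pair_def by (rule add(1)) (rule facts | (erule inj1 inj2, assumption))+
 assume "fredholm_pair V F"
 hence fV: "fredholm ysc hsc (csrc V F) (cech1 V F) cdiff" unfolding fredholm_pair_def .
 have "index ysc hsc (csrc V F) (cech1 V F) cdiff =
  index ysc hsc (csrc ?O F) (cech1 ?O F) cdiff + index ysc hsc (csrc V' F) (cech1 V' F) cdiff" by (rule add(2)) (rule facts fV | (erule inj1 inj2, assumption))+
 thus "int (dim_Hom V F) - int (dim_Ext1 V F) = chs F (- a) + (int (dim_Hom V' F) - int (dim_Ext1 V' F))" unfolding index_O[OF F] unfolding index_csrc[OF F] .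
qed

subsection \<open>Filtrations by line bundles\<close>

inductive filt :: "('n::finite => 'k::field * 'k) => ('n, 'k) sheaf => 'n pic list => bool" for Z where
 Nil: "cohr Z V ==> (!!j u. sx V j u = {0}) ==> filt Z V []"
| Cons: "sexact Z V' f V g (Os Z a) ==> filt Z V' as ==> filt Z V (a # as)"

lemma gHom_from_zero:
 assumes M: "gmd Z j M" and 0: "!!u. gsp M u = {0}" and N: "gmd Z j N"
 shows "gHom M N = {0}"
proof -
 have "h = 0" if h: "h : gHom M N" for h by (rule gHom_eqI[OF h hs.subspace_0[OF subspace_gHom[OF N]]])
   (use 0 ghom_0[OF M gHom_g[OF h]] in "simp add: zero_fun_def")
 thus ?thesis using hs.subspace_0[OF subspace_gHom[OF N]] by blast
qed

lemma fredholm_from_zero: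
 assumes V: "cohr Z V" and 0: "!!j u. sx V j u = {0}" and F: "cohr Z F"
 shows "fredholm_pair V F & int (dim_Hom V F) - int (dim_Ext1 V F) = 0"
proof -
 note g0 = gHom_from_zero[OF cgm[OF V] 0 cgm[OF F]]
 have c: "csrc V F <= {0}"
 proof
  fix y assume "y : csrc V F"
  hence "restricts V F (hc i) (y i False) (y i True)" for i by (simp add: csrc_def)
  hence "y i False : {0}" "y i True : {0}" for i using resD(1,2)[of V F "hc i" "y i False" "y i True"] unfolding g0 by blast+
  hence "y i k = 0" for i k by (cases k) simp_all
  thus "y : {0}" by (simp add: fun_eq_iff[of y] fun_eq_iff[of "y _"] fun0[where x = "_::bool"])
 qed
 have 1: "csrc V F = {0}" using c ys.subspace_0[OF subspace_csrc[OF F]] by blast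
 have 2: "cech1 V F = {0}" by (simp add: cech1_def g0)
 have 3: "cdiff (0 :: bool => bool => 'a pic => 'b amb => 'b amb) = 0" by (simp add: cdiff_def zero_fun_def)
 have 4: "{a : {0}. cdiff a = 0} = {0 :: bool => bool => 'a pic => 'b amb => 'b amb}" "cdiff ` {0 :: bool => bool => 'a pic => 'b amb => 'b amb} = {0}" using 3 by auto
 have q: "finq ysc {0} {0}" "qd ysc {0} {0 :: bool => bool => 'a pic => 'b amb => 'b amb} = 0"
  "finq hsc {0} {0}" "qd hsc {0} {0 :: 'a pic => 'b amb => 'b amb} = 0"
  unfolding finq_def quot_dim_def by (auto intro!: exI[of _ "{}"] Least_equality simp: ys.span_base hs.span_base)
 have "index ysc hsc (csrc V F) (cech1 V F) cdiff = 0" unfolding index_def 1 2 4 q by simp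
 moreover have "fredholm_pair V F" unfolding fredholm_pair_def fredholm_def 1 2 4 using q by blast
 ultimately show ?thesis unfolding index_csrc[OF F] by simp
qed

lemma filt_coherent: "filt Z V as ==> cohr Z V" by (induction rule: filt.induct) (auto dest: ses_coh)

lemma filt_index:
 assumes V: "filt Z V as" and F: "cohr Z F" and fF: "!!v. fredholm_sec F v"
 shows "fredholm_pair V F & int (dim_Hom V F) - int (dim_Ext1 V F) = (SUM a<-as. chs F (- a))" using V
proof (induction rule: filt.induct)
 case (Nil V)
 thus ?case using fredholm_from_zero[OF Nil F] by simp
next
 case (Cons V' f V g a as)
 have O: "fredholm_pair (Os Z a) F" unfolding fredholm_O[OF F] by (rule fF)
 show ?case using fredholm_ext[OF Cons(1) F O] index_ext[OF Cons(1) F O] Cons(3) by simp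
qed

lemma ses_chart_split:
 assumes ses: "sexact Z V' f V g (Os Z a)"
 shows "EX e. csplit Z j (ch V' j) (ch V j) (f j) (g j) a e"
proof -
 have "one : g j (- a) ` sx V j (- a)" unfolding ses_surj[OF ses] using one_in[of Z a j] by simp
 then obtain e where e: "e : sx V j (- a)" "one = g j (- a) e" by (elim imageE)
 have gj: "g j : gHom (ch V j) (Oc Z a j)" using Hom_gHom[OF ses_Hom(2)[OF ses], of j] by simp
 show ?thesis by (rule exI[of _ e], rule csplit.intro[OF cgm[OF ses_coh(1)[OF ses]] cgm[OF ses_coh(2)[OF ses]] Hom_gHom[OF ses_Hom(1)[OF ses]] gj
   ses_inj[OF ses] ses_ex[OF ses] e(1) e(2)[symmetric]])
qed

text \<open>A homomorphism on a chart is determined by its values on the subsheaf and on a lift of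
  the generator of the line bundle quotient; the generator of O(a) has degree
  \<open>- a\<close>.\<close>

lemma filt_gHom_zero:
 assumes "filt Z V as" and N: "gmd Z j N" and 0: "!!a. a : set as ==> gsp N (- a) = {0}"
  and h: "h : gHom (ch V j) N"
 shows "h = 0" using assms(1) 0 h
proof (induction arbitrary: h rule: filt.induct)
 case (Nil V)
 thus ?case using gHom_from_zero[OF cgm[OF Nil(1)] Nil(2) N] by blast
next
 case (Cons V' f V g a as)
 obtain e where e: "csplit Z j (ch V' j) (ch V j) (f j) (g j) a e" using ses_chart_split[OF Cons(1)] ..
 note z = hs.subspace_0[OF subspace_gHom[OF N]]
 have hf: "cmp h (f j) = 0" by (rule Cons.IH[OF _ cmp_gHom[OF cgm[OF ses_coh(2)[OF Cons(1)]] Hom_gHom[OF ses_Hom(1)[OF Cons(1)]] Cons.prems(2)]])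
   (use Cons.prems(1) in simp)
 have "h (- a) e : gsp N (- a)" by (rule gin[OF gHom_g[OF Cons.prems(2)] csplit.e(1)[OF e]])
 hence he: "h (- a) e = 0" using Cons.prems(1) by simp
 show ?case by (rule gHom_eqI[OF Cons.prems(2) z], rule csplit.split_unique[OF e N gHom_g[OF Cons.prems(2)] gHom_g[OF z]])
   (simp_all add: cmp_0[OF hf] he, simp_all add: zero_fun_def)
qed

lemma filt_Hom_zero:
 assumes V: "filt Z V as" and F: "cohr Z F" and 0: "!!a j. a : set as ==> sx F j (- a) = {0}"
 shows "Hom V F = {0}"
proof -
 have "h = 0" if "h : Hom V F" for h using filt_gHom_zero[OF V cgm[OF F] 0 Hom_gHom[OF that]] by (auto simp: fun_eq_iff[of h] fun0[where x = "_::chart"])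
 thus ?thesis using ms.subspace_0[OF subspace_Hom[OF F]] by blast
qed

subsection \<open>Multiplication by the square roots\<close>

text \<open>The forms of two distinct points are a basis of the linear forms; the coefficients of
  either coordinate come from Cramer's rule with determinant \<open>D\<close>.\<close>

lemma vform_unit_combination:
 assumes "~ same_point x y"
 shows "EX al be. ALL (M :: ('n::finite, 'k::field) gmod) u a. asc al (lmul M (vform x) u a) + asc be (lmul M (vform y) u a) = xop b M u a"
proof -
 obtain p q r s where l: "x = (p, q)" "y = (r, s)" by fastforce
 define D where "D = p * s - q * r"
 have D: "D ~= 0" using assms l unfolding D_def same_point_def by simp
 have "EX al be. al * q + be * s = (if b then 0 else 1) & - al * p - be * r = (if b then 1 else 0)"
  using D by (cases b; intro exI[of _ "(if b then - s else - r) / D"] exI[of _ "(if b then q else p) / D"])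
   (simp_all add: field_simps, simp_all add: D_def asimps)
 then obtain al be where ab: "al * q + be * s = (if b then 0 else 1)" "- al * p - be * r = (if b then 1 else 0)" by blast
 have "asc al (lmul M (vform x) u a) + asc be (lmul M (vform y) u a)
   = asc (al * q + be * s) (xop False M u a) + asc (- al * p - be * r) (xop True M u a)" for M :: "('n, 'k) gmod" and u a
  unfolding lmul_xop vform_def l by (simp add: asc.scale_right_distrib asc.scale_right_diff_distrib asc.scale_left_distrib asc.scale_left_diff_distrib)
 thus ?thesis unfolding ab by (intro exI[of _ al] exI[of _ be]) (simp split: if_split)
qed

text \<open>\<open>t_i\<close> and \<open>t_k\<close> have no common zero: an invertible coordinate
  is a combination of their squares. Hence their images together fill every module, and
  \<open>t_i\<close> divides \<open>y\<close> as soon as it divides \<open>t_k y\<close>.\<close>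

lemma
 fixes Z :: "'n::finite => 'k::field * 'k"
 assumes Z: "distinct_points Z" "i ~= k" and M: "gmd Z j M" and y: "y : gsp M v"
 shows t_t_generate: "EX z:gsp M (v - px i). EX x:gsp M (v - px k). y = opt M i (v - px i) z + opt M k (v - px k) x"
  and t_t_coprime: "z : gsp M (v + px k - px i) ==> opt M k v y = opt M i (v + px k - px i) z ==>
   EX x:gsp M (v - px i). y = opt M i (v - px i) x"
proof -
 obtain b where b: "inv_on b j" using inv_on_other[of j] inv_on_U01 by (cases "j = U01") blast+
 obtain al be where ab: "!!(M :: ('n, 'k) gmod) u x. asc al (lmul M (vform (Z i)) u x) + asc be (lmul M (vform (Z k)) u x) = xop b M u x"
  using vform_unit_combination[of "Z i" "Z k"] Z unfolding distinct_points_def by blast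
 have e: "v - pc + px m = v - px m" for m by (simp add: pc_eq[of m] asimps)
 have e2: "v + px k - px i - pc + px k = v - px i" "v - pc + px i = v - px i" "v + px k - px i - pc + px i + px k = v"
  "v - pc + px k = v + px k - px i - pc + px i" using pc_eq[of i] pc_eq[of k] by (simp_all add: asimps)
 obtain y0 where y0: "y0 : gsp M (v - pc)" "xop b M (v - pc) y0 = y" using gm_x_surj[OF M b, of y "v - pc"] y by auto
 have y_eq: "y = asc al (opt M i (v - px i) (opt M i (v - pc) y0)) + asc be (opt M k (v - px k) (opt M k (v - pc) y0))"
  using ab[of M "v - pc" y0] gm_t_sq[OF M y0(1), of i] gm_t_sq[OF M y0(1), of k] unfolding e y0(2) by simp
 have in1: "opt M m (v - pc) y0 : gsp M (v - px m)" for m using gm_t_in[OF M y0(1), of m] unfolding e .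
 have lt: "opt M m (v - px m) (asc c x) = asc c (opt M m (v - px m) x)" if "x : gsp M (v - px m)" for m c x by (rule lin_scale[OF gm_t[OF M] that])
 show "EX z:gsp M (v - px i). EX x:gsp M (v - px k). y = opt M i (v - px i) z + opt M k (v - px k) x"
  by (intro bexI[of _ "asc al (opt M i (v - pc) y0)"] bexI[of _ "asc be (opt M k (v - pc) y0)"])
   (use y_eq lt[OF in1] gm_asc[OF M in1] in simp_all)
 assume z: "z : gsp M (v + px k - px i)" and eq: "opt M k v y = opt M i (v + px k - px i) z"
 let ?w = "v + px k - px i - pc"
 obtain z0 where z0: "z0 : gsp M ?w" "xop b M ?w z0 = z" using gm_x_surj[OF M b, of z ?w] z by auto
 have "xop b M (v - pc + px k) (opt M k (v - pc) y0) = xop b M (?w + px i) (opt M i ?w z0)" unfolding gm_x_t[OF M y0(1)] gm_x_t[OF M z0(1)] y0(2) z0(2) using eq by simp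
 hence "opt M k (v - pc) y0 = opt M i ?w z0"
  using gm_x_inj[OF M b, of "opt M k (v - pc) y0" "v - pc + px k" "opt M i ?w z0"] gm_t_in[OF M y0(1), of k] gm_t_in[OF M z0(1), of i] unfolding e2 by simp
 hence tt: "opt M k (v - px k) (opt M k (v - pc) y0) = opt M i (v - px i) (opt M k ?w z0)"
  using gm_t_t[OF M z0(1), of k i] unfolding e2(1) by (simp add: pc_eq[of k] asimps)
 have z1: "opt M k ?w z0 : gsp M (v - px i)" using gm_t_in[OF M z0(1), of k] unfolding e2(1) .
 show "EX x:gsp M (v - px i). y = opt M i (v - px i) x" by (rule bexI[of _ "asc al (opt M i (v - pc) y0) + asc be (opt M k ?w z0)"])
   (unfold y_eq tt lin_add[OF gm_t[OF M] gm_asc[OF M in1] gm_asc[OF M z1]] lt[OF in1] lt[OF z1],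
    rule refl, rule gm_add[OF M gm_asc[OF M in1] gm_asc[OF M z1]])
qed

lemma t_map_Hom:
 "t_map Z i u : Hom (Os Z u) (Os Z (u + px i))"
proof (rule HomI)
 let ?R = "%j. Oc Z 0 j"
 fix j
 show "ghom (ch (Os Z u) j) (ch (Os Z (u + px i)) j) (t_map Z i u j)"
 proof (rule ghom_cong[OF cgm[OF coh_O]])
  note M = gm_O[of Z j 0]
  have s: "u + px i + v = u + v + px i" "u + (v + w) = u + v + w" for v w by (simp_all add: asimps)
  show "ghom (ch (Os Z u) j) (ch (Os Z (u + px i)) j) (%v. opt (?R j) i (u + v))"
  proof (rule ghomI)
   show "lbet (gsp (ch (Os Z u) j) v) (gsp (ch (Os Z (u + px i)) j) v) (opt (?R j) i (u + v))" for v
    using gm_op_between[OF M, of "u + v" "Inl i"] by (simp add: s del: O_simps(2))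
   fix v a k assume "a : gsp (ch (Os Z u) j) v"
   hence a: "a : gsp (?R j) (u + v)" by simp
   show "opt (?R j) i (u + (v + dg k)) (hop (ch (Os Z u) j) k v a) = hop (ch (Os Z (u + px i)) j) k v (opt (?R j) i (u + v) a)"
    using gm_op_op[OF M a, of "Inl i" k] by (cases k) (simp_all add: s)
  qed
 qed (simp add: t_map_def)
next
 show "t_map Z i u U01 v (res (Os Z u) j v a) = res (Os Z (u + px i)) j v (t_map Z i u j v a)"
  if "j ~= U01" "a : gsp (ch (Os Z u) j) v" for j v a using that ring_part_U01 by (auto simp: t_map_def)
qed (simp_all add: t_map_def)

lemma t_map_inj:
 assumes Z: "adp Z" and p: "p : gsp (ch (Os Z u) j) v" "t_map Z i u j v p = 0"
 shows "p = 0"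
proof -
 have p': "p : Rp j (u + v)" using p(1) by simp
 let ?q = "opt (Oc Z (u + px i) j) i v (t_map Z i u j v p)"
 have f: "ghom (Oc Z u j) (Oc Z (u + px i) j) (t_map Z i u j)" using Hom_g[OF t_map_Hom[of Z i u], of j] by simp
 have "t_map Z i u j (- u) one ~= 0" using one_in[of Z u j] by (auto simp: t_map_def one_def delta_def fun_eq_iff zero_fun_def intro: exI[of _ 0])
 thus ?thesis by (rule O_hom_inj[OF Z f _ p' p(2)])
qed

lemma ses_t:
 assumes Z: "adp Z"
 shows "EX q Q. sexact Z (Os Z u) (t_map Z i u) (Os Z (u + px i)) q Q"
 by (intro exI) (rule ses_quot[OF coh_O coh_O t_map_Hom t_map_inj[OF Z] subsheaf_image[OF coh_O coh_O t_map_Hom] refl])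

text \<open>The cokernels of multiplication by \<open>t_i\<close> exist, so the sheaves chosen by
  description do fit into their defining sequences.\<close>

lemma
 assumes Z: "adp Z"
 shows S_sheaf: "EX q. sexact Z (Os Z (- px i)) (t_map Z i (- px i)) (Os Z 0) q (S_sheaf Z i)"
  and S'_sheaf: "EX q. sexact Z (Os Z 0) (t_map Z i 0) (Os Z (px i)) q (S'_sheaf Z i)" unfolding S_sheaf_def S'_sheaf_def
 using ses_t[OF Z, of "- px i" i] ses_t[OF Z, of 0 i] by (simp_all add: some_eq_ex del: ex_simps) (rule someI_ex, blast)+

text \<open>If the target degree is odd at \<open>i\<close>, multiplication by \<open>t_i\<close>
  adds a new factor to each monomial and is bijective, so the cokernel vanishes there. This ties
  \<open>S_i\<close> and \<open>S'_i\<close> to the parities of line bundles.\<close>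

lemma ses_t_zero:
 assumes ses: "sexact Z (Os Z u) (t_map Z i u) (Os Z w) q Q" and w: "w = u + px i" and i: "i : podd (w + v)"
 shows "sx Q j v = {0}"
proof -
 have np: "i ~: podd (u + v)" using i unfolding w by (simp add: podd_add)
 have r: "Rp j (u + v) = (Rp j (w + v) :: 'b amb set)"
  using np by (simp add: Rp_def w pmul_add_px add.assoc add.commute[of "px i"]) (simp add: add.assoc[symmetric] pmul_add_px)
 have "t_map Z i u j v ` Rp j (u + v) = Rp j (w + v)" using np r by (auto simp: t_map_def image_iff)
 hence "Rp j (w + v) = {b : Rp j (w + v). q j v b = 0}" using ses_ex[OF ses, of j v] by simp
 hence "q j v ` Rp j (w + v) <= {0}" by blast
 hence "sx Q j v <= {0}" using ses_surj[OF ses, of j v] by simp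
 thus ?thesis using gm_0[OF cgm[OF ses_coh(3)[OF ses]], of j v] by blast
qed

subsection \<open>Additive functions on coherent sheaves\<close>

definition additive :: "('n::finite => 'k::field * 'k) => (('n, 'k) sheaf => rat) => bool" where
 "additive Z ph <-> (ALL E f F g G. sexact Z E f F g G --> ph F = ph E + ph G)"

lemma additiveD: "additive Z ph ==> sexact Z E f F g G ==> ph F = ph E + ph G" unfolding additive_def by blast

lemma
 assumes "additive Z ph" and "additive Z ps"
 shows additive_add: "additive Z (%F. ph F + ps F)" and additive_diff: "additive Z (%F. ph F - ps F)" using assms unfolding additive_def by (simp_all add: asimps)

lemma additive_scale: "additive Z ph ==> additive Z (%F. c * ph F)" unfolding additive_def by (simp add: asimps)

lemma additive_sum: "(!!i. i : I ==> additive Z (ph i)) ==> additive Z (%F. SUM i:I. ph i F)"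
 unfolding additive_def by (auto simp: sum.distrib[symmetric] intro!: sum.cong)

lemma ses_id_zero:
 assumes E: "cohr Z E" and F: "cohr Z F" and 0: "!!j u. sx F j u = {0}"
 shows "sexact Z E (cut E (%j u a. a)) E 0 F"
proof (rule short_exactI[OF E E F cut_Hom[OF E] ms.subspace_0[OF subspace_Hom[OF F]]])
 show "ghom (ch E j) (ch E j) (%u a. a)" for j by (rule ghomI) (simp_all add: linear_between_def)
 have z: "(0 :: ('a, 'b) shmap) j u a = 0" for j u a by (simp add: zero_fun_def)
 show "cut E (%j u a. a) j u ` sx E j u = {b : sx E j u. (0 :: ('a, 'b) shmap) j u b = 0}" for j u unfolding z by (auto simp: cut_def)
 show "(0 :: ('a, 'b) shmap) j u ` sx E j u = sx F j u" for j u unfolding z 0 using gm_0[OF cgm[OF E]] by (auto simp: image_constant_conv)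
qed (simp_all add: cut_def)

text \<open>The zero sheaf is the cokernel of the identity of a line bundle, so its case reduces to
  \<open>cok\<close>.\<close>

lemma line_induct:
 assumes Z: "adp Z" and F: "cohr Z F"
  and line: "!!u. P (Os Z u)"
  and ext: "!!E f F g G. sexact Z E f F g G ==> P E ==> P G ==> P F"
  and cok: "!!E f F g G. sexact Z E f F g G ==> P E ==> P F ==> P G"
 shows "P F" by (rule coherent_induct[where P = P, OF Z line _ ext cok F])
  (assumption | rule cok[OF ses_id_zero[OF coh_O] line line])+

lemma additive_eqI:
 assumes Z: "adp Z" and F: "cohr Z F" and a: "additive Z ph" "additive Z ps"
  and line: "!!u. ph (Os Z u) = ps (Os Z u)"
 shows "ph F = ps F" by (rule line_induct[where P = "%F. ph F = ps F", OF Z F line]) (use a in "auto dest!: additiveD")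

lemma additive_zero:
 assumes a: "additive Z ph" and F: "cohr Z F" and 0: "!!j u. sx F j u = {0}"
 shows "ph F = 0" using additiveD[OF a ses_id_zero[OF coh_O F 0]] by simp

lemma additive_filt:
 assumes a: "additive Z ph" shows "filt Z V as ==> ph V = (SUM a<-as. ph (Os Z a))"
proof (induction rule: filt.induct)
 case (Cons V' f V g a as)
 thus ?case using additiveD[OF a Cons(1)] by simp
qed (simp add: additive_zero[OF a])

definition sgn_at :: "'n::finite pic => 'n => int" where "sgn_at u i = (if i : podd u then - 1 else 1)"

text \<open>Rank, degree, and twice the coordinates of the projection to the root lattice.\<close>
definition rho :: "('n::finite, 'k::field) sheaf => int" where "rho F = chs F pc - chs F 0"
definition tau :: "'n::finite => ('n, 'k::field) sheaf => int" where
 "tau i F = 2 * (chs F 0 - chs F (- px i)) - rho F"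
definition dlt :: "('n::finite, 'k::field) sheaf => int" where
 "dlt F = 2 * chs F 0 - 2 * rho F + (SUM i:UNIV. rho F - (chs F 0 - chs F (- px i)))"

text \<open>On O(u) the difference \<open>chs F 0 - chs F (- px i)\<close> is 0 if \<open>u\<close>
  is odd at \<open>i\<close> and 1 otherwise. This turns the Euler characteristics in the
  definitions into signs, and their sum into the number of odd entries that the degree needs besides
  \<open>2 * pmul u\<close>.\<close>

lemma
 shows rho_O: "rho (Os Z u :: ('n::finite, 'k::field) sheaf) = 1"
  and tau_O: "tau i (Os Z u :: ('n, 'k) sheaf) = sgn_at u i"
  and dlt_O: "dlt (Os Z u :: ('n, 'k) sheaf) = pdeg u"
proof -
 have 1: "pmul u - pmul (u - px i) = (if i : podd u then 0 else 1)" for i by (simp add: pmul_diff_px)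
 have 2: "rho (Os Z u :: ('n, 'k) sheaf) = 1" by (simp add: rho_def chi_sec_O)
 have 3: "chs (Os Z u) 0 - chs (Os Z u) (- px i) = (if i : podd u then 0 else 1)" for i using 1[of i] by (simp add: chi_sec_O)
 show "rho (Os Z u :: ('n, 'k) sheaf) = 1" "tau i (Os Z u :: ('n, 'k) sheaf) = sgn_at u i" unfolding 2 tau_def 3 by (simp_all add: sgn_at_def)
 have "(SUM i:UNIV. 1 - (if i : podd u then 0 else 1)) = int (card (podd u))" by (subst sum.mono_neutral_right[of UNIV "podd u"]) auto
 thus "dlt (Os Z u :: ('n, 'k) sheaf) = pdeg u" unfolding dlt_def 2 3 by (simp add: chi_sec_O pdeg_eq)
qed

context
 fixes Z :: "'n::finite => 'k::alg_closed_field * 'k"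
 assumes Z: "distinct_points Z"
begin

lemma fredholm_sec_coherent:
 assumes F: "cohr Z F"
 shows "fredholm_sec F v" by (rule line_induct[where P = "%F. fredholm_sec F v", OF Z F fredholm_sec_O]) (use fredholm_sec_ses in blast)+

lemma additive_chi_sec: "additive Z (%F. of_int (chs F v))" unfolding additive_def
proof (intro allI impI)
 fix E f F g G assume s: "sexact Z E f F g G"
 show "(of_int (chs F v) :: rat) = of_int (chs E v) + of_int (chs G v)"
  using chi_sec_ses[OF s fredholm_sec_coherent[OF ses_coh(1)[OF s]] fredholm_sec_coherent[OF ses_coh(2)[OF s]], of v] by simp
qed

lemma
 shows additive_rho: "additive Z (%F. of_int (rho F))"
  and additive_tau: "additive Z (%F. of_int (tau i F))"
  and additive_dlt: "additive Z (%F. of_int (dlt F))"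
proof -
 show r: "additive Z (%F. of_int (rho F))" using additive_diff[OF additive_chi_sec[of pc] additive_chi_sec[of 0]] by (simp add: rho_def)
 note h = additive_diff[OF additive_chi_sec[of 0] additive_chi_sec]
 show "additive Z (%F. of_int (tau i F))" unfolding tau_def of_int_diff of_int_mult by (rule additive_diff[OF additive_scale[OF h] r])
 show "additive Z (%F. of_int (dlt F))" unfolding dlt_def of_int_diff of_int_add of_int_mult of_int_sum
  by (rule additive_add[OF additive_diff[OF additive_scale[OF additive_chi_sec] additive_scale[OF r]] additive_sum[OF additive_diff[OF r h]]])
qed

lemma sum_sgn_at: "(SUM i:UNIV. of_int (sgn_at u i) * of_int (sgn_at v i)) = (of_nat CARD('n) - 2 * of_nat (card (podd (u - v))) :: rat)"
 for u v :: "'n pic"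
proof -
 have "of_int (sgn_at u i) * of_int (sgn_at v i) = 1 - (if i : podd (u - v) then 2 else 0 :: rat)" for i by (simp add: sgn_at_def podd_diff)
 thus ?thesis by (simp add: sum_subtractf sum.If_cases)
qed

text \<open>Riemann-Roch. Both sides are additive in \<open>F\<close>, so line bundles suffice;
  there the sum of products of signs counts the indices at which the parities of \<open>u\<close>
  and \<open>a\<close> differ.\<close>

lemma chi_sec_formula:
 assumes F: "cohr Z F"
 shows "of_int (chs F (- a)) = (1 - of_nat CARD('n) / 4) * of_int (rho F) + (of_int (dlt F) - of_int (pdeg a) * of_int (rho F)) / 2
  + (SUM i:UNIV. of_int (sgn_at a i) * of_int (tau i F)) / (4 :: rat)"
proof -
 let ?ps = "%F. ((1 - of_nat CARD('n) / 4) * of_int (rho F) + (1/2 * of_int (dlt F) - (of_int (pdeg a) / 2) * of_int (rho F)))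
  + 1/4 * (SUM i:UNIV. of_int (sgn_at a i) * of_int (tau i F)) :: rat"
 have "of_int (chs F (- a)) = ?ps F"
 proof (rule additive_eqI[OF Z F additive_chi_sec])
  show "additive Z ?ps" by (intro additive_add additive_diff) (rule additive_scale additive_rho additive_dlt additive_sum additive_tau | assumption)+
  fix u
  have "2 * (pmul (u - a) + 1) = 2 + pdeg u - pdeg a - int (card (podd (u - a)))" using pdeg_eq[of "u - a"] by simp
  from arg_cong[OF this, of rat_of_int]
  show "rat_of_int (chs (Os Z u) (- a)) = ?ps (Os Z u)" unfolding rho_O tau_O dlt_O sum_sgn_at chi_sec_O using podd_minus[of "u - a"] by (simp add: field_simps)
 qed
 thus ?thesis by (simp add: field_simps)
qed

end

subsection \<open>The Grothendieck group\<close>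

interpretation fs: vector_space fsc by standard (auto simp: fsc_def fun_eq_iff funp asimps)

lemma subspace_K_free: "fs.subspace (K_free Z)" and subspace_K_rel: "fs.subspace (K_rel Z)" unfolding K_free_def K_rel_def by (rule fs.subspace_span)+

lemmas Kf_closed = fs.subspace_add[OF subspace_K_free] fs.subspace_diff[OF subspace_K_free] fs.subspace_scale[OF subspace_K_free]
 fs.subspace_0[OF subspace_K_free] fs.subspace_sum[OF subspace_K_free]
lemmas K_rel_closed = fs.subspace_add[OF subspace_K_rel] fs.subspace_diff[OF subspace_K_rel] fs.subspace_scale[OF subspace_K_rel]
 fs.subspace_0[OF subspace_K_rel] fs.subspace_sum[OF subspace_K_rel] fs.subspace_neg[OF subspace_K_rel]

lemma gen_K_free: "cohr Z F ==> gen F : K_free Z" unfolding K_free_def by (rule fs.span_base) blast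

lemma ses_K_rel: "sexact Z E f F g G ==> gen F - gen E - gen G : K_rel Z" unfolding K_rel_def by (rule fs.span_base) blast

lemma K_rel_sub: "K_rel Z <= K_free Z" unfolding K_rel_def by (rule fs.span_minimal[OF _ subspace_K_free], rule subsetI, elim CollectE exE conjE, simp only:)
  (intro Kf_closed(2) gen_K_free; erule ses_coh)

lemma K_class_refl: "x : K_free Z ==> x : Kc Z x" by (simp add: K_class_def K_rel_closed)

lemma K_class_eqI: "x - y : K_rel Z ==> Kc Z x = Kc Z y" unfolding K_class_def using K_rel_closed(1,2)[of _ Z "x - y"] by (force simp: asimps)

lemma K_class_K0: "x : K_free Z ==> Kc Z x : K0 Z" by (simp add: K0_def)

lemma K0E:
 assumes "X : K0 Z" obtains x where "x : K_free Z" "X = Kc Z x" using assms unfolding K0_def by blast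

lemma K_add_class:
 assumes x: "x : K_free Z" and y: "y : K_free Z"
 shows "K_add (Kc Z x) (Kc Z y) = Kc Z (x + y)"
proof (intro equalityI subsetI)
 fix z assume "z : K_add (Kc Z x) (Kc Z y)"
 then obtain a b where "a : K_free Z" "a - x : K_rel Z" "b : K_free Z" "b - y : K_rel Z" "z = a + b" unfolding K_add_def K_class_def by blast
 thus "z : Kc Z (x + y)" using K_rel_closed(1)[of "a - x" Z "b - y"] by (simp add: K_class_def Kf_closed asimps)
next
 fix z assume "z : Kc Z (x + y)"
 hence z: "z : K_free Z" "z - (x + y) : K_rel Z" by (auto simp: K_class_def)
 have "z = x + (z - x)" by simp
 moreover have "z - x : Kc Z y" using z x by (simp add: K_class_def Kf_closed asimps)
 ultimately show "z : K_add (Kc Z x) (Kc Z y)" unfolding K_add_def using K_class_refl[OF x] by blast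
qed

lemma K_scale_class:
 assumes x: "x : K_free Z" shows "K_scale Z c (Kc Z x) = Kc Z (fsc c x)"
proof (intro equalityI subsetI)
 fix z assume "z : K_scale Z c (Kc Z x)"
 then obtain a b where a: "a : K_free Z" "a - x : K_rel Z" "b : K_rel Z" "z = fsc c a + b" unfolding K_scale_def K_class_def by blast
 have "z - fsc c x = fsc c (a - x) + b" unfolding a(4) by (simp add: fs.scale_right_diff_distrib)
 moreover have "z : K_free Z" unfolding a(4) by (rule Kf_closed(1)[OF Kf_closed(3)[OF a(1)] subsetD[OF K_rel_sub a(3)]])
 ultimately show "z : Kc Z (fsc c x)" using K_rel_closed(1)[OF K_rel_closed(3)[OF a(2), of c] a(3)] by (simp add: K_class_def)
next
 fix z assume "z : Kc Z (fsc c x)"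
 hence "z - fsc c x : K_rel Z" by (simp add: K_class_def)
 moreover have "z = fsc c x + (z - fsc c x)" by simp
 ultimately show "z : K_scale Z c (Kc Z x)" unfolding K_scale_def using K_class_refl[OF x] by blast
qed

definition lin_ext :: "(('n, 'k) sheaf => rat) => ('n, 'k) fsum => rat" where
 "lin_ext ph x = (SUM F | x F ~= 0. x F * ph F)"

lemma finK: "x : K_free Z ==> finite {F. x F ~= 0}" unfolding K_free_def
proof (induction rule: fs.span_induct_alt)
 case (step c x y)
 have "{F. (fsc c x + y) F ~= 0} <= {F. x F ~= 0} Un {F. y F ~= 0}" by (auto simp: fsc_def funp)
 moreover have "finite {F. x F ~= 0}" using step(1) by (auto simp: gen_def)
 ultimately show ?case using step(2) finite_subset finite_UnI by metis
qed (simp add: fun0)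

lemma lin_ext_superset: "finite A ==> {F. x F ~= 0} <= A ==> lin_ext ph x = (SUM F:A. x F * ph F)" unfolding lin_ext_def by (rule sum.mono_neutral_left) auto

lemma
 assumes x: "finite {F. x F ~= 0}" and y: "finite {F. y F ~= 0}"
 shows lin_ext_add: "lin_ext ph (x + y) = lin_ext ph x + lin_ext ph y"
  and lin_ext_diff: "lin_ext ph (x - y) = lin_ext ph x - lin_ext ph y"
  and lin_ext_scale: "lin_ext ph (fsc c x) = c * lin_ext ph x"
proof -
 let ?A = "{F. x F ~= 0} Un {F. y F ~= 0}"
 have A: "finite ?A" using x y by simp
 note s = lin_ext_superset[OF A]
 have 1: "{F. x F ~= 0} <= ?A" "{F. y F ~= 0} <= ?A" "{F. (x + y) F ~= 0} <= ?A" "{F. (x - y) F ~= 0} <= ?A" "{F. fsc c x F ~= 0} <= ?A"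
  by (auto simp: funp minus_apply fsc_def)
 show "lin_ext ph (x + y) = lin_ext ph x + lin_ext ph y" "lin_ext ph (x - y) = lin_ext ph x - lin_ext ph y" "lin_ext ph (fsc c x) = c * lin_ext ph x"
  unfolding s[OF 1(1)] s[OF 1(2)] s[OF 1(3)] s[OF 1(4)] s[OF 1(5)]
  by (simp_all add: funp[of x y] minus_apply fsc_def sum.distrib[symmetric] sum_subtractf[symmetric] sum_distrib_left asimps)
qed

lemma lin_ext_gen [simp]: "lin_ext ph (gen F) = ph F"
proof -
 have "{E. gen F E ~= 0} = {F}" by (auto simp: gen_def)
 thus ?thesis by (simp add: lin_ext_def gen_def)
qed

lemma lin_ext_rel:
 assumes a: "additive Z ph" and "x : K_rel Z" shows "lin_ext ph x = 0"
proof -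
 have "x : K_free Z & lin_ext ph x = 0" using assms(2) unfolding K_rel_def
 proof (induction rule: fs.span_induct_alt)
  case base
  show ?case by (intro conjI Kf_closed(4)) (simp add: lin_ext_def fun0)
 next
  case (step c x y)
  obtain E f F g G where s: "sexact Z E f F g G" and x: "x = gen F - gen E - gen G" using step(1) by blast
  have g: "gen F : K_free Z" "gen E : K_free Z" "gen G : K_free Z" using ses_coh[OF s] gen_K_free by blast+
  hence k: "gen F - gen E : K_free Z" "x : K_free Z" unfolding x by (simp_all add: Kf_closed)
  have y: "y : K_free Z" using step(2) by blast
  have "lin_ext ph x = 0" unfolding x lin_ext_diff[OF finK[OF k(1)] finK[OF g(3)]] lin_ext_diff[OF finK[OF g(1)] finK[OF g(2)]] using additiveD[OF a s] by simp
  hence "lin_ext ph (fsc c x + y) = 0" unfolding lin_ext_add[OF finK[OF Kf_closed(3)[OF k(2)]] finK[OF y]]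
    lin_ext_scale[OF finK[OF k(2)] finK[OF k(2)]] using step(2) by simp
  thus ?case using Kf_closed(1)[OF Kf_closed(3)[OF k(2)] y] by blast
 qed
 thus ?thesis ..
qed

text \<open>The value at an arbitrarily picked representative; for additive \<open>ph\<close> it
  does not depend on the pick, since \<open>lin_ext ph\<close> vanishes on the relations.\<close>

definition K_fun :: "(('n, 'k) sheaf => rat) => ('n, 'k) fsum set => rat" where
 "K_fun ph X = lin_ext ph (SOME x. x : X)"

lemma K_fun_class:
 assumes a: "additive Z ph" and x: "x : K_free Z"
 shows "K_fun ph (Kc Z x) = lin_ext ph x"
proof -
 define y where "y = (SOME y. y : Kc Z x)"
 have "y : Kc Z x" unfolding y_def by (rule someI[of _ x]) (rule K_class_refl[OF x])
 hence y: "y : K_free Z" "y - x : K_rel Z" by (auto simp: K_class_def)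
 show ?thesis using lin_ext_rel[OF a y(2)] lin_ext_diff[OF finK[OF y(1)] finK[OF x], of ph] by (simp add: K_fun_def y_def)
qed

lemma K_linear_K_fun:
 assumes a: "additive Z ph" shows "K_linear Z (K_fun ph)" unfolding K_linear_def
proof (intro conjI ballI allI)
 fix X assume "X : K0 Z"
 then obtain x where x: "x : K_free Z" "X = Kc Z x" by (rule K0E)
 show "K_fun ph (K_add X Y) = K_fun ph X + K_fun ph Y" if Y: "Y : K0 Z" for Y
 proof -
  obtain y where y: "y : K_free Z" "Y = Kc Z y" by (rule K0E[OF Y])
  show ?thesis unfolding x(2) y(2) K_add_class[OF x(1) y(1)] K_fun_class[OF a x(1)] K_fun_class[OF a y(1)]
    K_fun_class[OF a Kf_closed(1)[OF x(1) y(1)]] by (rule lin_ext_add[OF finK[OF x(1)] finK[OF y(1)]])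
 qed
 show "K_fun ph (K_scale Z c X) = c * K_fun ph X" for c unfolding x(2) K_scale_class[OF x(1)] K_fun_class[OF a x(1)] K_fun_class[OF a Kf_closed(3)[OF x(1)]]
  by (rule lin_ext_scale[OF finK[OF x(1)] finK[OF x(1)]])
qed

lemma K_fun_sheaf: "additive Z ph ==> cohr Z F ==> K_fun ph (scl Z F) = ph F" unfolding sheaf_class_def by (simp add: K_fun_class gen_K_free)

subsection \<open>Coordinates on the Grothendieck group\<close>

abbreviation "O_gen Z u \<equiv> gen (Os Z u)"

text \<open>\<open>A_gen\<close>, \<open>B_gen\<close> and \<open>C_gen\<close> are dual to rank,
  degree and \<open>tau\<close>. \<open>B_gen\<close> is half the class of an ordinary point;
  \<open>C_gen\<close> at \<open>i\<close> is a quarter of the difference of the classes of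
  \<open>S_i\<close> and \<open>S'_i\<close>, that is, half of \<open>epsilon_i\<close>.\<close>

definition A_gen where "A_gen Z = O_gen Z 0 - (SUM i:UNIV. fsc (1/4) (O_gen Z 0 - O_gen Z (- px i) - (O_gen Z (px i) - O_gen Z 0)))"
definition B_gen where "B_gen Z = fsc (1/2) (O_gen Z 0 - O_gen Z (- pc))"
definition C_gen where "C_gen Z i = fsc (1/4) (O_gen Z 0 - O_gen Z (- px i) - (O_gen Z (px i) - O_gen Z 0))"

context
 fixes Z :: "'n::finite => 'k::alg_closed_field * 'k"
 assumes Z: "distinct_points Z"
begin

text \<open>As \<open>t_k\<close> and \<open>t_i\<close> have no common zero, \<open>t_k\<close>
  acts invertibly on cokernels of \<open>t_i\<close>. Instead of an isomorphism between two
  cokernels, the second sequence is built with the cokernel of the first and with the projection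
  composed with \<open>t_k\<close>.\<close>

lemma line_difference:
 assumes ik: "i ~= k"
 shows "(O_gen Z (u + px k + px i) - O_gen Z (u + px k)) - (O_gen Z (u + px i) - O_gen Z u) : K_rel Z"
proof -
 let ?w = "u + px i + px k" and ?v = "u + px k"
 define N where "N j v = t_map Z i ?v j v ` gsp (ch (Os Z ?v) j) v" for j v
 have vi: "?v + px i = ?w" by (simp add: asimps)
 have f: "t_map Z i ?v : Hom (Os Z ?v) (Os Z ?w)" using t_map_Hom[of Z i ?v] unfolding vi .
 have N: "subsheaf (Os Z ?w) N" unfolding N_def by (rule subsheaf_image[OF coh_O coh_O f])
 let ?Q = "qsh (Os Z ?w) N" and ?p = "cut (Os Z ?w) (%j. qproj (ch (Os Z ?w) j) (N j))"
 have 1: "sexact Z (Os Z ?v) (t_map Z i ?v) (Os Z ?w) ?p ?Q" by (rule ses_quot[OF coh_O coh_O f t_map_inj[OF Z] N N_def[symmetric]])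
 let ?g = "cut (Os Z (u + px i)) (%j v x. ?p j v (t_map Z k (u + px i) j v x))"
 have Q: "cohr Z ?Q" and p: "?p : Hom (Os Z ?w) ?Q" using ses_coh(3)[OF 1] ses_Hom(2)[OF 1] .
 note tk = t_map_Hom[of Z k "u + px i"] and ti = t_map_Hom[of Z i u]
 note s1 = ses_ex[OF 1] and s2 = ses_surj[OF 1]
 let ?M = "%j. Oc Z ?w j"
 \<comment> \<open>Multiplication by \<open>t_m\<close> depends on the total degree only, so the
   computations are all moved into the chart of O(?w).\<close>
 have deg: "opt (Oc Z x j) m v = opt (?M j) m v'" if "x + v = ?w + v'" for x j m v v' using that by (simp add: fun_eq_iff)
 have p0: "?p j v y = 0 <-> (EX z:Rp j (?v + v). y = opt (?M j) i (v - px i) z)" if y: "y : Rp j (?w + v)" for j v y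
 proof -
  have d: "opt (Oc Z ?v j) i v = opt (?M j) i (v - px i)" by (rule deg) (simp add: asimps)
  have "?p j v y = 0 <-> y : t_map Z i ?v j v ` Rp j (?v + v)" using s1[of j v] y by simp
  also have "... <-> (EX z:Rp j (?v + v). y = opt (?M j) i (v - px i) z)" unfolding d[symmetric] image_iff t_map_def by (auto simp del: O_simps(2))
  finally show ?thesis .
 qed
 have tk': "t_map Z k (u + px i) j v x = opt (?M j) k (v - px k) x" if "x : Rp j (u + px i + v)" for j v x
 proof -
  have "opt (Oc Z (u + px i) j) k v = opt (?M j) k (v - px k)" by (rule deg) (simp add: asimps)
  thus ?thesis using that unfolding t_map_def by (simp del: O_simps(2))
 qed
 have ti': "t_map Z i u j v x = opt (?M j) i (v - px k - px i) x" if "x : Rp j (u + v)" for j v x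
 proof -
  have "opt (Oc Z u j) i v = opt (?M j) i (v - px k - px i)" by (rule deg) (simp add: asimps)
  thus ?thesis using that unfolding t_map_def by (simp del: O_simps(2))
 qed
 have 2: "sexact Z (Os Z u) (t_map Z i u) (Os Z (u + px i)) ?g ?Q"
 proof (rule short_exactI[OF coh_O coh_O Q ti _ t_map_inj[OF Z]])
  show "?g : Hom (Os Z (u + px i)) ?Q"
  proof (rule cut_Hom[OF coh_O])
   show "ghom (ch (Os Z (u + px i)) j) (ch ?Q j) (%v x. ?p j v (t_map Z k (u + px i) j v x))" for j by (rule ghom_comp[OF Hom_g[OF tk] Hom_g[OF p]])
   show "?p U01 v (t_map Z k (u + px i) U01 v (res (Os Z (u + px i)) j v x)) = res ?Q j v (?p j v (t_map Z k (u + px i) j v x))"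
    if "j ~= U01" "x : gsp (ch (Os Z (u + px i)) j) v" for j v x using Hom_res[OF tk that] Hom_res[OF p that(1) gin[OF Hom_g[OF tk] that(2)]] by (simp only:)
  qed
  fix j v
  have a: "u + px i + v = ?w + (v - px k)" "u + v = ?w + (v - px k - px i)" "?v + v = ?w + (v - px i)"
   "v - px k + px k = v" "v - px k + px k - px i = v - px i" by (simp_all add: asimps)
  have g: "?g j v x = ?p j v (opt (?M j) k (v - px k) x)" if "x : Rp j (?w + (v - px k))" for x unfolding tk'[of x j v, unfolded a(1), OF that, symmetric] using that
   by (simp only: cut_def[of "Os Z (u + px i)"] O_sheaf_simps O_simps(1) a(1) if_True)
  have in_k: "opt (?M j) k (v - px k) x : Rp j (?w + v)" if "x : Rp j (?w + (v - px k))" for x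
   using gm_t_in[OF gm_O[of Z j ?w], of x "v - px k" k] that unfolding a(4) by (simp del: O_simps(2))
  have im: "t_map Z i u j v ` Rp j (u + v) = opt (?M j) i (v - px k - px i) ` Rp j (?w + (v - px k - px i))" unfolding a(2)[symmetric] by (rule image_cong[OF refl ti'])
  have eqv: "y : t_map Z i u j v ` Rp j (u + v) <-> y : {b : Rp j (u + px i + v). ?g j v b = 0}" for y
  proof
   assume "y : t_map Z i u j v ` Rp j (u + v)"
   then obtain x where x: "x : Rp j (?w + (v - px k - px i))" "y = opt (?M j) i (v - px k - px i) x" unfolding im by (elim imageE)
   have y: "y : Rp j (?w + (v - px k))" using gm_t_in[OF gm_O[of Z j ?w], of x "v - px k - px i" i] x by (simp del: O_simps(2))
   have "opt (?M j) k (v - px k) y = opt (?M j) i (v - px i) (opt (?M j) k (v - px k - px i) x)"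
    using gm_t_t[OF gm_O[of Z j ?w], of x "v - px k - px i" k i] x by (simp add: asimps del: O_simps(2))
   moreover have "opt (?M j) k (v - px k - px i) x : Rp j (?v + v)" using gm_t_in[OF gm_O[of Z j ?w], of x "v - px k - px i" k] x(1) by (simp add: asimps del: O_simps(2))
   ultimately have "?g j v y = 0" unfolding g[OF y] p0[OF in_k[OF y]] by blast
   thus "y : {b : Rp j (u + px i + v). ?g j v b = 0}" using y unfolding a(1) by blast
  next
   assume "y : {b : Rp j (u + px i + v). ?g j v b = 0}"
   hence y: "y : Rp j (?w + (v - px k))" and "?g j v y = 0" unfolding a(1) by auto
   then obtain z where z: "z : Rp j (?w + (v - px i))" "opt (?M j) k (v - px k) y = opt (?M j) i (v - px i) z" unfolding g[OF y] p0[OF in_k[OF y]] a(3) by blast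
   have "EX x:gsp (?M j) (v - px k - px i). y = opt (?M j) i (v - px k - px i) x"
    by (rule t_t_coprime[OF Z ik gm_O[of Z j ?w], where z = z]) (use y z in "simp_all add: a(4,5) del: O_simps(2)")
   thus "y : t_map Z i u j v ` Rp j (u + v)" unfolding im by (simp only: O_simps(1) image_iff)
  qed
  have "t_map Z i u j v ` Rp j (u + v) = {b : Rp j (u + px i + v). ?g j v b = 0}" by (rule Set.set_eqI) (rule eqv)
  thus "t_map Z i u j v ` gsp (ch (Os Z u) j) v = {b : gsp (ch (Os Z (u + px i)) j) v. ?g j v b = 0}" unfolding O_sheaf_simps O_simps(1) .
  have pim: "?p j v ` Rp j (?w + v) = gsp (ch ?Q j) v" using s2[of j v] unfolding O_sheaf_simps O_simps(1) .
  have "?g j v ` Rp j (?w + (v - px k)) = gsp (ch ?Q j) v"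
  proof (intro equalityI subsetI)
   fix y assume "y : ?g j v ` Rp j (?w + (v - px k))"
   then obtain x where x: "x : Rp j (?w + (v - px k))" "y = ?g j v x" by (elim imageE)
   show "y : gsp (ch ?Q j) v" unfolding x(2) g[OF x(1)] pim[symmetric] by (rule imageI[OF in_k[OF x(1)]])
  next
   fix y assume "y : gsp (ch ?Q j) v"
   then obtain y' where y': "y' : Rp j (?w + v)" "y = ?p j v y'" unfolding pim[symmetric] by (elim imageE)
   obtain z x where zx: "z : Rp j (?w + (v - px i))" "x : Rp j (?w + (v - px k))"
    "y' = opt (?M j) i (v - px i) z + opt (?M j) k (v - px k) x" using t_t_generate[OF Z ik gm_O[of Z j ?w], of y' v, unfolded O_simps(1), OF y'(1)] by (elim bexE)
   have in_i: "opt (?M j) i (v - px i) z : Rp j (?w + v)" using gm_t_in[OF gm_O[of Z j ?w], of z "v - px i" i] zx(1) by (simp del: O_simps(2))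
   have "?p j v (opt (?M j) i (v - px i) z) = 0" unfolding p0[OF in_i] a(3) using zx(1) by blast
   hence "y = ?g j v x" unfolding y'(2) zx(3) g[OF zx(2)] using ghom_add[OF Hom_g[OF p], of _ j v] in_i in_k[OF zx(2)] by (simp del: O_simps(2))
   thus "y : ?g j v ` Rp j (?w + (v - px k))" by (rule image_eqI[OF _ zx(2)])
  qed
  thus "?g j v ` gsp (ch (Os Z (u + px i)) j) v = gsp (ch ?Q j) v" unfolding O_sheaf_simps O_simps(1) a(1) .
 qed
 have "(O_gen Z ?w - O_gen Z ?v - gen ?Q) - (O_gen Z (u + px i) - O_gen Z u - gen ?Q) : K_rel Z" by (rule K_rel_closed(2)[OF ses_K_rel[OF 1] ses_K_rel[OF 2]])
 moreover have "u + px k + px i = ?w" by (simp add: asimps)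
 ultimately show ?thesis by (simp add: asimps)
qed

end

definition rhoK :: "('n::finite, 'k::field) fsum set => rat" where "rhoK = K_fun (%F. of_int (rho F))"
definition dltK :: "('n::finite, 'k::field) fsum set => rat" where "dltK = K_fun (%F. of_int (dlt F))"
definition tauK :: "'n::finite => ('n, 'k::field) fsum set => rat" where "tauK i = K_fun (%F. of_int (tau i F))"

context
 fixes Z :: "'n::finite => 'k::alg_closed_field * 'k"
 assumes Z: "distinct_points Z" and card: "CARD('n) >= 2"
begin

definition "keq x y <-> x - y : K_rel Z"

lemma keq_refl: "keq x x" by (simp add: keq_def K_rel_closed)
lemma keq_sym: "keq x y ==> keq y x" using K_rel_closed(6)[of "x - y" Z] by (simp add: keq_def)
lemma keq_trans [trans]: "keq x y ==> keq y z ==> keq x z" using K_rel_closed(1)[of "x - y" Z "y - z"] by (simp add: keq_def)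
lemma keq_add: "keq x y ==> keq x' y' ==> keq (x + x') (y + y')" using K_rel_closed(1)[of "x - y" Z "x' - y'"] by (simp add: keq_def asimps)
lemma keq_diff: "keq x y ==> keq x' y' ==> keq (x - x') (y - y')" using K_rel_closed(2)[of "x - y" Z "x' - y'"] by (simp add: keq_def asimps)
lemma keq_scale: "keq x y ==> keq (fsc c x) (fsc c y)" using K_rel_closed(3)[of "x - y" Z c] by (simp add: keq_def fs.scale_right_diff_distrib)
definition "step i u = O_gen Z (u + px i) - O_gen Z u"

lemma step_px: "i ~= k ==> keq (step i (u + px k)) (step i u)" unfolding keq_def step_def by (rule line_difference[OF Z])

lemma step_parity:
 assumes p: "i : podd u <-> i : podd v" shows "keq (step i u) (step i v)"
proof -
 have "UNIV ~= {i}" using card by (intro notI) (drule arg_cong[where f = card], simp)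
 \<comment> \<open>A second marked point is available, and \<open>pc\<close> is twice
   \<open>px k\<close>: a shift by \<open>pc\<close> becomes two shifts that do not change the step
   at \<open>i\<close>.\<close>
 then obtain k where k: "k ~= i" by blast
 have c: "keq (step i (u + pc)) (step i u)" for u
 proof -
  have e: "u + pc = u + px k + px k" by (simp add: pc_eq[of k] add.assoc)
  show ?thesis unfolding e by (rule keq_trans[OF step_px step_px]) (use k in simp_all)
 qed
 have m: "keq (step i (u + kc m)) (step i u)" for u m
 proof (induction m rule: int_induct[where k = 0])
  case base
  show ?case by (simp add: keq_refl)
 next
  case (step1 m)
  have e: "u + kc (m + 1) = u + kc m + pc" by (simp add: kc_add add.assoc)
  show ?case unfolding e by (rule keq_trans[OF c step1(2)])
 next
  case (step2 m)
  have e: "u + kc (m - 1) + pc = u + kc m" by (simp add: kc_diff)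
  show ?case by (rule keq_trans[OF keq_sym[OF c]]) (unfold e, rule step2(2))
 qed
 have s: "i ~: A ==> keq (step i (u + psum A)) (step i u)" for u A
 proof (induction A rule: finite_induct[OF finite])
  case (2 l A)
  have e: "u + psum (insert l A) = u + psum A + px l" using 2(2) by (simp add: psum_insert add.assoc)
  show ?case unfolding e by (rule keq_trans[OF step_px]) (use 2(3,4) in auto)
 qed (simp add: keq_refl)
 have "i ~: podd (u - v)" using p by (simp add: podd_diff)
 from keq_trans[OF m[of "v + psum (podd (u - v))" "pmul (u - v)"] s[OF this, of v]]
 have "keq (step i (v + (psum (podd (u - v)) + kc (pmul (u - v))))) (step i v)" by (simp add: add.assoc)
 thus ?thesis unfolding pic_normal_form by simp
qed

text \<open>A step at \<open>i\<close> has two classes, one for each parity. \<open>B_gen\<close>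
  represents their half sum, and twice \<open>C_gen\<close> at \<open>i\<close> their half
  difference.\<close>

lemma step_formula: "keq (step i u) (B_gen Z - fsc (2 * of_int (sgn_at u i)) (C_gen Z i))"
proof -
 have e: "- px i + px i = (0 :: 'n pic)" "- pc + px i = - px i" by (simp_all add: pc_eq[of i])
 have C: "C_gen Z i = fsc (1/4) (step i (- px i) - step i 0)" unfolding C_gen_def step_def e by simp
 have B: "B_gen Z = fsc (1/2) (step i (- px i) + step i (- pc))" unfolding B_gen_def step_def e by simp
 have B': "keq (B_gen Z) (fsc (1/2) (step i (- px i) + step i 0))" unfolding B by (intro keq_scale keq_add keq_refl step_parity) simp
 have half: "fsc (1/2) x + fsc (1/2) x = x" for x :: "('n, 'k) fsum" unfolding fs.scale_left_distrib[symmetric] by simp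
 show ?thesis
 proof (cases "i : podd u")
  case True
  have "keq (B_gen Z - fsc (2 * of_int (sgn_at u i)) (C_gen Z i)) (fsc (1/2) (step i (- px i) + step i 0) + fsc (1/2) (step i (- px i) - step i 0))"
   using keq_add[OF B' keq_refl[of "fsc (1/2) (step i (- px i) - step i 0)"]] True by (simp add: C sgn_at_def)
  also have "fsc (1/2) (step i (- px i) + step i 0) + fsc (1/2) (step i (- px i) - step i 0) = step i (- px i)"
   using half[of "step i (- px i)"] by (simp add: fs.scale_right_distrib fs.scale_right_diff_distrib)
  also have "keq ... (step i u)" by (rule step_parity) (simp add: True)
  finally show ?thesis by (rule keq_sym)
 next
  case False
  have "keq (B_gen Z - fsc (2 * of_int (sgn_at u i)) (C_gen Z i)) (fsc (1/2) (step i (- px i) + step i 0) - fsc (1/2) (step i (- px i) - step i 0))"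
   using keq_diff[OF B' keq_refl[of "fsc (1/2) (step i (- px i) - step i 0)"]] False by (simp add: C sgn_at_def)
  also have "fsc (1/2) (step i (- px i) + step i 0) - fsc (1/2) (step i (- px i) - step i 0) = step i 0"
   using half[of "step i 0"] by (simp add: fs.scale_right_distrib fs.scale_right_diff_distrib)
  also have "keq ... (step i u)" by (rule step_parity) (simp add: False)
  finally show ?thesis by (rule keq_sym)
 qed
qed

definition "coord r d t = fsc r (A_gen Z) + fsc d (B_gen Z) + (SUM i:UNIV. fsc (t i) (C_gen Z i))"

lemma line_formula: "keq (O_gen Z u) (coord 1 (of_int (pdeg u)) (%i. of_int (sgn_at u i)))" (is "keq _ (?c u)")
proof -
 have st: "?c (u + px i) = ?c u + (B_gen Z - fsc (2 * of_int (sgn_at u i)) (C_gen Z i))" for u i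
 proof -
  have s: "of_int (sgn_at (u + px i) k) = of_int (sgn_at u k) - (if k = i then 2 * of_int (sgn_at u i) else 0 :: rat)" for k by (auto simp: sgn_at_def podd_add)
  have "(SUM k:UNIV. fsc (if k = i then 2 * of_int (sgn_at u i) else 0) (C_gen Z k)) = fsc (2 * of_int (sgn_at u i)) (C_gen Z i)"
   by (subst sum.mono_neutral_right[of UNIV "{i}"]) (auto simp: fs.scale_zero_left)
  thus ?thesis unfolding coord_def s fs.scale_left_diff_distrib sum_subtractf by (simp add: fs.scale_left_distrib)
 qed
 show ?thesis
 proof (induction u rule: pic_induct)
  case 0
  have "?c 0 = O_gen Z 0" by (simp add: coord_def sgn_at_def A_gen_def C_gen_def)
  thus ?case by (simp add: keq_refl)
 next
  case (add u i)
  have "keq (O_gen Z u + step i u) (?c (u + px i))" unfolding st by (rule keq_add[OF add step_formula])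
  thus ?case by (simp add: step_def)
 next
  case (diff u i)
  have "?c u = ?c (u - px i) + (B_gen Z - fsc (2 * of_int (sgn_at (u - px i) i)) (C_gen Z i))" using st[of "u - px i" i] by simp
  hence "keq (O_gen Z u - step i (u - px i)) (?c (u - px i))" using keq_diff[OF diff step_formula[of i "u - px i"]] by (simp only: add_diff_cancel_right')
  thus ?case by (simp add: step_def)
 qed
qed

lemma coord_add: "coord r d t + coord r' d' t' = coord (r + r') (d + d') (%i. t i + t' i)" by (simp add: coord_def fs.scale_left_distrib sum.distrib)

lemma coord_scale: "fsc c (coord r d t) = coord (c * r) (c * d) (%i. c * t i)" by (simp add: coord_def fs.scale_right_distrib fs.scale_sum_right)

lemma coherent_formula:
 assumes F: "cohr Z F"
 shows "keq (gen F) (coord (of_int (rho F)) (of_int (dlt F)) (%i. of_int (tau i F)))"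
proof (rule line_induct[where P = "%F. keq (gen F) (coord (of_int (rho F)) (of_int (dlt F)) (%i. of_int (tau i F)))", OF Z F])
 show "keq (O_gen Z u) (coord (of_int (rho (Os Z u))) (of_int (dlt (Os Z u))) (%i. of_int (tau i (Os Z u))))" for u
  using line_formula[of u] unfolding rho_O dlt_O tau_O by simp
next
 fix E f F g G assume s: "sexact Z E f F g G"
 note a = additiveD[OF additive_rho[OF Z] s] additiveD[OF additive_dlt[OF Z] s] additiveD[OF additive_tau[OF Z] s]
 let ?c = "%F. coord (of_int (rho F)) (of_int (dlt F)) (%i. of_int (tau i F))"
 have c: "?c F = ?c E + ?c G" unfolding a coord_add ..
 have k: "keq (gen F) (gen E + gen G)" using ses_K_rel[OF s] by (simp add: keq_def asimps)
 show "keq (gen F) (?c F)" if "keq (gen E) (?c E)" "keq (gen G) (?c G)" unfolding c by (rule keq_trans[OF k keq_add[OF that]])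
 show "keq (gen G) (?c G)" if "keq (gen E) (?c E)" "keq (gen F) (?c F)" using keq_diff[OF keq_trans[OF keq_sym[OF k] that(2)] that(1)] unfolding c by simp
qed

lemmas K_funs = K_linear_K_fun[OF additive_rho[OF Z], folded rhoK_def] K_linear_K_fun[OF additive_dlt[OF Z], folded dltK_def]
 K_linear_K_fun[OF additive_tau[OF Z], folded tauK_def]

lemma K_coord:
 assumes x: "x : K_free Z"
 shows "keq x (coord (rhoK (Kc Z x)) (dltK (Kc Z x)) (%i. tauK i (Kc Z x)))"
proof -
 let ?c = "%x :: ('n, 'k) fsum. coord (lin_ext (%F. of_int (rho F)) x) (lin_ext (%F. of_int (dlt F)) x) (%i. lin_ext (%F. of_int (tau i F)) x)"
 have "x : K_free Z & keq x (?c x)" using x unfolding K_free_def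
 proof (induction rule: fs.span_induct_alt)
  case base
  have 0: "lin_ext ph (0 :: ('n, 'k) fsum) = 0" for ph by (simp add: lin_ext_def fun0)
  show ?case unfolding 0 K_free_def[symmetric] by (intro conjI Kf_closed(4)) (simp add: coord_def keq_refl)
 next
  case (step c y z)
  obtain F where F: "y = gen F" "cohr Z F" using step(1) by blast
  have y: "y : K_free Z" and z: "z : K_free Z" using gen_K_free[OF F(2)] F(1) step(2) unfolding K_free_def by blast+
  note e = lin_ext_add[OF finK[OF Kf_closed(3)[OF y]] finK[OF z]] lin_ext_scale[OF finK[OF y] finK[OF y]]
  have c: "?c (fsc c y + z) = fsc c (?c y) + ?c z" unfolding e coord_add coord_scale ..
  have "keq (fsc c y + z) (?c (fsc c y + z))" unfolding c by (intro keq_add keq_scale) (use coherent_formula[OF F(2)] F(1) step(2) in simp_all)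
  thus ?case using Kf_closed(1)[OF Kf_closed(3)[OF y] z] unfolding K_free_def by blast
 qed
 thus ?thesis unfolding rhoK_def dltK_def tauK_def
  by (simp add: K_fun_class[OF additive_rho[OF Z] x] K_fun_class[OF additive_dlt[OF Z] x] K_fun_class[OF additive_tau[OF Z] x])
qed

lemma K_ext:
 assumes X: "X : K0 Z" and Y: "Y : K0 Z" and r: "rhoK X = rhoK Y" and d: "dltK X = dltK Y" and t: "!!i. tauK i X = tauK i Y"
 shows "X = Y"
proof -
 obtain x where x: "x : K_free Z" "X = Kc Z x" using X by (rule K0E)
 obtain y where y: "y : K_free Z" "Y = Kc Z y" using Y by (rule K0E)
 have "keq x (coord (rhoK Y) (dltK Y) (%i. tauK i Y))" using K_coord[OF x(1)] unfolding x(2)[symmetric] r d t .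
 from keq_trans[OF this] have "keq x y" using keq_sym[OF K_coord[OF y(1)]] unfolding y(2) .
 thus ?thesis unfolding x(2) y(2) keq_def by (rule K_class_eqI)
qed

definition "line_span = fs.span (range (O_gen Z))"

text \<open>Rank, degree and Euler form are prescribed on bundles only. This makes them unique,
  since every class is a combination of classes of line bundles.\<close>

lemma K_linear_lines:
 assumes h: "K_linear Z h" and k: "K_linear Z k" and eq: "!!u. h (scl Z (Os Z u)) = k (scl Z (Os Z u))"
  and X: "X : K0 Z"
 shows "h X = k X"
proof -
 have g: "O_gen Z u : line_span" for u unfolding line_span_def by (rule fs.span_base) simp
 note sp = fs.subspace_span[of "range (O_gen Z)", folded line_span_def]
 note cl = fs.subspace_add[OF sp] fs.subspace_diff[OF sp] fs.subspace_scale[OF sp] fs.subspace_sum[OF sp]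
 have c: "coord r d t : line_span" for r d t unfolding coord_def A_gen_def B_gen_def C_gen_def by (intro cl g)
 have l: "l (Kc Z 0) = 0" if "K_linear Z l" for l
 proof -
  have z: "Kc Z 0 : K0 Z" by (rule K_class_K0[OF Kf_closed(4)])
  have "l (K_scale Z 0 (Kc Z 0)) = 0" using that z unfolding K_linear_def by simp
  thus ?thesis unfolding K_scale_class[OF Kf_closed(4)] by simp
 qed
 have "x : K_free Z & h (Kc Z x) = k (Kc Z x)" if "x : line_span" for x using that unfolding line_span_def
 proof (induction rule: fs.span_induct_alt)
  case base
  show ?case using l[OF h] l[OF k] by (simp add: Kf_closed(4))
 next
  case (step c y z)
  obtain u where y: "y = O_gen Z u" using step(1) by blast
  have yf: "y : K_free Z" unfolding y by (rule gen_K_free[OF coh_O])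
  have zf: "z : K_free Z" using step(2) by blast
  note cf = Kf_closed(3)[OF yf]
  have *: "l (Kc Z (fsc c y + z)) = c * l (Kc Z y) + l (Kc Z z)" if "K_linear Z l" for l unfolding K_add_class[OF cf zf, symmetric] K_scale_class[OF yf, symmetric]
   using that K_class_K0[OF yf] K_class_K0[OF zf] K_class_K0[OF cf, folded K_scale_class[OF yf]] unfolding K_linear_def by simp
  have "h (Kc Z y) = k (Kc Z y)" unfolding y using eq unfolding sheaf_class_def .
  thus ?case unfolding *[OF h] *[OF k] using step(2) Kf_closed(1)[OF cf zf] by simp
 qed
 note main = this[OF c]
 obtain x where x: "x : K_free Z" "X = Kc Z x" using X by (rule K0E)
 have "EX r d t. X = Kc Z (coord r d t)" unfolding x(2) by (intro exI, rule K_class_eqI[OF K_coord[OF x(1), unfolded keq_def]])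
 thus ?thesis using main by (elim exE) simp
qed

end

subsection \<open>Vector bundles have no torsion\<close>

fun lms :: "('n::finite, 'k::field) gmod => ('k * 'k) list => ('n,'k) mp" where
 "lms M [] v a = a"
| "lms M (l # ls) v a = lms M ls (v + pc) (lmul M l v a)"

lemma kc_length_Cons: "v + pc + kl ls = v + kc (int (length (l # ls)))" unfolding length_Cons kc_Suc by (simp add: add_ac)

lemma lmuls_lms: "lmuls M ls (v, a) = (v + kl ls, lms M ls v a)"
proof (induction ls arbitrary: v a)
 case (Cons l ls)
 thus ?case unfolding kc_length_Cons[of v ls l, symmetric] by simp
qed simp

lemma lms_append: "lms M (ls @ ls') v a = lms M ls' (v + kl ls) (lms M ls v a)"
proof (induction ls arbitrary: v a)
 case (Cons l ls)
 thus ?case unfolding kc_length_Cons[of v ls l, symmetric] by simp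
qed simp

lemma lmul_linear:
 assumes M: "gmd Z j M"
 shows "lin_on asc asc (gsp M u) (lmul M l u)" unfolding lin_on_def lmul_xop using lin_add[OF gm_x[OF M]] lin_scale[OF gm_x[OF M]]
 by (simp add: asc.scale_right_distrib mult.commute)

lemma lms_linear:
 assumes M: "gmd Z j M"
 shows "lin_on asc asc (gsp M u) (lms M ls u)"
proof (induction ls arbitrary: u)
 case (Cons l ls)
 show ?case unfolding lin_on_def using lin_add[OF lmul_linear[OF M]] lin_scale[OF lmul_linear[OF M]] lin_add[OF Cons] lin_scale[OF Cons] gm_lmul_in[OF M] by simp
qed (simp add: lin_on_def)

lemma gs_lms:
 assumes N: "gsub j M N" shows "a : N u ==> lms M ls u a : N (u + kl ls)"
proof (induction ls arbitrary: u a)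
 case (Cons l ls)
 show ?case using Cons.IH[OF gs_lmul[OF N Cons.prems, of l]] unfolding kc_length_Cons[of u ls l, symmetric] by simp
qed simp

lemma lms_in: "gmd Z j M ==> a : gsp M u ==> lms M ls u a : gsp M (u + kl ls)" by (rule gs_lms[OF gs_full])

lemma lmul_xop_comm:
 assumes M: "gmd Z j M" and a: "a : gsp M u"
 shows "lmul M l (u + pc) (xop b M u a) = xop b M (u + pc) (lmul M l u a)" unfolding lmul_xop
 using gm_x_x[OF M a, of _ b] lin_add[OF gm_x[OF M] gm_asc[OF M gm_x_in[OF M a]] gm_asc[OF M gm_x_in[OF M a]]]
  lin_scale[OF gm_x[OF M] gm_x_in[OF M a]] by simp

lemma lmul_lmul:
 assumes M: "gmd Z j M" and a: "a : gsp M u"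
 shows "lmul M l (u + pc) (lmul M l' u a) = lmul M l' (u + pc) (lmul M l u a)"
 unfolding lmul_xop[of M l'] using lin_add[OF lmul_linear[OF M] gm_asc[OF M gm_x_in[OF M a]] gm_asc[OF M gm_x_in[OF M a]]]
  lin_scale[OF lmul_linear[OF M] gm_x_in[OF M a]] lmul_xop_comm[OF M a] by simp

lemma lms_op:
 assumes M: "gmd Z j M"
 shows "a : gsp M u ==> lms M ls (u + dg s) (hop M s u a) = hop M s (u + kl ls) (lms M ls u a)"
proof (induction ls arbitrary: u a)
 case (Cons l ls)
 have e: "u + dg s + pc = u + pc + dg s" by (simp add: add_ac)
 show ?case unfolding kc_length_Cons[of u ls l, symmetric]
  using Cons.IH[OF gm_lmul_in[OF M Cons.prems, of l]] gm_lmul_t[OF M Cons.prems, of l] lmul_xop_comm[OF M Cons.prems, of l]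
  by (cases s) (simp_all add: e[unfolded dg_def] add_ac)
qed simp

lemma lms_lmul:
 assumes M: "gmd Z j M"
 shows "a : gsp M u ==> lms M ls (u + pc) (lmul M k u a) = lmul M k (u + kl ls) (lms M ls u a)"
proof (induction ls arbitrary: u a)
 case (Cons l ls)
 show ?case unfolding kc_length_Cons[of u ls l, symmetric] using Cons.IH[OF gm_lmul_in[OF M Cons.prems, of l]] lmul_lmul[OF M Cons.prems, of l k] by simp
qed simp

text \<open>The lowest nonzero coefficient of \<open>p\<close> survives unless the coefficient of
  \<open>X0\<close> in the form is 0, and then the form is a multiple of \<open>X1\<close>.\<close>

lemma lmul_O_inj:
 assumes p: "p : Rp j (u + v)" and l: "l ~= (0, 0)" and 0: "lmul (Oc Z u j) l v p = 0"
 shows "p = 0"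
proof (rule ccontr)
 assume "p ~= 0"
 hence ne: "{n. p n ~= 0} ~= {}" by (auto simp: zero_fun_def)
 note fin = ring_part_finite[OF p]
 define n where "n = Min {n. p n ~= 0}"
 have n: "p n ~= 0" "!!m. p m ~= 0 ==> n <= m" using Min_in[OF fin ne] Min_le[OF fin] by (auto simp: n_def)
 have e: "fst l * p m + snd l * p (m - 1) = 0" for m using fun_cong[OF 0, of m] by (simp add: lmul_xop asc_def shift1_def funp fun0)
 have "p (n - 1) = 0" using n(2)[of "n - 1"] by force
 hence "fst l = 0" using e[of n] n(1) by simp
 thus False using e[of "n + 1"] n(1) l by (cases l) simp
qed

definition in_ch :: "chart => 'k::field * 'k => bool" where
 "in_ch j q <-> (j = U0 & fst q ~= 0) | (j = U1 & snd q ~= 0)"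

lemma bundle_coherent: "vector_bundle Z r V ==> cohr Z V" unfolding vector_bundle_def by (rule conjunct1)

lemma bundle_local:
 assumes V: "vector_bundle Z r V" and p: "in_ch j p"
 shows "EX us ph Q. length us = r & finite Q & (ALL q:Q. ~ same_point p q) &
  (ALL k<r. ghom (Oc Z (us ! k) j) (ch V j) (ph k)) &
  (ALL v s. (ALL k<r. s k : Rp j (us ! k + v)) & (SUM k<r. ph k v (s k)) = 0 --> (ALL k<r. s k = 0)) &
  (ALL v. ALL a:sx V j v. EX qs s. set qs <= Q & (ALL k<r. s k : Rp j (us ! k + (v + kl qs))) &
   lms (ch V j) (map vform qs) v a = (SUM k<r. ph k (v + kl qs) (s k)))"
proof -
 note loc = V[unfolded vector_bundle_def, THEN conjunct2, rule_format, OF p[unfolded in_ch_def]]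
 obtain us ph Q where *: "length us = r" "finite Q" "ALL q:Q. ~ same_point p q"
  "ALL k<r. ghom (Oc Z (us ! k) j) (ch V j) (ph k)"
  "ALL v s. (ALL k<r. s k : gsp (Oc Z (us ! k) j) v) & (SUM k<r. ph k v (s k)) = 0 --> (ALL k<r. s k = 0)"
  "ALL v. ALL a:sx V j v. EX qs w s. set qs <= Q & (ALL k<r. s k : gsp (Oc Z (us ! k) j) w) &
   lmuls (ch V j) (map vform qs) (v, a) = (w, SUM k<r. ph k w (s k))" using loc by (elim exE conjE)
 have "EX qs s. set qs <= Q & (ALL k<r. s k : Rp j (us ! k + (v + kl qs))) &
   lms (ch V j) (map vform qs) v a = (SUM k<r. ph k (v + kl qs) (s k))" if "a : sx V j v" for v a
   using *(6)[rule_format, OF that] unfolding lmuls_lms by auto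
 hence 6: "ALL v. ALL a:sx V j v. EX qs s. set qs <= Q & (ALL k<r. s k : Rp j (us ! k + (v + kl qs))) &
   lms (ch V j) (map vform qs) v a = (SUM k<r. ph k (v + kl qs) (s k))" by (intro allI ballI)
 show ?thesis by (intro exI conjI, rule *(1), rule *(2), rule *(3), rule *(4), rule *(5)[unfolded O_simps(1)], rule 6)
qed

lemma sum_in: "asc.subspace W ==> (!!k. k < (r::nat) ==> f k : W) ==> (SUM k<r. f k) : W" by (rule asc.subspace_sum) auto

lemma lin_sum:
 assumes W: "asc.subspace W" and f: "lin_on asc asc W f" and x: "!!k. k < (r::nat) ==> x k : W"
 shows "f (SUM k<r. x k) = (SUM k<r. f (x k))" using x
proof (induction r)
 case 0
 show ?case using asc2.linear_on_zero[OF f W] by simp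
next
 case (Suc r)
 have "f (SUM k<r. x k) = (SUM k<r. f (x k))" by (rule Suc.IH, rule Suc.prems, simp)
 moreover have "f ((SUM k<r. x k) + x r) = f (SUM k<r. x k) + f (x r)" by (rule lin_add[OF f], rule sum_in[OF W], rule Suc.prems, simp, rule Suc.prems, simp)
 ultimately show ?case by (simp only: sum.lessThan_Suc)
qed

text \<open>Near \<open>q\<close> the bundle is a sum of line bundles, which have no torsion. Hence
  \<open>y\<close> is killed by a product of forms not vanishing at \<open>q\<close>, besides the
  form of \<open>q\<close> itself; each of these, together with the form of \<open>q\<close>,
  generates an invertible coordinate, so the factors are removed one by one.\<close>

lemma torsion_free:
 fixes V :: "('n::finite, 'k::field) sheaf"
 assumes V: "vector_bundle Z r V" and q: "in_ch j q" and y: "y : sx V j v" and 0: "lmul (ch V j) (vform q) v y = 0"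
 shows "y = 0"
proof -
 note M = cgm[OF bundle_coherent[OF V]]
 obtain us ph Q where ns: "ALL q':Q. ~ same_point q q'"
  and ph: "ALL k<r. ghom (Oc Z (us ! k) j) (ch V j) (ph k)"
  and inj: "ALL v s. (ALL k<r. s k : Rp j (us ! k + v)) & (SUM k<r. ph k v (s k)) = 0 --> (ALL k<r. s k = 0)"
  and dec: "ALL v. ALL a:sx V j v. EX qs s. set qs <= Q & (ALL k<r. s k : Rp j (us ! k + (v + kl qs))) &
   lms (ch V j) (map vform qs) v a = (SUM k<r. ph k (v + kl qs) (s k))" using bundle_local[OF V q] by (elim exE conjE)
 obtain qs s where qs: "set qs <= Q" and s: "!!k. k < r ==> s k : Rp j (us ! k + (v + kl qs))"
  and eq: "lms (ch V j) (map vform qs) v y = (SUM k<r. ph k (v + kl qs) (s k))" using dec[rule_format, OF y] by blast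
 let ?w = "v + kl qs"
 let ?s' = "%k. lmul (Oc Z (us ! k) j) (vform q) ?w (s k)"
 have s'in: "?s' k : Rp j (us ! k + (?w + pc))" if "k < r" for k using gm_lmul_in[OF gm_O[of Z j "us ! k"], of "s k" ?w] s[OF that] by simp
 have "lmul (ch V j) (vform q) ?w (lms (ch V j) (map vform qs) v y) = 0"
  using lms_lmul[OF M y, of "map vform qs" "vform q"] 0 asc2.linear_on_zero[OF lms_linear[where u = "v + pc" and ls = "map vform qs", OF M] gm_subspace[OF M]] by simp
 hence "(SUM k<r. ph k (?w + pc) (?s' k)) = 0"
  unfolding eq using lin_sum[where x = "%k. ph k ?w (s k)", OF gm_subspace[OF M] lmul_linear[where u = ?w and l = "vform q", OF M], of r]
   gin[OF ph[rule_format]] ghom_lmul[OF gm_O ph[rule_format]] s by simp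
 hence "?s' k = 0" if "k < r" for k using inj[rule_format, of ?s' "?w + pc"] s'in that by blast
 moreover have "vform q ~= (0, 0)" using q by (auto simp: in_ch_def vform_def)
 ultimately have "s k = 0" if "k < r" for k using lmul_O_inj[OF s[OF that]] that by blast
 hence z: "lms (ch V j) (map vform qs) v y = 0" unfolding eq using ghom_0[OF gm_O ph[rule_format]] by simp
 obtain b where b: "inv_on b j" using inv_on_other[of j] inv_on_U01 by (cases "j = U01") blast+
 have ns: "ALL q':set qs. ~ same_point q q'" using ns qs by blast
 show ?thesis using z ns y 0
 proof (induction qs arbitrary: y v)
  case (Cons q' qs)
  let ?y = "lmul (ch V j) (vform q') v y"
  have "?y = 0"
  proof (rule Cons.IH)
   show "lmul (ch V j) (vform q) (v + pc) ?y = 0" using lmul_lmul[OF M Cons.prems(3), of "vform q" "vform q'"] Cons.prems(4)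
     asc2.linear_on_zero[OF lmul_linear[where u = "v + pc" and l = "vform q'", OF M] gm_subspace[OF M]] by simp
  qed (use Cons.prems gm_lmul_in[OF M] in simp_all)
  moreover obtain al be where "!!(M :: ('n, 'k) gmod) u a. asc al (lmul M (vform q) u a) + asc be (lmul M (vform q') u a) = xop b M u a"
   using vform_unit_combination[of q q' b, where 'n = 'n] Cons.prems(2) by auto
  ultimately have "xop b (ch V j) v y = 0" using Cons.prems(4) by (metis asc_0(1) add_0)
  thus ?case using gm_x_inj[OF M b Cons.prems(3) gm_0[OF M]] gm_op_0[OF M] by simp
 qed simp
qed

subsection \<open>Extending homomorphisms to line bundles\<close>

lemma kc_nat_add: "v + kc (int (m + k)) = v + kn k + kn m" by (simp add: kc_add add_ac)

text \<open>An element over \<open>U01\<close> is a fraction with a power of \<open>X1\<close> as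
  denominator, and its image has to be the corresponding fraction. The relation \<open>R\<close>
  leaves the denominator open; independence of it rests on \<open>X1\<close> acting injectively on
  line bundles.\<close>

lemma ghom_extend_U01:
 assumes V: "cohr Z V" and h: "ghom (ch V U0) (Oc Z u U0) h"
 shows "EX h'. ghom (ch V U01) (Oc Z u U01) h' & (ALL v. ALL x:sx V U0 v. h' v (res V U0 v x) = h v x)"
proof -
 let ?M = "ch V U01" and ?N = "Oc Z u U01"
 note M = cgm[OF V, of U01] and M0 = cgm[OF V, of U0] and N = gm_O[of Z U01 u]
 have r: "ghom (ch V U0) (ch V U01) (res V U0)" by (rule coh_res[OF V]) simp
 define S where "S v x y m a <-> a : sx V U0 (v + kn m) & res V U0 (v + kn m) a = xpow True ?M m v x &
  y : gsp ?N v & xpow True ?N m v y = h (v + kn m) a" for v x y m a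
 define R where "R v x y <-> (EX m a. S v x y m a)" for v x y
 \<comment> \<open>Fractions are expanded in order to reach a common denominator.\<close>
 have raise: "S v x y (k + m) (xpow True (ch V U0) k (v + kn m) a)" if s: "S v x y m a" for v x y m a k
 proof -
  have a: "a : sx V U0 (v + kn m)" using s by (simp add: S_def)
  show ?thesis unfolding S_def kc_nat_add xpow_add[of True _ k m] using xpow_in[OF M0 a, of True k] ghom_xpow[OF M0 r a, of k True] ghom_xpow[OF M0 h a, of k True] s
   unfolding S_def O_U01_ops(4)[of True Z u U0] by simp
 qed
 have inj: "h v a = h v a'" if a: "a : sx V U0 v" "a' : sx V U0 v" and eq: "res V U0 v a = res V U0 v a'" for v a a'
 proof -
  note d = gm_diff[OF M0 a]
  have "res V U0 v (a - a') = 0" using ghom_diff[OF M0 r a] eq by simp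
  then obtain m where m: "xpow True (ch V U0) m v (a - a') = 0" using coh_ker[OF V _ d] by auto
  have "xpow True (Oc Z u U0) m v (h v (a - a')) = 0" using ghom_xpow[OF M0 h d, of m True] m ghom_0[OF M0 h] by simp
  hence "h v (a - a') (n - int m) = 0" for n by (simp add: xpow_O fun_eq_iff fun0)
  from this[of "_ + int m"] have "h v (a - a') = 0" by (simp add: fun_eq_iff fun0)
  thus ?thesis using ghom_diff[OF M0 h a] by simp
 qed
 have inj_xp: "y = y'" if "y : gsp ?N v" "y' : gsp ?N v" "xpow True ?N m v y = xpow True ?N m v y'" for y y' m v
  using inj_onD[OF bij_betw_imp_inj_on[OF xpow_bij[OF N inv_on_U01]] that(3,1,2)] .
 have "EX f. ghom ?M ?N f & (ALL v. ALL x:gsp ?M v. R v x (f v x))"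
 proof (rule ghom_of_rel[OF M, where N = ?N and R = R])
  fix v x assume x: "x : gsp ?M v"
  obtain m a where a: "a : sx V U0 (v + kn m)" "res V U0 (v + kn m) a = xpow True ?M m v x" using coh_ext[OF V _ x, of U0] by auto
  have "h (v + kn m) a : gsp ?N (v + kn m)" using gin[OF h a(1)] ring_part_U01 by auto
  hence "h (v + kn m) a : xpow True ?N m v ` gsp ?N v" using bij_betw_imp_surj_on[OF xpow_bij[OF N inv_on_U01, of True m v]] by simp
  thus "EX y. R v x y" unfolding R_def S_def using a by (elim imageE) (intro exI conjI, assumption+, rule sym)
 next
  show "y : gsp ?N v" if "R v x y" for v x y using that unfolding R_def S_def by blast
 next
  fix v y assume "R v 0 y"
  then obtain m a where s: "S v 0 y m a" unfolding R_def by blast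
  have "h (v + kn m) a = h (v + kn m) 0" by (rule inj) (use s gm_0[OF M0] gm_op_0(3)[OF M] ghom_0[OF M0 r] in "simp_all add: S_def")
  hence "xpow True ?N m v y = xpow True ?N m v 0" using s ghom_0[OF M0 h] gm_op_0(3)[OF N, of True m v] by (simp add: S_def)
  thus "y = 0" using inj_xp[of y v 0 m] s gm_0[OF N] by (simp add: S_def)
 next
  fix v x x' y y' c assume x: "x : gsp ?M v" "x' : gsp ?M v" and "R v x y" "R v x' y'"
  then obtain m a m' a' where s: "S v x y m a" "S v x' y' m' a'" unfolding R_def by blast
  from raise[OF s(1), of m'] raise[OF s(2), of m] obtain b b' where s': "S v x y (m' + m) b" "S v x' y' (m' + m) b'" by (simp add: add.commute[of m])
  have b: "b : sx V U0 (v + kc (int (m' + m)))" "b' : sx V U0 (v + kc (int (m' + m)))"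
   and y: "y : gsp ?N v" "y' : gsp ?N v" using s' unfolding S_def by blast+
  have "S v (x + asc c x') (y + asc c y') (m' + m) (b + asc c b')" unfolding S_def using s' gm_add[OF M0 b(1) gm_asc[OF M0 b(2)]] gm_add[OF N y(1) gm_asc[OF N y(2)]]
    ghom_add[OF r b(1) gm_asc[OF M0 b(2)]] ghom_add[OF h b(1) gm_asc[OF M0 b(2)]] ghom_asc[OF r b(2)] ghom_asc[OF h b(2)]
    lin_add[OF xpow_linear[OF M] x(1) gm_asc[OF M x(2)]] lin_add[OF xpow_linear[OF N] y(1) gm_asc[OF N y(2)]]
    lin_scale[OF xpow_linear[OF M] x(2)] lin_scale[OF xpow_linear[OF N] y(2)] unfolding S_def by simp
  thus "R v (x + asc c x') (y + asc c y')" unfolding R_def by blast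
 next
  fix v x y s assume x: "x : gsp ?M v" and "R v x y"
  then obtain m a where S: "S v x y m a" unfolding R_def by blast
  hence a: "a : sx V U0 (v + kn m)" and y: "y : gsp ?N v" by (simp_all add: S_def)
  have d: "v + dg s + kn m = v + kn m + dg s" by (simp add: add_ac)
  have "S (v + dg s) (hop ?M s v x) (hop ?N s v y) m (hop (ch V U0) s (v + kn m) a)"
   unfolding S_def d using S gm_op_in[OF M0 a] gm_op_in[OF N y] ghom_op[OF r a] ghom_op[OF h a] xpow_op[OF M x] xpow_op[OF N y]
   unfolding S_def O_U01_ops(3)[of Z u U0] by (simp del: O_simps)
  thus "R (v + dg s) (hop ?M s v x) (hop ?N s v y)" unfolding R_def by blast
 qed
 then obtain f where f: "ghom ?M ?N f" "!!v x. x : gsp ?M v ==> R v x (f v x)" by blast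
 have "f v (res V U0 v x) = h v x" if x: "x : sx V U0 v" for v x
 proof -
  obtain m a where s: "S v (res V U0 v x) (f v (res V U0 v x)) m a" using f(2)[OF gin[OF r x]] unfolding R_def by blast
  have hx: "h v x : gsp ?N v" using gin[OF h x] ring_part_U01 by auto
  have "h (v + kn m) a = h (v + kn m) (xpow True (ch V U0) m v x)" by (rule inj) (use s xpow_in[OF M0 x] ghom_xpow[OF M0 r x] in "simp_all add: S_def")
  hence "xpow True ?N m v (f v (res V U0 v x)) = xpow True ?N m v (h v x)" using s ghom_xpow[OF M0 h x, of m True] unfolding S_def O_U01_ops(4)[of True Z u U0] by simp
  thus ?thesis using inj_xp[of "f v (res V U0 v x)" v "h v x" m] hx s by (simp add: S_def)
 qed
 thus ?thesis using f(1) by blast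
qed

lemma ring_part_pole:
 assumes "p : Rp U01 w" shows "EX m::nat. ALL k>=m. p : Rp U1 (w + kn k)"
proof -
 note fin = ring_part_finite[OF assms]
 define B where "B = Max {n. p n ~= 0}"
 have B: "n <= B" if "p n ~= 0" for n unfolding B_def by (rule Max_ge[OF fin]) (simp add: that)
 have "p : Rp U1 (w + kn k)" if "k >= nat (B - pmul w)" for k using fin B that by (force simp: Rp_def)
 thus ?thesis by blast
qed

text \<open>Coefficients are indexed by the exponent of \<open>X1\<close>, so multiplication by
  \<open>X0\<close> is the identity on them. Where \<open>X0\<close> is invertible, a twist by a
  multiple of \<open>c\<close> is therefore literally the same module.\<close>

lemma O_twist:
 fixes Z :: "'n::finite => 'k::field * 'k"
 assumes "j ~= U1" shows "Oc Z (u + kc m) j = Oc Z u j"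
proof -
 have "podd (u + kc m + v) = podd (u + v)" "Rp j (u + kc m + v) = (Rp j (u + v) :: 'k amb set)" for v using assms by (auto simp: podd_add Rp_def)
 thus ?thesis by (simp add: O_chart_def)
qed

text \<open>Over \<open>U1\<close> the extension may have poles at the point missing from
  \<open>U0\<close>. Finitely many generators bound the order of the poles, and a twist by a
  multiple of \<open>c\<close> absorbs them.\<close>

lemma hom_extend:
 fixes Z :: "'n::finite => 'k::field * 'k"
 assumes V: "cohr Z V" and h: "ghom (ch V U0) (Oc Z u U0) h"
 shows "EX m yi. yi : Hom V (Os Z (u + kn m)) & (ALL v. ALL x:sx V U0 v. yi U0 v x = h v x)"
proof -
 obtain h' where h': "ghom (ch V U01) (Oc Z u U01) h'" "!!v x. x : sx V U0 v ==> h' v (res V U0 v x) = h v x" using ghom_extend_U01[OF V h] by blast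
 have r1: "ghom (ch V U1) (ch V U01) (res V U1)" by (rule coh_res[OF V]) simp
 note f = ghom_comp[OF r1 h'(1)]
 obtain G where G: "finite G" "gnr U1 (ch V U1) G" using coh_fg[OF V] by blast
 have "EX m::nat. ALL (v, x):G. h' v (res V U1 v x) : Rp U1 (u + v + kn m)"
 proof -
  have "EX m::nat. ALL k>=m. h' (fst g) (res V U1 (fst g) (snd g)) : Rp U1 (u + fst g + kn k)" if "g : G" for g
   by (rule ring_part_pole) (use gin[OF f generatesD(1)[OF G(2), of "fst g" "snd g"]] that in simp)
  then obtain m where m: "!!g k. g : G ==> k >= (m g :: nat) ==> h' (fst g) (res V U1 (fst g) (snd g)) : Rp U1 (u + fst g + kn k)" by metis
  have "ALL (v, x):G. h' v (res V U1 v x) : Rp U1 (u + v + kc (int (Max (m ` G))))" using m[OF _ Max_ge[OF finite_imageI[OF G(1)]]] by force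
  thus ?thesis ..
 qed
 then obtain m :: nat where m: "!!v x. (v, x) : G ==> h' v (res V U1 v x) : Rp U1 (u + v + kn m)" by blast
 let ?u = "u + kn m"
 have d: "u + v + kn m = ?u + v" for v by (simp add: add_ac)
 have gs: "gsub U1 (Oc Z ?u U01) (%v. Rp U1 (?u + v))"
 proof (rule gsubmoduleI)
  note O = gm_O[of Z U1 ?u]
  show "asc.subspace (Rp U1 (?u + v) :: 'k amb set)" for v using gm_subspace[OF O] by simp
  show "Rp U1 (?u + v) <= gsp (Oc Z ?u U01) v" for v using ring_part_U01 by simp
  show "hop (Oc Z ?u U01) s v a : Rp U1 (?u + (v + dg s))" if "a : Rp U1 (?u + v)" for s v a
   using gm_op_in[OF O, of a v s] that unfolding O_U01_ops(3)[of Z ?u U1] by simp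
  show "a : Rp U1 (?u + v)" if bb: "inv_on b U1" and "a : gsp (Oc Z ?u U01) v" and ab: "xop b (Oc Z ?u U01) v a : Rp U1 (?u + (v + pc))" for b v a
  proof -
   have b: b using bb by (auto simp: inv_on_def split: if_splits)
   obtain a' where a': "a' : Rp U1 (?u + v)" "xop b (Oc Z ?u U1) v a' = xop b (Oc Z ?u U01) v a" using gm_x_surj[OF O bb, of "xop b (Oc Z ?u U01) v a" v] ab by auto
   have "a' = a" using a'(2) b by (simp add: shift1_def fun_eq_iff) (metis diff_add_cancel add_diff_cancel_right')
   thus ?thesis using a'(1) by simp
  qed
 qed
 have f': "ghom (ch V U1) (Oc Z ?u U01) (%v x. h' v (res V U1 v x))" using f by (simp add: O_twist)
 have K: "{x : sx V U1 v. h' v (res V U1 v x) : Rp U1 (?u + v)} = sx V U1 v" for v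
  by (rule generatesD(2)[OF G(2) gs_preimage[OF cgm[OF V] f' gs]]) (use generatesD(1)[OF G(2)] m d in simp)
 hence in1: "h' v (res V U1 v x) : Rp U1 (?u + v)" if "x : sx V U1 v" for v x using that by blast
 define g where "g j = (case j of U0 => h | U1 => %v x. h' v (res V U1 v x) | U01 => h')" for j
 have "cut V g : Hom V (Os Z ?u)"
 proof (rule cut_Hom[OF V])
  show "ghom (ch V j) (ch (Os Z ?u) j) (g j)" for j
  proof (cases j)
   case U0 thus ?thesis using h by (simp add: g_def O_twist)
  next
   case U01 thus ?thesis using h'(1) by (simp add: g_def O_twist)
  next
   case U1
   have "ghom (ch V U1) (Oc Z ?u U1) (%v x. h' v (res V U1 v x))"
   proof (rule ghomI)
    show "lbet (sx V U1 v) (gsp (Oc Z ?u U1) v) (%x. h' v (res V U1 v x))" for v using ghom_between[OF f', of v] in1 by (simp add: linear_between_def)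
    show "h' (v + dg s) (res V U1 (v + dg s) (hop (ch V U1) s v x)) = hop (Oc Z ?u U1) s v (h' v (res V U1 v x))"
     if "x : sx V U1 v" for v x s using ghom_op[OF f' that] unfolding O_U01_ops(3)[of Z ?u U1] .
   qed
   thus ?thesis using U1 by (simp add: g_def)
  qed
  show "g U01 v (res V j v x) = res (Os Z ?u) j v (g j v x)" if "j ~= U01" "x : sx V j v" for j v x using that h'(2) by (cases j) (simp_all add: g_def)
 qed
 moreover have "cut V g U0 v x = h v x" if "x : sx V U0 v" for v x using that by (simp add: cut_def g_def)
 ultimately show ?thesis by blast
qed

subsection \<open>Vector bundles are filtered by line bundles\<close>

lemma hom_factor:
 assumes A: "cohr Z A" and B: "cohr Z B" and V: "cohr Z V" and g: "g : Hom A B" and yi: "yi : Hom V B"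
  and inj: "!!j v y. y : sx A j v ==> g j v y = 0 ==> y = 0"
  and im: "!!j v x. x : sx V j v ==> yi j v x : g j v ` sx A j v"
 shows "EX pr. pr : Hom V A & (ALL j v. ALL x:sx V j v. g j v (pr j v x) = yi j v x)"
proof -
 have eq: "y = y'" if "y : sx A j v" "y' : sx A j v" "g j v y = g j v y'" for j v y y'
  using inj[OF gm_diff[OF cgm[OF A] that(1,2)]] ghom_diff[OF cgm[OF A] Hom_g[OF g] that(1,2)] that(3) by simp
 have "EX p. ghom (ch V j) (ch A j) p & (ALL v. ALL x:sx V j v. g j v (p v x) = yi j v x)" for j
  by (rule ghom_factor[OF cgm[OF A] cgm[OF V] Hom_g[OF g] Hom_g[OF yi] inj im])
 then obtain p where p: "!!j. ghom (ch V j) (ch A j) (p j)" "!!j v x. x : sx V j v ==> g j v (p j v x) = yi j v x" by metis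
 note pin = gin[OF p(1)]
 have "cut V p : Hom V A"
 proof (rule cut_Hom[OF V p(1)])
  fix j v x assume j: "j ~= U01" and x: "x : sx V j v"
  note rx = gin[OF coh_res[OF V j] x]
  show "p U01 v (res V j v x) = res A j v (p j v x)" by (rule eq[OF pin[OF rx] gin[OF coh_res[OF A j] pin[OF x]]])
    (simp add: p(2)[OF rx] Hom_res[OF yi j x] Hom_res[OF g j pin[OF x]] p(2)[OF x])
 qed
 thus ?thesis using p(2) by (intro exI[of _ "cut V p"]) (simp add: cut_def)
qed

text \<open>On each chart the quotient is free on one generator, so the kernel is a direct summand,
  and the retraction carries generators of \<open>V\<close> to generators of the kernel.\<close>

lemma ses_line_quotient:
 assumes V: "cohr Z V" and pr: "pr : Hom V (Os Z a)" and surj: "!!j v. pr j v ` sx V j v = Rp j (a + v)"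
 shows "EX f. sexact Z (sub_sheaf V (%j v. {x : sx V j v. pr j v x = 0})) f V pr (Os Z a)"
proof -
 define K where "K j v = {x : sx V j v. pr j v x = 0}" for j v
 let ?W = "sub_sheaf V K" and ?f = "cut (sub_sheaf V K) (%j u a. a)"
 have K: "subsheaf V K" unfolding K_def by (rule subsheaf_kernel[OF V coh_O pr])
 have M: "gmd Z j (ch ?W j)" for j unfolding sub_simps by (rule gmodule_sub[OF cgm[OF V] ss_gs[OF K]])
 have inc: "?f j : gHom (ch ?W j) (ch V j)" for j
 proof -
  have e: "?f j = (%u a. if a : gsp (ch ?W j) u then a else 0)" by (simp add: cut_def fun_eq_iff)
  show ?thesis unfolding e by (rule gHom_cut[OF M ghom_sub[OF ss_gs[OF K], of j, folded sub_simps(1)[of V K]]])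
 qed
 have fid: "?f j v x = x" if "x : K j v" for j v x using that by (simp add: cut_def sub_simps)
 have im: "?f j v ` gsp (ch ?W j) v = {x : sx V j v. pr j v x = 0}" for j v using fid[of _ j v] by (auto simp: sub_simps K_def image_iff)
 have split: "EX e. csplit Z j (ch ?W j) (ch V j) (?f j) (pr j) a e" for j
 proof -
  have "one : pr j (- a) ` sx V j (- a)" unfolding surj using one_in[of Z a j] by simp
  then obtain e where e: "e : sx V j (- a)" "one = pr j (- a) e" by (elim imageE)
  have g: "pr j : gHom (ch V j) (Oc Z a j)" using Hom_gHom[OF pr, of j] by simp
  have i: "x = 0" if "x : gsp (ch ?W j) u" "?f j u x = 0" for u x using that by (simp add: cut_def)
  show ?thesis by (rule exI[of _ e], rule csplit.intro[OF M cgm[OF V] inc g i im e(1) e(2)[symmetric]])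
 qed
 have fg: "EX G. finite G & gnr j ((ch V j)(|gsp := K j|)) G" for j
 proof -
  obtain e where "csplit Z j (ch ?W j) (ch V j) (?f j) (pr j) a e" using split by blast
  from csplit.split_ex[OF this] obtain P p where p: "ghom (ch V j) (ch ?W j) p" and P: "ghom (Oc Z a j) (ch V j) P"
   and dec: "ALL u. ALL x:sx V j u. x = ?f j u (p u x) + P u (pr j u x)" by (elim exE conjE)
  have pK: "p v x = x" if x: "x : K j v" for v x
  proof -
   have xV: "x : sx V j v" and x0: "pr j v x = 0" using x by (simp_all add: K_def)
   have "p v x : K j v" using gin[OF p xV] by (simp add: sub_simps)
   thus ?thesis using dec[rule_format, OF xV] fid x0 ghom_0[OF gm_O P] by simp
  qed
  have "p v ` sx V j v = gsp (ch ?W j) v" for v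
  proof (intro equalityI subsetI)
   show "y : gsp (ch ?W j) v" if "y : p v ` sx V j v" for y using that gin[OF p] by blast
   show "y : p v ` sx V j v" if "y : gsp (ch ?W j) v" for y using that pK[of y v] by (intro image_eqI[of y "p v" y]) (simp_all add: sub_simps K_def)
  qed
  moreover obtain G where G: "finite G" "gnr j (ch V j) G" using coh_fg[OF V] by blast
  ultimately have "gnr j (ch ?W j) ((%(u, a). (u, p u a)) ` G)" using generates_image[OF cgm[OF V] p] by blast
  thus ?thesis unfolding sub_simps using G(1) by blast
 qed
 note W = coherent_sub[OF V K fg]
 have f: "?f : Hom ?W V" by (rule cut_Hom[OF W]) (simp_all add: sub_simps ghom_sub[OF ss_gs[OF K]])
 have "sexact Z ?W ?f V pr (Os Z a)" by (rule short_exactI[OF W V coh_O f pr _ im]) (simp_all add: cut_def surj)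
 thus ?thesis unfolding K_def by blast
qed

text \<open>The image of the last map is a nonzero ideal sheaf in a line bundle, hence a line
  bundle, and its kernel inherits the other maps. The elements \<open>ph\<close> keep all these
  images nonzero, so exactly \<open>r\<close> factors appear.\<close>

lemma filt_of_maps:
 fixes Z :: "'n::finite => 'k::alg_closed_field * 'k" and us ws :: "nat => 'n pic"
 assumes Z: "distinct_points Z" and "cohr Z V"
  and "!!k. k < r ==> yi k : Hom V (Os Z (us k))"
  and "!!j v x. x : sx V j v ==> (!!k. k < r ==> yi k j v x = 0) ==> x = 0"
  and "!!k. k < r ==> ph k : sx V U0 (ws k)"
  and "!!k l. k < r ==> l < r ==> yi l U0 (ws k) (ph k) = 0 <-> l ~= k"
 shows "EX as. length as = r & filt Z V as" using assms(2-)
proof (induction r arbitrary: V yi)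
 case 0
 have "sx V j v = {0}" for j v using 0(3)[of _ j v] gm_0[OF cgm[OF 0(1)], of j v] by blast
 hence "filt Z V []" by (rule filt.Nil[OF 0(1)])
 thus ?case by (intro exI[of _ "[]"]) simp
next
 case (Suc r)
 note V = Suc.prems(1) and yi = Suc.prems(2) and inj = Suc.prems(3) and ph = Suc.prems(4) and dual = Suc.prems(5)
 have yir: "yi r : Hom V (Os Z (us r))" by (rule yi) simp
 define N where "N j v = yi r j v ` sx V j v" for j v
 have N: "subsheaf (Os Z (us r)) N" unfolding N_def by (rule subsheaf_image[OF V coh_O yir])
 have c: "yi r U0 (ws r) (ph r) : N U0 (ws r)" unfolding N_def by (rule imageI, rule ph) simp
 have c0: "yi r U0 (ws r) (ph r) ~= 0" using dual[of r r] by simp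
 obtain v0 g s where g: "g : Hom (Os Z (- v0)) (Os Z (us r))" "ALL j w. g j w ` Rp j (- v0 + w) = N j w"
  "s ~= 0" "ALL j. g j v0 one = s" using ideal_sheaf_hom[OF Z N c c0] by (elim exE conjE)
 have ginj: "y = 0" if "y : gsp (ch (Os Z (- v0)) j) v" "g j v y = 0" for j v y
 proof -
  have gj: "ghom (Oc Z (- v0) j) (Oc Z (us r) j) (g j)" using Hom_g[OF g(1), of j] by simp
  show ?thesis by (rule O_hom_inj[OF Z gj]) (use g(3,4) that in simp_all)
 qed
 have "EX pr. pr : Hom V (Os Z (- v0)) & (ALL j v. ALL x:sx V j v. g j v (pr j v x) = yi r j v x)"
  by (rule hom_factor[OF coh_O coh_O V g(1) yir ginj]) (use g(2) in "simp_all add: N_def")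
 then obtain pr where pr: "pr : Hom V (Os Z (- v0))" "!!j v x. x : sx V j v ==> g j v (pr j v x) = yi r j v x" by blast
 have prin: "pr j v x : Rp j (- v0 + v)" if "x : sx V j v" for j v x using gin[OF Hom_g[OF pr(1)] that] by simp
 have g0: "g j v 0 = 0" for j v using ghom_0[OF cgm[OF coh_O] Hom_g[OF g(1)]] .
 have pr0: "pr j v x = 0 <-> yi r j v x = 0" if "x : sx V j v" for j v x using pr(2)[OF that] ginj[of "pr j v x" j v] prin[OF that] g0[of j v] by auto
 have surj: "pr j v ` sx V j v = Rp j (- v0 + v)" for j v
 proof (intro equalityI subsetI)
  show "y : Rp j (- v0 + v)" if "y : pr j v ` sx V j v" for y using that prin by blast
  fix y :: "'k amb" assume y: "y : Rp j (- v0 + v)"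
  hence "g j v y : N j v" using g(2) by blast
  then obtain x where x: "x : sx V j v" "g j v y = yi r j v x" unfolding N_def by (elim imageE)
  have gj: "ghom (Oc Z (- v0) j) (Oc Z (us r) j) (g j)" using Hom_g[OF g(1), of j] by simp
  have "g j v (y - pr j v x) = 0" using ghom_diff[OF gm_O gj, of y v "pr j v x"] y prin[OF x(1)] x(2) pr(2)[OF x(1)] by simp
  moreover have "y - pr j v x : gsp (ch (Os Z (- v0)) j) v" using gm_diff[OF gm_O, of y Z "- v0" j v "pr j v x"] y prin[OF x(1)] by simp
  ultimately have "y = pr j v x" using ginj[of "y - pr j v x" j v] by simp
  thus "y : pr j v ` sx V j v" using x(1) by blast
 qed
 define W where "W = sub_sheaf V (%j v. {x : sx V j v. pr j v x = 0})"
 obtain f where ses: "sexact Z W f V pr (Os Z (- v0))" using ses_line_quotient[OF V pr(1) surj] unfolding W_def by blast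
 note W = ses_coh(1)[OF ses]
 have Win: "x : sx W j v <-> x : sx V j v & yi r j v x = 0" for x j v using pr0[of x j v] by (auto simp: W_def sub_simps)
 have resW: "res W j v x = res V j v x" for j v x by (simp add: W_def sub_simps)
 have K: "subsheaf V (%j v. {x : sx V j v. pr j v x = 0})" by (rule subsheaf_kernel[OF V coh_O pr(1)])
 have "EX as. length as = r & filt Z W as"
 proof (rule Suc.IH[where yi = "%k. cut W (yi k)", OF W])
  fix k assume k: "k < r"
  note yik = yi[OF less_SucI[OF k]]
  show "cut W (yi k) : Hom W (Os Z (us k))"
  proof (rule cut_Hom[OF W])
   show "ghom (ch W j) (ch (Os Z (us k)) j) (yi k j)" for j using ghom_comp[OF ghom_sub[OF ss_gs[OF K]] Hom_g[OF yik], of j] by (simp add: W_def sub_simps)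
   show "yi k U01 v (res W j v x) = res (Os Z (us k)) j v (yi k j v x)" if "j ~= U01" "x : sx W j v" for j v x
    unfolding resW by (rule Hom_res[OF yik that(1)]) (use that(2) Win in blast)
  qed
  show p: "ph k : sx W U0 (ws k)" unfolding Win using ph[of k] dual[of k r] k by simp
  show "cut W (yi l) U0 (ws k) (ph k) = 0 <-> l ~= k" if "l < r" for l using p dual[of k l] k that by (simp add: cut_def)
 next
  fix j v x assume x: "x : sx W j v" and 0: "!!k. k < r ==> cut W (yi k) j v x = 0"
  have xV: "x : sx V j v" "yi r j v x = 0" using x Win by blast+
  show "x = 0"
  proof (rule inj[OF xV(1)])
   show "yi k j v x = 0" if "k < Suc r" for k using that xV(2) 0[of k] x by (cases "k = r") (simp_all add: cut_def)
  qed
 qed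
 then obtain as where "length as = r" "filt Z W as" by blast
 thus ?case using filt.Cons[OF ses] by (intro exI[of _ "- v0 # as"]) simp
qed

lemma lms_cancel:
 assumes M: "gmd Z j M" and ls: "!!l v y. l : set ls ==> y : gsp M v ==> lmul M l v y = 0 ==> y = 0"
 shows "y : gsp M v ==> lms M ls v y = 0 ==> y = 0" using ls
proof (induction ls arbitrary: v y)
 case (Cons l ls)
 have "lmul M l v y = 0" by (rule Cons.IH[OF gm_lmul_in[OF M Cons.prems(1)]]) (use Cons.prems(2) in simp, rule Cons.prems(3), simp_all)
 thus ?case by (rule Cons.prems(3)[rotated 2]) (use Cons.prems(1) in simp_all)
qed simp

text \<open>If \<open>q\<close> is not a point of the chart, its form is a nonzero multiple of the
  invertible coordinate.\<close>

lemma torsion_free':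
 assumes V: "vector_bundle Z r V" and j: "j ~= U01" and q: "q ~= (0, 0)" and y: "y : sx V j v" and 0: "lmul (ch V j) (vform q) v y = 0"
 shows "y = 0"
proof (cases "in_ch j q")
 case False
 note M = cgm[OF bundle_coherent[OF V], of j]
 obtain c b where c: "c ~= 0" and b: "inv_on b j" "lmul (ch V j) (vform q) v y = asc c (xop b (ch V j) v y)"
 proof (cases j)
  case U0
  hence "fst q = 0" "snd q ~= 0" using False q by (auto simp: in_ch_def prod_eq_iff)
  thus thesis using that[of "snd q" False] U0 by (simp add: lmul_xop vform_def inv_on_def)
 next
  case U1
  hence "snd q = 0" "- fst q ~= 0" using False q by (auto simp: in_ch_def prod_eq_iff)
  thus thesis using that[of "- fst q" True] U1 by (simp add: lmul_xop vform_def inv_on_def)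
 qed (use j in simp)
 have "xop b (ch V j) v y = asc (inverse c) (asc c (xop b (ch V j) v y))" using c by simp
 also have "... = 0" using b(2) 0 by simp
 finally show ?thesis using gm_x_inj[OF M b(1) y gm_0[OF M]] gm_op_0[OF M] by simp
qed (use torsion_free[OF V _ y 0] in blast)

text \<open>Up to a product \<open>L\<close> of forms not vanishing at \<open>p\<close>, the module
  lies in the image of a sum of line bundles. The coordinates of \<open>L x\<close> are the desired
  maps, into line bundles twisted by the degree of \<open>L\<close>; they are jointly injective
  because multiplication by \<open>L\<close> is injective.\<close>

lemma local_coordinates:
 fixes Z :: "'n::finite => 'k::field * 'k" and p :: "'k * 'k"
 assumes V: "vector_bundle Z r V" and p: "in_ch j p"
 shows "EX us yi ws ph. (ALL k<r. ghom (ch V j) (Oc Z (us k) j) (yi k)) &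
  (ALL v. ALL x:sx V j v. (ALL k<r. yi k v x = 0) --> x = 0) &
  (ALL k<r. ph k : sx V j (ws k)) & (ALL k<r. ALL l<r. yi l (ws k) (ph k) = 0 <-> l ~= k)"
proof -
 let ?M = "ch V j"
 note V' = bundle_coherent[OF V]
 note M = cgm[OF V', of j]
 have j: "j ~= U01" using p by (auto simp: in_ch_def)
 obtain us ph Q where ns: "ALL q:Q. ~ same_point p q"
  and ph': "ALL k<r. ghom (Oc Z (us ! k) j) ?M (ph k)"
  and inj: "ALL v s. (ALL k<r. s k : Rp j (us ! k + v)) & (SUM k<r. ph k v (s k)) = 0 --> (ALL k<r. s k = 0)"
  and dec: "ALL v. ALL a:gsp ?M v. EX qs s. set qs <= Q & (ALL k<r. s k : Rp j (us ! k + (v + kl qs))) &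
   lms ?M (map vform qs) v a = (SUM k<r. ph k (v + kl qs) (s k))" using bundle_local[OF V p] by (elim exE conjE)
 note ph = ph'[rule_format]
 define T where "T v s <-> (ALL k<r. s k : Rp j (us ! k + v))" for v and s :: "nat => 'k amb"
 define Ph where "Ph v s = (SUM k<r. ph k v (s k))" for v and s :: "nat => 'k amb"
 have inT: "s k : gsp (Oc Z (us ! k) j) v" if "T v s" "k < r" for v s k using that by (simp add: T_def)
 have phin: "ph k v (s k) : gsp ?M v" if "T v s" "k < r" for v s k by (rule gin[OF ph[OF that(2)] inT[OF that]])
 have Phin: "Ph v s : gsp ?M v" if "T v s" for v s unfolding Ph_def by (rule sum_in[OF gm_subspace[OF M] phin[OF that]])
 let ?O = "%k. Oc Z (us ! k) j"
 have T0: "T v (%_. 0)" "Ph v (%_. 0) = 0" for v using gm_0[OF gm_O] ghom_0[OF gm_O ph] by (auto simp: T_def Ph_def asc.subspace_0[OF sub_Rp])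
 have Tlin: "T v (%k. s k + asc c (s' k))" "Ph v (%k. s k + asc c (s' k)) = Ph v s + asc c (Ph v s')"
  if s: "T v s" "T v s'" for v s s' c
 proof -
  have "s k + asc c (s' k) : Rp j (us ! k + v)" if k: "k < r" for k using gm_add[OF gm_O inT[OF s(1) k] gm_asc[OF gm_O inT[OF s(2) k]]] by simp
  thus "T v (%k. s k + asc c (s' k))" by (simp add: T_def)
  show "Ph v (%k. s k + asc c (s' k)) = Ph v s + asc c (Ph v s')" unfolding Ph_def asc.scale_sum_right sum.distrib[symmetric]
   by (rule sum.cong[OF refl]) (simp add: ghom_add[OF ph inT[OF s(1)] gm_asc[OF gm_O inT[OF s(2)]]] ghom_asc[OF ph inT[OF s(2)]])
 qed
 have Top: "T (v + dg x) (%k. hop (?O k) x v (s k))" "Ph (v + dg x) (%k. hop (?O k) x v (s k)) = hop ?M x v (Ph v s)" if "T v s" for v s x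
 proof -
  show "T (v + dg x) (%k. hop (?O k) x v (s k))" unfolding T_def using gm_op_in[OF gm_O inT[OF that]] unfolding O_simps(1) by blast
  have e: "hop ?M x v (SUM k<r. ph k v (s k)) = (SUM k<r. hop ?M x v (ph k v (s k)))" by (rule lin_sum[OF gm_subspace[OF M] gm_op[OF M] phin[OF that]])
  show "Ph (v + dg x) (%k. hop (?O k) x v (s k)) = hop ?M x v (Ph v s)" unfolding Ph_def e by (rule sum.cong[OF refl]) (simp add: ghom_op[OF ph inT[OF that]])
 qed
 have Tinj: "s k = s' k" if "T v s" "T v s'" "Ph v s = Ph v s'" "k < r" for v s s' k
  using inj[rule_format, of "%k. s k + asc (- 1) (s' k)" v k] Tlin[OF that(1,2), of "- 1"] that(3,4) unfolding T_def Ph_def by simp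
 define S where "S v = {Ph v s |s. T v s}" for v
 have S: "gsub j ?M S"
 proof (rule gsubmoduleI)
  show "asc.subspace (S v)" for v
  proof (rule asc.subspace_lincomb)
   show "0 : S v" unfolding S_def using T0[of v] by force
   show "x + asc c y : S v" if xy: "x : S v" "y : S v" for x y c
   proof -
    obtain s s' where s: "T v s" "T v s'" "x = Ph v s" "y = Ph v s'" using xy unfolding S_def by blast
    show ?thesis unfolding S_def s(3,4) Tlin(2)[OF s(1,2), symmetric] using Tlin(1)[OF s(1,2)] by blast
   qed
  qed
  show "S v <= gsp ?M v" for v unfolding S_def using Phin by blast
  show "hop ?M x v a : S (v + dg x)" if "a : S v" for v a x
  proof -
   obtain s where s: "T v s" "a = Ph v s" using \<open>a : S v\<close> unfolding S_def by blast
   show ?thesis unfolding S_def s(2) Top(2)[OF s(1), symmetric] using Top(1)[OF s(1)] by blast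
  qed
 next
  fix b v a assume b: "inv_on b j" and a: "a : gsp ?M v" "xop b ?M v a : S (v + pc)"
  obtain s where s: "T (v + pc) s" "xop b ?M v a = Ph (v + pc) s" using a(2) unfolding S_def by blast
  have "EX y. y : Rp j (us ! k + v) & xop b (?O k) v y = s k" if k: "k < r" for k by (rule gm_x_surj[OF gm_O b inT[OF s(1) k]]) (use O_simps(1) in blast)
  then obtain s' where s': "!!k. k < r ==> s' k : Rp j (us ! k + v)" "!!k. k < r ==> xop b (?O k) v (s' k) = s k" by metis
  have Ts': "T v s'" using s'(1) by (simp add: T_def)
  have "Ph (v + pc) (%k. xop b (?O k) v (s' k)) = Ph (v + pc) s" unfolding Ph_def by (rule sum.cong[OF refl]) (simp add: s'(2) del: O_simps)
  hence "xop b ?M v a = xop b ?M v (Ph v s')" using Top(2)[OF Ts', of "Inr b"] s(2) by (simp del: O_simps)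
  hence "a = Ph v s'" by (rule gm_x_inj[OF M b a(1) Phin[OF Ts']])
  thus "a : S v" unfolding S_def using Ts' by blast
 qed
 obtain G where G: "finite G" "gnr j ?M G" using coh_fg[OF V'] by blast
 \<comment> \<open>One list of points has to serve all generators; the lists found for the single
   generators are concatenated.\<close>
 have "EX qs. set qs <= Q & (ALL (v, g):G. lms ?M (map vform qs) v g : S (v + kl qs))"
  if "ALL (v, g):G. g : gsp ?M v" using G(1) that
 proof (induction G rule: finite_induct)
  case empty
  show ?case by (intro exI[of _ "[]"]) simp
 next
  case (insert x G)
  obtain w y where x: "x = (w, y)" by fastforce
  have y: "y : gsp ?M w" using insert.prems x by simp
  obtain qs where qs: "set qs <= Q" "ALL (v, g):G. lms ?M (map vform qs) v g : S (v + kl qs)" using insert.IH insert.prems by blast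
  let ?w = "w + kl qs"
  have "lms ?M (map vform qs) w y : gsp ?M ?w" using lms_in[OF M y, of "map vform qs"] by simp
  from dec[rule_format, OF this] obtain qs' s where q': "set qs' <= Q" "ALL k<r. s k : Rp j (us ! k + (?w + kl qs'))"
   "lms ?M (map vform qs') ?w (lms ?M (map vform qs) w y) = (SUM k<r. ph k (?w + kl qs') (s k))" by (elim exE conjE)
  have d: "v + kl (qs @ qs') = v + kl qs + kl qs'" for v :: "'n pic" by (simp add: kc_add add_ac)
  have a: "lms ?M (map vform (qs @ qs')) v g = lms ?M (map vform qs') (v + kl qs) (lms ?M (map vform qs) v g)" for v g by (simp add: lms_append)
  have "lms ?M (map vform (qs @ qs')) w y : S (w + kl (qs @ qs'))" unfolding a d q'(3) S_def Ph_def T_def using q'(2) by blast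
  moreover have "lms ?M (map vform (qs @ qs')) v g : S (v + kl (qs @ qs'))" if "(v, g) : G" for v g
   unfolding a d using gs_lms[OF S, of "lms ?M (map vform qs) v g" "v + kl qs" "map vform qs'"] qs(2) that by auto
  ultimately show ?case using qs(1) q'(1) x by (intro exI[of _ "qs @ qs'"]) auto
 qed
 then obtain qs where qs: "set qs <= Q" "!!v g. (v, g) : G ==> lms ?M (map vform qs) v g : S (v + kl qs)" using generatesD(1)[OF G(2)] by blast
 define L where "L = map vform qs"
 define n where "n = int (length qs)"
 have nL: "int (length L) = n" by (simp add: L_def n_def)
 have nx: "v + kc n + dg x = v + dg x + kc n" for v and x :: "'n + bool" by (simp add: add_ac)
 note nxc = nx[of _ "Inr _", unfolded hop_simps]
 have "gsub j ?M (%v. {x : gsp ?M v. lms ?M L v x : S (v + kc n)})"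
 proof (rule gsubmoduleI)
  show "asc.subspace {x : gsp ?M v. lms ?M L v x : S (v + kc n)}" for v by (rule asc2.subspace_preimage_on[OF lms_linear[OF M] gm_subspace[OF M] gs_subspace[OF S]])
  show "hop ?M s v a : {x : gsp ?M (v + dg s). lms ?M L (v + dg s) x : S (v + dg s + kc n)}"
   if "a : {x : gsp ?M v. lms ?M L v x : S (v + kc n)}" for s v a
   using that gm_op_in[OF M, of a v s] lms_op[OF M, of a v L s] gs_op[OF S, of "lms ?M L v a" "v + kc n" s] unfolding nL nx by simp
  show "a : {x : gsp ?M v. lms ?M L v x : S (v + kc n)}"
   if b: "inv_on b j" and a: "a : gsp ?M v" and xa: "xop b ?M v a : {x : gsp ?M (v + pc). lms ?M L (v + pc) x : S (v + pc + kc n)}" for b v a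
   using a xa lms_op[OF M a, of L "Inr b"] gs_inv[OF S b, of "lms ?M L v a" "v + kc n"] lms_in[OF M a, of L] unfolding nL nxc by simp
 qed blast
 from generatesD(2)[OF G(2) this] have full: "lms ?M L v x : S (v + kc n)" if "x : gsp ?M v" for v x
  using that qs(2) generatesD(1)[OF G(2)] unfolding L_def n_def by blast
 have "(0, 0) ~: Q" using ns by (auto simp: same_point_def)
 hence Lz: "l ~= (0, 0)" if "l : set L" for l using that qs(1) unfolding L_def by (auto simp: vform_def prod_eq_iff)
 have Linj: "x = 0" if "x : gsp ?M v" "lms ?M L v x = 0" for x v
 proof (rule lms_cancel[OF M _ that])
  fix l v y assume l: "l : set L" and y: "y : gsp ?M v" "lmul ?M l v y = 0"
  obtain q where q: "q : Q" "l = vform q" using l qs(1) unfolding L_def by auto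
  have "q ~= (0, 0)" using ns q(1) by (auto simp: same_point_def)
  thus "y = 0" by (rule torsion_free'[OF V j _ y(1)]) (use y(2) q(2) in simp)
 qed
 have d: "us ! k + (v + kc n) = us ! k + kc n + v" for k v by (simp add: add_ac)
 have op: "hop (?O k) s (v + kc n) = hop (Oc Z (us ! k + kc n) j) s v" for k s v by (cases s) (simp_all add: fun_eq_iff d)
 define R where "R k v x y <-> (EX s. T (v + kc n) s & lms ?M L v x = Ph (v + kc n) s & y = s k)" for k v x y
 have lms0: "lms ?M L v 0 = 0" for v by (rule asc2.linear_on_zero[OF lms_linear[OF M] gm_subspace[OF M]])
 have "EX f. ghom ?M (Oc Z (us ! k + kc n) j) f & (ALL v. ALL x:gsp ?M v. R k v x (f v x))" if k: "k < r" for k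
 proof (rule ghom_of_rel[OF M, where N = "Oc Z (us ! k + kc n) j" and R = "R k"])
  show "EX y. R k v x y" if "x : gsp ?M v" for v x using full[OF that] unfolding R_def S_def by blast
  show "y = 0" if "R k v 0 y" for v y using that Tinj[OF _ T0(1) _ k] T0(2) unfolding R_def lms0 by metis
  show "y : gsp (Oc Z (us ! k + kc n) j) v" if "R k v x y" for v x y using that k unfolding R_def T_def by (auto simp: d[symmetric])
  fix v x y assume x: "x : gsp ?M v" and "R k v x y"
  then obtain s where s: "T (v + kc n) s" "lms ?M L v x = Ph (v + kc n) s" "y = s k" unfolding R_def by blast
  show "R k v (x + asc c x') (y + asc c y')" if x': "x' : gsp ?M v" "R k v x' y'" for x' y' c
  proof -
   obtain s' where s': "T (v + kc n) s'" "lms ?M L v x' = Ph (v + kc n) s'" "y' = s' k" using x'(2) unfolding R_def by blast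
   have "lms ?M L v (x + asc c x') = Ph (v + kc n) (%k. s k + asc c (s' k))"
    unfolding Tlin(2)[OF s(1) s'(1)] lin_add[OF lms_linear[OF M] x gm_asc[OF M x'(1)]] lin_scale[OF lms_linear[OF M] x'(1)] s(2) s'(2) ..
   thus ?thesis unfolding R_def s(3) s'(3) using Tlin(1)[OF s(1) s'(1)] by blast
  qed
  have "lms ?M L (v + dg z) (hop ?M z v x) = Ph (v + dg z + kc n) (%k. hop (?O k) z (v + kc n) (s k))" for z
   unfolding lms_op[OF M x] nL s(2) Top(2)[OF s(1), symmetric] nx ..
  thus "R k (v + dg z) (hop ?M z v x) (hop (Oc Z (us ! k + kc n) j) z v y)" for z unfolding R_def s(3) op[symmetric] using Top(1)[OF s(1), of z] unfolding nx by blast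
 qed
 then obtain yi where gh: "!!k. k < r ==> ghom ?M (Oc Z (us ! k + kc n) j) (yi k)"
  and yi: "!!k v x. k < r ==> x : gsp ?M v ==> R k v x (yi k v x)" by metis
 have yiI: "yi k v x = s k" if "x : gsp ?M v" "T (v + kc n) s" "lms ?M L v x = Ph (v + kc n) s" "k < r" for v x s k
  using yi[OF that(4,1)] Tinj[OF _ that(2) _ that(4)] that(3) unfolding R_def by metis
 have joint: "x = 0" if x: "x : gsp ?M v" and 0: "ALL k<r. yi k v x = 0" for v x
 proof (rule Linj[OF x])
  obtain s where s: "T (v + kc n) s" "lms ?M L v x = Ph (v + kc n) s" using full[OF x] unfolding S_def by blast
  have "s k = 0" if "k < r" for k using yiI[OF x s that] 0 that by simp
  thus "lms ?M L v x = 0" unfolding s(2) Ph_def by (intro sum.neutral) (use ghom_0[OF gm_O ph] in simp)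
 qed
 have oneI: "one : gsp (Oc Z (us ! k) j) (- us ! k)" for k using one_in by simp
 \<comment> \<open>The coordinate of the \<open>k\<close>-th generator in its own direction is the
   product of the forms in \<open>L\<close>, which is not 0; the other coordinates vanish.\<close>
 have dual: "yi l (- us ! k) (ph k (- us ! k) one) = 0 <-> l ~= k" if k: "k < r" and l: "l < r" for k l
 proof -
  let ?v = "- us ! k" and ?y = "lms (Oc Z (us ! k) j) L (- us ! k) one"
  let ?s = "%l. if l = k then ?y else 0"
  have yin: "?y : Rp j (us ! k + (?v + kc n))" using lms_in[OF gm_O oneI, of k L] nL by simp
  have Ts: "T (?v + kc n) ?s" using yin by (simp add: T_def asc.subspace_0[OF sub_Rp])
  have "lms ?M ls (w) (ph k w z) = ph k (w + kl ls) (lms (Oc Z (us ! k) j) ls w z)"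
   if "z : gsp (Oc Z (us ! k) j) w" for ls w z using that
  proof (induction ls arbitrary: w z)
   case (Cons l ls)
   show ?case unfolding kc_length_Cons[of w ls l, symmetric] using Cons.IH[OF gm_lmul_in[OF gm_O Cons.prems, of l]] ghom_lmul[OF gm_O ph[OF k] Cons.prems, of l] by simp
  qed simp
  from this[OF oneI, of L] have "lms ?M L ?v (ph k ?v one) = ph k (?v + kc n) ?y" unfolding nL .
  also have "... = Ph (?v + kc n) ?s" unfolding Ph_def using k ghom_0[OF gm_O ph] by (subst sum.mono_neutral_right[of "{..<r}" "{k}"]) auto
  finally have "yi l ?v (ph k ?v one) = ?s l" by (rule yiI[OF gin[OF ph[OF k] oneI] Ts _ l])
  moreover have "?y ~= 0"
  proof
   assume "?y = 0"
   hence "one = (0 :: 'k amb)" by (rule lms_cancel[OF gm_O _ oneI, rotated]) (unfold O_simps(1), rule lmul_O_inj[OF _ Lz])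
   thus False by (auto simp: one_def delta_def fun_eq_iff zero_fun_def dest: spec[of _ 0])
  qed
  ultimately show ?thesis by auto
 qed
 show ?thesis by (rule exI[of _ "%k. us ! k + kc n"], rule exI[of _ yi], rule exI[of _ "%k. - us ! k"], rule exI[of _ "%k. ph k (- us ! k) one"])
   (use gh joint dual gin[OF ph oneI] in blast)
qed

text \<open>Coordinates near one point of \<open>U0\<close> are defined on all of \<open>U0\<close>
  and extend to global maps into line bundles. Their joint injectivity passes to \<open>U01\<close>
  by clearing denominators, and to \<open>U1\<close> because the bundle has no torsion
  there.\<close>

theorem bundle_filt:
 fixes Z :: "'n::finite => 'k::alg_closed_field * 'k"
 assumes Z: "distinct_points Z" and V: "vector_bundle Z r V"
 shows "EX as. length as = r & filt Z V as"
proof -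
 note V' = bundle_coherent[OF V]
 have p: "in_ch U0 (1, 0 :: 'k)" by (simp add: in_ch_def)
 obtain us yi ws ph where gh: "ALL k<r. ghom (ch V U0) (Oc Z (us k) U0) (yi k)"
  and joint: "ALL v. ALL x:sx V U0 v. (ALL k<r. yi k v x = 0) --> x = 0"
  and ph: "ALL k<r. ph k : sx V U0 (ws k)" and dual: "ALL k<r. ALL l<r. yi l (ws k) (ph k) = 0 <-> l ~= k" using local_coordinates[OF V p] by (elim exE conjE)
 have "EX m ze. ze : Hom V (Os Z (us k + kn m)) & (ALL v. ALL x:sx V U0 v. ze U0 v x = yi k v x)" if "k < r" for k by (rule hom_extend[OF V']) (use gh that in blast)
 then obtain m ze where ze: "!!k. k < r ==> ze k : Hom V (Os Z (us k + kc (int (m k))))"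
  "!!k v x. k < r ==> x : sx V U0 v ==> ze k U0 v x = yi k v x" by metis
 have j0: "x = 0" if "x : sx V U0 v" "!!k. k < r ==> ze k U0 v x = 0" for v x using joint that ze(2)[OF _ that(1)] by simp
 have j01: "x = 0" if x: "x : sx V U01 v" and 0: "!!k. k < r ==> ze k U01 v x = 0" for v x
 proof -
  obtain m a where a: "a : sx V U0 (v + kn m)" "res V U0 (v + kn m) a = xpow True (ch V U01) m v x" using coh_ext[OF V' _ x, of U0] by auto
  have "ze k U0 (v + kn m) a = 0" if k: "k < r" for k using Hom_res[OF ze(1)[OF k] _ a(1)] ghom_xpow[OF cgm[OF V'] Hom_g[OF ze(1)[OF k]] x, of m True] 0[OF k]
   unfolding a(2) by (simp add: xpow_O zero_fun_def)
  hence "a = 0" by (rule j0[OF a(1)])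
  hence "xpow True (ch V U01) m v x = xpow True (ch V U01) m v 0" using a(2) ghom_0[OF cgm[OF V'] coh_res[OF V']] gm_op_0[OF cgm[OF V']] by simp
  thus "x = 0" using inj_onD[OF bij_betw_imp_inj_on[OF xpow_bij[OF cgm[OF V'] inv_on_U01]] _ x gm_0[OF cgm[OF V']]] by blast
 qed
 have j1: "x = 0" if x: "x : sx V U1 v" and 0: "!!k. k < r ==> ze k U1 v x = 0" for v x
 proof -
  have r1: "ghom (ch V U1) (ch V U01) (res V U1)" by (rule coh_res[OF V']) simp
  have "res V U1 v x = 0" by (rule j01[OF gin[OF r1 x]]) (use Hom_res[OF ze(1) _ x] 0 in simp)
  then obtain m where m: "xpow False (ch V U1) m v x = 0" using coh_ker[OF V' _ x] by auto
  have q: "(0, 1 :: 'k) ~= (0, 0)" by simp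
  have "xop False (ch V U1) w y = lmul (ch V U1) (vform (0, 1)) w y" for w y by (simp add: lmul_xop vform_def)
  hence c: "y = 0" if "y : sx V U1 w" "xop False (ch V U1) w y = 0" for y w using torsion_free'[OF V _ q that(1)] that(2) by simp
  show "x = 0" using m x
  proof (induction m)
   case (Suc m)
   thus ?case using c[OF xpow_in[OF cgm[OF V'] x, of False m]] by simp
  qed simp
 qed
 show ?thesis
 proof (rule filt_of_maps[OF Z V' ze(1)])
  show "x = 0" if "x : sx V j v" "!!k. k < r ==> ze k j v x = 0" for j v x using j0 j1 j01 that by (cases j) blast+
  show "ph k : sx V U0 (ws k)" if "k < r" for k using ph that by blast
  show "ze l U0 (ws k) (ph k) = 0 <-> l ~= k" if "k < r" "l < r" for k l using ze(2)[OF that(2)] ph dual that by simp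
 qed
qed

subsection \<open>Alternating forms\<close>

lemma homog_update: "xs : Hl M r ==> a : gsp M v ==> xs[k := (v, a)] : Hl M r" unfolding homog_lists_def using set_update_subset_insert[of xs k "(v, a)"] by auto

lemma homog_nth: "xs : Hl M r ==> l < r ==> snd (xs ! l) : gsp M (fst (xs ! l))" unfolding homog_lists_def using nth_mem[of l xs] by (auto simp: case_prod_beta)

lemma deg_sum_update_cong: "dsum (xs[k := (v, a)]) = dsum (xs[k := (v, b)])" by (simp add: deg_sum_def map_update)

lemma deg_sum_update_add: "k < length xs ==> dsum (xs[k := (v + u, a)]) = dsum (xs[k := (v, b)]) + u"
 unfolding deg_sum_def map_update by (simp add: upd_conv_take_nth_drop add_ac)

lemma mset_list_swap:
 assumes "k < length xs" "l < length xs" shows "mset (xs[k := xs ! l, l := xs ! k]) = mset xs"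
proof -
 have "xs[k := xs ! l, l := xs ! k] = permute_list (Transposition.transpose k l) xs"
  using assms by (intro nth_equalityI) (auto simp: permute_list_def nth_list_update Transposition.transpose_def)
 thus ?thesis using assms mset_permute_list[of "Transposition.transpose k l" xs] permutes_swap_id[of k "{..<length xs}" l] by simp
qed

lemma deg_sum_swap: "k < length xs ==> l < length xs ==> dsum (xs[k := xs ! l, l := xs ! k]) = dsum xs"
 unfolding deg_sum_def using mset_list_swap[of k xs l] by (metis mset_map sum_mset_sum_list)

lemma
 assumes w: "alternating r M N w"
 shows alt_in: "xs : Hl M r ==> w xs : gsp N (dsum xs)"
  and alt_op: "xs : Hl M r ==> k < r ==> a : gsp M v ==>
   w (xs[k := (v + dg s, hop M s v a)]) = hop N s (dsum (xs[k := (v, a)])) (w (xs[k := (v, a)]))"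
  and alt_eq: "xs : Hl M r ==> k < r ==> l < r ==> k ~= l ==> xs ! k = xs ! l ==> w xs = 0"
  and alt_swap: "xs : Hl M r ==> k < r ==> l < r ==> k ~= l ==> w (xs[k := xs ! l, l := xs ! k]) = - w xs"
  and alt_lin: "gmd Z j M ==> xs : Hl M r ==> k < r ==> a : gsp M v ==> b : gsp M v ==>
   w (xs[k := (v, a + asc c b)]) = w (xs[k := (v, a)]) + asc c (w (xs[k := (v, b)]))"
proof -
 show "xs : Hl M r ==> w xs : gsp N (dsum xs)"
  "xs : Hl M r ==> k < r ==> l < r ==> k ~= l ==> xs ! k = xs ! l ==> w xs = 0"
  "xs : Hl M r ==> k < r ==> l < r ==> k ~= l ==> w (xs[k := xs ! l, l := xs ! k]) = - w xs" using w unfolding alternating_def by (elim conjE; simp; fail)+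
 have t: "xs : Hl M r ==> k < r ==> a : gsp M v ==> w (xs[k := (v + px i, opt M i v a)]) = opt N i (dsum (xs[k := (v, a)])) (w (xs[k := (v, a)]))"
  "xs : Hl M r ==> k < r ==> a : gsp M v ==> w (xs[k := (v + pc, xop b' M v a)]) = xop b' N (dsum (xs[k := (v, a)])) (w (xs[k := (v, a)]))"
  and add: "xs : Hl M r ==> k < r ==> a : gsp M v ==> b : gsp M v ==> w (xs[k := (v, a + b)]) = w (xs[k := (v, a)]) + w (xs[k := (v, b)])"
  and sc: "xs : Hl M r ==> k < r ==> a : gsp M v ==> w (xs[k := (v, asc c a)]) = asc c (w (xs[k := (v, a)]))" for i b' a b c
  using w unfolding alternating_def xop_def by (elim conjE; simp split: if_split; fail)+
 assume xs: "xs : Hl M r" "k < r" and a: "a : gsp M v"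
 show "w (xs[k := (v + dg s, hop M s v a)]) = hop N s (dsum (xs[k := (v, a)])) (w (xs[k := (v, a)]))" using t[OF xs a] by (cases s) simp_all
 assume M: "gmd Z j M" and b: "b : gsp M v"
 show "w (xs[k := (v, a + asc c b)]) = w (xs[k := (v, a)]) + asc c (w (xs[k := (v, b)]))" using add[OF xs a gm_asc[OF M b]] sc[OF xs b] by simp
qed

lemma alternatingI:
 assumes "!!xs. xs : Hl M r ==> w xs : gsp N (dsum xs)"
  and l: "!!xs k v a b c. xs : Hl M r ==> k < r ==> a : gsp M v ==> b : gsp M v ==>
   w (xs[k := (v, a + asc c b)]) = w (xs[k := (v, a)]) + asc c (w (xs[k := (v, b)]))"
  and x: "!!xs k v a s. xs : Hl M r ==> k < r ==> a : gsp M v ==>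
   w (xs[k := (v + dg s, hop M s v a)]) = hop N s (dsum (xs[k := (v, a)])) (w (xs[k := (v, a)]))"
  and "!!xs k l. xs : Hl M r ==> k < r ==> l < r ==> k ~= l ==> xs ! k = xs ! l ==> w xs = 0"
  and "!!xs k l. xs : Hl M r ==> k < r ==> l < r ==> k ~= l ==> w (xs[k := xs ! l, l := xs ! k]) = - w xs"
 shows "alternating r M N w"
proof -
 have e: "a + asc (c - 1) a = asc c a" for c and a :: "'b amb" by (simp add: asc.scale_left_diff_distrib)
 have s: "w (xs[k := (v, asc c a)]) = asc c (w (xs[k := (v, a)]))" if "xs : Hl M r" "k < r" "a : gsp M v" for xs k v a c
  using l[OF that that(3), of "c - 1"] unfolding e .
 show ?thesis unfolding alternating_def using assms(1,4,5) l[where c = 1, unfolded asc_1] s x[where s = "Inl _", unfolded hop_simps]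
   x[where s = "Inr True", unfolded hop_simps xop_simps] x[where s = "Inr False", unfolded hop_simps xop_simps] by (intro conjI ballI allI impI)
qed

lemma alternating_post:
 assumes w: "alternating r M N w" and M: "gmd Z j' M" and N: "gmd Z j N" and g: "ghom N N' g"
 shows "alternating r M N' (%xs. g (dsum xs) (w xs))"
proof (rule alternatingI)
 show "g (dsum xs) (w xs) : gsp N' (dsum xs)" if "xs : Hl M r" for xs by (rule gin[OF g alt_in[OF w that]])
 show "g (dsum xs) (w xs) = 0" if "xs : Hl M r" "k < r" "l < r" "k ~= l" "xs ! k = xs ! l" for xs k l using alt_eq[OF w that] ghom_0[OF N g] by simp
 show "g (dsum (xs[k := xs ! l, l := xs ! k])) (w (xs[k := xs ! l, l := xs ! k])) = - g (dsum xs) (w xs)"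
  if "xs : Hl M r" "k < r" "l < r" "k ~= l" for xs k l
 proof -
  have len: "length xs = r" using that(1) by (simp add: homog_lists_def)
  have "g (dsum xs) (asc (- 1) (w xs)) = asc (- 1) (g (dsum xs) (w xs))" by (rule ghom_asc[OF g alt_in[OF w that(1)]])
  thus ?thesis using alt_swap[OF w that] deg_sum_swap[of k xs l] len that by simp
 qed
 fix xs k v a assume xs: "xs : Hl M r" and k: "k < r" and a: "a : gsp M v"
 have len: "k < length xs" using xs k by (simp add: homog_lists_def)
 let ?y = "xs[k := (v, a)]"
 note y = alt_in[OF w homog_update[OF xs a, of k]]
 show "g (dsum (xs[k := (v, a + asc c b)])) (w (xs[k := (v, a + asc c b)])) = g (dsum ?y) (w ?y) + asc c (g (dsum (xs[k := (v, b)])) (w (xs[k := (v, b)])))"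
  if b: "b : gsp M v" for b c
 proof -
  have z: "w (xs[k := (v, b)]) : gsp N (dsum ?y)" using alt_in[OF w homog_update[OF xs b, of k]] unfolding deg_sum_update_cong[of xs k v b a] .
  show ?thesis
   unfolding deg_sum_update_cong[of xs k v "a + asc c b" a] deg_sum_update_cong[of xs k v b a] alt_lin[OF w M xs k a b] ghom_add[OF g y gm_asc[OF N z]] ghom_asc[OF g z] ..
 qed
 show "g (dsum (xs[k := (v + dg s, hop M s v a)])) (w (xs[k := (v + dg s, hop M s v a)])) = hop N' s (dsum ?y) (g (dsum ?y) (w ?y))" for s
  using ghom_op[OF g y] alt_op[OF w xs k a] unfolding deg_sum_update_add[OF len, of v "dg s" _ a] by simp
qed

definition hmap :: "('n::finite pic => 'k amb => 'k amb) => ('n pic \<times> 'k amb) list => ('n pic \<times> 'k amb) list" where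
 "hmap f = map (%(v, a). (v, f v a))"

lemma hmap_simps: "length (hmap f xs) = length xs" "dsum (hmap f xs) = dsum xs"
 "l < length xs ==> hmap f xs ! l = (fst (xs ! l), f (fst (xs ! l)) (snd (xs ! l)))"
 "hmap f (xs[k := (v, a)]) = (hmap f xs)[k := (v, f v a)]" by (simp_all add: hmap_def deg_sum_def comp_def case_prod_beta map_update)

lemma hmap_in: "ghom M M' f ==> xs : Hl M r ==> hmap f xs : Hl M' r" unfolding homog_lists_def hmap_def using gin by fastforce

lemma alternating_pre:
 assumes w: "alternating r M' N w" and M': "gmd Z j M'" and f: "ghom M M' f" and M: "gmd Z j' M"
 shows "alternating r M N (%xs. w (hmap f xs))"
proof (rule alternatingI)
 note h = hmap_in[OF f] and s = hmap_simps
 show "w (hmap f xs) : gsp N (dsum xs)" if "xs : Hl M r" for xs using alt_in[OF w h[OF that]] by (simp add: s)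
 have len: "length xs = r" if "xs : Hl M r" for xs using that by (simp add: homog_lists_def)
 show "w (hmap f xs) = 0" if "xs : Hl M r" "k < r" "l < r" "k ~= l" "xs ! k = xs ! l" for xs k l
  by (rule alt_eq[OF w h[OF that(1)] that(2-4)]) (use len[OF that(1)] that in "simp add: s")
 show "w (hmap f (xs[k := xs ! l, l := xs ! k])) = - w (hmap f xs)"
  if "xs : Hl M r" "k < r" "l < r" "k ~= l" for xs k l
 proof -
  have "hmap f (xs[k := xs ! l, l := xs ! k]) = (hmap f xs)[k := hmap f xs ! l, l := hmap f xs ! k]" using len[OF that(1)] that by (simp add: hmap_def map_update)
  thus ?thesis using alt_swap[OF w h[OF that(1)] that(2-4)] by simp
 qed
 fix xs k v a assume xs: "xs : Hl M r" and k: "k < r" and a: "a : gsp M v"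
 note y = gin[OF f a] and hx = h[OF xs]
 have d: "dsum (xs[k := (v, a)]) = dsum ((hmap f xs)[k := (v, f v a)])" by (simp flip: s(4) add: s(2))
 show "w (hmap f (xs[k := (v, a + asc c b)])) = w (hmap f (xs[k := (v, a)])) + asc c (w (hmap f (xs[k := (v, b)])))" if b: "b : gsp M v" for b c
  unfolding s(4) ghom_add[OF f a gm_asc[OF M b]] ghom_asc[OF f b] by (rule alt_lin[OF w M' hx k y gin[OF f b]])
 show "w (hmap f (xs[k := (v + dg t, hop M t v a)])) = hop N t (dsum (xs[k := (v, a)])) (w (hmap f (xs[k := (v, a)])))" for t
  unfolding s(4) d ghom_op[OF f a] by (rule alt_op[OF w hx k y])
qed

text \<open>The forms agree on all lists of generators, and the arguments are replaced by arbitrary elements one at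
 a time.\<close>
lemma alternating_eqI:
 assumes w: "alternating r M N w" "alternating r M N w'" and M: "gmd Z j M" and N: "gmd Z j N"
  and e: "!!k. k < r ==> e k : gsp M (v k)"
  and gen: "!!L u. gsub j M L ==> (!!k. k < r ==> e k : L (v k)) ==> L u = gsp M u"
  and 0: "w (map (%k. (v k, e k)) [0..<r]) = w' (map (%k. (v k, e k)) [0..<r])" and xs: "xs : Hl M r"
 shows "w xs = w' xs"
proof -
 define b where "b k = (v k, e k)" for k
 have bin: "map (b \<circ> p) [0..<r] : Hl M r" if "!!l. l < r ==> p l < r" for p unfolding homog_lists_def using e that by (auto simp: b_def)
 have perm: "w (map (b \<circ> p) [0..<r]) = w' (map (b \<circ> p) [0..<r])" if "p permutes {..<r}" for p using finite_lessThan[of r] that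
 proof (induction p rule: permutes_rev_induct)
  case id
  show ?case using 0 by (simp add: b_def comp_def)
 next
  case (swap k l p)
  let ?xs = "map (b \<circ> p) [0..<r]"
  have xs: "?xs : Hl M r" by (rule bin) (use permutes_in_image[OF swap.hyps(4)] in auto)
  have kl: "k < r" "l < r" using swap by auto
  have e: "map (b \<circ> (p \<circ> Transposition.transpose k l)) [0..<r] = ?xs[k := ?xs ! l, l := ?xs ! k]"
   using kl by (intro nth_equalityI) (auto simp: nth_list_update Transposition.transpose_def)
  show ?case unfolding e alt_swap[OF w(1) xs kl swap.hyps(3)] alt_swap[OF w(2) xs kl swap.hyps(3)] swap.IH ..
 qed
 \<comment> \<open>All arguments are generators here: either none repeats and the list is a
   permutation of the basis, or both forms vanish.\<close>
 have base: "w xs = w' xs" if xs: "xs : Hl M r" and B: "!!l. l < r ==> xs ! l : b ` {..<r}" for xs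
 proof -
  have len: "length xs = r" using xs by (simp add: homog_lists_def)
  have "EX k. k < r & xs ! l = b k" if "l < r" for l using B[OF that] by auto
  then obtain f where f: "!!l. l < r ==> f l < r" "!!l. l < r ==> xs ! l = b (f l)" by metis
  show ?thesis
  proof (cases "inj_on f {..<r}")
   case True
   define p where "p l = (if l < r then f l else l)" for l
   have "p ` {..<r} = f ` {..<r}" by (auto simp: p_def)
   moreover have "f ` {..<r} = {..<r}" by (rule card_subset_eq) (use f(1) card_image[OF True] in auto)
   moreover have "inj_on p {..<r}" using True by (auto simp: p_def inj_on_def)
   ultimately have "p permutes {..<r}" by (intro bij_imp_permutes) (auto simp: bij_betw_def p_def)
   moreover have "xs = map (b \<circ> p) [0..<r]" using len f(2) by (intro nth_equalityI) (simp_all add: p_def)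
   ultimately show ?thesis using perm by simp
  next
   case False
   then obtain k l where "k < r" "l < r" "k ~= l" "f k = f l" by (auto simp: inj_on_def)
   thus ?thesis using alt_eq[OF w(1) xs, of k l] alt_eq[OF w(2) xs, of k l] f(2) by simp
  qed
 qed
 \<comment> \<open>\<open>n\<close> bounds the positions that may hold arbitrary elements. At the
   last of them, the elements for which the forms agree make up a submodule.\<close>
 have "w xs = w' xs" if "n <= r" "xs : Hl M r" "!!l. n <= l ==> l < r ==> xs ! l : b ` {..<r}" for n xs using that
 proof (induction n arbitrary: xs)
  case 0
  thus ?case using base by simp
 next
  case (Suc n)
  note xs = Suc.prems(2)
  have n: "n < r" and len: "length xs = r" using Suc.prems xs by (auto simp: homog_lists_def)
  note lin = alt_lin[OF w(1) M xs n] alt_lin[OF w(2) M xs n] and op = alt_op[OF w(1) xs n] alt_op[OF w(2) xs n]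
  define L where "L u = {a : gsp M u. w (xs[n := (u, a)]) = w' (xs[n := (u, a)])}" for u
  have "gsub j M L"
  proof (rule gsubmoduleI)
   show "asc.subspace (L u)" for u
   proof (rule asc.subspace_lincomb)
    show "0 : L u" using lin[of 0 u 0 "- 1"] gm_0[OF M, of u] by (simp add: L_def)
    show "a + asc c b : L u" if "a : L u" "b : L u" for a b c using that lin[of a u b c] gm_add[OF M, of a u "asc c b"] gm_asc[OF M, of b u c] by (simp add: L_def)
   qed
   show "L u <= gsp M u" for u by (auto simp: L_def)
   show "hop M s u a : L (u + dg s)" if "a : L u" for u a s using that op[of a u s] gm_op_in[OF M, of a u s] by (simp add: L_def)
   show "a : L u" if c: "inv_on c j" and a: "a : gsp M u" and xa: "xop c M u a : L (u + pc)" for u a c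
    using gm_x_inj[OF N c alt_in[OF w(1) homog_update[OF xs a]] alt_in[OF w(2) homog_update[OF xs a]]] a xa op[OF a, of "Inr c"] by (simp add: L_def)
  qed
  moreover have "e k : L (v k)" if k: "k < r" for k
  proof -
   have "w (xs[n := (v k, e k)]) = w' (xs[n := (v k, e k)])" by (rule Suc.IH) (use n len k Suc.prems(3) homog_update[OF xs e[OF k]] in "auto simp: nth_list_update b_def")
   thus ?thesis using e[OF k] by (simp add: L_def)
  qed
  ultimately have "L (fst (xs ! n)) = gsp M (fst (xs ! n))" by (rule gen)
  hence "w (xs[n := (fst (xs ! n), snd (xs ! n))]) = w' (xs[n := (fst (xs ! n), snd (xs ! n))])" using homog_nth[OF xs n] unfolding L_def by blast
  thus ?case by simp
 qed
 from this[of r xs] xs show ?thesis by simp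
qed

subsection \<open>Frames of filtered sheaves\<close>

text \<open>A basis of each chart with its coordinate functions; the transition matrices are unitriangular.\<close>
definition frame where
 "frame Z V as c e <->
  (ALL j. ALL k<length as. ghom (ch V j) (Oc Z (as ! k) j) (c j k) & e j k : sx V j (- as ! k)) &
  (ALL j. ALL k<length as. ALL l<length as. c j l (- as ! k) (e j k) = (if l = k then one else 0)) &
  (ALL j L. gsub j (ch V j) L & (ALL k<length as. e j k : L (- as ! k)) --> (ALL u. L u = sx V j u)) &
  (ALL j k. j ~= U01 --> k < length as --> c U01 k (- as ! k) (res V j (- as ! k) (e j k)) = one &
   (ALL l<k. c U01 l (- as ! k) (res V j (- as ! k) (e j k)) = 0))"

lemma
 assumes fr: "frame Z V as c e"
 shows frame_c: "k < length as ==> ghom (ch V j) (Oc Z (as ! k) j) (c j k)"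
  and frame_e: "k < length as ==> e j k : sx V j (- as ! k)"
  and frame_dual: "k < length as ==> l < length as ==> c j l (- as ! k) (e j k) = (if l = k then one else 0)"
  and frame_gen: "gsub j (ch V j) L ==> (!!k. k < length as ==> e j k : L (- as ! k)) ==> L u = sx V j u"
  and frame_one: "j ~= U01 ==> k < length as ==> c U01 k (- as ! k) (res V j (- as ! k) (e j k)) = one"
  and frame_tri: "j ~= U01 ==> k < length as ==> l < k ==> c U01 l (- as ! k) (res V j (- as ! k) (e j k)) = 0"
proof -
 note f = fr[unfolded frame_def]
 note f1 = f[THEN conjunct1, rule_format] and f2 = f[THEN conjunct2, THEN conjunct1, rule_format]
  and f3 = f[THEN conjunct2, THEN conjunct2, THEN conjunct1, rule_format]
  and f4 = f[THEN conjunct2, THEN conjunct2, THEN conjunct2, rule_format]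
 show "k < length as ==> ghom (ch V j) (Oc Z (as ! k) j) (c j k)" "k < length as ==> e j k : sx V j (- as ! k)"
  by (rule f1[THEN conjunct1], assumption, rule f1[THEN conjunct2], assumption)
 show "k < length as ==> l < length as ==> c j l (- as ! k) (e j k) = (if l = k then one else 0)" by (rule f2)
 show "gsub j (ch V j) L ==> (!!k. k < length as ==> e j k : L (- as ! k)) ==> L u = sx V j u" by (rule f3, intro conjI allI impI)
 show "j ~= U01 ==> k < length as ==> c U01 k (- as ! k) (res V j (- as ! k) (e j k)) = one" by (rule f4[THEN conjunct1])
 show "j ~= U01 ==> k < length as ==> l < k ==> c U01 l (- as ! k) (res V j (- as ! k) (e j k)) = 0" by (rule f4[THEN conjunct2, rule_format])
qed

lemma filt_frame: "filt Z V as ==> EX c e. frame Z V as c e"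
proof (induction rule: filt.induct)
 case (Nil V)
 have 1: "L u = sx V j u" if L: "gsub j (ch V j) L" for j L u
  using gs_sub[OF L, of u] asc.subspace_0[OF gs_subspace[OF L], of u] unfolding Nil(2)[of j u] by (intro equalityI) simp_all
 have "frame Z V [] undefined undefined" unfolding frame_def by (intro conjI allI impI) ((elim conjE, rule 1, assumption) | simp)+
 thus ?case by (intro exI)
next
 case (Cons V' f V g a as)
 note ses = Cons(1)
 note V' = ses_coh(1)[OF ses] and V = ses_coh(2)[OF ses]
 obtain c' e' where fr: "frame Z V' as c' e'" using Cons(3) by blast
 note c' = frame_c[OF fr] frame_e[OF fr] and d' = frame_dual[OF fr] and g' = frame_gen[OF fr] and t' = frame_one[OF fr] frame_tri[OF fr]
 have "ALL j. EX x P p. csplit Z j (ch V' j) (ch V j) (f j) (g j) a x & ghom (Oc Z a j) (ch V j) P & P (- a) one = x &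
   ghom (ch V j) (ch V' j) p & (ALL u. ALL x:sx V j u. x = f j u (p u x) + P u (g j u x))"
 proof
  fix j
  obtain x where x: "csplit Z j (ch V' j) (ch V j) (f j) (g j) a x" using ses_chart_split[OF ses] by blast
  show "EX x P p. csplit Z j (ch V' j) (ch V j) (f j) (g j) a x & ghom (Oc Z a j) (ch V j) P & P (- a) one = x &
   ghom (ch V j) (ch V' j) p & (ALL u. ALL x:sx V j u. x = f j u (p u x) + P u (g j u x))"
   using csplit.split_ex[OF x] x by (elim exE conjE) (intro exI conjI, assumption+)
 qed
 then obtain x P p where all: "ALL j. csplit Z j (ch V' j) (ch V j) (f j) (g j) a (x j) & ghom (Oc Z a j) (ch V j) (P j) &
   P j (- a) one = x j & ghom (ch V j) (ch V' j) (p j) & (ALL u. ALL y:sx V j u. y = f j u (p j u y) + P j u (g j u y))" unfolding choice_iff by (elim exE)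
 note sp = all[rule_format, THEN conjunct1] and P = all[rule_format, THEN conjunct2, THEN conjunct1]
  all[rule_format, THEN conjunct2, THEN conjunct2, THEN conjunct1]
  and p = all[rule_format, THEN conjunct2, THEN conjunct2, THEN conjunct2, THEN conjunct1]
  and dec = all[THEN spec, THEN conjunct2, THEN conjunct2, THEN conjunct2, THEN conjunct2, rule_format]
 note ff = Hom_g[OF ses_Hom(1)[OF ses]] and gg = Hom_g[OF ses_Hom(2)[OF ses]]
 have x: "x j : sx V j (- a)" "g j (- a) (x j) = one" for j by (rule csplit.e[OF sp[of j]])+
 have gf: "g j u (f j u y) = 0" if "y : sx V' j u" for j u y by (rule csplit.gf_0[OF sp that])
 have finj: "y = z" if "y : sx V' j u" "z : sx V' j u" "f j u y = f j u z" for j u y z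
  using ses_inj[OF ses gm_diff[OF cgm[OF V'] that(1,2)]] ghom_diff[OF cgm[OF V'] ff that(1,2)] that(3) by simp
 have pf: "p j u (f j u y) = y" if y: "y : sx V' j u" for j u y
 proof -
  note fy = gin[OF ff y]
  have "f j u y = f j u (p j u (f j u y))" using dec[OF fy] gf[OF y] ghom_0[OF gm_O P(1)] by simp
  thus ?thesis using finj[OF gin[OF p fy] y] by simp
 qed
 have px: "p j (- a) (x j) = 0" for j
 proof -
  have "f j (- a) (p j (- a) (x j)) = 0" using dec[OF x(1)] x(2) P(2) by simp
  thus ?thesis using ses_inj[OF ses gin[OF p x(1)]] by simp
 qed
 \<comment> \<open>The lift of the unit becomes basis element 0, with the projection to the line
   bundle as its coordinate; the old frame is carried over by \<open>f\<close> and \<open>p\<close>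
   and shifted by one. Restricted old basis elements are killed by the projection, which keeps the
   transition matrix triangular.\<close>
 define c where "c j k = (case k of 0 => g j | Suc k => %u y. c' j k u (p j u y))" for j k
 define e where "e j k = (case k of 0 => x j | Suc k => f j (- as ! k) (e' j k))" for j k
 have "frame Z V (a # as) c e" unfolding frame_def
 proof (intro conjI allI impI)
  fix j k assume k: "k < length (a # as)"
  show "ghom (ch V j) (Oc Z ((a # as) ! k) j) (c j k)"
  proof (cases k)
   case 0 thus ?thesis using gg[of j] by (simp add: c_def)
  next
   case (Suc m) thus ?thesis using ghom_comp[OF p c'(1), of m j] k by (simp add: c_def)
  qed
  show "e j k : sx V j (- (a # as) ! k)"
  proof (cases k)
   case 0 thus ?thesis using x(1) by (simp add: e_def)
  next
   case (Suc m) thus ?thesis using gin[OF ff c'(2), of m j] k by (simp add: e_def)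
  qed
  fix l assume l: "l < length (a # as)"
  show "c j l (- (a # as) ! k) (e j k) = (if l = k then one else 0)"
  proof (cases k)
   case 0
   thus ?thesis using x(2) px l ghom_0[OF cgm[OF V'] c'(1)] by (cases l) (simp_all add: c_def e_def)
  next
   case (Suc m)
   hence m: "m < length as" using k by simp
   show ?thesis using Suc l gf[OF c'(2)[OF m]] pf[OF c'(2)[OF m]] d'[OF m] by (cases l) (simp_all add: c_def e_def)
  qed
 next
  fix j L u assume L: "gsub j (ch V j) L & (ALL k<length (a # as). e j k : L (- (a # as) ! k))"
  hence gsL: "gsub j (ch V j) L" by blast
  have eL: "e j k : L (- (a # as) ! k)" if "k < length (a # as)" for k using L that by blast
  have eS: "f j (- as ! k) (e' j k) : L (- as ! k)" if "k < length as" for k using eL[of "Suc k"] that by (simp add: e_def)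
  have x0: "x j : L (- a)" using eL[of 0] by (simp add: e_def)
  have 1: "{y : sx V' j u. f j u y : L u} = sx V' j u" for u by (rule g'[OF gs_preimage[OF cgm[OF V'] ff gsL]]) (use c'(2) eS in simp)
  have 2: "{y : gsp (Oc Z a j) u. P j u y : L u} = gsp (Oc Z a j) u" for u
   by (rule generatesD(2)[OF generates_O gs_preimage[OF gm_O P(1) gsL]]) (use one_in[of Z a j] P(2) x0 in auto)
  have "y : L u" if y: "y : sx V j u" for y
  proof -
   have "f j u (p j u y) : L u" using 1[of u] gin[OF p y] unfolding set_eq_iff by blast
   moreover have "P j u (g j u y) : L u" using 2[of u] gin[OF gg[of j] y, unfolded O_sheaf_simps] unfolding set_eq_iff by blast
   ultimately show ?thesis by (subst dec[OF y]) (rule gs_add[OF gsL])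
  qed
  thus "L u = sx V j u" using gs_sub[OF gsL, of u] by blast
 next
  fix j k assume j: "j ~= U01" and k: "k < length (a # as)"
  have rf: "res V j (- as ! m) (f j (- as ! m) (e' j m)) = f U01 (- as ! m) (res V' j (- as ! m) (e' j m))" if "m < length as" for m
   using Hom_res[OF ses_Hom(1)[OF ses] j c'(2)[OF that]] by simp
  have r': "res V' j (- as ! m) (e' j m) : sx V' U01 (- as ! m)" if "m < length as" for m by (rule gin[OF coh_res[OF V' j] c'(2)[OF that]])
  show "c U01 k (- (a # as) ! k) (res V j (- (a # as) ! k) (e j k)) = one"
  proof (cases k)
   case 0 thus ?thesis using Hom_res[OF ses_Hom(2)[OF ses] j x(1)] x(2) by (simp add: c_def e_def)
  next
   case (Suc m)
   hence m: "m < length as" using k by simp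
   show ?thesis using Suc rf[OF m] pf[OF r'[OF m]] t'(1)[OF j m] by (simp add: c_def e_def)
  qed
  show "c U01 l (- (a # as) ! k) (res V j (- (a # as) ! k) (e j k)) = 0" if l: "l < k" for l
  proof (cases k)
   case (Suc m)
   hence m: "m < length as" using k by simp
   show ?thesis using Suc l rf[OF m] gf[OF r'[OF m]] pf[OF r'[OF m]] t'(2)[OF j m] by (cases l) (simp_all add: c_def e_def)
  qed (use l in simp)
 qed
 thus ?case by blast
qed

subsection \<open>Determinants of coordinates\<close>

definition dt :: "nat => (nat => nat => 'a::comm_ring_1) => 'a" where
 "dt r A = det (mat r r (%(i, j). A i j))"

lemma dt_leibniz: "dt r A = (SUM p:{p. p permutes {0..<r}}. signof p * (PROD i=0..<r. A i (p i)))"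
proof -
 have "(PROD i=0..<r. mat r r (%(i, j). A i j) $$ (i, p i)) = (PROD i=0..<r. A i (p i))" if "p permutes {0..<r}" for p
  using permutes_in_image[OF that] by (intro prod.cong) auto
 thus ?thesis unfolding dt_def by (subst det_def'[of _ r]) (auto intro!: sum.cong)
qed

lemma dt_cong: "(!!i j. i < r ==> j < r ==> A i j = B i j) ==> dt r A = dt r B" unfolding dt_def by (intro arg_cong[of _ _ det] eq_matI) auto

lemma
 assumes k: "k < r"
 shows dt_add: "dt r (A(k := %m. x m + y m)) = dt r (A(k := x)) + dt r (A(k := y))"
  and dt_scale: "dt r (A(k := %m. c * x m)) = c * dt r (A(k := x))"
proof -
 have *: "(PROD i=0..<r. (A(k := x)) i (p i)) = x (p k) * (PROD i:{0..<r} - {k}. A i (p i))" for p x using k by (subst prod.remove[of _ k]) (auto intro!: prod.cong)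
 show "dt r (A(k := %m. x m + y m)) = dt r (A(k := x)) + dt r (A(k := y))" unfolding dt_leibniz * sum.distrib[symmetric] by (simp add: asimps)
 show "dt r (A(k := %m. c * x m)) = c * dt r (A(k := x))" unfolding dt_leibniz * sum_distrib_left by (simp add: asimps)
qed

lemma dt_eq_rows: "k < r ==> l < r ==> k ~= l ==> (!!m. m < r ==> A k m = A l m) ==> dt r A = 0" unfolding dt_def by (rule det_identical_rows[of _ r k l]) auto

lemma dt_swap:
 assumes "k < r" "l < r" "k ~= l" shows "dt r (A(k := A l, l := A k)) = - dt r A"
proof -
 let ?s = "%m. A k m + A l m"
 have tw: "A(k := x, l := y) = (A(l := y))(k := x)" for x y using assms(3) by (rule fun_upd_twist)
 have 0: "dt r (A(k := x, l := x)) = 0" for x by (rule dt_eq_rows[OF assms]) (use assms in auto)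
 note 1 = dt_add[OF assms(2)]
 have 2: "dt r (A(k := ?s, l := y)) = dt r (A(k := A k, l := y)) + dt r (A(k := A l, l := y))" for y unfolding tw by (rule dt_add[OF assms(1)])
 have "dt r (A(k := A k, l := A l)) + dt r (A(k := A l, l := A k)) = 0" using 0[of ?s] unfolding 1 2 0 by (simp add: add.commute)
 hence "dt r A + dt r (A(k := A l, l := A k)) = 0" by simp
 thus ?thesis by (rule minus_unique[symmetric])
qed

lemma dt_triangular:
 assumes "!!i. i < r ==> A i i = 1" "!!i m. i < r ==> m < i ==> A i m = 0" shows "dt r A = 1"
proof -
 have "upper_triangular (mat r r (%(i, j). A i j))" using assms(2) by (auto simp: upper_triangular_def)
 hence "dt r A = prod_list (diag_mat (mat r r (%(i, j). A i j)))" unfolding dt_def by (rule det_upper_triangular[where n = r]) simp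
 also have "diag_mat (mat r r (%(i, j). A i j)) = map (%_. 1) [0..<r]" using assms(1) by (simp add: diag_mat_def)
 also have "prod_list ... = 1" by (simp add: map_replicate_const)
 finally show ?thesis .
qed

text \<open>Products and determinants of coordinates are formed pointwise in the field; this says
  that the resulting function comes from a ring element of degree \<open>u\<close>.\<close>

definition repr :: "('n::finite => 'k::alg_closed_field * 'k) => chart => 'n pic => ('k => 'k) => bool" where
 "repr Z j u F <-> (EX p:Rp j u. ALL z:genpts Z. ev Z u p z = F z)"

lemma repr_ev: "p : Rp j u ==> repr Z j u (ev Z u p)" unfolding repr_def by blast

lemma repr_sum:
 assumes "finite I" "!!i. i : I ==> repr Z j u (F i)" shows "repr Z j u (%z. SUM i:I. F i z)" using assms
proof (induction I rule: finite_induct)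
 case empty
 show ?case unfolding repr_def by (rule bexI[of _ 0]) (simp_all add: asc.subspace_0[OF sub_Rp])
next
 case (insert i I)
 obtain p q where pq: "p : Rp j u" "ALL z:genpts Z. ev Z u p z = F i z"
  "q : Rp j u" "ALL z:genpts Z. ev Z u q z = (SUM i:I. F i z)" using insert unfolding repr_def by blast
 show ?case unfolding repr_def by (rule bexI[of _ "p + q"]) (use pq insert(1,2) in "simp_all add: ev_add asc.subspace_add[OF sub_Rp]")
qed

lemma repr_scale:
 assumes "repr Z j u F" shows "repr Z j u (%z. c * F z)"
proof -
 obtain p where "p : Rp j u" "ALL z:genpts Z. ev Z u p z = F z" using assms unfolding repr_def by blast
 thus ?thesis unfolding repr_def by (intro bexI[of _ "asc c p"]) (simp_all add: ev_asc asc.subspace_scale[OF sub_Rp])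
qed

lemma repr_prod:
 assumes "finite I" "!!i. i : I ==> repr Z j (u i) (F i)" shows "repr Z j (SUM i:I. u i) (%z. PROD i:I. F i z)" using assms
proof (induction I rule: finite_induct)
 case empty
 show ?case unfolding repr_def using one_in[of Z 0 j] by (intro bexI[of _ one]) simp_all
next
 case (insert i I)
 obtain p q where pq: "p : Rp j (u i)" "ALL z:genpts Z. ev Z (u i) p z = F i z"
  "q : Rp j (SUM i:I. u i)" "ALL z:genpts Z. ev Z (SUM i:I. u i) q z = (PROD i:I. F i z)" using insert unfolding repr_def by blast
 show ?case
 proof (rule ring_mult_ex[where Z = Z, OF pq(1,3)])
  fix t assume "t : Rp j (u i + (SUM i:I. u i))"
   "!!z. z : genpts Z ==> ev Z (u i + (SUM i:I. u i)) t z = ev Z (u i) p z * ev Z (SUM i:I. u i) q z"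
  thus ?thesis unfolding repr_def using pq insert(1,2) by (intro bexI[of _ t]) simp_all
 qed
qed

text \<open>All terms of the Leibniz formula have the same degree, since a permutation only reorders
  the degrees \<open>a m\<close>.\<close>

lemma repr_dt:
 assumes "!!i m. i < r ==> m < r ==> repr Z j (a m + v i) (A i m)"
 shows "repr Z j ((SUM m<r. a m) + (SUM i<r. v i)) (%z. dt r (%i m. A i m z))" unfolding dt_leibniz
proof (rule repr_sum, goal_cases)
 case 1
 show ?case by (rule finite_permutations) simp
next
 case (2 p)
 hence p: "p permutes {0..<r}" by simp
 have "repr Z j (SUM i=0..<r. a (p i) + v i) (%z. PROD i=0..<r. A i (p i) z)" using assms permutes_in_image[OF p] by (intro repr_prod) auto
 hence "repr Z j (SUM i=0..<r. a (p i) + v i) (%z. signof p * (PROD i=0..<r. A i (p i) z))" by (rule repr_scale)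
 moreover have "(SUM i=0..<r. a (p i) + v i) = (SUM m<r. a m) + (SUM i<r. v i)" unfolding sum.distrib lessThan_atLeast0 sum.permute[OF p, of a] comp_def ..
 ultimately show ?case by (simp only:)
qed

subsection \<open>The determinant line bundle\<close>

locale framed =
 fixes Z :: "'n::finite => 'k::alg_closed_field * 'k" and V :: "('n, 'k) sheaf" and as c e
 assumes Z: "distinct_points Z" and V: "cohr Z V" and fr: "frame Z V as c e"
begin

text \<open>\<open>Dv\<close> is the determinant of the coordinates of the arguments at the point
  \<open>z\<close>, and \<open>D\<close> the ring element with these values: the top exterior form
  attached to the frame.\<close>

definition "rowv j z x m = ev Z (as ! m + fst x) (c j m (fst x) (snd x)) z"
definition "Dv j xs z = dt (length as) (%l. rowv j z (xs ! l))"
definition "D j xs = (SOME p. p : Rp j (sum_list as + dsum xs) &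
 (ALL z:genpts Z. ev Z (sum_list as + dsum xs) p z = Dv j xs z))"

lemma c_in: "m < length as ==> a : sx V j v ==> c j m v a : Rp j (as ! m + v)" using gin[OF frame_c[OF fr], of m a j v] by simp

lemma
 assumes xs: "xs : Hl (ch V j) (length as)"
 shows D_in: "D j xs : Rp j (sum_list as + dsum xs)"
  and D_ev: "z : genpts Z ==> ev Z (sum_list as + dsum xs) (D j xs) z = Dv j xs z"
proof -
 let ?r = "length as"
 have len: "length xs = ?r" using xs by (simp add: homog_lists_def)
 have "repr Z j ((SUM m<?r. as ! m) + (SUM i<?r. fst (xs ! i))) (%z. dt ?r (%i m. rowv j z (xs ! i) m))"
  unfolding rowv_def by (rule repr_dt, rule repr_ev, rule c_in, assumption, rule homog_nth[OF xs])
 moreover have "(SUM m<?r. as ! m) = sum_list as" by (simp add: sum_list_sum_nth lessThan_atLeast0)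
 moreover have "(SUM i<?r. fst (xs ! i)) = dsum xs" using len by (simp add: deg_sum_def sum_list_sum_nth lessThan_atLeast0)
 ultimately have "EX p. p : Rp j (sum_list as + dsum xs) & (ALL z:genpts Z. ev Z (sum_list as + dsum xs) p z = Dv j xs z)" unfolding repr_def Dv_def by auto
 from someI_ex[OF this] show "D j xs : Rp j (sum_list as + dsum xs)"
  "z : genpts Z ==> ev Z (sum_list as + dsum xs) (D j xs) z = Dv j xs z" unfolding D_def by blast+
qed

lemma D_eqI:
 assumes "xs : Hl (ch V j) (length as)" "p : Rp j (sum_list as + dsum xs)"
  "!!z. z : genpts Z ==> ev Z (sum_list as + dsum xs) p z = Dv j xs z"
 shows "D j xs = p" by (rule ev_inj[OF Z D_in[OF assms(1)] assms(2)]) (simp add: D_ev[OF assms(1)] assms(3))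

lemma Dv_row:
 assumes "xs : Hl (ch V j) (length as)" "k < length as" "!!m. m < length as ==> rowv j z y m = f m"
 shows "Dv j (xs[k := y]) z = dt (length as) ((%l. rowv j z (xs ! l))(k := f))"
 unfolding Dv_def by (rule dt_cong) (use assms in "auto simp: homog_lists_def nth_list_update")

text \<open>Elements of the ring are determined by their values at generic points, where every claim
  is a property of determinants over the field.\<close>

lemma D_alternating: "alternating (length as) (ch V j) (Oc Z (sum_list as) j) (D j)"
proof (rule alternatingI)
 let ?r = "length as" and ?u = "sum_list as" and ?M = "ch V j"
 note M = cgm[OF V, of j]
 show "D j xs : gsp (Oc Z ?u j) (dsum xs)" if "xs : Hl ?M ?r" for xs using D_in[OF that] by simp
 have len: "length xs = ?r" if "xs : Hl ?M ?r" for xs using that by (simp add: homog_lists_def)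
 show "D j xs = 0" if xs: "xs : Hl ?M ?r" and "k < ?r" "l < ?r" "k ~= l" "xs ! k = xs ! l" for xs k l
 proof (rule D_eqI[OF xs])
  show "0 : (Rp j (?u + dsum xs) :: 'k amb set)" by (rule asc.subspace_0[OF sub_Rp])
  have "Dv j xs z = 0" for z unfolding Dv_def by (rule dt_eq_rows[of k _ l]) (use that in simp_all)
  thus "ev Z (?u + dsum xs) 0 z = Dv j xs z" for z by simp
 qed
 show "D j (xs[k := xs ! l, l := xs ! k]) = - D j xs" if xs: "xs : Hl ?M ?r" and kl: "k < ?r" "l < ?r" "k ~= l" for xs k l
 proof -
  let ?ys = "xs[k := xs ! l, l := xs ! k]"
  have d: "dsum ?ys = dsum xs" using deg_sum_swap[of k xs l] len[OF xs] kl by simp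
  have ys: "?ys : Hl ?M ?r" using homog_update[OF homog_update[OF xs homog_nth[OF xs kl(2)], of k] homog_nth[OF xs kl(1)], of l] by simp
  have "D j ?ys = asc (- 1) (D j xs)"
  proof (rule D_eqI[OF ys], unfold d)
   show "asc (- 1) (D j xs) : Rp j (?u + dsum xs)" by (rule asc.subspace_scale[OF sub_Rp D_in[OF xs]])
   fix z assume z: "z : genpts Z"
   have "Dv j ?ys z = dt ?r ((%i. rowv j z (xs ! i))(k := rowv j z (xs ! l), l := rowv j z (xs ! k)))"
    unfolding Dv_def by (rule dt_cong) (use len[OF xs] kl in "auto simp: nth_list_update")
   thus "ev Z (?u + dsum xs) (asc (- 1) (D j xs)) z = Dv j ?ys z"
    unfolding dt_swap[OF kl, of "%i. rowv j z (xs ! i)"] ev_asc[OF D_in[OF xs]] D_ev[OF xs z] by (simp add: Dv_def[of j xs])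
  qed
  thus ?thesis by simp
 qed
 fix xs k v a assume xs: "xs : Hl ?M ?r" and k: "k < ?r" and a: "a : gsp ?M v"
 let ?y = "xs[k := (v, a)]" and ?A = "%z l. rowv j z (xs ! l)"
 have kx: "k < length xs" using len[OF xs] k by simp
 note cg = frame_c[OF fr] and y = homog_update[OF xs a, of k] and row = Dv_row[OF xs k] and sub = sub_Rp
 have yb: "Dv j (xs[k := (v, b)]) z = dt ?r ((?A z)(k := rowv j z (v, b)))" for z b by (rule row[OF refl])
 show "D j (xs[k := (v, a + asc s b)]) = D j ?y + asc s (D j (xs[k := (v, b)]))" if b: "b : gsp ?M v" for b s
 proof (rule D_eqI[OF homog_update[OF xs gm_add[OF M a gm_asc[OF M b]]]], unfold deg_sum_update_cong[of xs k v "a + asc s b" a])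
  note z' = homog_update[OF xs b, of k] and d = deg_sum_update_cong[of xs k v b a]
  have p: "D j (xs[k := (v, b)]) : Rp j (?u + dsum ?y)" using D_in[OF z'] unfolding d .
  note sp = asc.subspace_scale[OF sub p]
  show "D j ?y + asc s (D j (xs[k := (v, b)])) : Rp j (?u + dsum ?y)" by (rule asc.subspace_add[OF sub D_in[OF y] sp])
  fix z assume z: "z : genpts Z"
  note ev = ev_add[OF c_in[OF _ a] asc.subspace_scale[OF sub c_in[OF _ b]]] ev_asc[OF c_in[OF _ b]]
  have "Dv j (xs[k := (v, a + asc s b)]) z = dt ?r ((?A z)(k := %m. rowv j z (v, a) m + s * rowv j z (v, b) m))"
   by (rule row) (simp add: rowv_def ghom_add[OF cg a gm_asc[OF M b]] ghom_asc[OF cg b] ev)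
  thus "ev Z (?u + dsum ?y) (D j ?y + asc s (D j (xs[k := (v, b)]))) z = Dv j (xs[k := (v, a + asc s b)]) z"
   unfolding dt_add[OF k] dt_scale[OF k] ev_add[OF D_in[OF y] sp] ev_asc[OF p] D_ev[OF y z] D_ev[OF z' z, unfolded d] yb by simp
 qed
 show "D j (xs[k := (v + dg s, hop ?M s v a)]) = hop (Oc Z ?u j) s (dsum ?y) (D j ?y)" for s
 proof (rule D_eqI[OF homog_update[OF xs gm_op_in[OF M a]]], unfold deg_sum_update_add[OF kx, of v "dg s" _ a] add.assoc[symmetric])
  have "hop (Oc Z ?u j) s (dsum ?y) (D j ?y) : gsp (Oc Z ?u j) (dsum ?y + dg s)" by (rule gm_op_in[OF gm_O]) (use D_in[OF y] in simp)
  thus "hop (Oc Z ?u j) s (dsum ?y) (D j ?y) : Rp j (?u + dsum ?y + dg s)" unfolding O_simps(1) add.assoc .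
  fix z assume z: "z : genpts Z"
  have "rowv j z (v + dg s, hop ?M s v a) m = op_value Z s z * rowv j z (v, a) m" if m: "m < ?r" for m
   using ev_op[OF z c_in[OF m a], of s] unfolding rowv_def fst_conv snd_conv ghom_op[OF cg[OF m] a] add.assoc .
  hence "Dv j (xs[k := (v + dg s, hop ?M s v a)]) z = dt ?r ((?A z)(k := %m. op_value Z s z * rowv j z (v, a) m))" by (rule row)
  thus "ev Z (?u + dsum ?y + dg s) (hop (Oc Z ?u j) s (dsum ?y) (D j ?y)) z = Dv j (xs[k := (v + dg s, hop ?M s v a)]) z"
   unfolding dt_scale[OF k] ev_op[OF z D_in[OF y]] D_ev[OF y z] yb by simp
 qed
qed

definition "basis j = map (%k. (- as ! k, e j k)) [0..<length as]"

lemma basis_in: "basis j : Hl (ch V j) (length as)" using frame_e[OF fr] by (auto simp: homog_lists_def basis_def)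

lemma basis_deg: "dsum (basis j) = - sum_list as"
proof -
 have "dsum (basis j) = (SUM k<length as. - as ! k)" by (simp add: deg_sum_def basis_def comp_def sum_list_sum_nth lessThan_atLeast0)
 thus ?thesis by (simp add: sum_negf sum_list_sum_nth lessThan_atLeast0)
qed

lemma one_ring: "one : (Rp j (0 :: 'n pic) :: 'k amb set)" using one_in[of Z 0 j] by simp

lemma D_basis: "D j (basis j) = one"
proof (rule D_eqI[OF basis_in])
 show "one : (Rp j (sum_list as + dsum (basis j)) :: 'k amb set)" by (simp add: basis_deg one_ring)
 fix z :: 'k
 have "Dv j (basis j) z = 1" unfolding Dv_def by (rule dt_triangular) (simp_all add: rowv_def basis_def frame_dual[OF fr])
 thus "ev Z (sum_list as + dsum (basis j)) one z = Dv j (basis j) z" by (simp add: basis_deg)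
qed

lemma D_res_basis:
 assumes j: "j ~= U01" shows "D U01 (hmap (res V j) (basis j)) = one"
proof (rule D_eqI[OF hmap_in[OF coh_res[OF V j] basis_in]], unfold hmap_simps(2))
 show "one : (Rp U01 (sum_list as + dsum (basis j)) :: 'k amb set)" by (simp add: basis_deg one_ring)
 fix z :: 'k
 have "hmap (res V j) (basis j) ! l = (- as ! l, res V j (- as ! l) (e j l))" if "l < length as" for l using that by (simp add: hmap_simps(3) basis_def)
 hence "Dv U01 (hmap (res V j) (basis j)) z = 1" unfolding Dv_def by (intro dt_triangular) (simp_all add: rowv_def frame_one[OF fr j] frame_tri[OF fr j])
 thus "ev Z (sum_list as + dsum (basis j)) one z = Dv U01 (hmap (res V j) (basis j)) z" by (simp add: basis_deg)
qed

lemma alternating_eq_basis: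
 assumes w: "alternating (length as) (ch V j) N w" "alternating (length as) (ch V j) N w'" and N: "gmd Z j N"
  and eq: "w (basis j) = w' (basis j)" and xs: "xs : Hl (ch V j) (length as)"
 shows "w xs = w' xs"
proof (rule alternating_eqI[where e = "e j" and v = "%k. - as ! k", OF w cgm[OF V] N])
 show "L u = sx V j u" if "gsub j (ch V j) L" "!!k. k < length as ==> e j k : L (- as ! k)" for L u by (rule frame_gen[OF fr that])
qed (rule frame_e[OF fr], assumption, rule eq[unfolded basis_def], rule xs)

lemma det_iso_exists: "det_iso Z (length as) V (sum_list as)" unfolding det_iso_def
proof (intro exI[of _ D] conjI allI ballI D_alternating)
 show "gnr j (Oc Z (sum_list as) j) {(dsum xs, D j xs) |xs. xs : Hl (ch V j) (length as)}" for j
 proof (rule generatesI)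
  show "a : gsp (Oc Z (sum_list as) j) u" if "(u, a) : {(dsum xs, D j xs) |xs. xs : Hl (ch V j) (length as)}" for u a using that D_in by auto
  fix N u a assume N: "gsub j (Oc Z (sum_list as) j) N"
   and G: "!!u a. (u, a) : {(dsum xs, D j xs) |xs. xs : Hl (ch V j) (length as)} ==> a : N u"
   and a: "a : gsp (Oc Z (sum_list as) j) u"
  have "one : N (- sum_list as)" by (rule G) (use basis_in[of j] basis_deg[of j] D_basis[of j] in \<open>auto intro!: exI[of _ "basis j"]\<close>)
  thus "a : N u" using generatesD(2)[OF generates_O N, of u] a by auto
 qed
 fix j xs assume "j : {U0, U1}" and xs: "xs : Hl (ch V j) (length as)"
 hence j: "j ~= U01" by auto
 have "D U01 (hmap (res V j) xs) = D j xs"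
 proof (rule alternating_eq_basis[OF alternating_pre[OF D_alternating cgm[OF V] coh_res[OF V j] cgm[OF V]] _ _ _ xs])
  show "alternating (length as) (ch V j) (Oc Z (sum_list as) U01) (D j)" using alternating_post[OF D_alternating cgm[OF V] gm_O ghom_O_U01] .
  show "gmd Z j (Oc Z (sum_list as) U01)" by (rule gmodule_weaken[OF gm_O])
  show "D U01 (hmap (res V j) (basis j)) = D j (basis j)" unfolding D_basis by (rule D_res_basis[OF j])
 qed
 thus "D U01 (map (%(v, a). (v, res V j v a)) xs) = res (Os Z (sum_list as)) j (dsum xs) (D j xs)" by (simp add: hmap_def)
qed

text \<open>Any other determinant form is a map \<open>G\<close> of line bundles applied to
  \<open>D\<close>, since alternating forms are determined on the basis. Generation makes
  \<open>G\<close> surjective, so it is injective with zero cokernel, and additive functions then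
  show equal degrees and parities.\<close>

lemma det_iso_unique:
 assumes d: "det_iso Z (length as) V u" shows "u = sum_list as"
proof -
 let ?r = "length as" and ?s = "sum_list as"
 obtain w where w: "!!j. alternating ?r (ch V j) (Oc Z u j) (w j)"
  and gen: "!!j. gnr j (Oc Z u j) {(dsum xs, w j xs) |xs. xs : Hl (ch V j) ?r}"
  and res: "!!j xs. j : {U0, U1} ==> xs : Hl (ch V j) ?r ==> w U01 (hmap (res V j) xs) = w j xs" using d unfolding det_iso_def hmap_def by auto
 define y where "y j = w j (basis j)" for j
 have yin: "y j : Rp j (u - ?s)" for j using alt_in[OF w basis_in, of j] by (simp add: y_def basis_deg)
 have "EX f. ghom (Oc Z ?s j) (Oc Z u j) f & f (- ?s) one = y j" for j
  using O_hom_ex[OF gm_O, of "y j" Z u j "- ?s"] yin[of j] by (metis O_simps(1) add_uminus_conv_diff minus_minus)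
 then obtain f where f: "!!j. ghom (Oc Z ?s j) (Oc Z u j) (f j)" "!!j. f j (- ?s) one = y j" by metis
 have wf: "w j xs = f j (dsum xs) (D j xs)" if "xs : Hl (ch V j) ?r" for j xs
  by (rule alternating_eq_basis[OF w alternating_post[OF D_alternating cgm[OF V] gm_O f(1)] gm_O _ that])
   (simp add: D_basis basis_deg f(2) y_def)
 have yj: "y j = y U01" if j: "j ~= U01" for j
 proof -
  have "y j = w U01 (hmap (res V j) (basis j))" using res[of j "basis j"] basis_in[of j] j by (cases j) (simp_all add: y_def)
  also have "... = f U01 (- ?s) one" using wf[OF hmap_in[OF coh_res[OF V j] basis_in]] by (simp add: D_res_basis[OF j] hmap_simps(2) basis_deg)
  finally show ?thesis unfolding f(2) .
 qed
 have "is_section (Os Z u) (- ?s) y" unfolding is_section_def using yin yj by simp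
 then obtain G where G: "G : Hom (Os Z ?s) (Os Z u)" "!!j. G j (- ?s) one = y j" using section_hom[OF coh_O, of Z u "- ?s" y] by auto
 have GG: "ghom (Oc Z ?s j) (Oc Z u j) (G j)" for j using Hom_g[OF G(1), of j] by simp
 have wG: "w j xs = G j (dsum xs) (D j xs)" if "xs : Hl (ch V j) ?r" for j xs
  by (rule alternating_eq_basis[OF w alternating_post[OF D_alternating cgm[OF V] gm_O GG] gm_O _ that])
   (simp add: D_basis basis_deg G(2) y_def)
 have surj: "G j v ` Rp j (?s + v) = Rp j (u + v)" for j v
 proof -
  have "G j v ` gsp (Oc Z ?s j) v = gsp (Oc Z u j) v" by (rule generatesD(2)[OF gen gs_image[OF gm_O gm_O GG gs_full[OF gm_O]]])
    (use wG D_in in auto)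
  thus ?thesis by simp
 qed
 have y0: "y j ~= 0" for j
 proof
  assume 0: "y j = 0"
  obtain x where x: "x : Rp j (?s - u)" "one = G j (- u) x" using surj[of j "- u"] one_ring[of j] by auto
  have "G j (- u) x = 0" by (rule O_hom_unique[where f = "G j" and g = "%_ _. 0", OF gm_O GG]) (use 0 G(2) x ghom_zero[OF gm_O] in auto)
  thus False using x(2) by (auto simp: one_def delta_def fun_eq_iff zero_fun_def dest: spec[of _ 0])
 qed
 have inj: "p = 0" if "p : gsp (ch (Os Z ?s) j) v" "G j v p = 0" for j v p by (rule O_hom_inj[OF Z GG]) (use y0 G(2) that in simp_all)
 have N: "subsheaf (Os Z u) (%j v. Rp j (u + v))" using subsheaf_image[OF coh_O coh_O G(1)] by (simp add: surj)
 have "EX q Q. sexact Z (Os Z ?s) G (Os Z u) q Q" by (intro exI, rule ses_quot[OF coh_O coh_O G(1) inj N]) (simp_all add: surj)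
 then obtain q Q where Q: "sexact Z (Os Z ?s) G (Os Z u) q Q" by blast
 have "sx Q j v = {0}" for j v
 proof -
  have "Rp j (u + v) = {b : Rp j (u + v). q j v b = 0}" using ses_ex[OF Q, of j v] surj[of j v] by simp
  hence "q j v ` Rp j (u + v) <= {0}" by blast
  hence "sx Q j v <= {0}" using ses_surj[OF Q, of j v] by simp
  thus ?thesis using gm_0[OF cgm[OF ses_coh(3)[OF Q]], of j v] by blast
 qed
 hence add: "ph (Os Z u) = ph (Os Z ?s)" if "additive Z ph" for ph using additiveD[OF that Q] additive_zero[OF that ses_coh(3)[OF Q]] by simp
 have "pdeg u = pdeg ?s" using add[OF additive_dlt[OF Z]] by (simp add: dlt_O)
 moreover have "sgn_at u i = sgn_at ?s i" for i using add[OF additive_tau[OF Z, of i]] by (simp add: tau_O)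
 hence "i : podd u <-> i : podd ?s" for i by (auto simp: sgn_at_def split: if_splits dest: meta_spec[of _ i])
 hence "podd u = podd ?s" by blast
 ultimately show ?thesis by (intro pic_eqI)
qed

end

lemma sum_list_pdeg: "pdeg (sum_list as) = (SUM a<-as. pdeg a)" by (induction as) simp_all

text \<open>Since \<open>rho\<close> recovers the rank, the rank hidden in the description of the
  degree is forced, and the determinant class is then unique as well.\<close>

theorem bundle_invariants:
 fixes Z :: "'n::finite => 'k::alg_closed_field * 'k"
 assumes Z: "distinct_points Z" and VB: "vector_bundle Z r V"
 shows "rho V = int r" and "bundle_degree Z V = dlt V"
proof -
 have rank: "rho V = int s" if s: "vector_bundle Z s V" for s
 proof -
  obtain as where "length as = s" "filt Z V as" using bundle_filt[OF Z s] by blast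
  thus ?thesis using additive_filt[OF additive_rho[OF Z], of V as] by (simp add: rho_O sum_list_triv)
 qed
 show "rho V = int r" by (rule rank[OF VB])
 obtain as where as: "length as = r" "filt Z V as" using bundle_filt[OF Z VB] by blast
 obtain c e where "frame Z V as c e" using filt_frame[OF as(2)] by blast
 then interpret framed Z V as c e using Z filt_coherent[OF as(2)] by unfold_locales
 have "(THE u. EX r. vector_bundle Z r V & det_iso Z r V u) = sum_list as"
 proof (rule the_equality)
  show "EX r. vector_bundle Z r V & det_iso Z r V (sum_list as)" using VB det_iso_exists as(1) by blast
  show "u = sum_list as" if "EX r. vector_bundle Z r V & det_iso Z r V u" for u using that rank rank[OF VB] as(1) det_iso_unique by auto
 qed
 hence "bundle_degree Z V = (SUM a<-as. pdeg a)" unfolding bundle_degree_def by (simp add: sum_list_pdeg)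
 moreover have "rat_of_int (dlt V) = rat_of_int (SUM a<-as. pdeg a)"
 proof -
  have "rat_of_int (SUM a<-bs. pdeg a) = (SUM a<-bs. rat_of_int (pdeg a))" for bs :: "'n pic list" by (induction bs) simp_all
  thus ?thesis using additive_filt[OF additive_dlt[OF Z] as(2)] by (simp add: dlt_O)
 qed
 ultimately show "bundle_degree Z V = dlt V" by simp
qed

lemma vector_bundle_O: "vector_bundle Z 1 (Os Z u)" unfolding vector_bundle_def
proof (intro conjI coh_O allI impI)
 fix p :: "'b \<times> 'b" and j
 show "EX us ph Q. length us = 1 & finite Q & (ALL q:Q. ~ same_point p q) &
   (ALL k<1. ghom (Oc Z (us ! k) j) (ch (Os Z u) j) (ph k)) &
   (ALL v s. (ALL k<1. s k : gsp (Oc Z (us ! k) j) v) & (SUM k<1. ph k v (s k)) = 0 --> (ALL k<1. s k = 0)) &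
   (ALL v. ALL a:gsp (ch (Os Z u) j) v. EX qs w s. set qs <= Q &
    (ALL k<1. s k : gsp (Oc Z (us ! k) j) w) &
    lmuls (ch (Os Z u) j) (map vform qs) (v, a) = (w, SUM k<1. ph k w (s k)))" by (rule exI[of _ "[u]"], rule exI[of _ "%_ _ x. x"], rule exI[of _ "{}"])
   (auto intro!: ghom_id)
qed

subsection \<open>Rank, degree and Euler form on the Grothendieck group\<close>

lemma K_linearD:
 assumes "K_linear Z h"
 shows K_linear_add: "X : K0 Z ==> Y : K0 Z ==> h (K_add X Y) = h X + h Y"
  and K_linear_scale: "X : K0 Z ==> h (K_scale Z c X) = c * h X" using assms unfolding K_linear_def by blast+

lemma K_linear_combine:
 assumes "K_linear Z h" "K_linear Z k"
 shows "K_linear Z (%X. a * h X + b * k X)" unfolding K_linear_def using K_linearD[OF assms(1)] K_linearD[OF assms(2)] by (simp add: asimps)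

lemma K_linear_0: "K_linear Z (%X. 0)" by (simp add: K_linear_def)

lemma K_linear_sum: "finite I ==> (!!i. i : I ==> K_linear Z (h i)) ==> K_linear Z (%X. SUM i:I. a i * h i X)"
proof (induction I rule: finite_induct)
 case (insert i I)
 thus ?case using K_linear_combine[of Z "h i" "%X. SUM i:I. a i * h i X" "a i" 1] by simp
qed (simp add: K_linear_0)

text \<open>The Riemann-Roch form in coordinates. As \<open>tau\<close> is twice the coordinate
  along \<open>epsilon_i\<close>, the last sum is the standard scalar product on the root lattice
  part.\<close>

definition euler :: "('n::finite, 'k::field) fsum set => ('n, 'k) fsum set => rat" where
 "euler X Y = (1 - of_nat CARD('n) / 4) * (rhoK X * rhoK Y) + (rhoK X * dltK Y - dltK X * rhoK Y) / 2
  + (SUM i:UNIV. tauK i X * tauK i Y) / 4"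

context
 fixes Z :: "'n::finite => 'k::alg_closed_field * 'k"
 assumes Z: "distinct_points Z" and card: "CARD('n) >= 2"
begin

lemma sheaf_class_K0: "cohr Z F ==> scl Z F : K0 Z" unfolding sheaf_class_def by (rule K_class_K0[OF gen_K_free])

lemmas KL = K_funs[OF Z card]

lemma
 assumes F: "cohr Z F"
 shows rhoK_sheaf: "rhoK (scl Z F) = of_int (rho F)" and dltK_sheaf: "dltK (scl Z F) = of_int (dlt F)"
  and tauK_sheaf: "tauK i (scl Z F) = of_int (tau i F)" unfolding rhoK_def dltK_def tauK_def
 by (rule K_fun_sheaf[OF additive_rho[OF Z] F] K_fun_sheaf[OF additive_dlt[OF Z] F] K_fun_sheaf[OF additive_tau[OF Z] F])+

lemma K_rank_eq:
 assumes X: "X : K0 Z" shows "K_rank Z X = rhoK X"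
proof -
 let ?P = "%h. K_linear Z h & (ALL r V. vector_bundle Z r V --> h (scl Z V) = of_nat r)"
 have "?P rhoK" using KL(1) bundle_invariants(1)[OF Z] rhoK_sheaf[OF bundle_coherent] by simp
 hence P: "?P (K_rank Z)" unfolding K_rank_def by (rule someI[where P = ?P])
 have "K_rank Z (scl Z (Os Z u)) = rhoK (scl Z (Os Z u))" for u using P[THEN conjunct2, rule_format, OF vector_bundle_O[of Z u]] by (simp add: rhoK_sheaf[OF coh_O] rho_O)
 thus ?thesis using K_linear_lines[OF Z card conjunct1[OF P] KL(1) _ X] by blast
qed

lemma K_degree_eq:
 assumes X: "X : K0 Z" shows "K_degree Z X = dltK X"
proof -
 let ?P = "%h. K_linear Z h & (ALL V. is_bundle Z V --> h (scl Z V) = of_int (bundle_degree Z V))"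
 have Q: "dltK (scl Z V) = of_int (bundle_degree Z V)" if "is_bundle Z V" for V
  using that bundle_invariants(2)[OF Z] dltK_sheaf[OF bundle_coherent] unfolding is_bundle_def by force
 hence "?P dltK" using KL(2) by blast
 hence P: "?P (K_degree Z)" unfolding K_degree_def by (rule someI[where P = ?P])
 have "is_bundle Z (Os Z u)" for u unfolding is_bundle_def using vector_bundle_O by blast
 thus ?thesis by (intro K_linear_lines[OF Z card _ KL(2) _ X]) (use P Q in simp_all)
qed

lemma K_linear_euler: "K_linear Z (euler X)" "K_linear Z (%Y. euler Y X)"
proof -
 let ?T = "%Y. SUM i:UNIV. tauK i X * tauK i Y"
 have T: "K_linear Z ?T" by (rule K_linear_sum) (simp_all add: KL(3))
 note c = K_linear_combine
 have "K_linear Z (%Y. 1 * (((1 - of_nat CARD('n) / 4) * rhoK X - dltK X / 2) * rhoK Y + rhoK X / 2 * dltK Y) + 1/4 * ?T Y)" by (rule c[OF c[OF KL(1) KL(2)] T])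
 thus "K_linear Z (euler X)" by (simp add: euler_def[abs_def] asimps diff_divide_distrib)
 have "K_linear Z (%Y. 1 * (((1 - of_nat CARD('n) / 4) * rhoK X + dltK X / 2) * rhoK Y + (- rhoK X / 2) * dltK Y) + 1/4 * ?T Y)" by (rule c[OF c[OF KL(1) KL(2)] T])
 thus "K_linear Z (%Y. euler Y X)" by (simp add: euler_def[abs_def] asimps diff_divide_distrib)
qed

text \<open>For fixed \<open>F\<close> the formula is additive in \<open>V\<close> and equals
  \<open>chs F (- a)\<close> on O(a); a filtration of \<open>V\<close> then gives the alternating
  dimension count.\<close>

lemma euler_bundle:
 assumes V: "is_bundle Z V" and F: "cohr Z F"
 shows "euler (scl Z V) (scl Z F) = of_nat (dim_Hom V F) - of_nat (dim_Ext1 V F)"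
proof -
 obtain r where r: "vector_bundle Z r V" using V unfolding is_bundle_def by blast
 obtain as where as: "filt Z V as" using bundle_filt[OF Z r] by blast
 let ?ps = "%V. ((1 - of_nat CARD('n) / 4) * of_int (rho F) + of_int (dlt F) / 2) * of_int (rho V) - (of_int (rho F) / 2) * of_int (dlt V)
  + (SUM i:UNIV. (of_int (tau i F) / 4) * of_int (tau i V)) :: rat"
 have "additive Z ?ps" by (intro additive_add additive_diff additive_sum additive_scale additive_rho[OF Z] additive_dlt[OF Z] additive_tau[OF Z])
 from additive_filt[OF this as] have 1: "?ps V = (SUM a<-as. ?ps (Os Z a))" .
 have 2: "?ps (Os Z a) = of_int (chs F (- a))" for a unfolding chi_sec_formula[OF Z F] rho_O dlt_O tau_O by (simp add: field_simps sum_divide_distrib)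
 have 3: "(SUM a<-as. rat_of_int (chs F (- a))) = of_int (SUM a<-as. chs F (- a))" for as :: "'n pic list" by (induction as) simp_all
 have "of_int (int (dim_Hom V F) - int (dim_Ext1 V F)) = ?ps V" unfolding 1 2 3 using filt_index[OF as F fredholm_sec_coherent[OF Z F]] by simp
 moreover have "euler (scl Z V) (scl Z F) = ?ps V" unfolding euler_def rhoK_sheaf[OF F] dltK_sheaf[OF F] tauK_sheaf[OF F] rhoK_sheaf[OF bundle_coherent[OF r]]
   dltK_sheaf[OF bundle_coherent[OF r]] tauK_sheaf[OF bundle_coherent[OF r]] by (simp add: field_simps sum_divide_distrib)
 ultimately show ?thesis by simp
qed

text \<open>The forms agree on pairs of line bundles, and \<open>K_linear_lines\<close> is used in
  the second argument and then in the first.\<close>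

lemma euler_eq:
 assumes X: "X : K0 Z" and Y: "Y : K0 Z"
 shows "euler_form Z X Y = euler X Y"
proof -
 let ?P = "%b. (ALL X:K0 Z. K_linear Z (b X) & K_linear Z (%Y. b Y X)) &
   (ALL V F. is_bundle Z V & cohr Z F --> b (scl Z V) (scl Z F) = of_nat (dim_Hom V F) - of_nat (dim_Ext1 V F))"
 have "?P euler" using K_linear_euler euler_bundle by blast
 hence P: "?P (euler_form Z)" unfolding euler_form_def by (rule someI[where P = ?P])
 have b: "is_bundle Z (Os Z u)" for u unfolding is_bundle_def using vector_bundle_O by blast
 note O = sheaf_class_K0[OF coh_O]
 have 0: "euler_form Z (scl Z (Os Z u)) (scl Z (Os Z v)) =
   euler (scl Z (Os Z u)) (scl Z (Os Z v))" for u v using P[THEN conjunct2, rule_format, OF conjI[OF b coh_O]] euler_bundle[OF b coh_O] by (simp only:)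
 have 1: "euler_form Z (scl Z (Os Z u)) Y = euler (scl Z (Os Z u)) Y" for u by (rule K_linear_lines[OF Z card _ K_linear_euler(1) 0 Y]) (use P O in blast)
 show ?thesis by (rule K_linear_lines[OF Z card _ K_linear_euler(2) _ X, where h = "%X. euler_form Z X Y"]) (use P Y 1 in simp_all)
qed

lemma lin_ext_sum:
 "finite I ==> (!!i. i : I ==> x i : K_free Z) ==> lin_ext ph (SUM i:I. x i) = (SUM i:I. lin_ext ph (x i))"
proof (induction I rule: finite_induct)
 case empty
 show ?case by (simp add: lin_ext_def fun0)
next
 case (insert i I)
 have "sum x I : K_free Z" by (rule Kf_closed(5)) (simp add: insert.prems)
 from lin_ext_add[OF finK[OF insert.prems[of i]] finK[OF this]] show ?case using insert by simp
qed

lemma S_coherent: "cohr Z (S_sheaf Z i)" using S_sheaf[OF Z, of i] ses_coh(3) by blast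

lemma eps_K_free: "gen (S_sheaf Z i) + fsc (1/2) (O_gen Z (- pc) - O_gen Z 0) : K_free Z" by (intro Kf_closed(1-3) gen_K_free S_coherent coh_O)

lemma lin_ext_eps:
 assumes a: "additive Z ph"
 shows "lin_ext ph (gen (S_sheaf Z i) + fsc (1/2) (O_gen Z (- pc) - O_gen Z 0)) =
  ph (Os Z 0) - ph (Os Z (- px i)) + (ph (Os Z (- pc)) - ph (Os Z 0)) / 2"
proof -
 note k = gen_K_free[OF S_coherent[of i]] gen_K_free[OF coh_O[of Z "- pc"]] gen_K_free[OF coh_O[of Z 0]]
 note d = Kf_closed(2)[OF k(2,3)] and f = finK
 obtain q where "sexact Z (Os Z (- px i)) (t_map Z i (- px i)) (Os Z 0) q (S_sheaf Z i)" using S_sheaf[OF Z] by blast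
 from additiveD[OF a this] show ?thesis
  unfolding lin_ext_add[OF f[OF k(1)] f[OF Kf_closed(3)[OF d]]] lin_ext_scale[OF f[OF d] f[OF d]] lin_ext_diff[OF f[OF k(2)] f[OF k(3)]] by simp
qed

lemma
 shows eps_comb_K0: "eps_comb Z a : K0 Z" and eps_comb_rho: "rhoK (eps_comb Z a) = 0"
  and eps_comb_dlt: "dltK (eps_comb Z a) = 0" and eps_comb_tau: "tauK i (eps_comb Z a) = 2 * a i"
proof -
 let ?e = "%i. gen (S_sheaf Z i) + fsc (1/2) (O_gen Z (- pc) - O_gen Z 0)"
 have k: "fsc (a i) (?e i) : K_free Z" for i by (rule Kf_closed(3)[OF eps_K_free])
 have x: "(SUM i:UNIV. fsc (a i) (?e i)) : K_free Z" by (rule Kf_closed(5)) (rule k)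
 show "eps_comb Z a : K0 Z" unfolding eps_comb_def by (rule K_class_K0[OF x])
 have l: "K_fun ph (eps_comb Z a) = (SUM i:UNIV. a i * (ph (Os Z 0) - ph (Os Z (- px i)) + (ph (Os Z (- pc)) - ph (Os Z 0)) / 2))"
  if ph: "additive Z ph" for ph unfolding eps_comb_def K_fun_class[OF ph x] lin_ext_sum[OF finite k] lin_ext_scale[OF finK[OF eps_K_free] finK[OF eps_K_free]]
   lin_ext_eps[OF ph] ..
 show "rhoK (eps_comb Z a) = 0" unfolding rhoK_def l[OF additive_rho[OF Z]] by (simp add: rho_O)
 show "dltK (eps_comb Z a) = 0" unfolding dltK_def l[OF additive_dlt[OF Z]] by (simp add: dlt_O)
 have "tauK i (eps_comb Z a) = (SUM k:UNIV. if k = i then 2 * a k else 0)" unfolding tauK_def l[OF additive_tau[OF Z]] tau_O by (rule sum.cong) (auto simp: sgn_at_def)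
 thus "tauK i (eps_comb Z a) = 2 * a i" by simp
qed

lemma Lambda_iff: "X : Lambda Z <-> X : K0 Z & rhoK X = 0 & dltK X = 0" unfolding Lambda_def using K_rank_eq K_degree_eq by auto

text \<open>Against a class of rank and degree 0 only the sum of products of \<open>tau\<close>
  survives in the Euler form, on either side; testing with \<open>epsilon_i\<close> isolates one
  coordinate.\<close>

lemma Lambda_perp_iff: "X : Lambda_perp Z <-> X : K0 Z & (ALL i. tauK i X = 0)"
proof (intro iffI conjI allI)
 show X: "X : K0 Z" if "X : Lambda_perp Z" using that by (simp add: Lambda_perp_def)
 fix i assume p: "X : Lambda_perp Z"
 let ?Y = "eps_comb Z (%k. if k = i then 1 else 0)"
 have Y: "?Y : Lambda Z" by (simp add: Lambda_iff eps_comb_K0 eps_comb_rho eps_comb_dlt)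
 have "euler_form Z X ?Y = 0" using p Y unfolding Lambda_perp_def by blast
 hence "euler X ?Y = 0" unfolding euler_eq[OF X[OF p] eps_comb_K0] .
 thus "tauK i X = 0" by (simp add: euler_def eps_comb_rho eps_comb_dlt eps_comb_tau if_distrib[of "%x. _ * (2 * x)"] cong: if_cong)
next
 assume X: "X : K0 Z & (ALL i. tauK i X = 0)"
 have "euler_form Z X Y = 0 & euler_form Z Y X = 0" if "Y : Lambda Z" for Y using that X euler_eq[of X Y] euler_eq[of Y X] unfolding Lambda_iff by (simp add: euler_def)
 thus "X : Lambda_perp Z" using X by (simp add: Lambda_perp_def)
qed

text \<open>Half of \<open>tau i\<close> is the coordinate along \<open>epsilon_i\<close>; what
  remains after subtracting this combination has all \<open>tau\<close> equal to 0.\<close>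

lemma Lambda_proj_eq:
 assumes X: "X : K0 Z"
 shows "Lambda_proj Z X = eps_comb Z (%i. tauK i X / 2)" unfolding Lambda_proj_def
proof (rule the_equality)
 let ?Y = "eps_comb Z (%i. tauK i X / 2)"
 obtain x where x: "x : K_free Z" "X = Kc Z x" using X by (rule K0E)
 obtain y where y: "y : K_free Z" "?Y = Kc Z y" using eps_comb_K0 by (rule K0E)
 let ?Zz = "Kc Z (x - y)"
 have xy: "x - y : K_free Z" by (rule Kf_closed(2)[OF x(1) y(1)])
 have "K_add ?Y ?Zz = Kc Z (y + (x - y))" unfolding y(2) by (rule K_add_class[OF y(1) xy])
 hence add: "X = K_add ?Y ?Zz" using x(2) by simp
 have "tauK i X = tauK i ?Y + tauK i ?Zz" for i using K_linear_add[OF KL(3) eps_comb_K0 K_class_K0[OF xy], of i "%i. tauK i X / 2"] unfolding add[symmetric] .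
 hence Zp: "?Zz : Lambda_perp Z" by (simp add: Lambda_perp_iff K_class_K0[OF xy] eps_comb_tau)
 show "?Y : Lambda Z & (EX Zz:Lambda_perp Z. X = K_add ?Y Zz)"
  by (rule conjI, simp only: Lambda_iff eps_comb_K0 eps_comb_rho eps_comb_dlt simp_thms, rule bexI[OF _ Zp], rule add)
 fix Y assume Y': "Y : Lambda Z & (EX Zz:Lambda_perp Z. X = K_add Y Zz)"
 have Y: "Y : K0 Z" "rhoK Y = 0" "dltK Y = 0" using Y'[THEN conjunct1] by (simp_all only: Lambda_iff)
 obtain Zz where "Zz : Lambda_perp Z" and XYZ: "X = K_add Y Zz" using Y'[THEN conjunct2] by (elim bexE)
 hence Zz: "Zz : K0 Z" "!!i. tauK i Zz = 0" by (simp_all only: Lambda_perp_iff)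
 have t: "tauK i Y = tauK i ?Y" for i using K_linear_add[OF KL(3) Y(1) Zz(1), of i] unfolding XYZ[symmetric] Zz(2) eps_comb_tau by simp
 show "Y = ?Y" by (rule K_ext[OF Z card Y(1) eps_comb_K0 _ _ t]) (simp_all only: Y(2,3) eps_comb_rho eps_comb_dlt)
qed

end

subsection \<open>The numerical argument\<close>

lemma sum_squares_le_square_sum:
 fixes b :: "'a => int"
 assumes "finite I" "!!i. i : I ==> b i >= 0" shows "(SUM i:I. (b i)\<^sup>2) <= (SUM i:I. b i)\<^sup>2" using assms
proof (induction I rule: finite_induct)
 case (insert i I)
 have "0 <= b i * sum b I" using insert.prems by (intro mult_nonneg_nonneg sum_nonneg) auto
 thus ?case using insert by (simp add: power2_sum)
qed simp

text \<open>Subtracting twice the smallest of at least four terms keeps the inequality.\<close>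
lemma sum_squares_le_square_signed_sum:
 fixes b :: "'a => int"
 assumes I: "card I = 4" and l: "l : I" and b: "!!i. i : I ==> 0 <= b l & b l <= b i"
 shows "(SUM i:I. (b i)\<^sup>2) <= ((SUM i:I. b i) - 2 * b l)\<^sup>2" and "(SUM i:I. b i) - 2 * b l >= 0"
proof -
 have fin: "finite I" using I by (metis card.infinite zero_neq_numeral)
 have "card (I - {l}) = 3" using I l fin by simp
 then obtain p q t where J: "I - {l} = {p, q, t}" "p ~= q" "q ~= t" "p ~= t" by (metis card_3_iff)
 have s: "sum f I = f l + f p + f q + f t" for f :: "'a => int" using sum.remove[OF fin l, of f] J by simp
 have pqt: "b l <= b p" "b l <= b q" "b l <= b t" "0 <= b l" using b[of p] b[of q] b[of t] b[OF l] J(1) by auto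
 have m: "b l * b p <= b q * b p" "b l * b q <= b t * b q" "b l * b t <= b p * b t" using pqt by (intro mult_right_mono; simp)+
 have "((SUM i:I. b i) - 2 * b l)\<^sup>2 - (SUM i:I. (b i)\<^sup>2) =
  2 * ((b q * b p - b l * b p) + (b t * b q - b l * b q) + (b p * b t - b l * b t))" unfolding s by (simp add: power2_eq_square asimps)
 also have "... >= 0" using m by simp
 finally show "(SUM i:I. (b i)\<^sup>2) <= ((SUM i:I. b i) - 2 * b l)\<^sup>2" by simp
 show "(SUM i:I. b i) - 2 * b l >= 0" unfolding s using pqt by linarith
qed

text \<open>Convexity excludes entries larger than \<open>2 * de + 1\<close>. The sum of five
  squares then bounds \<open>r\<close> above by a linear function of \<open>de\<close>, while
  \<open>r\<close> grows at least like \<open>(de + 1)^2\<close>; only \<open>de = 1\<close> and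
  \<open>de = 2\<close> remain to be examined.\<close>

lemma root_coordinates:
 fixes ta :: "'n::finite => int" and r de :: int
 assumes card: "CARD('n) = 5" and sq: "(SUM i:UNIV. (ta i)\<^sup>2) = r\<^sup>2 + 4"
  and bound: "!!i. \<bar>ta i\<bar> <= r - 2" and par: "!!i. even (ta i - r)"
  and signed: "!!A. even (card A) ==> (SUM i:UNIV. if i : A then - ta i else ta i) <= r + 2 * de"
  and de: "de >= 1" and r: "r > (de + 1)\<^sup>2"
 shows "r = 11 & de = 2 & (ALL i. \<bar>ta i\<bar> = 5) & odd (card {i. ta i < 0})"
proof -
 define a where "a i = \<bar>ta i\<bar>" for i
 define N where "N = {i. ta i < 0}"
 have a0: "0 <= a i" for i by (simp add: a_def)
 have sq': "(SUM i:UNIV. (a i)\<^sup>2) = r\<^sup>2 + 4" using sq by (simp add: a_def)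
 have even_N: "sum a UNIV <= r + 2 * de" if "even (card N)"
 proof -
  have "(SUM i:UNIV. if i : N then - ta i else ta i) = sum a UNIV" by (rule sum.cong) (auto simp: a_def N_def)
  thus ?thesis using signed[OF that] by simp
 qed
 \<comment> \<open>Making all entries nonnegative takes an odd number of sign changes, so one entry
   \<open>l\<close>, which may be chosen freely, has to be counted negatively.\<close>
 have odd_N: "sum a UNIV - 2 * a l <= r + 2 * de" if "odd (card N)" for l
 proof -
  define A where "A = (if l : N then N - {l} else insert l N)"
  have "even (card A)" using that card_Suc_Diff1[of N l] by (auto simp: A_def)
  moreover have "(SUM i:UNIV. if i : A then - ta i else ta i) = (SUM i:UNIV. a i - (if i = l then 2 * a i else 0))" by (rule sum.cong) (auto simp: a_def N_def A_def)
  ultimately show ?thesis using signed[of A] by (simp add: sum_subtractf)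
 qed
 have small: "a m <= 2 * de + 1" for m
 proof (rule ccontr)
  assume "~ a m <= 2 * de + 1"
  hence x: "2 * de + 2 <= a m" "a m <= r - 2" using bound[of m] by (simp_all add: a_def)
  let ?I = "UNIV - {m}"
  have I: "card ?I = 4" using card by simp
  have s: "sum f UNIV = f m + sum f ?I" for f :: "'n => int" by (rule sum.remove) auto
  have "EX y. (SUM i:?I. (a i)\<^sup>2) <= y\<^sup>2 & 0 <= y & a m + y <= r + 2 * de"
  proof (cases "even (card N)")
   case True
   show ?thesis by (rule exI[of _ "sum a ?I"]) (use sum_squares_le_square_sum[of ?I a] sum_nonneg[of ?I a] a0 even_N[OF True] s[of a] in simp)
  next
   case False
   have ne: "?I ~= {}" using I by (metis card.empty zero_neq_numeral)
   obtain l where l: "l : ?I" "!!i. i : ?I ==> a l <= a i" using arg_min_if_finite[of ?I a] ne by (auto simp: not_less)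
   show ?thesis by (rule exI[of _ "sum a ?I - 2 * a l"])
     (use sum_squares_le_square_signed_sum[OF I l(1), of a] l(2) a0 odd_N[OF False, of l] s[of a] in simp)
  qed
  then obtain y where y: "(SUM i:?I. (a i)\<^sup>2) <= y\<^sup>2" "0 <= y" "a m + y <= r + 2 * de" by blast
  have "y\<^sup>2 <= (r + 2 * de - a m)\<^sup>2" using y(2,3) by (intro power_mono) auto
  hence 1: "r\<^sup>2 + 4 <= (a m)\<^sup>2 + (r + 2 * de - a m)\<^sup>2" using sq' s[of "%i. (a i)\<^sup>2"] y(1) by linarith
  \<comment> \<open>On the interval from \<open>2 * de + 2\<close> to \<open>r - 2\<close> the
    convex function x^2 + (r + 2 de - x)^2 is largest at the ends, which this substitution
    exchanges.\<close>
  have "0 <= (a m - (2 * de + 2)) * (r - 2 - a m)" using x by simp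
  hence "(a m)\<^sup>2 + (r + 2 * de - a m)\<^sup>2 <= (r - 2)\<^sup>2 + (2 * de + 2)\<^sup>2" by (simp add: power2_eq_square asimps)
  also have "... = r\<^sup>2 + 4 - 4 * (r - (de + 1)\<^sup>2)" by (simp add: power2_eq_square asimps)
  finally have "r\<^sup>2 + 4 <= r\<^sup>2 + 4 - 4 * (r - (de + 1)\<^sup>2)" by (rule order_trans[OF 1])
  thus False using r by simp
 qed
 have up: "(SUM i:UNIV. (a i)\<^sup>2) <= 5 * k\<^sup>2" if "!!i. a i <= k" for k
 proof -
  have "(SUM i:UNIV. (a i)\<^sup>2) <= (SUM i:(UNIV :: 'n set). k\<^sup>2)" by (rule sum_mono) (use that a0 in "simp add: power_mono")
  thus ?thesis using card by simp
 qed
 have B: "r\<^sup>2 + 4 <= 5 * (2 * de + 1)\<^sup>2" using up[OF small] sq' by simp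
 have r1: "(de + 1)\<^sup>2 + 1 <= r" using r by simp
 have "((de + 1)\<^sup>2 + 1)\<^sup>2 <= r\<^sup>2" by (rule power_mono[OF r1]) simp
 hence C: "((de + 1)\<^sup>2 + 1)\<^sup>2 + 4 <= 5 * (2 * de + 1)\<^sup>2" using B by simp
 have "de < 3"
 proof (rule ccontr)
  assume "~ de < 3"
  then obtain e where e: "de = e + 3" "e >= 0" by (metis add.commute le_add_diff_inverse not_less diff_ge_0_iff_ge diff_add_cancel)
  \<comment> \<open>After the shift by 3 all coefficients are nonnegative; 48 = 293 - 245 is the gap
    at \<open>de = 3\<close>.\<close>
  have "0 <= e ^ 4 + 16 * e ^ 3 + 78 * e\<^sup>2 + 132 * e" using e(2) by simp
  also have "... = ((e + 3 + 1)\<^sup>2 + 1)\<^sup>2 + 4 - 5 * (2 * (e + 3) + 1)\<^sup>2 - 48" by (simp add: power2_eq_square power4_eq_xxxx power3_eq_cube asimps)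
  finally have "5 * (2 * de + 1)\<^sup>2 + 48 <= ((de + 1)\<^sup>2 + 1)\<^sup>2 + 4" unfolding e(1) by simp
  thus False using order_trans[OF _ C] by fastforce
 qed
 then consider "de = 1" | "de = 2" using de by linarith
 thus ?thesis
 proof cases
  case 1
  have r5: "5 <= r" "r < 7"
  proof -
   show "5 <= r" using r1 1 by simp
   show "r < 7"
   proof (rule ccontr)
    assume "~ r < 7"
    hence "7\<^sup>2 <= r\<^sup>2" by (intro power_mono) auto
    thus False using B 1 by simp
   qed
  qed
  have par': "even (a i - r)" for i using par[of i] by (auto simp: a_def abs_if)
  have a3: "a i <= 3" for i using small[of i] 1 by simp
  have "r ~= 6"
  proof
   assume 6: "r = 6"
   have "a i <= 2" for i using a3[of i] par'[of i] 6 by presburger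
   thus False using up[of 2] sq' 6 by simp
  qed
  hence r: "r = 5" using r5 by simp
  have a13: "a i = 1 | a i = 3" for i using a3[of i] a0[of i] par'[of i] r by presburger
  \<comment> \<open>1 and 3 are the roots of x^2 - 4 x + 3, so the sum of the squares determines the
    sum of the entries.\<close>
  have "(a i)\<^sup>2 = 4 * a i - 3" for i using a13[of i] by auto
  hence "29 = 4 * sum a UNIV - 15" using sq' r card by (simp add: sum_subtractf sum_distrib_left)
  hence S: "sum a UNIV = 11" by simp
  have "EX l. a l = 1"
  proof (rule ccontr)
   assume "\<nexists>l. a l = 1"
   hence "a l = 3" for l using a13 by blast
   thus False using S card by simp
  qed
  then obtain l where "a l = 1" ..
  thus ?thesis using even_N odd_N[of l] S r 1 by fastforce
 next
  case 2
  have r10: "10 <= r" using r1 2 by simp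
  have r12: "r < 12"
  proof (rule ccontr)
   assume "~ r < 12"
   hence "12\<^sup>2 <= r\<^sup>2" by (intro power_mono) auto
   thus False using B 2 by simp
  qed
  have par': "even (a i - r)" for i using par[of i] by (auto simp: a_def abs_if)
  have a5: "a i <= 5" for i using small[of i] 2 by simp
  have "r ~= 10"
  proof
   assume 10: "r = 10"
   have "a i <= 4" for i using a5[of i] par'[of i] 10 by presburger
   thus False using up[of 4] sq' 10 by simp
  qed
  hence r: "r = 11" using r10 r12 by simp
  \<comment> \<open>Now \<open>r^2 + 4\<close> is 125, exactly five times the square of the largest
    value allowed, so no entry can be smaller.\<close>
  have a5': "a i = 5" for i
  proof (rule ccontr)
   assume "a i ~= 5"
   hence i: "a i <= 4" using a5[of i] by simp
   have "(SUM k:UNIV. (a k)\<^sup>2) = (a i)\<^sup>2 + (SUM k:UNIV - {i}. (a k)\<^sup>2)" by (rule sum.remove) auto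
   also have "(SUM k:UNIV - {i}. (a k)\<^sup>2) <= (SUM k:UNIV - {i}. 5\<^sup>2)" by (rule sum_mono, rule power_mono[OF a5 a0])
   also have "... = 100" using card by simp
   also have "(a i)\<^sup>2 <= 4\<^sup>2" by (rule power_mono[OF i a0])
   finally show False using sq' r by simp
  qed
  have "odd (card N)" using even_N a5' card r 2 by fastforce
  thus ?thesis using r 2 a5' by (simp add: a_def N_def)
 qed
qed

subsection \<open>Homomorphisms between bundles and line bundles\<close>

lemma O_hom_zero:
 assumes M: "gmd Z j M" and f: "ghom (Oc Z u j) M f" and 0: "f (- u) one = 0" and p: "p : Rp j (u + v)"
 shows "f v p = 0"
proof -
 have "{a : gsp (Oc Z u j) v. f v a = 0} = gsp (Oc Z u j) v" by (rule generatesD(2)[OF generates_O gs_kernel[OF gm_O M f]]) (use 0 one_in[of Z u j] in auto)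
 thus ?thesis using p by auto
qed

lemma Hom_zeroI:
 assumes "f : Hom E F" "!!j v x. x : sx E j v ==> f j v x = 0" shows "f = 0" using assms Hom_outside[OF assms(1)] by (intro ext) (metis fun0)

lemma Hom_comp:
 assumes F: "cohr Z F" and f: "f : Hom E F" and g: "g : Hom F G"
 shows "(%j v x. g j v (f j v x)) : Hom E G"
proof (rule HomI)
 show "ghom (ch E j) (ch G j) (%v x. g j v (f j v x))" for j by (rule ghom_comp[OF Hom_g[OF f] Hom_g[OF g]])
 show "g j v (f j v x) = 0" if "x ~: sx E j v" for j v x using Hom_outside[OF f that] ghom_0[OF cgm[OF F] Hom_g[OF g]] by simp
 show "g U01 v (f U01 v (res E j v x)) = res G j v (g j v (f j v x))" if "j ~= U01" "x : sx E j v" for j v x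
  unfolding Hom_res[OF f that] by (rule Hom_res[OF g that(1) gin[OF Hom_g[OF f] that(2)]])
qed

text \<open>The composite with the top quotient is a map of line bundles, which is 0 or injective.
  If it is 0, the map factors through the subsheaf and the induction continues there.\<close>

lemma line_to_filt_inj:
 assumes Z: "adp Z"
 shows "filt Z V as ==> g : Hom (Os Z u) V ==>
  g = 0 | (ALL j v y. y : gsp (ch (Os Z u) j) v --> g j v y = 0 --> y = 0)"
proof (induction arbitrary: g rule: filt.induct)
 case (Nil V)
 have "g = 0" by (rule Hom_zeroI[OF Nil(3)]) (use gin[OF Hom_g[OF Nil(3)]] Nil(2) in blast)
 thus ?case ..
next
 case (Cons V' f V pr a as)
 note ses = Cons(1) and g = Cons.prems
 note V' = ses_coh(1)[OF ses] and V = ses_coh(2)[OF ses] and f = ses_Hom(1)[OF ses] and pr = ses_Hom(2)[OF ses]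
 let ?O = "Os Z u"
 note h = Hom_comp[OF V g pr]
 have hj: "ghom (Oc Z u j) (Oc Z a j) (%v x. pr j v (g j v x))" for j using Hom_g[OF h, of j] by simp
 have one: "one : gsp (ch ?O j) (- u)" for j using one_in by simp
 define s where "s j = pr j (- u) (g j (- u) one)" for j
 have s: "s j = s U01" for j using Hom_res[OF h _ one, of j] by (cases "j = U01") (simp_all add: s_def)
 show ?case
 proof (cases "s U01 = 0")
  case False
  have "y = 0" if "y : gsp (ch ?O j) v" "g j v y = 0" for j v y
  proof (rule O_hom_inj[OF Z hj])
   show "pr j (- u) (g j (- u) one) ~= 0" using False s[of j] by (simp add: s_def)
   show "y : Rp j (u + v)" using that(1) by simp
   show "pr j v (g j v y) = 0" using that(2) ghom_0[OF cgm[OF V] Hom_g[OF pr]] by simp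
  qed
  thus ?thesis by blast
 next
  case True
  have h0: "pr j v (g j v y) = 0" if "y : gsp (ch ?O j) v" for j v y by (rule O_hom_zero[OF gm_O hj]) (use True s[of j] that in "simp_all add: s_def")
  have "EX pr'. pr' : Hom ?O V' & (ALL j v. ALL x:gsp (ch ?O j) v. f j v (pr' j v x) = g j v x)"
  proof (rule hom_factor[OF V' V coh_O f g ses_inj[OF ses]])
   show "g j v x : f j v ` sx V' j v" if "x : gsp (ch ?O j) v" for j v x unfolding ses_ex[OF ses] using h0[OF that] gin[OF Hom_g[OF g] that] by simp
  qed
  then obtain g' where g': "g' : Hom ?O V'" "!!j v x. x : gsp (ch ?O j) v ==> f j v (g' j v x) = g j v x" by blast
  have f0: "f j v 0 = 0" for j v by (rule ghom_0[OF cgm[OF V'] Hom_g[OF f]])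
  from Cons.IH[OF g'(1)] show ?thesis
  proof
   assume "g' = 0"
   hence "g j v x = 0" if "x : gsp (ch ?O j) v" for j v x using g'(2)[OF that] f0 by (simp add: zero_fun_def)
   thus ?thesis using Hom_zeroI[OF g] by blast
  next
   assume i: "ALL j v y. y : gsp (ch ?O j) v --> g' j v y = 0 --> y = 0"
   have "y = 0" if y: "y : gsp (ch ?O j) v" and 0: "g j v y = 0" for j v y
   proof -
    have "g' j v y = 0" by (rule ses_inj[OF ses gin[OF Hom_g[OF g'(1)] y]]) (use g'(2)[OF y] 0 in simp)
    thus ?thesis using i y by blast
   qed
   thus ?thesis by blast
  qed
 qed
qed

text \<open>The image is a nonzero ideal sheaf in a line bundle and so has the class of a line
  bundle; \<open>V\<close> has the same class, since both have the same quotient.\<close>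

lemma rank_one_of_embedding:
 assumes Z: "adp Z" and V: "cohr Z V" and f: "f : Hom V (Os Z u)"
  and inj: "!!j v x. x : sx V j v ==> f j v x = 0 ==> x = 0" and x: "x : sx V j0 v0" "f j0 v0 x ~= 0"
 shows "rho V = 1"
proof -
 define N where "N j v = f j v ` sx V j v" for j v
 have N: "subsheaf (Os Z u) N" unfolding N_def by (rule subsheaf_image[OF V coh_O f])
 have c: "f j0 v0 x : N j0 v0" unfolding N_def by (rule imageI[OF x(1)])
 obtain v g s where g: "g : Hom (Os Z (- v)) (Os Z u)" "ALL j w. g j w ` Rp j (- v + w) = N j w"
  "s ~= 0" "ALL j. g j v one = s" using ideal_sheaf_hom[OF Z N c x(2)] by (elim exE conjE)
 have ginj: "y = 0" if "y : gsp (ch (Os Z (- v)) j) w" "g j w y = 0" for j w y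
 proof -
  have gj: "ghom (Oc Z (- v) j) (Oc Z u j) (g j)" using Hom_g[OF g(1), of j] by simp
  show ?thesis by (rule O_hom_inj[OF Z gj]) (use g(3,4) that in simp_all)
 qed
 have gim: "g j w ` gsp (ch (Os Z (- v)) j) w = N j w" for j w using g(2) by simp
 note 1 = ses_quot[OF V coh_O f inj N N_def[symmetric]] and 2 = ses_quot[OF coh_O coh_O g(1) ginj N gim]
 have "rat_of_int (rho V) = of_int (rho (Os Z (- v)))" using additiveD[OF additive_rho[OF Z] 1] additiveD[OF additive_rho[OF Z] 2] by simp
 thus ?thesis by (simp add: rho_O)
qed

text \<open>A composite \<open>V -> O(u) -> V\<close> is a scalar. If both maps are nonzero, the
  second is injective, so the scalar is not 0 and the first map is injective too; then
  \<open>V\<close> embeds in a line bundle and has rank 1.\<close>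

lemma not_both_Hom:
 assumes Z: "adp Z" and V: "vector_bundle Z r V" and r: "r ~= 1" and E: "Hom V V = range (scalar_map V)"
 shows "Hom V (Os Z u) = {0} | Hom (Os Z u) V = {0}"
proof (rule ccontr)
 assume no: "~ ?thesis"
 note V' = bundle_coherent[OF V]
 obtain as where as: "filt Z V as" using bundle_filt[OF Z V] by blast
 have z: "0 : Hom V (Os Z u)" "0 : Hom (Os Z u) V" using ms.subspace_0[OF subspace_Hom[OF coh_O]] ms.subspace_0[OF subspace_Hom[OF V']] .
 obtain f where f: "f : Hom V (Os Z u)" "f ~= 0" using no z by blast
 obtain g where g: "g : Hom (Os Z u) V" "g ~= 0" using no z by blast
 have ginj: "y = 0" if "y : gsp (ch (Os Z u) j) v" "g j v y = 0" for j v y using line_to_filt_inj[OF Z as g(1)] g(2) that by blast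
 obtain c where c: "(%j v x. g j v (f j v x)) = scalar_map V c" using Hom_comp[OF coh_O f(1) g(1)] E by blast
 have gf: "g j v (f j v x) = asc c x" if "x : sx V j v" for j v x using fun_cong[OF fun_cong[OF fun_cong[OF c, of j], of v], of x] that by (simp add: scalar_map_def)
 obtain j0 v0 x where x: "x : sx V j0 v0" "f j0 v0 x ~= 0" using Hom_zeroI[OF f(1)] f(2) by blast
 have "c ~= 0" using gf[OF x(1)] ginj[OF gin[OF Hom_g[OF f(1)] x(1)]] x(2) by auto
 have "y = 0" if y: "y : sx V j v" "f j v y = 0" for j v y
 proof -
  have "asc c y = 0" using gf[OF y(1)] y(2) ghom_0[OF cgm[OF coh_O] Hom_g[OF g(1)]] by simp
  hence "asc (inverse c) (asc c y) = 0" by simp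
  thus ?thesis using \<open>c ~= 0\<close> by simp
 qed
 hence "rho V = 1" by (rule rank_one_of_embedding[OF Z V' f(1) _ x])
 thus False using bundle_invariants(1)[OF Z V] r by simp
qed

subsection \<open>Exceptional and omnipresent bundles\<close>

lemma (in vector_space) quot_dim_self: "qd scale U U = 0" unfolding quot_dim_def by (rule Least_eq_0) (auto intro!: exI[of _ "{}"] span_base)

lemma dim_Hom_0: "Hom V F = {0} ==> dim_Hom V F = 0" unfolding dim_Hom_def using ms.quot_dim_self[of "{0}"] by simp

lemma exceptional_dims:
 assumes E: "exceptional_bundle Z V"
 shows "dim_Hom V V = 1" "dim_Ext1 V V = 0"
proof -
 show "dim_Ext1 V V = 0" unfolding dim_Ext1_def using E hs.quot_dim_self by (simp add: exceptional_bundle_def)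
 let ?e = "scalar_map V 1"
 have H: "Hom V V = range (scalar_map V)" "?e ~= 0" using E by (simp_all add: exceptional_bundle_def)
 have sc: "scalar_map V c = (%j u a. asc c (?e j u a))" for c by (simp add: scalar_map_def fun_eq_iff)
 show "dim_Hom V V = 1" unfolding dim_Hom_def quot_dim_def H(1)
 proof (rule Least_equality)
  have "scalar_map V c : ms.span ({0} Un {?e})" for c unfolding sc[of c] by (rule ms.span_scale[OF ms.span_base]) simp
  thus "EX B. finite B & card B = 1 & B <= range (scalar_map V) & range (scalar_map V) <= ms.span ({0} Un B)" by (intro exI[of _ "{?e}"]) auto
  fix m assume "EX B. finite B & card B = m & B <= range (scalar_map V) & range (scalar_map V) <= ms.span ({0} Un B)"
  then obtain B where B: "finite B" "card B = m" "range (scalar_map V) <= ms.span ({0} Un B)" by blast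
  show "1 <= m"
  proof (rule ccontr)
   assume "~ 1 <= m"
   hence "card B = 0" using B(2) by linarith
   hence "B = {}" using B(1) by simp
   hence "?e : ms.span {0}" using B(3) by auto
   thus False using H(2) by (simp add: ms.span_insert_0[of "{}", simplified])
  qed
 qed
qed

lemma sum_sgn_at_list:
 "(SUM a<-as. sgn_at a i) = int (length as) - 2 * int (length (filter (%a. i : podd a) as))" by (induction as) (simp_all add: sgn_at_def)

text \<open>\<open>tau i V\<close> is the rank minus twice the number of factors that are odd at
  \<open>i\<close>. If all factors were odd, every map to \<open>S_i\<close> would vanish, and if
  none were, every map to \<open>S'_i\<close>; so the number lies between 1 and
  \<open>r - 1\<close>.\<close>

lemma omnipresent_tau:
 fixes Z :: "'n::finite => 'k::alg_closed_field * 'k"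
 assumes Z: "distinct_points Z" and V: "vector_bundle Z r V" and om: "omnipresent Z V"
 shows "\<bar>tau i V\<bar> <= int r - 2" and "even (tau i V - int r)"
proof -
 obtain as where as: "length as = r" "filt Z V as" using bundle_filt[OF Z V] by blast
 have "rat_of_int (SUM a<-bs. sgn_at a i) = (SUM a<-bs. of_int (sgn_at a i))" for bs :: "'n pic list" by (induction bs) simp_all
 hence "rat_of_int (tau i V) = of_int (SUM a<-as. sgn_at a i)" using additive_filt[OF additive_tau[OF Z] as(2)] by (simp add: tau_O)
 hence t: "tau i V = int r - 2 * int (length (filter (%a. i : podd a) as))" unfolding of_int_eq_iff sum_sgn_at_list as(1) .
 obtain q where S: "sexact Z (Os Z (- px i)) (t_map Z i (- px i)) (Os Z 0) q (S_sheaf Z i)" using S_sheaf[OF Z] by blast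
 obtain q' where S': "sexact Z (Os Z 0) (t_map Z i 0) (Os Z (px i)) q' (S'_sheaf Z i)" using S'_sheaf[OF Z] by blast
 have "EX a:set as. i ~: podd a"
 proof (rule ccontr)
  assume "~ ?thesis"
  hence "gsp (ch (S_sheaf Z i) j) (- a) = {0}" if "a : set as" for a j using that by (intro ses_t_zero[OF S]) simp_all
  hence "Hom V (S_sheaf Z i) = {0}" by (rule filt_Hom_zero[OF as(2) ses_coh(3)[OF S]])
  thus False using om by (simp add: omnipresent_def)
 qed
 moreover have "EX a:set as. i : podd a"
 proof (rule ccontr)
  assume "~ ?thesis"
  hence "gsp (ch (S'_sheaf Z i) j) (- a) = {0}" if "a : set as" for a j using that by (intro ses_t_zero[OF S']) (auto simp: podd_diff)
  hence "Hom V (S'_sheaf Z i) = {0}" by (rule filt_Hom_zero[OF as(2) ses_coh(3)[OF S']])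
  thus False using om by (simp add: omnipresent_def)
 qed
 ultimately have "length (filter (%a. i ~: podd a) as) ~= 0" "length (filter (%a. i : podd a) as) ~= 0" by (auto simp: filter_empty_conv)
 thus "\<bar>tau i V\<bar> <= int r - 2" using sum_length_filter_compl[of "%a. i : podd a" as] as(1) unfolding t by linarith
 show "even (tau i V - int r)" unfolding t by simp
qed

theorem proposition3p5:
  fixes lam :: "'n::finite \<Rightarrow> 'k::alg_closed_field \<times> 'k"
    and V :: "('n, 'k) sheaf" and r :: nat and d :: int
  assumes "CARD('n) = 5" and "distinct_points lam"
    and "exceptional_bundle lam V" and "omnipresent lam V"
    and "vector_bundle lam r V" and "bundle_degree lam V = d"
    and "d < 0" and "int r > (- d + 1)^2"
  shows "(int r, d) = (11, -2) \<and>
    Lambda_proj lam (sheaf_class lam V) \<in> weyl_orbit lam (eps_comb lam (\<lambda>i. - 5/2))"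
proof -
 note n5 = assms(1) and lam = assms(2) and exc = assms(3) and VB = assms(5)
 note V = bundle_coherent[OF VB]
 have n2: "CARD('n) >= 2" using n5 by simp
 have rV: "rho V = int r" and dV: "dlt V = d" using bundle_invariants[OF lam VB] assms(6) by auto
 have isV: "is_bundle lam V" using VB unfolding is_bundle_def by blast
 have isO: "is_bundle lam (Os lam u)" for u unfolding is_bundle_def using vector_bundle_O by blast
 note cls = rhoK_sheaf[OF lam n2] dltK_sheaf[OF lam n2] tauK_sheaf[OF lam n2]
 have "euler (scl lam V) (scl lam V) = 1" using euler_bundle[OF lam n2 isV V] exceptional_dims[OF exc] by simp
 hence "rat_of_int (SUM i:UNIV. (tau i V)\<^sup>2) = of_int ((int r)\<^sup>2 + 4)" unfolding euler_def cls[OF V] rV n5 by (simp add: power2_eq_square field_simps)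
 hence sq: "(SUM i:UNIV. (tau i V)\<^sup>2) = (int r)\<^sup>2 + 4" unfolding of_int_eq_iff .
 \<comment> \<open>\<open>- d + 1\<close> is at least 2, so the rank exceeds 4 and
   \<open>not_both_Hom\<close> applies.\<close>
 have "2\<^sup>2 <= (- d + 1)\<^sup>2" using assms(7) by (intro power_mono) auto
 hence r1: "r ~= 1" using assms(8) by auto
 have signed: "(SUM i:UNIV. if i : A then - tau i V else tau i V) <= int r + 2 * (- d)" if A: "even (card A)" for A
 proof -
  \<comment> \<open>A class of degree 0 that is odd exactly on \<open>A\<close>; the correction by a
    multiple of \<open>c\<close> is possible because \<open>A\<close> has an even number of
    elements.\<close>
  define u where "u = psum A + kc (- int (card A div 2))"
  have u: "pdeg u = 0" "sgn_at u i = (if i : A then - 1 else 1)" for i using A by (auto simp: u_def sgn_at_def podd_add)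
  let ?S = "SUM i:UNIV. if i : A then - tau i V else tau i V"
  have S: "(SUM i:UNIV. rat_of_int (tau i V) * of_int (sgn_at u i)) = of_int ?S" "(SUM i:UNIV. rat_of_int (sgn_at u i) * of_int (tau i V)) = of_int ?S"
   unfolding u(2) of_int_sum by (rule sum.cong; simp)+
  have e: "euler (scl lam V) (scl lam (Os lam u)) = of_int ?S / 4 - of_nat r / 4 - of_int d / 2"
   "euler (scl lam (Os lam u)) (scl lam V) = of_int ?S / 4 - of_nat r / 4 + of_int d / 2"
   unfolding euler_def cls[OF V] cls[OF coh_O] rho_O tau_O dlt_O u(1) S rV dV n5 by (simp_all add: field_simps)
  have "(of_int ?S :: rat) <= of_int (int r + 2 * (- d))" using not_both_Hom[OF lam VB r1, of u]
  proof
   show "Hom V V = range (scalar_map V)" using exc by (simp add: exceptional_bundle_def)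
   \<comment> \<open>If \<open>V\<close> has no maps to the line bundle, the bound obtained is even
     \<open>r + 2 d\<close>, and \<open>d < 0\<close> weakens it to the stated one.\<close>
   have d0: "(of_int d :: rat) < 0" using assms(7) by simp
   assume "Hom V (Os lam u) = {0}"
   thus ?thesis using euler_bundle[OF lam n2 isV coh_O, of u] d0 unfolding e dim_Hom_0[OF \<open>Hom V (Os lam u) = {0}\<close>] by simp
  next
   assume "Hom (Os lam u) V = {0}"
   thus ?thesis using euler_bundle[OF lam n2 isO V, of u] unfolding e dim_Hom_0[OF \<open>Hom (Os lam u) V = {0}\<close>] by simp
  qed
  thus ?thesis unfolding of_int_le_iff .
 qed
 have num: "int r = 11 & - d = 2 & (ALL i. \<bar>tau i V\<bar> = 5) & odd (card {i. tau i V < 0})"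
  by (rule root_coordinates[OF n5 sq omnipresent_tau[OF lam VB assms(4)] signed]) (use assms(7,8) in auto)
 note X = sheaf_class_K0[OF lam n2 V]
 \<comment> \<open>The base point has all coordinates equal to -5/2, so a sign change is needed
   wherever \<open>tau i V\<close> is positive. The number of these places is 5 minus an odd number,
   hence even.\<close>
 define s :: "'n => rat" where "s i = (if tau i V < 0 then 1 else - 1)" for i
 have "{i. s i = - 1} = UNIV - {i. tau i V < 0}" by (auto simp: s_def)
 hence "card {i. s i = - 1} = 5 - card {i. tau i V < 0}" using n5 by (simp add: card_Diff_subset)
 hence w: "(id, s) : weyl_D" using num card_mono[of UNIV "{i. tau i V < 0}"] n5 by (auto simp: weyl_D_def s_def)
 have b: "tauK i (scl lam V) / 2 = s i * (- 5/2)" for i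
 proof -
  have "\<bar>tau i V\<bar> = 5" using num by blast
  hence "tau i V = (if tau i V < 0 then - 5 else 5)" by auto
  thus ?thesis unfolding cls[OF V] s_def by (auto split: if_splits)
 qed
 have "Lambda_proj lam (scl lam V) = eps_comb lam (%i. tauK i (scl lam V) / 2)" by (rule Lambda_proj_eq[OF lam n2 X])
 also have "... : weyl_orbit lam (eps_comb lam (%i. - 5/2))" unfolding weyl_orbit_def
  by (rule CollectI, rule exI[of _ "%i. - 5/2"], rule exI[of _ "%i. tauK i (scl lam V) / 2"], rule exI[of _ id], rule exI[of _ s])
   (use w b in auto)
 finally show ?thesis using num by simp
qed

end
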